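(* Let $\Bbbk$ be an algebraically closed field of characteristic $0$, let $G$ be a group, let $\mathcal D=(g,\varepsilon,\eta)$ be a YD-triple for $\Bbbk G$, let $\xi\in\mathrm{Der}_{\varepsilon,\varepsilon}(\Bbbk G,\Bbbk)$ and let $\lambda\in\Bbbk$. Then $\mathfrak U_\xi(\mathcal D,\lambda)$ is a Hopf algebra with comultiplication determined by $G(\mathfrak U_\xi(\mathcal D,\lambda))=G$ and $a_1,a_2\in\mathcal P_{g,1}(\mathfrak U_\xi(\mathcal D,\lambda))$. Thus $\mathfrak U_\xi(\mathcal D,\lambda)$ is pointed. The set $\{a_1^ma_2^nh: m,n\in\mathbb N_0,\ h\in G\}$ is a basis of $\mathfrak U_\xi(\mathcal D,\lambda)$; $\operatorname{gr}\mathfrak U_\xi(\mathcal D,\lambda)\simeq\mathscr B(\mathcal V(1,2))\#\Bbbk G$; and $$\operatorname{GKdim}\mathfrak U_\xi(\mathcal D,\lambda)=\operatorname{GKdim}\Bbbk G+2.$$ In particular, if $G$ is nilpotent-by-finite, then $\operatorname{GKdim}\mathfrak U_\xi(\mathcal D,\lambda)<\infty$.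
   Context: For a Hopf algebra $L$, $G(L)$ is its group of group-like elements and, for $g,h\in G(L)$, $\mathcal P_{g,h}(L)=\{\ell\in L:\Delta(\ell)=\ell\otimes h+g\otimes\ell\}$; $\operatorname{gr}L$ is the graded Hopf algebra associated with the coradical filtration of a pointed Hopf algebra $L$; $\operatorname{GKdim}$ denotes Gelfand-Kirillov dimension. $\varepsilon$ denotes the trivial character of $G$, and $\mathrm{Der}_{\varepsilon,\varepsilon}(\Bbbk G,\Bbbk)=\{\eta\in(\Bbbk G)^*:\eta(ht)=\eta(h)+\eta(t)\ \forall h,t\in G\}$. A YD-triple $\mathcal D=(g,\varepsilon,\eta)$ for $\Bbbk G$ consists of $g\in Z(G)$ and $\eta\in\mathrm{Der}_{\varepsilon,\varepsilon}(\Bbbk G,\Bbbk)$ with $\eta(g)=1$. $\mathfrak U_\xi(\mathcal D,\lambda)$ is the algebra generated by $h\in G$, $a_1$, $a_2$ with defining relations those of $G$ and, for all $h\in G$, $ha_1=a_1h$, $ha_2=(a_2+\eta(h)a_1+\xi(h)(1-g))h$, together with $a_1a_2-a_2a_1-\tfrac12a_1^2=\lambda(1-g^2)$. $\mathcal V(1,2)$ is the braided vector space with basis $x_1,x_2$ and braiding $c(x_i\otimes x_1)=x_1\otimes x_i$, $c(x_i\otimes x_2)=(x_1+x_2)\otimes x_i$, $i=1,2$. Its Nichols algebra $\mathscr B(\mathcal V(1,2))$ is the Jordan plane $\Bbbk\langle x_1,x_2\mid x_1x_2-x_2x_1-\tfrac12x_1^2\rangle$. In the bosonization $\mathscr B(\mathcal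 V(1,2))\#\Bbbk G$, $\mathcal V(1,2)$ is realized as a Yetter-Drinfeld module over $\Bbbk G$ with coaction $\delta(x_i)=g\otimes x_i$ and action $h\cdot x_1=x_1$, $h\cdot x_2=x_2+\eta(h)x_1$ for $h\in G$.
   Formalization: The Hopf algebra, pointedness and gr claims are stated only when ξ(g)=0 (no such Hopf structure exists otherwise, e.g. G=ℤ, ξ=η), and the final finiteness claim only for finitely generated nilpotent-by-finite G (it fails for an infinite direct sum of copies of ℤ). *)

theory Defs
  imports
    "HOL-Algebra.QuotRing"
    "HOL-Algebra.Generated_Groups"
    "HOL-Library.Poly_Mapping"
    "HOL-Library.Extended_Real"
    "HOL-Library.Liminf_Limsup"
    "HOL-Computational_Algebra.Polynomial"
    "HOL.Transcendental"
begin

section \<open>Formal linear combinations\<close>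

abbreviation supp :: "('a \<Rightarrow>\<^sub>0 'k::zero) \<Rightarrow> 'a set"
  where "supp \<equiv> Poly_Mapping.keys"

abbreviation coef :: "('a \<Rightarrow>\<^sub>0 'k::zero) \<Rightarrow> 'a \<Rightarrow> 'k"
  where "coef \<equiv> Poly_Mapping.lookup"

abbreviation pure :: "'a \<Rightarrow> ('a \<Rightarrow>\<^sub>0 'k::zero_neq_one)"
  where "pure x \<equiv> Poly_Mapping.single x 1"

definition pscale :: "'k::field \<Rightarrow> ('a \<Rightarrow>\<^sub>0 'k) \<Rightarrow> ('a \<Rightarrow>\<^sub>0 'k)"
  where "pscale c p = Poly_Mapping.map ((*) c) p"

definition lin_ext :: "('a \<Rightarrow> ('b \<Rightarrow>\<^sub>0 'k::field)) \<Rightarrow> ('a \<Rightarrow>\<^sub>0 'k) \<Rightarrow> ('b \<Rightarrow>\<^sub>0 'k)"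
  where "lin_ext f p = (\<Sum>x\<in>supp p. pscale (coef p x) (f x))"

definition lin_form :: "('a \<Rightarrow> 'k) \<Rightarrow> ('a \<Rightarrow>\<^sub>0 'k::field) \<Rightarrow> 'k"
  where "lin_form f p = (\<Sum>x\<in>supp p. coef p x * f x)"


section \<open>Algebras over a field\<close>

record ('a, 'k) kalg = "'a ring" +
  kscale :: "'k \<Rightarrow> 'a \<Rightarrow> 'a" (infixr \<open>\<cdot>\<index>\<close> 75)

locale k_algebra = ring A for A :: "('a, 'k::field, 'm) kalg_scheme" (structure) +
  assumes kscale_closed: "x \<in> carrier A \<Longrightarrow> c \<cdot> x \<in> carrier A"
    and kscale_add_right: "x \<in> carrier A \<Longrightarrow> y \<in> carrier A \<Longrightarrow> c \<cdot> (x \<oplus> y) = c \<cdot> x \<oplus> c \<cdot> y"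
    and kscale_add_left: "x \<in> carrier A \<Longrightarrow> (c + d) \<cdot> x = c \<cdot> x \<oplus> d \<cdot> x"
    and kscale_assoc: "x \<in> carrier A \<Longrightarrow> (c * d) \<cdot> x = c \<cdot> (d \<cdot> x)"
    and kscale_one: "x \<in> carrier A \<Longrightarrow> 1 \<cdot> x = x"
    and kscale_mult_left: "x \<in> carrier A \<Longrightarrow> y \<in> carrier A \<Longrightarrow> (c \<cdot> x) \<otimes> y = c \<cdot> (x \<otimes> y)"
    and kscale_mult_right: "x \<in> carrier A \<Longrightarrow> y \<in> carrier A \<Longrightarrow> x \<otimes> (c \<cdot> y) = c \<cdot> (x \<otimes> y)"

definition lincomb :: "('a, 'k::field, 'm) kalg_scheme \<Rightarrow> ('b \<Rightarrow> 'a) \<Rightarrow> ('b \<Rightarrow>\<^sub>0 'k) \<Rightarrow> 'a"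
  where "lincomb A f p = (\<Oplus>\<^bsub>A\<^esub>x\<in>supp p. coef p x \<cdot>\<^bsub>A\<^esub> f x)"

definition k_span :: "('a, 'k::field, 'm) kalg_scheme \<Rightarrow> 'a set \<Rightarrow> 'a set"
  where "k_span A S = {lincomb A id p | p. supp p \<subseteq> S}"

definition k_indep :: "('a, 'k::field, 'm) kalg_scheme \<Rightarrow> 'a set \<Rightarrow> bool"
  where "k_indep A S \<longleftrightarrow>
    S \<subseteq> carrier A \<and> (\<forall>p. supp p \<subseteq> S \<longrightarrow> lincomb A id p = \<zero>\<^bsub>A\<^esub> \<longrightarrow> p = 0)"

definition k_basis :: "('a, 'k::field, 'm) kalg_scheme \<Rightarrow> 'a set \<Rightarrow> 'a set \<Rightarrow> bool"
  where "k_basis A W B \<longleftrightarrow> k_indep A B \<and> k_span A B = W"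

text \<open>As for \<^const>\<open>card\<close>, the value on infinite-dimensional subspaces is the dummy \<open>0\<close>.\<close>

definition k_dim :: "('a, 'k::field, 'm) kalg_scheme \<Rightarrow> 'a set \<Rightarrow> nat"
  where "k_dim A W =
    (if \<exists>B. finite B \<and> k_basis A W B then card (SOME B. finite B \<and> k_basis A W B) else 0)"

definition quot_alg :: "('a, 'k::field, 'm) kalg_scheme \<Rightarrow> 'a set \<Rightarrow> ('a set, 'k) kalg"
  where "quot_alg A I = ring.extend (A Quot I)
    (kalg.fields (\<lambda>c X. \<Union>x\<in>X. I +>\<^bsub>A\<^esub> (c \<cdot>\<^bsub>A\<^esub> x)))"


subsection \<open>Gelfand-Kirillov dimension\<close>

primrec subspace_pow :: "('a, 'k::field, 'm) kalg_scheme \<Rightarrow> 'a set \<Rightarrow> nat \<Rightarrow> 'a set"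
  where
    "subspace_pow A V 0 = k_span A {\<one>\<^bsub>A\<^esub>}"
  | "subspace_pow A V (Suc n) = k_span A {x \<otimes>\<^bsub>A\<^esub> y | x y. x \<in> subspace_pow A V n \<and> y \<in> V}"

text \<open>The supremum over all finite-dimensional subspaces \<open>V\<close> of
  \<open>limsup log\<^sub>n dim (V\<^sup>0 + V\<^sup>1 + \<dots> + V\<^sup>n)\<close>.\<close>

definition GKdim :: "('a, 'k::field, 'm) kalg_scheme \<Rightarrow> ereal"
  where "GKdim A = (SUP V \<in> {k_span A S | S. finite S \<and> S \<subseteq> carrier A}.
    limsup (\<lambda>n. ereal (log (real n) (real (k_dim A (k_span A (\<Union>i\<le>n. subspace_pow A V i)))))))"


subsection \<open>Monoid algebras, free algebras, presentations\<close>

definition monoid_algebra :: "('g, 'm) monoid_scheme \<Rightarrow> ('g \<Rightarrow>\<^sub>0 'k, 'k::field) kalg"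
  where "monoid_algebra M = \<lparr>
    carrier = {p. supp p \<subseteq> carrier M},
    monoid.mult = (\<lambda>p q. lin_ext (\<lambda>x. lin_ext (\<lambda>y. pure (x \<otimes>\<^bsub>M\<^esub> y)) q) p),
    one = pure \<one>\<^bsub>M\<^esub>,
    zero = 0,
    add = (+),
    kscale = pscale\<rparr>"

definition free_monoid :: "'x set \<Rightarrow> 'x list monoid"
  where "free_monoid X = \<lparr>carrier = lists X, monoid.mult = (@), one = []\<rparr>"

abbreviation free_algebra :: "'x set \<Rightarrow> ('x list \<Rightarrow>\<^sub>0 'k, 'k::field) kalg"
  where "free_algebra X \<equiv> monoid_algebra (free_monoid X)"

abbreviation var :: "'x \<Rightarrow> ('x list \<Rightarrow>\<^sub>0 'k::field)"
  where "var x \<equiv> pure [x]"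

definition relation_ideal ::
    "'x set \<Rightarrow> (('x list \<Rightarrow>\<^sub>0 'k::field) \<times> ('x list \<Rightarrow>\<^sub>0 'k)) set \<Rightarrow> ('x list \<Rightarrow>\<^sub>0 'k) set"
  where "relation_ideal X R = Idl\<^bsub>free_algebra X\<^esub> {l - r | l r. (l, r) \<in> R}"


section \<open>Hopf algebras\<close>

text \<open>
  An element of \<open>A \<otimes> B\<close> is represented by a formal linear combination of pairs \<open>(a, b)\<close>
  standing for the pure tensors; two combinations represent the same element iff their
  difference lies in the subspace spanned by the bilinearity relations.
\<close>

inductive_set tensor_null ::
    "('a, 'k::field, 'm) kalg_scheme \<Rightarrow> ('b, 'k, 'n) kalg_scheme \<Rightarrow> ('a \<times> 'b \<Rightarrow>\<^sub>0 'k) set"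
  for A :: "('a, 'k::field, 'm) kalg_scheme" and B :: "('b, 'k, 'n) kalg_scheme"
  where
    zero: "0 \<in> tensor_null A B"
  | add: "s \<in> tensor_null A B \<Longrightarrow> t \<in> tensor_null A B \<Longrightarrow> s + t \<in> tensor_null A B"
  | scale: "s \<in> tensor_null A B \<Longrightarrow> pscale c s \<in> tensor_null A B"
  | add_left: "\<lbrakk>x \<in> carrier A; y \<in> carrier A; b \<in> carrier B\<rbrakk> \<Longrightarrow>
      pure (x \<oplus>\<^bsub>A\<^esub> y, b) - pure (x, b) - pure (y, b) \<in> tensor_null A B"
  | add_right: "\<lbrakk>a \<in> carrier A; x \<in> carrier B; y \<in> carrier B\<rbrakk> \<Longrightarrow>
      pure (a, x \<oplus>\<^bsub>B\<^esub> y) - pure (a, x) - pure (a, y) \<in> tensor_null A B"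
  | scale_left: "\<lbrakk>a \<in> carrier A; b \<in> carrier B\<rbrakk> \<Longrightarrow>
      pure (c \<cdot>\<^bsub>A\<^esub> a, b) - pscale c (pure (a, b)) \<in> tensor_null A B"
  | scale_right: "\<lbrakk>a \<in> carrier A; b \<in> carrier B\<rbrakk> \<Longrightarrow>
      pure (a, c \<cdot>\<^bsub>B\<^esub> b) - pscale c (pure (a, b)) \<in> tensor_null A B"

definition tensor_eq :: "('a, 'k::field, 'm) kalg_scheme \<Rightarrow> ('b, 'k, 'n) kalg_scheme \<Rightarrow>
    ('a \<times> 'b \<Rightarrow>\<^sub>0 'k) \<Rightarrow> ('a \<times> 'b \<Rightarrow>\<^sub>0 'k) \<Rightarrow> bool"
  where "tensor_eq A B s t \<longleftrightarrow> s - t \<in> tensor_null A B"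

inductive_set tensor3_null :: "('a, 'k::field, 'm) kalg_scheme \<Rightarrow> ('a \<times> 'a \<times> 'a \<Rightarrow>\<^sub>0 'k) set"
  for A :: "('a, 'k::field, 'm) kalg_scheme"
  where
    zero: "0 \<in> tensor3_null A"
  | add: "s \<in> tensor3_null A \<Longrightarrow> t \<in> tensor3_null A \<Longrightarrow> s + t \<in> tensor3_null A"
  | scale: "s \<in> tensor3_null A \<Longrightarrow> pscale c s \<in> tensor3_null A"
  | add1: "\<lbrakk>x \<in> carrier A; y \<in> carrier A; a \<in> carrier A; b \<in> carrier A\<rbrakk> \<Longrightarrow>
      pure (x \<oplus>\<^bsub>A\<^esub> y, a, b) - pure (x, a, b) - pure (y, a, b) \<in> tensor3_null A"
  | add2: "\<lbrakk>x \<in> carrier A; y \<in> carrier A; a \<in> carrier A; b \<in> carrier A\<rbrakk> \<Longrightarrow>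
      pure (a, x \<oplus>\<^bsub>A\<^esub> y, b) - pure (a, x, b) - pure (a, y, b) \<in> tensor3_null A"
  | add3: "\<lbrakk>x \<in> carrier A; y \<in> carrier A; a \<in> carrier A; b \<in> carrier A\<rbrakk> \<Longrightarrow>
      pure (a, b, x \<oplus>\<^bsub>A\<^esub> y) - pure (a, b, x) - pure (a, b, y) \<in> tensor3_null A"
  | scale1: "\<lbrakk>x \<in> carrier A; a \<in> carrier A; b \<in> carrier A\<rbrakk> \<Longrightarrow>
      pure (c \<cdot>\<^bsub>A\<^esub> x, a, b) - pscale c (pure (x, a, b)) \<in> tensor3_null A"
  | scale2: "\<lbrakk>x \<in> carrier A; a \<in> carrier A; b \<in> carrier A\<rbrakk> \<Longrightarrow>
      pure (a, c \<cdot>\<^bsub>A\<^esub> x, b) - pscale c (pure (a, x, b)) \<in> tensor3_null A"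
  | scale3: "\<lbrakk>x \<in> carrier A; a \<in> carrier A; b \<in> carrier A\<rbrakk> \<Longrightarrow>
      pure (a, b, c \<cdot>\<^bsub>A\<^esub> x) - pscale c (pure (a, b, x)) \<in> tensor3_null A"

definition tensor3_eq :: "('a, 'k::field, 'm) kalg_scheme \<Rightarrow>
    ('a \<times> 'a \<times> 'a \<Rightarrow>\<^sub>0 'k) \<Rightarrow> ('a \<times> 'a \<times> 'a \<Rightarrow>\<^sub>0 'k) \<Rightarrow> bool"
  where "tensor3_eq A s t \<longleftrightarrow> s - t \<in> tensor3_null A"

definition tensor_map :: "('a \<Rightarrow> 'c) \<Rightarrow> ('b \<Rightarrow> 'd) \<Rightarrow> ('a \<times> 'b \<Rightarrow>\<^sub>0 'k::field) \<Rightarrow> ('c \<times> 'd \<Rightarrow>\<^sub>0 'k)"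
  where "tensor_map f h = lin_ext (\<lambda>(a, b). pure (f a, h b))"

definition tensor_mult :: "('a, 'k::field, 'm) kalg_scheme \<Rightarrow>
    ('a \<times> 'a \<Rightarrow>\<^sub>0 'k) \<Rightarrow> ('a \<times> 'a \<Rightarrow>\<^sub>0 'k) \<Rightarrow> ('a \<times> 'a \<Rightarrow>\<^sub>0 'k)"
  where "tensor_mult A s t =
    lin_ext (\<lambda>(a, b). lin_ext (\<lambda>(c, d). pure (a \<otimes>\<^bsub>A\<^esub> c, b \<otimes>\<^bsub>A\<^esub> d)) t) s"

record (overloaded) ('a, 'k) khopf = "('a, 'k) kalg" +
  comult :: "'a \<Rightarrow> ('a \<times> 'a \<Rightarrow>\<^sub>0 'k)"
  counit :: "'a \<Rightarrow> 'k"

locale hopf_algebra = k_algebra H for H :: "('a, 'k::field, 'm) khopf_scheme" (structure) +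
  assumes comult_closed: "x \<in> carrier H \<Longrightarrow> supp (comult H x) \<subseteq> carrier H \<times> carrier H"
    and comult_add: "\<lbrakk>x \<in> carrier H; y \<in> carrier H\<rbrakk> \<Longrightarrow>
      tensor_eq H H (comult H (x \<oplus> y)) (comult H x + comult H y)"
    and comult_scale: "x \<in> carrier H \<Longrightarrow>
      tensor_eq H H (comult H (c \<cdot> x)) (pscale c (comult H x))"
    and counit_add: "\<lbrakk>x \<in> carrier H; y \<in> carrier H\<rbrakk> \<Longrightarrow>
      counit H (x \<oplus> y) = counit H x + counit H y"
    and counit_scale: "x \<in> carrier H \<Longrightarrow> counit H (c \<cdot> x) = c * counit H x"
    and coassoc: "x \<in> carrier H \<Longrightarrow> tensor3_eq H
      (lin_ext (\<lambda>(a, b). lin_ext (\<lambda>(a', a''). pure (a', a'', b)) (comult H a)) (comult H x))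
      (lin_ext (\<lambda>(a, b). lin_ext (\<lambda>(b', b''). pure (a, b', b'')) (comult H b)) (comult H x))"
    and counit_left: "x \<in> carrier H \<Longrightarrow>
      lincomb H (\<lambda>(a, b). counit H a \<cdot> b) (comult H x) = x"
    and counit_right: "x \<in> carrier H \<Longrightarrow>
      lincomb H (\<lambda>(a, b). counit H b \<cdot> a) (comult H x) = x"
    and comult_mult: "\<lbrakk>x \<in> carrier H; y \<in> carrier H\<rbrakk> \<Longrightarrow>
      tensor_eq H H (comult H (x \<otimes> y)) (tensor_mult H (comult H x) (comult H y))"
    and comult_one: "tensor_eq H H (comult H \<one>) (pure (\<one>, \<one>))"
    and counit_mult: "\<lbrakk>x \<in> carrier H; y \<in> carrier H\<rbrakk> \<Longrightarrow>
      counit H (x \<otimes> y) = counit H x * counit H y"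
    and counit_one: "counit H \<one> = 1"
    and antipode: "\<exists>S \<in> carrier H \<rightarrow> carrier H.
      (\<forall>x\<in>carrier H. \<forall>y\<in>carrier H. S (x \<oplus> y) = S x \<oplus> S y) \<and>
      (\<forall>c. \<forall>x\<in>carrier H. S (c \<cdot> x) = c \<cdot> S x) \<and>
      (\<forall>x\<in>carrier H. lincomb H (\<lambda>(a, b). S a \<otimes> b) (comult H x) = counit H x \<cdot> \<one>) \<and>
      (\<forall>x\<in>carrier H. lincomb H (\<lambda>(a, b). a \<otimes> S b) (comult H x) = counit H x \<cdot> \<one>)"

definition same_coalgebra ::
    "('a, 'k::field, 'm) khopf_scheme \<Rightarrow> ('a, 'k, 'n) khopf_scheme \<Rightarrow> bool"
  where "same_coalgebra H H' \<longleftrightarrow> (\<forall>x\<in>carrier H.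
    tensor_eq H H (comult H x) (comult H' x) \<and> counit H x = counit H' x)"

definition grouplikes :: "('a, 'k::field, 'm) khopf_scheme \<Rightarrow> 'a set"
  where "grouplikes H =
    {x \<in> carrier H. x \<noteq> \<zero>\<^bsub>H\<^esub> \<and> tensor_eq H H (comult H x) (pure (x, x))}"

definition skew_primitives :: "('a, 'k::field, 'm) khopf_scheme \<Rightarrow> 'a \<Rightarrow> 'a \<Rightarrow> 'a set"
  where "skew_primitives H g h =
    {l \<in> carrier H. tensor_eq H H (comult H l) (pure (l, h) + pure (g, l))}"

definition hopf_iso ::
    "('a, 'k::field, 'm) khopf_scheme \<Rightarrow> ('b, 'k, 'n) khopf_scheme \<Rightarrow> ('a \<Rightarrow> 'b) \<Rightarrow> bool"
  where "hopf_iso H K \<phi> \<longleftrightarrow>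
    hopf_algebra H \<and> hopf_algebra K \<and> \<phi> \<in> ring_iso H K \<and>
    (\<forall>c. \<forall>x\<in>carrier H. \<phi> (c \<cdot>\<^bsub>H\<^esub> x) = c \<cdot>\<^bsub>K\<^esub> \<phi> x) \<and>
    (\<forall>x\<in>carrier H. tensor_eq K K (comult K (\<phi> x)) (tensor_map \<phi> \<phi> (comult H x))) \<and>
    (\<forall>x\<in>carrier H. counit K (\<phi> x) = counit H x)"

text \<open>The second component of each pair is the sequence of homogeneous components.\<close>

definition graded_hopf_isomorphic ::
    "('a, 'k::field, 'm) khopf_scheme \<times> (nat \<Rightarrow> 'a set) \<Rightarrow>
     ('b, 'k, 'n) khopf_scheme \<times> (nat \<Rightarrow> 'b set) \<Rightarrow> bool"
  where "graded_hopf_isomorphic = (\<lambda>(H, HH) (K, KK).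
    \<exists>\<phi>. hopf_iso H K \<phi> \<and> (\<forall>n. \<phi> ` HH n = KK n))"


subsection \<open>Coradical filtration and associated graded Hopf algebra\<close>

definition subcoalgebra :: "('a, 'k::field, 'm) khopf_scheme \<Rightarrow> 'a set \<Rightarrow> bool"
  where "subcoalgebra H C \<longleftrightarrow> C \<subseteq> carrier H \<and> k_span H C = C \<and>
    (\<forall>x\<in>C. \<exists>s. supp s \<subseteq> C \<times> C \<and> tensor_eq H H (comult H x) s)"

definition simple_subcoalgebra :: "('a, 'k::field, 'm) khopf_scheme \<Rightarrow> 'a set \<Rightarrow> bool"
  where "simple_subcoalgebra H C \<longleftrightarrow> subcoalgebra H C \<and> C \<noteq> {\<zero>\<^bsub>H\<^esub>} \<and>
    (\<forall>D. subcoalgebra H D \<longrightarrow> D \<subseteq> C \<longrightarrow> D = {\<zero>\<^bsub>H\<^esub>} \<or> D = C)"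

definition pointed :: "('a, 'k::field, 'm) khopf_scheme \<Rightarrow> bool"
  where "pointed H \<longleftrightarrow> (\<forall>C. simple_subcoalgebra H C \<longrightarrow> k_dim H C = 1)"

definition coradical :: "('a, 'k::field, 'm) khopf_scheme \<Rightarrow> 'a set"
  where "coradical H = k_span H (\<Union>{C. simple_subcoalgebra H C})"

primrec corad_filt :: "('a, 'k::field, 'm) khopf_scheme \<Rightarrow> nat \<Rightarrow> 'a set"
  where
    "corad_filt H 0 = coradical H"
  | "corad_filt H (Suc n) = {x \<in> carrier H. \<exists>s.
       supp s \<subseteq> carrier H \<times> corad_filt H n \<union> coradical H \<times> carrier H \<and>
       tensor_eq H H (comult H x) s}"

primrec corad_below :: "('a, 'k::field, 'm) khopf_scheme \<Rightarrow> nat \<Rightarrow> 'a set"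
  where
    "corad_below H 0 = {\<zero>\<^bsub>H\<^esub>}"
  | "corad_below H (Suc n) = corad_filt H n"

text \<open>
  An element of \<open>gr H\<close> is the sequence of its homogeneous components, the \<open>n\<close>-th one being a
  coset of \<open>H\<^sub>n\<^sub>-\<^sub>1\<close> in \<open>H\<^sub>n\<close>; \<open>gr_hom H n x\<close> is the class of \<open>x\<close> placed in degree \<open>n\<close>.
\<close>

definition gr_rep :: "(nat \<Rightarrow> 'a set) \<Rightarrow> nat \<Rightarrow> 'a"
  where "gr_rep f n = (SOME x. x \<in> f n)"

definition gr_class :: "('a, 'k::field, 'm) khopf_scheme \<Rightarrow> nat \<Rightarrow> 'a \<Rightarrow> 'a set"
  where "gr_class H n x = corad_below H n +>\<^bsub>H\<^esub> x"

definition gr_hom :: "('a, 'k::field, 'm) khopf_scheme \<Rightarrow> nat \<Rightarrow> 'a \<Rightarrow> (nat \<Rightarrow> 'a set)"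
  where "gr_hom H n x = (\<lambda>m. if m = n then gr_class H n x else corad_below H m)"

definition gr_degrees :: "('a, 'k::field, 'm) khopf_scheme \<Rightarrow> (nat \<Rightarrow> 'a set) \<Rightarrow> nat set"
  where "gr_degrees H f = {n. f n \<noteq> corad_below H n}"

text \<open>
  For \<open>x \<in> H\<^sub>n\<close> write \<open>\<Delta> x\<close> as a combination of pure tensors \<open>a \<otimes> b\<close>, each lying in some
  \<open>H\<^sub>i \<otimes> H\<^sub>n\<^sub>-\<^sub>i\<close>, and project to the sum of the \<open>gr\<^sub>i \<otimes> gr\<^sub>n\<^sub>-\<^sub>i\<close>.  If \<open>a \<otimes> b\<close> lies in
  \<open>H\<^sub>i \<otimes> H\<^sub>n\<^sub>-\<^sub>i\<close> for several \<open>i\<close>, then all of its projections vanish, so the inner sum has at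
  most one nonzero term.
\<close>

definition gr_comult_hom :: "('a, 'k::field, 'm) khopf_scheme \<Rightarrow> nat \<Rightarrow> 'a \<Rightarrow>
    ((nat \<Rightarrow> 'a set) \<times> (nat \<Rightarrow> 'a set) \<Rightarrow>\<^sub>0 'k)"
  where "gr_comult_hom H n x =
    lin_ext (\<lambda>(a, b). \<Sum>i | i \<le> n \<and> a \<in> corad_filt H i \<and> b \<in> corad_filt H (n - i).
        pure (gr_hom H i a, gr_hom H (n - i) b))
      (SOME s. supp s \<subseteq> (\<Union>i\<le>n. corad_filt H i \<times> corad_filt H (n - i)) \<and>
        tensor_eq H H (comult H x) s)"

definition gr_hopf :: "('a, 'k::field, 'm) khopf_scheme \<Rightarrow> (nat \<Rightarrow> 'a set, 'k) khopf"
  where "gr_hopf H = \<lparr>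
    carrier = {f. (\<forall>n. \<exists>x\<in>corad_filt H n. f n = gr_class H n x) \<and> finite (gr_degrees H f)},
    monoid.mult = (\<lambda>f f' n. gr_class H n (\<Oplus>\<^bsub>H\<^esub>i\<in>{..n}. gr_rep f i \<otimes>\<^bsub>H\<^esub> gr_rep f' (n - i))),
    one = gr_hom H 0 \<one>\<^bsub>H\<^esub>,
    zero = corad_below H,
    add = (\<lambda>f f' n. f n <+>\<^bsub>H\<^esub> f' n),
    kscale = (\<lambda>c f n. gr_class H n (c \<cdot>\<^bsub>H\<^esub> gr_rep f n)),
    comult = (\<lambda>f. \<Sum>n\<in>gr_degrees H f. gr_comult_hom H n (gr_rep f n)),
    counit = (\<lambda>f. counit H (gr_rep f 0))\<rparr>"

definition gr_component :: "('a, 'k::field, 'm) khopf_scheme \<Rightarrow> nat \<Rightarrow> (nat \<Rightarrow> 'a set) set"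
  where "gr_component H n = gr_hom H n ` corad_filt H n"


section \<open>Nichols algebras and bosonization\<close>

text \<open>
  A braided vector space is given by a basis (a type) and the images \<open>c x y\<close> of the basis
  tensors \<open>x \<otimes> y\<close>.  Words of length \<open>n\<close> form a basis of \<open>T\<^sup>n(V)\<close>; \<open>braid_at c i\<close> is the braiding
  applied to the tensor factors \<open>i\<close> and \<open>i + 1\<close>, counted from \<open>0\<close>.
\<close>

type_synonym ('x, 'k) braiding = "'x \<Rightarrow> 'x \<Rightarrow> ('x \<times> 'x \<Rightarrow>\<^sub>0 'k)"

definition braid_at :: "('x, 'k::field) braiding \<Rightarrow> nat \<Rightarrow> ('x list \<Rightarrow>\<^sub>0 'k) \<Rightarrow> ('x list \<Rightarrow>\<^sub>0 'k)"
  where "braid_at c i = lin_ext (\<lambda>w.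
    lin_ext (\<lambda>(a, b). pure (take i w @ [a, b] @ drop (i + 2) w)) (c (w ! i) (w ! (i + 1))))"

text \<open>
  The quantum symmetrizer \<open>\<Sum>\<^sub>\<sigma> c\<^sub>\<sigma>\<close> over the symmetric group on \<open>n\<close> letters, where \<open>c\<^sub>\<sigma>\<close> is
  the composition of the \<open>c\<^sub>i = braid_at c i\<close> along a reduced expression of \<open>\<sigma>\<close>.  Every
  permutation of \<open>n + 1\<close> letters is, with lengths adding, the product of one of \<open>n\<close> letters and
  a unique \<open>s\<^sub>n\<^sub>-\<^sub>1 \<cdots> s\<^sub>j\<close> with \<open>0 \<le> j \<le> n\<close>; so the sum factors as
  \<open>QS\<^sub>n\<^sub>+\<^sub>1 = (QS\<^sub>n \<otimes> id) (\<Sum>\<^sub>j c\<^sub>n\<^sub>-\<^sub>1 \<cdots> c\<^sub>j)\<close>.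
\<close>

primrec quantum_symmetrizer ::
    "('x, 'k::field) braiding \<Rightarrow> nat \<Rightarrow> ('x list \<Rightarrow>\<^sub>0 'k) \<Rightarrow> ('x list \<Rightarrow>\<^sub>0 'k)"
  where
    "quantum_symmetrizer c 0 p = p"
  | "quantum_symmetrizer c (Suc n) p =
      quantum_symmetrizer c n (\<Sum>j\<le>n. fold (braid_at c) [j..<n] p)"

definition word_component :: "nat \<Rightarrow> ('x list \<Rightarrow>\<^sub>0 'k::field) \<Rightarrow> ('x list \<Rightarrow>\<^sub>0 'k)"
  where "word_component n = lin_ext (\<lambda>w. if length w = n then pure w else 0)"

definition nichols_ideal :: "('x, 'k::field) braiding \<Rightarrow> ('x list \<Rightarrow>\<^sub>0 'k) set"
  where "nichols_ideal c = {p. \<forall>n. quantum_symmetrizer c n (word_component n p) = 0}"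

text \<open>
  A Hopf algebra \<open>R\<close> in the category of Yetter-Drinfeld modules over \<open>\<Bbbk>G\<close>, with the
  action of \<open>G\<close> and the coaction \<open>r \<mapsto> r\<^sub>(\<^sub>-\<^sub>1\<^sub>) \<otimes> r\<^sub>(\<^sub>0\<^sub>)\<close>, the first factor expanded
  in the basis \<open>G\<close> of \<open>\<Bbbk>G\<close>.
\<close>

record (overloaded) ('g, 'a, 'k) yd_hopf = "('a, 'k) khopf" +
  yd_act :: "'g \<Rightarrow> 'a \<Rightarrow> 'a"
  yd_coact :: "'a \<Rightarrow> ('g \<times> 'a \<Rightarrow>\<^sub>0 'k)"

text \<open>
  The product \<open>(a \<otimes> b)(c \<otimes> d) = a (b\<^sub>(\<^sub>-\<^sub>1\<^sub>) \<cdot> c) \<otimes> b\<^sub>(\<^sub>0\<^sub>) d\<close> for the action \<open>\<alpha>\<close> and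
  the coaction \<open>\<delta>\<close>.
\<close>

definition braided_tensor_mult :: "('a, 'k::field, 'm) kalg_scheme \<Rightarrow>
    ('g \<Rightarrow> 'a \<Rightarrow> 'a) \<Rightarrow> ('a \<Rightarrow> ('g \<times> 'a \<Rightarrow>\<^sub>0 'k)) \<Rightarrow>
    ('a \<times> 'a \<Rightarrow>\<^sub>0 'k) \<Rightarrow> ('a \<times> 'a \<Rightarrow>\<^sub>0 'k) \<Rightarrow> ('a \<times> 'a \<Rightarrow>\<^sub>0 'k)"
  where "braided_tensor_mult R \<alpha> \<delta> s t =
    lin_ext (\<lambda>(a, b). lin_ext (\<lambda>(c, d).
      lin_ext (\<lambda>(u, b'). pure (a \<otimes>\<^bsub>R\<^esub> \<alpha> u c, b' \<otimes>\<^bsub>R\<^esub> d)) (\<delta> b)) t) s"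

text \<open>
  A Yetter-Drinfeld module over \<open>\<Bbbk>G\<close> is given by a homogeneous basis (a type), the degrees
  \<open>d x\<close>, i.e. \<open>\<delta>(x) = d x \<otimes> x\<close>, and the action \<open>\<alpha>\<close> on the basis.
\<close>

definition yd_braiding ::
    "('x \<Rightarrow> 'g) \<Rightarrow> ('g \<Rightarrow> 'x \<Rightarrow> ('x \<Rightarrow>\<^sub>0 'k::field)) \<Rightarrow> ('x, 'k) braiding"
  where "yd_braiding d \<alpha> x y = lin_ext (\<lambda>z. pure (z, x)) (\<alpha> (d x) y)"

primrec word_act :: "('g \<Rightarrow> 'x \<Rightarrow> ('x \<Rightarrow>\<^sub>0 'k::field)) \<Rightarrow> 'g \<Rightarrow> 'x list \<Rightarrow> ('x list \<Rightarrow>\<^sub>0 'k)"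
  where
    "word_act \<alpha> h [] = pure []"
  | "word_act \<alpha> h (x # w) = lin_ext var (\<alpha> h x) \<otimes>\<^bsub>free_algebra UNIV\<^esub> word_act \<alpha> h w"

primrec word_degree :: "('g, 'm) monoid_scheme \<Rightarrow> ('x \<Rightarrow> 'g) \<Rightarrow> 'x list \<Rightarrow> 'g"
  where
    "word_degree G d [] = \<one>\<^bsub>G\<^esub>"
  | "word_degree G d (x # w) = d x \<otimes>\<^bsub>G\<^esub> word_degree G d w"

definition tensor_act :: "('g \<Rightarrow> 'x \<Rightarrow> ('x \<Rightarrow>\<^sub>0 'k::field)) \<Rightarrow>
    'g \<Rightarrow> ('x list \<Rightarrow>\<^sub>0 'k) \<Rightarrow> ('x list \<Rightarrow>\<^sub>0 'k)"
  where "tensor_act \<alpha> h = lin_ext (word_act \<alpha> h)"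

definition tensor_coact :: "('g, 'm) monoid_scheme \<Rightarrow> ('x \<Rightarrow> 'g) \<Rightarrow>
    ('x list \<Rightarrow>\<^sub>0 'k::field) \<Rightarrow> ('g \<times> ('x list \<Rightarrow>\<^sub>0 'k) \<Rightarrow>\<^sub>0 'k)"
  where "tensor_coact G d = lin_ext (\<lambda>w. pure (word_degree G d w, pure w))"

text \<open>
  The braided comultiplication of \<open>T(V)\<close> is the algebra map to the braided tensor square with
  \<open>v \<mapsto> v \<otimes> 1 + 1 \<otimes> v\<close>.
\<close>

primrec word_comult :: "('g, 'm) monoid_scheme \<Rightarrow> ('x \<Rightarrow> 'g) \<Rightarrow>
    ('g \<Rightarrow> 'x \<Rightarrow> ('x \<Rightarrow>\<^sub>0 'k::field)) \<Rightarrow> 'x list \<Rightarrow>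
    (('x list \<Rightarrow>\<^sub>0 'k) \<times> ('x list \<Rightarrow>\<^sub>0 'k) \<Rightarrow>\<^sub>0 'k)"
  where
    "word_comult G d \<alpha> [] = pure (pure [], pure [])"
  | "word_comult G d \<alpha> (x # w) =
      braided_tensor_mult (free_algebra UNIV) (tensor_act \<alpha>) (tensor_coact G d)
        (pure (var x, pure []) + pure (pure [], var x)) (word_comult G d \<alpha> w)"

definition tensor_yd :: "('g, 'm) monoid_scheme \<Rightarrow> ('x \<Rightarrow> 'g) \<Rightarrow>
    ('g \<Rightarrow> 'x \<Rightarrow> ('x \<Rightarrow>\<^sub>0 'k::field)) \<Rightarrow> ('g, 'x list \<Rightarrow>\<^sub>0 'k, 'k) yd_hopf"
  where "tensor_yd G d \<alpha> = khopf.extend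
    (kalg.extend (free_algebra UNIV)
      (khopf.fields (lin_ext (word_comult G d \<alpha>)) (\<lambda>p. coef p [])))
    (yd_hopf.fields (tensor_act \<alpha>) (tensor_coact G d))"

definition quot_yd :: "('g, 'a, 'k::field) yd_hopf \<Rightarrow> 'a set \<Rightarrow> ('g, 'a set, 'k) yd_hopf"
  where "quot_yd R J = (let \<pi> = (\<lambda>p. J +>\<^bsub>R\<^esub> p); rep = (\<lambda>X. SOME p. p \<in> X) in
    khopf.extend
      (kalg.extend (quot_alg R J)
        (khopf.fields (\<lambda>X. tensor_map \<pi> \<pi> (comult R (rep X))) (\<lambda>X. counit R (rep X))))
      (yd_hopf.fields (\<lambda>h X. \<pi> (yd_act R h (rep X)))
        (\<lambda>X. tensor_map id \<pi> (yd_coact R (rep X)))))"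

text \<open>
  An element of \<open>R # \<Bbbk>G = R \<otimes> \<Bbbk>G\<close> is a finitely supported family of elements of \<open>R\<close>
  indexed by \<open>G\<close>; \<open>smash R r h\<close> is \<open>r # h\<close>.  The structure is
  \<open>(r # h)(s # t) = r (h \<cdot> s) # h t\<close> and
  \<open>\<Delta>(r # h) = r\<^sup>(\<^sup>1\<^sup>) # (r\<^sup>(\<^sup>2\<^sup>))\<^sub>(\<^sub>-\<^sub>1\<^sub>) h \<otimes> (r\<^sup>(\<^sup>2\<^sup>))\<^sub>(\<^sub>0\<^sub>) # h\<close>.
\<close>

definition smash :: "('g, 'a, 'k::field) yd_hopf \<Rightarrow> 'a \<Rightarrow> 'g \<Rightarrow> ('g \<Rightarrow> 'a)"
  where "smash R r h = (\<lambda>t. if t = h then r else \<zero>\<^bsub>R\<^esub>)"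

definition smash_supp :: "('g, 'a, 'k::field) yd_hopf \<Rightarrow> ('g \<Rightarrow> 'a) \<Rightarrow> 'g set"
  where "smash_supp R f = {h. f h \<noteq> \<zero>\<^bsub>R\<^esub>}"

definition bosonization ::
    "('g, 'm) monoid_scheme \<Rightarrow> ('g, 'a, 'k::field) yd_hopf \<Rightarrow> ('g \<Rightarrow> 'a, 'k) khopf"
  where "bosonization G R = \<lparr>
    carrier = {f. range f \<subseteq> carrier R \<and> smash_supp R f \<subseteq> carrier G \<and> finite (smash_supp R f)},
    monoid.mult = (\<lambda>f f' x. \<Oplus>\<^bsub>R\<^esub>h\<in>smash_supp R f.
      \<Oplus>\<^bsub>R\<^esub>t\<in>{t \<in> smash_supp R f'. h \<otimes>\<^bsub>G\<^esub> t = x}. f h \<otimes>\<^bsub>R\<^esub> yd_act R h (f' t)),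
    one = smash R \<one>\<^bsub>R\<^esub> \<one>\<^bsub>G\<^esub>,
    zero = (\<lambda>_. \<zero>\<^bsub>R\<^esub>),
    add = (\<lambda>f f' h. f h \<oplus>\<^bsub>R\<^esub> f' h),
    kscale = (\<lambda>c f h. c \<cdot>\<^bsub>R\<^esub> f h),
    comult = (\<lambda>f. \<Sum>h\<in>smash_supp R f. lin_ext (\<lambda>(r, s).
        lin_ext (\<lambda>(u, s'). pure (smash R r (u \<otimes>\<^bsub>G\<^esub> h), smash R s' h)) (yd_coact R s))
      (comult R (f h))),
    counit = (\<lambda>f. \<Sum>h\<in>smash_supp R f. counit R (f h))\<rparr>"


subsection \<open>The block \<open>\<V>(1,2)\<close>\<close>

datatype block = X1 | X2

fun block_braiding :: "(block, 'k::field) braiding"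
  where
    "block_braiding x X1 = pure (X1, x)"
  | "block_braiding x X2 = pure (X1, x) + pure (X2, x)"

fun block_act :: "(('g \<Rightarrow>\<^sub>0 'k::field) \<Rightarrow> 'k) \<Rightarrow> 'g \<Rightarrow> block \<Rightarrow> (block \<Rightarrow>\<^sub>0 'k)"
  where
    "block_act \<eta> h X1 = pure X1"
  | "block_act \<eta> h X2 = pure X2 + pscale (\<eta> (pure h)) (pure X1)"

definition block_nichols :: "('g, 'm) monoid_scheme \<Rightarrow> 'g \<Rightarrow> (('g \<Rightarrow>\<^sub>0 'k::field) \<Rightarrow> 'k) \<Rightarrow>
    ('g, (block list \<Rightarrow>\<^sub>0 'k) set, 'k) yd_hopf"
  where "block_nichols G g \<eta> =
    quot_yd (tensor_yd G (\<lambda>_. g) (block_act \<eta>)) (nichols_ideal block_braiding)"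

definition block_bosonization :: "('g, 'm) monoid_scheme \<Rightarrow> 'g \<Rightarrow> (('g \<Rightarrow>\<^sub>0 'k::field) \<Rightarrow> 'k) \<Rightarrow>
    ('g \<Rightarrow> (block list \<Rightarrow>\<^sub>0 'k) set, 'k) khopf"
  where "block_bosonization G g \<eta> = bosonization G (block_nichols G g \<eta>)"

definition block_component :: "('g, 'm) monoid_scheme \<Rightarrow> 'g \<Rightarrow> (('g \<Rightarrow>\<^sub>0 'k::field) \<Rightarrow> 'k) \<Rightarrow>
    nat \<Rightarrow> ('g \<Rightarrow> (block list \<Rightarrow>\<^sub>0 'k) set) set"
  where "block_component G g \<eta> n = {f \<in> carrier (block_bosonization G g \<eta>).
    \<forall>h. \<exists>p. (\<forall>w\<in>supp p. length w = n) \<and>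
      f h = nichols_ideal block_braiding +>\<^bsub>free_algebra UNIV\<^esub> p}"


section \<open>Yetter-Drinfeld triples and the algebras \<open>\<UU>\<^sub>\<xi>(\<D>, \<lambda>)\<close>\<close>

definition Der_triv :: "('g, 'm) monoid_scheme \<Rightarrow> (('g \<Rightarrow>\<^sub>0 'k::field) \<Rightarrow> 'k) set"
  where "Der_triv G = {\<eta>.
    (\<forall>p \<in> carrier (monoid_algebra G). \<forall>q \<in> carrier (monoid_algebra G). \<eta> (p + q) = \<eta> p + \<eta> q) \<and>
    (\<forall>c. \<forall>p \<in> carrier (monoid_algebra G). \<eta> (pscale c p) = c * \<eta> p) \<and>
    (\<forall>h \<in> carrier G. \<forall>t \<in> carrier G. \<eta> (pure (h \<otimes>\<^bsub>G\<^esub> t)) = \<eta> (pure h) + \<eta> (pure t))}"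

definition yd_triple :: "('g, 'm) monoid_scheme \<Rightarrow> 'g \<Rightarrow> (('g \<Rightarrow>\<^sub>0 'k::field) \<Rightarrow> 'k) \<Rightarrow> bool"
  where "yd_triple G g \<eta> \<longleftrightarrow>
    g \<in> carrier G \<and> (\<forall>h \<in> carrier G. g \<otimes>\<^bsub>G\<^esub> h = h \<otimes>\<^bsub>G\<^esub> g) \<and>
    \<eta> \<in> Der_triv G \<and> \<eta> (pure g) = 1"

lemma block_braiding_eq_yd_braiding:
  assumes "\<eta> (pure g) = 1"
  shows "yd_braiding (\<lambda>_. g) (block_act \<eta>) = block_braiding"
proof (intro ext)
  fix x y :: block
  have ps: "pscale 1 p = p" for p :: "'c \<Rightarrow>\<^sub>0 'a"
    unfolding pscale_def by (rule poly_mapping_eqI) (simp add: Poly_Mapping.map.rep_eq when_def)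
  have k: "supp (pure X2 + pure X1 :: block \<Rightarrow>\<^sub>0 'a) = {X1, X2}"
    by (auto simp: in_keys_iff lookup_add lookup_single when_def split: if_splits)
  show "yd_braiding (\<lambda>_. g) (block_act \<eta>) x y = block_braiding x y"
    by (cases y) (auto simp: yd_braiding_def lin_ext_def assms ps k lookup_add lookup_single)
qed

datatype 'g gen = Grp 'g | A1 | A2

abbreviation lift_gens :: "('g, 'm) monoid_scheme \<Rightarrow> 'g gen set"
  where "lift_gens G \<equiv> Grp ` carrier G \<union> {A1, A2}"

definition lift_relations :: "('g, 'm) monoid_scheme \<Rightarrow> 'g \<Rightarrow>
    (('g \<Rightarrow>\<^sub>0 'k::field) \<Rightarrow> 'k) \<Rightarrow> (('g \<Rightarrow>\<^sub>0 'k) \<Rightarrow> 'k) \<Rightarrow> 'k \<Rightarrow>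
    (('g gen list \<Rightarrow>\<^sub>0 'k) \<times> ('g gen list \<Rightarrow>\<^sub>0 'k)) set"
  where "lift_relations G g \<eta> \<xi> lam =
    (let F = free_algebra (lift_gens G); u = (\<lambda>h. var (Grp h)); a1 = var A1; a2 = var A2 in
      {(u h \<otimes>\<^bsub>F\<^esub> u t, u (h \<otimes>\<^bsub>G\<^esub> t)) | h t. h \<in> carrier G \<and> t \<in> carrier G} \<union>
      {(u \<one>\<^bsub>G\<^esub>, \<one>\<^bsub>F\<^esub>)} \<union>
      {(u h \<otimes>\<^bsub>F\<^esub> a1, a1 \<otimes>\<^bsub>F\<^esub> u h) | h. h \<in> carrier G} \<union>
      {(u h \<otimes>\<^bsub>F\<^esub> a2,
        (a2 + pscale (\<eta> (pure h)) a1 + pscale (\<xi> (pure h)) (\<one>\<^bsub>F\<^esub> - u g)) \<otimes>\<^bsub>F\<^esub> u h) | h.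
        h \<in> carrier G} \<union>
      {(a1 \<otimes>\<^bsub>F\<^esub> a2 - a2 \<otimes>\<^bsub>F\<^esub> a1 - pscale (1/2) (a1 \<otimes>\<^bsub>F\<^esub> a1),
        pscale lam (\<one>\<^bsub>F\<^esub> - u g \<otimes>\<^bsub>F\<^esub> u g))})"

definition lift_ideal :: "('g, 'm) monoid_scheme \<Rightarrow> 'g \<Rightarrow>
    (('g \<Rightarrow>\<^sub>0 'k::field) \<Rightarrow> 'k) \<Rightarrow> (('g \<Rightarrow>\<^sub>0 'k) \<Rightarrow> 'k) \<Rightarrow> 'k \<Rightarrow> ('g gen list \<Rightarrow>\<^sub>0 'k) set"
  where "lift_ideal G g \<eta> \<xi> lam = relation_ideal (lift_gens G) (lift_relations G g \<eta> \<xi> lam)"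

definition lift_alg :: "('g, 'm) monoid_scheme \<Rightarrow> 'g \<Rightarrow>
    (('g \<Rightarrow>\<^sub>0 'k::field) \<Rightarrow> 'k) \<Rightarrow> (('g \<Rightarrow>\<^sub>0 'k) \<Rightarrow> 'k) \<Rightarrow> 'k \<Rightarrow> (('g gen list \<Rightarrow>\<^sub>0 'k) set, 'k) kalg"
  where "lift_alg G g \<eta> \<xi> lam = quot_alg (free_algebra (lift_gens G)) (lift_ideal G g \<eta> \<xi> lam)"

definition lift_gen :: "('g, 'm) monoid_scheme \<Rightarrow> 'g \<Rightarrow>
    (('g \<Rightarrow>\<^sub>0 'k::field) \<Rightarrow> 'k) \<Rightarrow> (('g \<Rightarrow>\<^sub>0 'k) \<Rightarrow> 'k) \<Rightarrow> 'k \<Rightarrow> 'g gen \<Rightarrow> ('g gen list \<Rightarrow>\<^sub>0 'k) set"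
  where "lift_gen G g \<eta> \<xi> lam x =
    lift_ideal G g \<eta> \<xi> lam +>\<^bsub>free_algebra (lift_gens G)\<^esub> var x"

text \<open>
  Hopf algebra structures on \<open>\<UU>\<^sub>\<xi>(\<D>, \<lambda>)\<close> whose group-likes are the images of the elements
  of \<open>G\<close> and in which \<open>a\<^sub>1\<close>, \<open>a\<^sub>2\<close> are \<open>(g, 1)\<close>-primitive.
  They exist only if \<open>\<xi>(g) = 0\<close>: since \<open>g a\<^sub>2 - a\<^sub>2 g = a\<^sub>1 g + \<xi>(g) (1 - g) g\<close>, applying such
  a comultiplication to \<open>a\<^sub>1 a\<^sub>2 - a\<^sub>2 a\<^sub>1 - 1/2 a\<^sub>1\<^sup>2 - \<lambda> (1 - g\<^sup>2) = 0\<close> gives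
  \<open>\<xi>(g) (g - g\<^sup>2) \<otimes> a\<^sub>1 = 0\<close>, whereas \<open>g \<noteq> g\<^sup>2\<close> and \<open>a\<^sub>1 \<noteq> 0\<close>.
\<close>

definition lift_hopf :: "('g, 'm) monoid_scheme \<Rightarrow> 'g \<Rightarrow>
    (('g \<Rightarrow>\<^sub>0 'k::field) \<Rightarrow> 'k) \<Rightarrow> (('g \<Rightarrow>\<^sub>0 'k) \<Rightarrow> 'k) \<Rightarrow> 'k \<Rightarrow>
    (('g gen list \<Rightarrow>\<^sub>0 'k) set, 'k) khopf \<Rightarrow> bool"
  where "lift_hopf G g \<eta> \<xi> lam H \<longleftrightarrow>
    (let x = lift_gen G g \<eta> \<xi> lam in
      hopf_algebra H \<and> kalg.truncate H = lift_alg G g \<eta> \<xi> lam \<and>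
      grouplikes H = (\<lambda>h. x (Grp h)) ` carrier G \<and>
      x A1 \<in> skew_primitives H (x (Grp g)) \<one>\<^bsub>H\<^esub> \<and>
      x A2 \<in> skew_primitives H (x (Grp g)) \<one>\<^bsub>H\<^esub>)"

definition lift_monomial :: "('g, 'm) monoid_scheme \<Rightarrow> 'g \<Rightarrow>
    (('g \<Rightarrow>\<^sub>0 'k::field) \<Rightarrow> 'k) \<Rightarrow> (('g \<Rightarrow>\<^sub>0 'k) \<Rightarrow> 'k) \<Rightarrow> 'k \<Rightarrow>
    nat \<times> nat \<times> 'g \<Rightarrow> ('g gen list \<Rightarrow>\<^sub>0 'k) set"
  where "lift_monomial G g \<eta> \<xi> lam = (\<lambda>(m, n, h).
    let U = lift_alg G g \<eta> \<xi> lam; x = lift_gen G g \<eta> \<xi> lam in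
      x A1 [^]\<^bsub>U\<^esub> m \<otimes>\<^bsub>U\<^esub> x A2 [^]\<^bsub>U\<^esub> n \<otimes>\<^bsub>U\<^esub> x (Grp h))"


section \<open>Nilpotent-by-finite groups\<close>

primrec lower_central :: "('g, 'm) monoid_scheme \<Rightarrow> 'g set \<Rightarrow> nat \<Rightarrow> 'g set"
  where
    "lower_central G N 0 = N"
  | "lower_central G N (Suc n) = generate G
      {x \<otimes>\<^bsub>G\<^esub> y \<otimes>\<^bsub>G\<^esub> inv\<^bsub>G\<^esub> x \<otimes>\<^bsub>G\<^esub> inv\<^bsub>G\<^esub> y | x y. x \<in> lower_central G N n \<and> y \<in> N}"

definition nilpotent_by_finite :: "('g, 'm) monoid_scheme \<Rightarrow> bool"
  where "nilpotent_by_finite G \<longleftrightarrow>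
    (\<exists>N. N \<lhd> G \<and> (\<exists>n. lower_central G N n = {\<one>\<^bsub>G\<^esub>}) \<and> finite (carrier (G Mod N)))"

definition finitely_generated :: "('g, 'm) monoid_scheme \<Rightarrow> bool"
  where "finitely_generated G \<longleftrightarrow> (\<exists>S. finite S \<and> S \<subseteq> carrier G \<and> generate G S = carrier G)"

end

theory Submission
  imports Defs
begin

text \<open>
  The generators act on the space with basis \<open>a\<^sub>1\<^sup>m h a\<^sub>2\<^sup>n\<close> by explicit operators satisfying the
  relations; applying words to the vacuum and rewriting words to normal form are mutually
  inverse, which gives the basis and structure constants for \<open>\<UU>\<^sub>\<xi>(\<D>, \<lambda>)\<close>.  Two Hopf algebras with
  the same structure constants are isomorphic.

  Filter by the degree \<open>m + n\<close>.  In characteristic \<open>0\<close> the bidegree \<open>(1, N - 1)\<close> part of \<open>\<Delta>(v)\<close> does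
  not vanish if \<open>v\<close> has degree \<open>N \<ge> 1\<close>.  Hence the simple subcoalgebras are the lines spanned by the
  elements of \<open>G\<close>, the coradical filtration is the filtration by degree, and \<open>gr\<close> has the structure
  constants of the case \<open>\<xi> = 0\<close>, \<open>\<lambda> = 0\<close>.  In that case the skew derivations occurring in the
  recursion of the quantum symmetrizer are the \<open>(N - 1, 1)\<close> parts of \<open>\<Delta>\<close>, whose joint kernel is
  trivial by a triangularity argument; so the Nichols ideal is the kernel of the map from the tensor
  algebra to the Jordan plane, and the bosonization has the same structure constants.

  If \<open>g\<close> is among the generators of \<open>G\<close>, then \<open>m + n\<close> plus the word length of \<open>h\<close> is subadditive, so
  up to rescaling \<open>n\<close> the powers of a generating subspace have dimension \<open>n\<^sup>2\<close> times the size of a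
  ball in \<open>G\<close>.  For nilpotent \<open>G\<close>, moving one letter to the left of a word of length \<open>n\<close> produces
  polynomially many commutators from the next term of the lower central series, which bounds the
  balls by induction; finite index is handled by coset representatives.
\<close>

section \<open>Linear algebra of formal linear combinations\<close>

text \<open>Tensor products are given as formal combinations of pairs modulo an inductively
  generated subspace, in which it is hard to show that something is not null. A linear bijection
  onto the finitely supported functions on an index set turns equality of tensors into equality of
  coefficients, and a Hopf algebra into a product and a coproduct on such functions. All algebras
  below therefore share one index set of triples (exponent of a1, group element, exponent of a2),
  and an isomorphism between two of them is a mere change of carrier.

  The group element stands in the middle because left multiplication by h, a1 and a2 is then a short
  formula; on monomials a1^m a2^n h, multiplication by h would already involve the n-th power of a2
  + \<eta>(h) a1 + \<xi>(h)(1 - g). The order used in the statement is recovered by a unitriangular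
  change of basis.

  Characteristic 0 enters through the exponents: contracting \<Delta>(a1^m h a2^n) with a functional
  of degree 1 multiplies coefficients by m or n, so leading terms survive. The summand 2 in the
  dimension counts the two exponents.\<close>

lemma coef_pscale [simp]: "coef (pscale c p) x = c * coef p x"
  by (simp add: pscale_def Poly_Mapping.map.rep_eq when_def)

lemma supp_pscale_subset: "supp (pscale c p) \<subseteq> supp p"
  by (auto simp: in_keys_iff)

lemma pscale_add_right: "pscale c (p + q) = pscale c p + pscale c q"
  by (rule poly_mapping_eqI) (simp add: lookup_add algebra_simps)

lemma pscale_diff_right: "pscale c (p - q) = pscale c p - pscale c q"
  by (rule poly_mapping_eqI) (simp add: lookup_minus algebra_simps)

lemma pscale_add_left: "pscale (c + d) p = pscale c p + pscale d p"
  by (rule poly_mapping_eqI) (simp add: lookup_add algebra_simps)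

lemma pscale_minus_left: "pscale (- c) p = - pscale c p"
  by (rule poly_mapping_eqI) simp

lemma pscale_pscale [simp]: "pscale c (pscale d p) = pscale (c * d) p"
  by (rule poly_mapping_eqI) (simp add: algebra_simps)

lemma pscale_one [simp]: "pscale 1 p = p"
  by (rule poly_mapping_eqI) simp

lemma pscale_zero_left [simp]: "pscale 0 p = 0"
  by (rule poly_mapping_eqI) simp

lemma pscale_zero_right [simp]: "pscale c 0 = 0"
  by (rule poly_mapping_eqI) simp

lemma supp_pscale: "supp (pscale c p) = (if c = 0 then {} else supp p)"
  by (auto simp: in_keys_iff)

lemma pscale_sum: "pscale c (\<Sum>x\<in>A. f x) = (\<Sum>x\<in>A. pscale c (f x))"
  by (induction A rule: infinite_finite_induct) (auto simp: pscale_add_right)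

lemma pscale_eq_0_iff [simp]: "pscale c p = 0 \<longleftrightarrow> c = 0 \<or> p = 0"
proof
  assume *: "pscale c p = 0"
  have "p = 0" if "c \<noteq> 0"
  proof (rule poly_mapping_eqI)
    fix x
    have "c * coef p x = 0"
      by (metis * coef_pscale lookup_zero)
    with that show "coef p x = coef 0 x" by simp
  qed
  then show "c = 0 \<or> p = 0" by auto
qed auto

lemma pure_neq_0 [simp]: "(pure x :: 'a \<Rightarrow>\<^sub>0 'k::field) \<noteq> 0"
  by (metis lookup_single_eq lookup_zero zero_neq_one)

lemma supp_minus: "supp (p - q) \<subseteq> supp p \<union> supp (q :: 'a \<Rightarrow>\<^sub>0 'k::ab_group_add)"
  by (auto simp: in_keys_iff lookup_minus)

lemma supp_sum: "supp (\<Sum>x\<in>A. f x) \<subseteq> (\<Union>x\<in>A. supp (f x))"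
  by (auto simp: in_keys_iff lookup_sum dest!: sum.not_neutral_contains_not_neutral)

lemma lin_ext_superset:
  assumes "finite A" and "supp p \<subseteq> A"
  shows "lin_ext f p = (\<Sum>x\<in>A. pscale (coef p x) (f x))"
  unfolding lin_ext_def
  by (rule sum.mono_neutral_left) (use assms in \<open>auto simp: in_keys_iff\<close>)

lemma lin_ext_0 [simp]: "lin_ext f 0 = 0"
  by (simp add: lin_ext_def)

lemma lin_ext_pure [simp]: "lin_ext f (pure x) = f x"
  by (simp add: lin_ext_def)

lemma lin_ext_add: "lin_ext f (p + q) = lin_ext f p + lin_ext f q"
proof -
  have "lin_ext f (p + q) =
      (\<Sum>x\<in>supp p \<union> supp q. pscale (coef p x) (f x) + pscale (coef q x) (f x))"
    by (subst lin_ext_superset[of "supp p \<union> supp q"])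
      (use keys_add[of p q] in \<open>auto simp: lookup_add pscale_add_left\<close>)
  also have "\<dots> = lin_ext f p + lin_ext f q"
    by (subst sum.distrib, subst (1 2) lin_ext_superset[of "supp p \<union> supp q"]) auto
  finally show ?thesis .
qed

lemma lin_ext_pscale: "lin_ext f (pscale c p) = pscale c (lin_ext f p)"
  by (subst lin_ext_superset[of "supp p"]) (auto simp: supp_pscale lin_ext_def pscale_sum)

lemma lin_ext_uminus: "lin_ext f (- p) = - lin_ext f p"
  using lin_ext_pscale[of f "-1" p] by (simp add: pscale_minus_left)

lemma lin_ext_diff: "lin_ext f (p - q) = lin_ext f p - lin_ext f q"
  using lin_ext_add[of f p "- q"] by (simp add: lin_ext_uminus)

lemma lin_ext_sum: "lin_ext f (\<Sum>x\<in>A. h x) = (\<Sum>x\<in>A. lin_ext f (h x))"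
  by (induction A rule: infinite_finite_induct) (auto simp: lin_ext_add)

lemmas lin_ext_simps =
  lin_ext_add lin_ext_diff lin_ext_pscale lin_ext_uminus lin_ext_sum

lemma lin_ext_cong: "(\<And>x. x \<in> supp p \<Longrightarrow> f x = h x) \<Longrightarrow> lin_ext f p = lin_ext h p"
  by (simp add: lin_ext_def)

lemma lin_ext_pure_id [simp]: "lin_ext pure p = p"
proof (rule poly_mapping_eqI)
  fix y
  have "coef (lin_ext pure p) y = (\<Sum>x\<in>supp p. if x = y then coef p x else 0)"
    unfolding lin_ext_def lookup_sum by (rule sum.cong) (auto simp: lookup_single when_def)
  also have "\<dots> = coef p y"
    by (auto simp: in_keys_iff)
  finally show "coef (lin_ext pure p) y = coef p y" .
qed

text \<open>A formal combination is the sum of its scaled basis elements. The set \<open>A\<close>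
  is carried along so that a support condition is still available in the base case.\<close>

lemma linear_induct [consumes 1, case_names zero add scale pure]:
  assumes "supp p \<subseteq> A"
    and "P 0" and "\<And>p q. P p \<Longrightarrow> P q \<Longrightarrow> P (p + q)"
    and "\<And>c p. P p \<Longrightarrow> P (pscale c p)" and "\<And>x. x \<in> A \<Longrightarrow> P (pure x)"
  shows "P (p :: 'a \<Rightarrow>\<^sub>0 'k::field)"
proof -
  have "P (\<Sum>x\<in>B. pscale (coef p x) (pure x))" if "B \<subseteq> supp p" for B
    using finite_subset[OF that finite_keys] that
    by (induction B rule: finite_induct) (use assms in auto)
  from this[of "supp p"] show ?thesis
    using lin_ext_pure_id[of p] unfolding lin_ext_def by simp
qed

section \<open>Linear maps between spaces of formal combinations\<close>

definition plin :: "(('a \<Rightarrow>\<^sub>0 'k::field) \<Rightarrow> ('b \<Rightarrow>\<^sub>0 'k)) \<Rightarrow> bool"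
  where "plin f \<longleftrightarrow> (\<forall>p q. f (p + q) = f p + f q) \<and> (\<forall>c p. f (pscale c p) = pscale c (f p))"

lemma plinI: "(\<And>p q. f (p + q) = f p + f q) \<Longrightarrow> (\<And>c p. f (pscale c p) = pscale c (f p)) \<Longrightarrow> plin f"
  by (simp add: plin_def)

lemma plin_add: "plin f \<Longrightarrow> f (p + q) = f p + f q"
  and plin_pscale: "plin f \<Longrightarrow> f (pscale c p) = pscale c (f p)"
  by (simp_all add: plin_def)

lemma plin_0: "plin f \<Longrightarrow> f 0 = 0"
  using plin_pscale[of f 0 0] by simp

lemma plin_uminus: "plin f \<Longrightarrow> f (- p) = - f p"
  for f :: "('a \<Rightarrow>\<^sub>0 'k::field) \<Rightarrow> ('b \<Rightarrow>\<^sub>0 'k)"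
  using plin_pscale[of f "-1" p] by (simp add: pscale_minus_left)

lemma plin_diff: "plin f \<Longrightarrow> f (p - q) = f p - f q"
  using plin_add[of f p "- q"] by (simp add: plin_uminus[of f])

lemma plin_sum: "plin f \<Longrightarrow> f (\<Sum>x\<in>A. h x) = (\<Sum>x\<in>A. f (h x))"
  by (induction A rule: infinite_finite_induct) (auto simp: plin_add[of f] plin_0[of f])

lemmas plin_rules = plin_add plin_diff plin_pscale plin_0 plin_uminus plin_sum

lemma plin_lin_ext [simp, intro]: "plin (lin_ext f)"
  by (rule plinI) (simp_all add: lin_ext_simps)

lemma plin_id [simp, intro]: "plin (\<lambda>x. x)"
  by (simp add: plin_def)

lemma plin_comp: "plin f \<Longrightarrow> plin h \<Longrightarrow> plin (\<lambda>x. f (h x))"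
  by (simp add: plin_def)

lemma plin_plus: "plin f \<Longrightarrow> plin h \<Longrightarrow> plin (\<lambda>x. f x + h x)"
  by (simp add: plin_def pscale_add_right add_ac)

lemma plin_scale: "plin f \<Longrightarrow> plin (\<lambda>x. pscale c (f x))"
  by (simp add: plin_def pscale_add_right mult.commute)

lemma plin_minus: "plin f \<Longrightarrow> plin h \<Longrightarrow> plin (\<lambda>x. f x - h x)"
  by (simp add: plin_def pscale_diff_right algebra_simps)

lemma plin_eq_on:
  assumes "supp p \<subseteq> A" and "plin f" and "plin h" and "\<And>x. x \<in> A \<Longrightarrow> f (pure x) = h (pure x)"
  shows "f p = h p"
  using assms(1) by (induction p rule: linear_induct) (use assms in \<open>auto simp: plin_rules[OF assms(2)] plin_rules[OF assms(3)]\<close>)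

lemma plin_eq_lin_ext: "plin f \<Longrightarrow> f p = lin_ext (\<lambda>x. f (pure x)) p"
  by (rule plin_eq_on[OF subset_UNIV _ plin_lin_ext]) simp_all

lemma plin_in_subspace:
  assumes "supp p \<subseteq> A" and "plin f" and "\<And>x. x \<in> A \<Longrightarrow> supp (f (pure x)) \<subseteq> B"
  shows "supp (f p) \<subseteq> B"
  using assms(1)
proof (induction p rule: linear_induct)
  case (add p q) then show ?case using keys_add[of "f p" "f q"] by (auto simp: plin_rules[OF assms(2)])
next
  case (scale c p) then show ?case using supp_pscale_subset[of c "f p"] by (auto simp: plin_rules[OF assms(2)])
qed (use assms in \<open>auto simp: plin_rules[OF assms(2)]\<close>)

lemma plin_lin_ext_comp: "plin f \<Longrightarrow> f (lin_ext h p) = lin_ext (\<lambda>x. f (h x)) p"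
  unfolding lin_ext_def by (simp add: plin_sum[of f] plin_pscale[of f])

lemma lin_ext_fun_add: "lin_ext (\<lambda>x. f x + h x) p = lin_ext f p + lin_ext h p"
  by (simp add: lin_ext_def pscale_add_right sum.distrib)

lemma lin_ext_fun_pscale: "lin_ext (\<lambda>x. pscale c (f x)) p = pscale c (lin_ext f p)"
  by (simp add: lin_ext_def pscale_sum mult.commute)

lemma lin_ext_swap:
  "lin_ext (\<lambda>x. lin_ext (\<lambda>y. f x y) q) p = lin_ext (\<lambda>y. lin_ext (\<lambda>x. f x y) p) q"
  unfolding lin_ext_def pscale_sum
  by (subst sum.swap) (simp add: mult.commute)

text \<open>Here \<open>v\<close> occurs in the function being extended, not in its argument. This
  is the second half of bilinearity for nested uses of \<open>lin_ext\<close>.\<close>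

lemma plin_lin_ext_fun:
  assumes "\<And>x. plin (\<lambda>v. f v x)"
  shows "plin (\<lambda>v. lin_ext (f v) p)"
proof (rule plinI)
  fix v w c
  have "f (v + w) x = f v x + f w x" and "f (pscale c v) x = pscale c (f v x)" for x
    using plin_add[OF assms] plin_pscale[OF assms] by auto
  then have "f (v + w) = (\<lambda>x. f v x + f w x)" and "f (pscale c v) = (\<lambda>x. pscale c (f v x))"
    by auto
  then show "lin_ext (f (v + w)) p = lin_ext (f v) p + lin_ext (f w) p"
    and "lin_ext (f (pscale c v)) p = pscale c (lin_ext (f v) p)"
    by (simp_all add: lin_ext_fun_add lin_ext_fun_pscale)
qed

lemma supp_lin_ext: "supp (lin_ext f p) \<subseteq> (\<Union>x\<in>supp p. supp (f x))"
proof -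
  have "supp (lin_ext f p) \<subseteq> (\<Union>x\<in>supp p. supp (pscale (coef p x) (f x)))"
    unfolding lin_ext_def by (rule supp_sum)
  also have "\<dots> \<subseteq> (\<Union>x\<in>supp p. supp (f x))"
    by (intro UN_mono supp_pscale_subset) auto
  finally show ?thesis .
qed

lemma supp_lin_ext_subset: "(\<And>x. x \<in> supp p \<Longrightarrow> supp (f x) \<subseteq> B) \<Longrightarrow> supp (lin_ext f p) \<subseteq> B"
  using supp_lin_ext[of f p] by blast

lemma coef_lin_ext: "coef (lin_ext f p) y = (\<Sum>x\<in>supp p. coef p x * coef (f x) y)"
  by (simp add: lin_ext_def lookup_sum)

lemma lin_form_superset:
  assumes "finite A" and "supp p \<subseteq> A"
  shows "lin_form f p = (\<Sum>x\<in>A. coef p x * f x)"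
  unfolding lin_form_def
  by (rule sum.mono_neutral_left) (use assms in \<open>auto simp: in_keys_iff\<close>)

lemma lin_form_0 [simp]: "lin_form f 0 = 0"
  by (simp add: lin_form_def)

lemma lin_form_pure [simp]: "lin_form f (pure x) = f x"
  by (simp add: lin_form_def)

lemma lin_form_add: "lin_form f (p + q) = lin_form f p + lin_form f q"
proof -
  have "lin_form f (p + q) = (\<Sum>x\<in>supp p \<union> supp q. coef p x * f x + coef q x * f x)"
    by (subst lin_form_superset[of "supp p \<union> supp q"])
      (use keys_add[of p q] in \<open>auto simp: lookup_add algebra_simps\<close>)
  also have "\<dots> = lin_form f p + lin_form f q"
    by (subst sum.distrib, subst (1 2) lin_form_superset[of "supp p \<union> supp q"]) auto
  finally show ?thesis .
qed

lemma lin_form_pscale: "lin_form f (pscale c p) = c * lin_form f p"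
  by (subst lin_form_superset[of "supp p"])
    (auto simp: supp_pscale lin_form_def sum_distrib_left mult.assoc)

lemma lin_form_diff: "lin_form f (p - q) = lin_form f p - lin_form f q"
  using lin_form_add[of f p "pscale (-1) q"]
  by (subst (asm) lin_form_pscale) (simp add: pscale_minus_left)

lemmas lin_form_simps = lin_form_add lin_form_pscale lin_form_diff

lemma lin_form_lin_ext: "lin_form f (lin_ext h p) = lin_form (\<lambda>x. lin_form f (h x)) p"
  by (induction p rule: linear_induct[OF subset_UNIV]) (simp_all add: lin_form_simps lin_ext_simps)

text \<open>The tensor product of two coordinate vectors, again a coordinate vector on pairs of
  basis elements. In contrast to \<open>pure (a, b)\<close> for elements of an algebra it is
  bilinear on the nose.\<close>

definition tens :: "('a \<Rightarrow>\<^sub>0 'k::field) \<Rightarrow> ('b \<Rightarrow>\<^sub>0 'k) \<Rightarrow> ('a \<times> 'b \<Rightarrow>\<^sub>0 'k)"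
  where "tens p q = lin_ext (\<lambda>x. lin_ext (\<lambda>y. pure (x, y)) q) p"

lemma tens_pure [simp]: "tens (pure x) (pure y) = pure (x, y)"
  by (simp add: tens_def)

lemma plin_tens_left: "plin (\<lambda>p. tens p q)"
  by (simp add: tens_def)

lemma plin_tens_right: "plin (tens p)"
  unfolding tens_def by (subst lin_ext_swap) simp

lemma tens_add_left: "tens (p + p') q = tens p q + tens p' q"
  and tens_diff_left: "tens (p - p') q = tens p q - tens p' q"
  and tens_pscale_left: "tens (pscale c p) q = pscale c (tens p q)"
  and tens_0_left [simp]: "tens 0 q = 0"
  by (simp_all add: plin_rules[OF plin_tens_left])

lemma tens_add_right: "tens p (q + q') = tens p q + tens p q'"
  and tens_diff_right: "tens p (q - q') = tens p q - tens p q'"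
  and tens_pscale_right: "tens p (pscale c q) = pscale c (tens p q)"
  and tens_0_right [simp]: "tens p 0 = 0"
  by (simp_all add: plin_rules[OF plin_tens_right])

lemmas tens_simps = tens_add_left tens_diff_left tens_pscale_left
  tens_add_right tens_diff_right tens_pscale_right

lemma coef_tens: "coef (tens p q) (x, y) = coef p x * coef q y"
proof -
  have 1: "coef (tens p (pure b)) (x, y) = coef p x * coef (pure b) y" for b
    by (induction p rule: linear_induct[OF subset_UNIV])
      (auto simp: tens_simps lookup_add lookup_single when_def algebra_simps)
  show ?thesis
    by (induction q rule: linear_induct[OF subset_UNIV])
      (auto simp: 1 tens_simps lookup_add algebra_simps)
qed

lemma supp_tens: "supp (tens p q) = supp p \<times> supp q"
  by (auto simp: in_keys_iff coef_tens)

definition pbilin :: "(('a \<Rightarrow>\<^sub>0 'k::field) \<Rightarrow> ('b \<Rightarrow>\<^sub>0 'k) \<Rightarrow> ('c \<Rightarrow>\<^sub>0 'k)) \<Rightarrow> bool"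
  where "pbilin f \<longleftrightarrow> (\<forall>p. plin (f p)) \<and> (\<forall>q. plin (\<lambda>p. f p q))"

lemma pbilinD: "pbilin f \<Longrightarrow> plin (f p)" "pbilin f \<Longrightarrow> plin (\<lambda>p. f p q)"
  by (auto simp: pbilin_def)

lemma pbilin_tens: "pbilin tens"
  by (simp add: pbilin_def plin_tens_left plin_tens_right)

lemma pbilin_eq_on:
  assumes "supp p \<subseteq> A" and "supp q \<subseteq> B" and "pbilin f" and "pbilin h"
    and "\<And>x y. x \<in> A \<Longrightarrow> y \<in> B \<Longrightarrow> f (pure x) (pure y) = h (pure x) (pure y)"
  shows "f p q = h p q"
proof (rule plin_eq_on[OF assms(1)])
  fix x assume "x \<in> A"
  then show "f (pure x) q = h (pure x) q"
    by (intro plin_eq_on[OF assms(2) pbilinD(1)[OF assms(3)] pbilinD(1)[OF assms(4)]] assms(5))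
qed (rule pbilinD(2)[OF assms(3)] pbilinD(2)[OF assms(4)])+

lemma pbilin_ext: "pbilin (\<lambda>p q. lin_ext (\<lambda>x. lin_ext (f x) q) p)"
  unfolding pbilin_def by (auto simp: plin_lin_ext_fun)

lemma pbilin_comp:
  "pbilin f \<Longrightarrow> plin k \<Longrightarrow> plin h \<Longrightarrow> plin j \<Longrightarrow> pbilin (\<lambda>p q. k (f (h p) (j q)))"
  unfolding pbilin_def plin_def by simp

section \<open>Algebras and Hopf algebras in coordinates\<close>

text \<open>The coordinate space with basis \<open>I\<close>. A set rather than a type, so that
  bounds on degrees or group components only change \<open>I\<close>.\<close>

definition lc :: "'i set \<Rightarrow> ('i \<Rightarrow>\<^sub>0 'k::field) set"
  where "lc I = {p. supp p \<subseteq> I}"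

lemma lc_0 [simp, intro]: "0 \<in> lc I"
  and lc_add: "p \<in> lc I \<Longrightarrow> q \<in> lc I \<Longrightarrow> p + q \<in> lc I"
  and lc_minus: "p \<in> lc I \<Longrightarrow> q \<in> lc I \<Longrightarrow> p - q \<in> lc I"
  and lc_uminus: "p \<in> lc I \<Longrightarrow> - p \<in> lc I"
  and lc_pscale: "p \<in> lc I \<Longrightarrow> pscale c p \<in> lc I"
  and lc_pure [simp]: "(pure i :: 'i \<Rightarrow>\<^sub>0 'k) \<in> lc I \<longleftrightarrow> i \<in> I"
  for p q :: "'i \<Rightarrow>\<^sub>0 'k::field"
  using keys_add[of p q] supp_minus[of p q] by (auto simp: lc_def supp_pscale)

lemma lc_sum: "(\<And>x. x \<in> A \<Longrightarrow> f x \<in> lc I) \<Longrightarrow> (\<Sum>x\<in>A. f x) \<in> lc I"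
  using supp_sum[of f A] by (fastforce simp: lc_def)

lemma lc_lin_ext: "(\<And>x. x \<in> supp p \<Longrightarrow> f x \<in> lc I) \<Longrightarrow> lin_ext f p \<in> lc I"
  unfolding lin_ext_def by (intro lc_sum lc_pscale)

lemma lc_mono: "I \<subseteq> J \<Longrightarrow> lc I \<subseteq> lc J"
  by (auto simp: lc_def)

lemma lc_plin: "plin f \<Longrightarrow> p \<in> lc I \<Longrightarrow> (\<And>i. i \<in> I \<Longrightarrow> f (pure i) \<in> lc J) \<Longrightarrow> f p \<in> lc J"
  using plin_in_subspace[of p I f J] by (simp add: lc_def)

lemma lc_tens: "p \<in> lc I \<Longrightarrow> q \<in> lc J \<Longrightarrow> tens p q \<in> lc (I \<times> J)"
  by (auto simp: lc_def supp_tens)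

lemmas lc_intros = lc_0 lc_add lc_minus lc_uminus lc_pscale lc_sum lc_lin_ext lc_tens

text \<open>The universal property of the tensor product: both sides are bilinear and agree on pairs
  of basis elements.\<close>

lemma bilin_tens:
  assumes "pbilin \<Phi>"
  shows "lin_ext (\<lambda>(i, j). \<Phi> (pure i) (pure j)) (tens p q) = \<Phi> p q"
  by (rule pbilin_eq_on[OF subset_UNIV subset_UNIV, of "\<lambda>p q. lin_ext _ (tens p q)" \<Phi>])
    (use assms in \<open>auto intro!: pbilin_comp[OF pbilin_tens, where h = "\<lambda>x. x" and j = "\<lambda>x. x"]\<close>)

text \<open>Bridge between the sums of a ring record and those of a type class; coordinate maps go
  from the former to the latter.\<close>

lemma finsum_hom:
  fixes R (structure)
  assumes R: "abelian_monoid R"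
    and add: "\<And>x y. x \<in> carrier R \<Longrightarrow> y \<in> carrier R \<Longrightarrow> f (x \<oplus> y) = f x + (f y :: 'b::comm_monoid_add)"
    and zero: "f \<zero> = 0" and h: "h \<in> A \<rightarrow> carrier R"
  shows "f (finsum R h A) = (\<Sum>x\<in>A. f (h x))"
proof -
  interpret abelian_monoid R by (rule R)
  show ?thesis
    using h
  proof (induction A rule: infinite_finite_induct)
    case (infinite A)
    then show ?case by (simp add: zero finsum_infinite)
  next
    case (insert x A)
    then have "finsum R h (insert x A) = h x \<oplus> finsum R h A"
      by (intro finsum_insert) auto
    with insert show ?case by (simp add: add)
  qed (simp add: zero)
qed

text \<open>The map \<kappa> tensor \<kappa> on representatives. It kills the bilinearity relations,
  and for an algebra with coordinates its kernel on tensors over the carrier consists of exactly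
  these.\<close>

definition tcoord :: "('a \<Rightarrow> ('i \<Rightarrow>\<^sub>0 'k::field)) \<Rightarrow> ('a \<times> 'a \<Rightarrow>\<^sub>0 'k) \<Rightarrow> ('i \<times> 'i \<Rightarrow>\<^sub>0 'k)"
  where "tcoord \<kappa> = lin_ext (\<lambda>(a, b). tens (\<kappa> a) (\<kappa> b))"

definition t3coord :: "('a \<Rightarrow> ('i \<Rightarrow>\<^sub>0 'k::field)) \<Rightarrow> ('a \<times> 'a \<times> 'a \<Rightarrow>\<^sub>0 'k) \<Rightarrow> ('i \<times> 'i \<times> 'i \<Rightarrow>\<^sub>0 'k)"
  where "t3coord \<kappa> = lin_ext (\<lambda>(a, b, c). tens (\<kappa> a) (tens (\<kappa> b) (\<kappa> c)))"

lemma tcoord_simps [simp]: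
  "tcoord \<kappa> (s + t) = tcoord \<kappa> s + tcoord \<kappa> t" "tcoord \<kappa> (s - t) = tcoord \<kappa> s - tcoord \<kappa> t"
  "tcoord \<kappa> (pscale c s) = pscale c (tcoord \<kappa> s)" "tcoord \<kappa> 0 = 0"
  "tcoord \<kappa> (pure (a, b)) = tens (\<kappa> a) (\<kappa> b)"
  by (simp_all add: tcoord_def lin_ext_simps)

lemma tcoord_lin_ext: "tcoord \<kappa> (lin_ext f s) = lin_ext (\<lambda>x. tcoord \<kappa> (f x)) s"
  unfolding tcoord_def by (rule plin_lin_ext_comp) simp

lemma tcoord_sum: "tcoord \<kappa> (\<Sum>x\<in>A. f x) = (\<Sum>x\<in>A. tcoord \<kappa> (f x))"
  by (simp add: tcoord_def lin_ext_sum)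

lemma t3coord_simps [simp]:
  "t3coord \<kappa> (s + t) = t3coord \<kappa> s + t3coord \<kappa> t" "t3coord \<kappa> (s - t) = t3coord \<kappa> s - t3coord \<kappa> t"
  "t3coord \<kappa> (pscale c s) = pscale c (t3coord \<kappa> s)" "t3coord \<kappa> 0 = 0"
  "t3coord \<kappa> (pure (a, b, d)) = tens (\<kappa> a) (tens (\<kappa> b) (\<kappa> d))"
  by (simp_all add: t3coord_def lin_ext_simps)

lemma t3coord_lin_ext: "t3coord \<kappa> (lin_ext f s) = lin_ext (\<lambda>x. t3coord \<kappa> (f x)) s"
  unfolding t3coord_def by (rule plin_lin_ext_comp) simp

text \<open>The Hopf algebra axioms are sums over whatever representative the record provides. A
  summand that is bilinear in the coordinates of the two factors makes the sum depend only on the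
  coordinates of the tensor, so the representative can be forgotten.\<close>

lemma lin_ext_tcoord:
  assumes "pbilin \<Phi>" and "\<And>a b. (a, b) \<in> supp s \<Longrightarrow> f (a, b) = \<Phi> (\<kappa> a) (\<kappa> b)"
  shows "lin_ext f s = lin_ext (\<lambda>(i, j). \<Phi> (pure i) (pure j)) (tcoord \<kappa> s)"
proof -
  have "lin_ext (\<lambda>(i, j). \<Phi> (pure i) (pure j)) (tcoord \<kappa> s) =
      lin_ext (\<lambda>x. lin_ext (\<lambda>(i, j). \<Phi> (pure i) (pure j)) (case x of (a, b) \<Rightarrow> tens (\<kappa> a) (\<kappa> b))) s"
    unfolding tcoord_def by (rule plin_lin_ext_comp) simp
  also have "\<dots> = lin_ext f s"
    by (rule lin_ext_cong) (use assms(2) in \<open>auto simp: bilin_tens[OF assms(1)]\<close>)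
  finally show ?thesis by simp
qed

lemma tcoord_tensor_map: "tcoord \<kappa> (tensor_map f f s) = tcoord (\<lambda>x. \<kappa> (f x)) s"
  unfolding tensor_map_def tcoord_lin_ext unfolding tcoord_def
  by (rule lin_ext_cong) (auto simp: lin_ext_simps)

lemma tcoord_cong:
  assumes "\<And>a b. (a, b) \<in> supp s \<Longrightarrow> \<kappa> a = \<kappa>' a \<and> \<kappa> b = \<kappa>' b"
  shows "tcoord \<kappa> s = tcoord \<kappa>' s"
  unfolding tcoord_def by (rule lin_ext_cong) (use assms in auto)

text \<open>An algebra with a chosen basis: \<open>\<kappa>\<close> is the coordinate map and
  \<open>I\<close> the index set. The product is left unconstrained, which suffices for tensors,
  spans and dimensions.\<close>

locale coords = k_algebra A for A :: "('a, 'k::field, 'm) kalg_scheme" (structure) +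
  fixes \<kappa> :: "'a \<Rightarrow> ('i \<Rightarrow>\<^sub>0 'k)" and I :: "'i set"
  assumes \<kappa>_bij: "bij_betw \<kappa> (carrier A) (lc I)"
    and \<kappa>_add: "x \<in> carrier A \<Longrightarrow> y \<in> carrier A \<Longrightarrow> \<kappa> (x \<oplus> y) = \<kappa> x + \<kappa> y"
    and \<kappa>_scale: "x \<in> carrier A \<Longrightarrow> \<kappa> (c \<cdot> x) = pscale c (\<kappa> x)"
begin

definition elt :: "('i \<Rightarrow>\<^sub>0 'k) \<Rightarrow> 'a"
  where "elt = inv_into (carrier A) \<kappa>"

lemma \<kappa>_closed: "x \<in> carrier A \<Longrightarrow> \<kappa> x \<in> lc I"
  using \<kappa>_bij by (auto simp: bij_betw_def)

lemma \<kappa>_inj: "x \<in> carrier A \<Longrightarrow> y \<in> carrier A \<Longrightarrow> \<kappa> x = \<kappa> y \<Longrightarrow> x = y"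
  using \<kappa>_bij by (auto simp: bij_betw_def dest: inj_onD)

lemma elt_closed: "p \<in> lc I \<Longrightarrow> elt p \<in> carrier A"
  unfolding elt_def using \<kappa>_bij by (metis bij_betw_def inv_into_into)

lemma \<kappa>_elt: "p \<in> lc I \<Longrightarrow> \<kappa> (elt p) = p"
  unfolding elt_def using \<kappa>_bij by (metis bij_betw_def f_inv_into_f)

lemma elt_\<kappa>: "x \<in> carrier A \<Longrightarrow> elt (\<kappa> x) = x"
  unfolding elt_def using \<kappa>_bij by (metis bij_betw_def inv_into_f_f)

lemma \<kappa>_zero: "\<kappa> \<zero> = 0"
  using \<kappa>_add[of \<zero> \<zero>] by simp

lemma kscale_zero: "x \<in> carrier A \<Longrightarrow> 0 \<cdot> x = \<zero>"
  by (intro \<kappa>_inj) (auto simp: kscale_closed \<kappa>_scale \<kappa>_zero)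

lemma elt_zero: "elt 0 = \<zero>"
  by (intro \<kappa>_inj) (auto simp: elt_closed \<kappa>_elt \<kappa>_zero)

lemma elt_add: "p \<in> lc I \<Longrightarrow> q \<in> lc I \<Longrightarrow> elt (p + q) = elt p \<oplus> elt q"
  by (intro \<kappa>_inj) (auto simp: elt_closed \<kappa>_elt \<kappa>_add lc_intros)

lemma elt_pscale: "p \<in> lc I \<Longrightarrow> elt (pscale c p) = c \<cdot> elt p"
  by (intro \<kappa>_inj) (auto simp: elt_closed \<kappa>_elt \<kappa>_scale lc_intros kscale_closed)

lemma \<kappa>_minus: "x \<in> carrier A \<Longrightarrow> y \<in> carrier A \<Longrightarrow> \<kappa> (x \<ominus> y) = \<kappa> x - \<kappa> y"
  using \<kappa>_add[of "x \<ominus> y" y] by (simp add: a_minus_def a_assoc l_neg)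

lemma \<kappa>_finsum: "h \<in> S \<rightarrow> carrier A \<Longrightarrow> \<kappa> (finsum A h S) = (\<Sum>x\<in>S. \<kappa> (h x))"
  by (rule finsum_hom) (auto simp: \<kappa>_add \<kappa>_zero abelian_monoid_axioms)

lemma lincomb_closed:
  "(\<And>x. x \<in> supp p \<Longrightarrow> f x \<in> carrier A) \<Longrightarrow> lincomb A f p \<in> carrier A"
  unfolding lincomb_def by (intro finsum_closed) (auto simp: kscale_closed)

lemma \<kappa>_lincomb:
  "(\<And>x. x \<in> supp p \<Longrightarrow> f x \<in> carrier A) \<Longrightarrow> \<kappa> (lincomb A f p) = lin_ext (\<lambda>x. \<kappa> (f x)) p"
  unfolding lincomb_def lin_ext_def
  by (subst \<kappa>_finsum) (auto simp: kscale_closed \<kappa>_scale intro!: sum.cong)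

lemma tensor_null_tcoord: "s \<in> tensor_null A A \<Longrightarrow> tcoord \<kappa> s = 0"
  by (induction rule: tensor_null.induct) (auto simp: \<kappa>_add \<kappa>_scale tens_simps)

lemma null_diff: "s \<in> tensor_null A A \<Longrightarrow> t \<in> tensor_null A A \<Longrightarrow> s - t \<in> tensor_null A A"
  using tensor_null.add[OF _ tensor_null.scale[of t A A "-1"], of s] by (simp add: pscale_minus_left)

lemma null3_diff: "s \<in> tensor3_null A \<Longrightarrow> t \<in> tensor3_null A \<Longrightarrow> s - t \<in> tensor3_null A"
  using tensor3_null.add[OF _ tensor3_null.scale[of t A "-1"], of s] by (simp add: pscale_minus_left)

text \<open>The canonical representative of a tensor with given coordinates, using only pairs of
  basis elements.\<close>

definition basis_rep :: "('i \<times> 'i \<Rightarrow>\<^sub>0 'k) \<Rightarrow> ('a \<times> 'a \<Rightarrow>\<^sub>0 'k)"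
  where "basis_rep = lin_ext (\<lambda>(i, j). pure (elt (pure i), elt (pure j)))"

definition basis_rep3 :: "('i \<times> 'i \<times> 'i \<Rightarrow>\<^sub>0 'k) \<Rightarrow> ('a \<times> 'a \<times> 'a \<Rightarrow>\<^sub>0 'k)"
  where "basis_rep3 = lin_ext (\<lambda>(i, j, k). pure (elt (pure i), elt (pure j), elt (pure k)))"

lemma plin_basis_rep: "plin basis_rep" "plin basis_rep3"
  by (simp_all add: basis_rep_def basis_rep3_def)

lemmas basis_rep_rules = plin_rules[OF plin_basis_rep(1)] plin_rules[OF plin_basis_rep(2)]

lemma basis_rep_pure [simp]:
  "basis_rep (pure (i, j)) = pure (elt (pure i), elt (pure j))"
  "basis_rep3 (pure (i, j, k)) = pure (elt (pure i), elt (pure j), elt (pure k))"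
  by (simp_all add: basis_rep_def basis_rep3_def)

lemma elt_pure_closed: "i \<in> I \<Longrightarrow> elt (pure i) \<in> carrier A"
  by (simp add: elt_closed)

text \<open>Handles one tensor slot at a time: \<open>f\<close> is linear only modulo
  \<open>N\<close>, while \<open>g\<close> is linear exactly, so a congruence on basis elements
  spreads to all elements. The subspace \<open>N\<close> is arbitrary in order to serve twofold and
  threefold tensors.\<close>

lemma linear_mod_null:
  assumes "p \<in> lc I"
    and N: "0 \<in> N" "\<And>s t. s \<in> N \<Longrightarrow> t \<in> N \<Longrightarrow> s + t \<in> N" "\<And>c s. s \<in> N \<Longrightarrow> pscale c s \<in> N"
    and add: "\<And>x y. x \<in> carrier A \<Longrightarrow> y \<in> carrier A \<Longrightarrow> f (x \<oplus> y) - f x - f y \<in> N"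
    and scale: "\<And>c x. x \<in> carrier A \<Longrightarrow> f (c \<cdot> x) - pscale c (f x) \<in> N"
    and g: "plin g" and pure: "\<And>i. i \<in> I \<Longrightarrow> f (elt (pure i)) - g (pure i) \<in> N"
  shows "f (elt p) - g p \<in> (N :: ('c \<Rightarrow>\<^sub>0 'k) set)"
proof -
  from assms(1) have "supp p \<subseteq> I" by (simp add: lc_def)
  then have "p \<in> lc I \<and> f (elt p) - g p \<in> N"
  proof (induction p rule: linear_induct)
    case zero
    \<comment> \<open>Scaling zero by \<open>0\<close> shows that \<open>f\<close> of zero lies in
      \<open>N\<close>.\<close>
    from scale[of \<zero> 0] show ?case by (simp add: elt_zero plin_rules[OF g] kscale_zero)
  next
    case (add p q)
    then have "f (elt p \<oplus> elt q) - f (elt p) - f (elt q) \<in> N" by (intro assms elt_closed) auto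
    then have "(f (elt p \<oplus> elt q) - f (elt p) - f (elt q)) + ((f (elt p) - g p) + (f (elt q) - g q)) \<in> N"
      using add by (intro N) auto
    with add show ?case by (simp add: elt_add plin_rules[OF g] lc_intros algebra_simps)
  next
    case (scale c p)
    then have "f (c \<cdot> elt p) - pscale c (f (elt p)) \<in> N" by (intro assms elt_closed) auto
    then have "(f (c \<cdot> elt p) - pscale c (f (elt p))) + pscale c (f (elt p) - g p) \<in> N"
      using scale by (intro N) auto
    with scale show ?case by (simp add: elt_pscale plin_rules[OF g] lc_intros pscale_diff_right)
  qed (use pure in auto)
  then show ?thesis by simp
qed

text \<open>Expanding both factors in the basis uses only the bilinearity relations. Hence a tensor
  with vanishing coordinates is null, the converse of \<open>tensor_null_tcoord\<close>.\<close>

lemma tensor_null_basis_rep: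
  assumes "supp s \<subseteq> carrier A \<times> carrier A"
  shows "s - basis_rep (tcoord \<kappa> s) \<in> tensor_null A A"
  using assms
proof (induction s rule: linear_induct)
  case (add s t)
  from tensor_null.add[OF this] show ?case by (simp add: basis_rep_rules algebra_simps)
next
  case (scale c s)
  from tensor_null.scale[OF this, of c] show ?case by (simp add: basis_rep_rules pscale_diff_right)
next
  case (pure x)
  then obtain p q where x: "x = (elt p, elt q)" and pq: "p \<in> lc I" "q \<in> lc I"
    by (metis SigmaE \<kappa>_closed elt_\<kappa>)
  note N = tensor_null.zero tensor_null.add tensor_null.scale
  have "pure (elt p, elt q) - basis_rep (tens p q) \<in> tensor_null A A"
    if "p \<in> lc I" "q \<in> lc I" for p q
    using that(1)
  proof (rule linear_mod_null[where f = "\<lambda>a. pure (a, elt q)" and g = "\<lambda>p. basis_rep (tens p q)"])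
    show "pure (elt (pure i), elt q) - basis_rep (tens (pure i) q) \<in> tensor_null A A" if "i \<in> I" for i
      using \<open>q \<in> lc I\<close>
      by (rule linear_mod_null[where f = "\<lambda>a. pure (elt (pure i), a)" and g = "\<lambda>q. basis_rep (tens (pure i) q)"])
        (use that in \<open>auto intro: N tensor_null.add_right tensor_null.scale_right elt_pure_closed
          plin_comp[OF plin_basis_rep(1)] plin_tens_right\<close>)
  qed (use that in \<open>auto intro: N tensor_null.add_left tensor_null.scale_left elt_closed
          plin_comp[OF plin_basis_rep(1)] plin_tens_left\<close>)
  from this[OF pq] show ?case by (simp add: x \<kappa>_elt pq)
qed (simp add: basis_rep_rules tensor_null.zero)

lemma tensor3_null_basis_rep:
  assumes "supp s \<subseteq> carrier A \<times> carrier A \<times> carrier A"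
  shows "s - basis_rep3 (t3coord \<kappa> s) \<in> tensor3_null A"
  using assms
proof (induction s rule: linear_induct)
  case (add s t)
  from tensor3_null.add[OF this] show ?case by (simp add: basis_rep_rules algebra_simps)
next
  case (scale c s)
  from tensor3_null.scale[OF this, of c] show ?case by (simp add: basis_rep_rules pscale_diff_right)
next
  case (pure x)
  then obtain a b c where "x = (a, b, c)" "a \<in> carrier A" "b \<in> carrier A" "c \<in> carrier A"
    by auto
  then obtain p q r where x: "x = (elt p, elt q, elt r)" and pqr: "p \<in> lc I" "q \<in> lc I" "r \<in> lc I"
    using elt_\<kappa>[of a] elt_\<kappa>[of b] elt_\<kappa>[of c] \<kappa>_closed[of a] \<kappa>_closed[of b] \<kappa>_closed[of c] by metis
  note N = tensor3_null.zero tensor3_null.add tensor3_null.scale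
  have lin: "plin (\<lambda>q. basis_rep3 (tens (pure i) (tens (pure j) q)))" for i j
    by (rule plin_comp[OF plin_basis_rep(2) plin_comp[OF plin_tens_right plin_tens_right]])
  have 1: "pure (elt (pure i), elt (pure j), elt r) - basis_rep3 (tens (pure i) (tens (pure j) r)) \<in> tensor3_null A"
    if "i \<in> I" "j \<in> I" "r \<in> lc I" for i j r
    using that(3)
    by (rule linear_mod_null[where f = "\<lambda>a. pure (elt (pure i), elt (pure j), a)"
          and g = "\<lambda>q. basis_rep3 (tens (pure i) (tens (pure j) q))"])
      (use that lin in
        \<open>auto intro: N tensor3_null.add3 tensor3_null.scale3 elt_pure_closed\<close>)
  have 2: "pure (elt (pure i), elt q, elt r) - basis_rep3 (tens (pure i) (tens q r)) \<in> tensor3_null A"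
    if "i \<in> I" "q \<in> lc I" "r \<in> lc I" for i q r
    using that(2)
    by (rule linear_mod_null[where f = "\<lambda>a. pure (elt (pure i), a, elt r)"
          and g = "\<lambda>q. basis_rep3 (tens (pure i) (tens q r))"])
      (use that 1 in \<open>auto intro: N tensor3_null.add2 tensor3_null.scale2 elt_closed elt_pure_closed
          plin_comp[OF plin_basis_rep(2) plin_comp[OF plin_tens_right plin_tens_left]]\<close>)
  have 3: "pure (elt p, elt q, elt r) - basis_rep3 (tens p (tens q r)) \<in> tensor3_null A"
    if "p \<in> lc I" "q \<in> lc I" "r \<in> lc I" for p q r
    using that(1)
    by (rule linear_mod_null[where f = "\<lambda>a. pure (a, elt q, elt r)"
          and g = "\<lambda>p. basis_rep3 (tens p (tens q r))"])
      (use that 2 in \<open>auto intro: N tensor3_null.add1 tensor3_null.scale1 elt_closed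
          plin_comp[OF plin_basis_rep(2) plin_tens_left]\<close>)
  from 3[OF pqr] show ?case by (simp add: x \<kappa>_elt pqr)
qed (simp add: basis_rep_rules tensor3_null.zero)

lemma tensor_eq_iff:
  assumes "supp s \<subseteq> carrier A \<times> carrier A" and "supp t \<subseteq> carrier A \<times> carrier A"
  shows "tensor_eq A A s t \<longleftrightarrow> tcoord \<kappa> s = tcoord \<kappa> t"
proof
  assume "tcoord \<kappa> s = tcoord \<kappa> t"
  with null_diff[OF tensor_null_basis_rep[OF assms(1)] tensor_null_basis_rep[OF assms(2)]]
  show "tensor_eq A A s t" by (simp add: tensor_eq_def)
qed (use tensor_null_tcoord[of "s - t"] in \<open>simp add: tensor_eq_def\<close>)

lemma tensor_eq_tcoord: "tensor_eq A A s t \<Longrightarrow> tcoord \<kappa> s = tcoord \<kappa> t"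
  using tensor_null_tcoord[of "s - t"] by (simp add: tensor_eq_def)

lemma tensor3_eqI:
  assumes "supp s \<subseteq> carrier A \<times> carrier A \<times> carrier A" and "supp t \<subseteq> carrier A \<times> carrier A \<times> carrier A"
    and "t3coord \<kappa> s = t3coord \<kappa> t"
  shows "tensor3_eq A s t"
  using null3_diff[OF tensor3_null_basis_rep[OF assms(1)] tensor3_null_basis_rep[OF assms(2)]] assms(3)
  by (simp add: tensor3_eq_def)

end

text \<open>Addition and scaling are those of formal combinations after passing to coordinates, so
  all module and distributive laws pull back along the injective \<open>\<kappa>\<close>. Only
  associativity and the unit laws of \<open>\<mu>\<close> carry information.\<close>

lemma k_algebra_coords:
  fixes A :: "('a, 'k::field, 'm) kalg_scheme" (structure)
  assumes bij: "bij_betw \<kappa> (carrier A) (lc I)"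
    and add: "\<And>x y. x \<in> carrier A \<Longrightarrow> y \<in> carrier A \<Longrightarrow> x \<oplus> y \<in> carrier A \<and> \<kappa> (x \<oplus> y) = \<kappa> x + \<kappa> y"
    and scale: "\<And>c x. x \<in> carrier A \<Longrightarrow> c \<cdot> x \<in> carrier A \<and> \<kappa> (c \<cdot> x) = pscale c (\<kappa> x)"
    and mult: "\<And>x y. x \<in> carrier A \<Longrightarrow> y \<in> carrier A \<Longrightarrow> x \<otimes> y \<in> carrier A \<and> \<kappa> (x \<otimes> y) = \<mu> (\<kappa> x) (\<kappa> y)"
    and zero: "\<zero> \<in> carrier A" "\<kappa> \<zero> = 0"
    and one: "\<one> \<in> carrier A" "\<kappa> \<one> = e"
    and bil: "pbilin \<mu>"
    and assoc: "\<And>p q r. p \<in> lc I \<Longrightarrow> q \<in> lc I \<Longrightarrow> r \<in> lc I \<Longrightarrow> \<mu> (\<mu> p q) r = \<mu> p (\<mu> q r)"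
    and unit: "\<And>p. p \<in> lc I \<Longrightarrow> \<mu> e p = p" "\<And>p. p \<in> lc I \<Longrightarrow> \<mu> p e = p"
  shows "coords A \<kappa> I"
proof -
  have inj: "x = y" if "x \<in> carrier A" "y \<in> carrier A" "\<kappa> x = \<kappa> y" for x y
    using bij that by (auto simp: bij_betw_def dest: inj_onD)
  have cl: "\<kappa> x \<in> lc I" if "x \<in> carrier A" for x
    using bij that by (auto simp: bij_betw_def)
  note b = plin_rules[OF pbilinD(1)[OF bil]] plin_rules[OF pbilinD(2)[OF bil]]
  have "abelian_group A"
  proof (rule abelian_groupI)
    fix x assume x: "x \<in> carrier A"
    show "\<exists>y\<in>carrier A. y \<oplus> x = \<zero>"
    proof
      \<comment> \<open>The record provides no negation; scaling by -1 supplies the additive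
        inverse.\<close>
      show "(-1) \<cdot> x \<oplus> x = \<zero>"
        by (rule inj) (use x in \<open>auto simp: add scale zero pscale_minus_left\<close>)
    qed (use x scale in auto)
  qed (auto intro!: inj simp: add zero ac_simps)
  moreover have "monoid A"
    by (rule monoidI) (auto intro!: inj simp: mult one assoc unit cl)
  moreover have "ring_axioms A"
    by unfold_locales (auto intro!: inj simp: mult add b)
  ultimately have "ring A" by (rule ring.intro)
  moreover have "k_algebra_axioms A"
    by unfold_locales
      (auto intro!: inj simp: scale add mult b pscale_add_right pscale_add_left)
  ultimately have "k_algebra A" by (rule k_algebra.intro)
  then show ?thesis
    by (rule coords.intro) (unfold_locales, auto simp: bij add scale)
qed

section \<open>Hopf algebras given by structure constants\<close>

locale hopf_model =
  fixes I :: "'i set" and \<mu> :: "('i \<Rightarrow>\<^sub>0 'k::field) \<Rightarrow> ('i \<Rightarrow>\<^sub>0 'k) \<Rightarrow> ('i \<Rightarrow>\<^sub>0 'k)"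
    and e :: "'i \<Rightarrow>\<^sub>0 'k" and \<Delta> :: "('i \<Rightarrow>\<^sub>0 'k) \<Rightarrow> ('i \<times> 'i \<Rightarrow>\<^sub>0 'k)"
    and ep :: "'i \<Rightarrow> 'k" and S :: "('i \<Rightarrow>\<^sub>0 'k) \<Rightarrow> ('i \<Rightarrow>\<^sub>0 'k)"
  assumes \<mu>_bilin: "pbilin \<mu>" and \<Delta>_lin: "plin \<Delta>" and S_lin: "plin S"
    and e_in: "e \<in> lc I"
    and \<mu>_in: "\<lbrakk>p \<in> lc I; q \<in> lc I\<rbrakk> \<Longrightarrow> \<mu> p q \<in> lc I"
    and S_in: "p \<in> lc I \<Longrightarrow> S p \<in> lc I"
    and \<mu>_assoc: "\<lbrakk>p \<in> lc I; q \<in> lc I; r \<in> lc I\<rbrakk> \<Longrightarrow> \<mu> (\<mu> p q) r = \<mu> p (\<mu> q r)"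
    and \<mu>_unit: "p \<in> lc I \<Longrightarrow> \<mu> e p = p" "p \<in> lc I \<Longrightarrow> \<mu> p e = p"
    and \<Delta>_coassoc: "p \<in> lc I \<Longrightarrow>
      lin_ext (\<lambda>(i, j). lin_ext (\<lambda>(a, b). pure (a, b, j)) (\<Delta> (pure i))) (\<Delta> p) =
      lin_ext (\<lambda>(i, j). lin_ext (\<lambda>(a, b). pure (i, a, b)) (\<Delta> (pure j))) (\<Delta> p)"
    and \<Delta>_counit: "p \<in> lc I \<Longrightarrow> lin_ext (\<lambda>(i, j). pscale (ep i) (pure j)) (\<Delta> p) = p"
      "p \<in> lc I \<Longrightarrow> lin_ext (\<lambda>(i, j). pscale (ep j) (pure i)) (\<Delta> p) = p"
    and \<Delta>_mult: "\<lbrakk>p \<in> lc I; q \<in> lc I\<rbrakk> \<Longrightarrow> \<Delta> (\<mu> p q) =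
      lin_ext (\<lambda>(a, b). lin_ext (\<lambda>(c, d). tens (\<mu> (pure a) (pure c)) (\<mu> (pure b) (pure d))) (\<Delta> q)) (\<Delta> p)"
    and \<Delta>_one: "\<Delta> e = tens e e"
    and ep_mult: "\<lbrakk>p \<in> lc I; q \<in> lc I\<rbrakk> \<Longrightarrow> lin_form ep (\<mu> p q) = lin_form ep p * lin_form ep q"
    and ep_one: "lin_form ep e = 1"
    and antipode_left: "p \<in> lc I \<Longrightarrow>
      lin_ext (\<lambda>(i, j). \<mu> (S (pure i)) (pure j)) (\<Delta> p) = pscale (lin_form ep p) e"
    and antipode_right: "p \<in> lc I \<Longrightarrow>
      lin_ext (\<lambda>(i, j). \<mu> (pure i) (S (pure j))) (\<Delta> p) = pscale (lin_form ep p) e"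

text \<open>A record whose operations become those of the model under \<open>\<kappa>\<close>. The
  coproduct of an element is only a representative, so its coordinates alone are prescribed. The
  antipode is no field of the record; the map \<open>S\<close> of the model serves as witness for
  its existence.\<close>

locale hopf_realization = hopf_model I \<mu> e \<Delta> ep S
  for I :: "'i set" and \<mu> :: "('i \<Rightarrow>\<^sub>0 'k::field) \<Rightarrow> ('i \<Rightarrow>\<^sub>0 'k) \<Rightarrow> ('i \<Rightarrow>\<^sub>0 'k)"
    and e :: "'i \<Rightarrow>\<^sub>0 'k" and \<Delta> :: "('i \<Rightarrow>\<^sub>0 'k) \<Rightarrow> ('i \<times> 'i \<Rightarrow>\<^sub>0 'k)"
    and ep :: "'i \<Rightarrow> 'k" and S :: "('i \<Rightarrow>\<^sub>0 'k) \<Rightarrow> ('i \<Rightarrow>\<^sub>0 'k)" +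
  fixes H :: "('a, 'k, 'm) khopf_scheme" (structure) and \<kappa> :: "'a \<Rightarrow> ('i \<Rightarrow>\<^sub>0 'k)"
  assumes \<kappa>_bij: "bij_betw \<kappa> (carrier H) (lc I)"
    and add: "x \<in> carrier H \<Longrightarrow> y \<in> carrier H \<Longrightarrow> x \<oplus> y \<in> carrier H \<and> \<kappa> (x \<oplus> y) = \<kappa> x + \<kappa> y"
    and scale: "x \<in> carrier H \<Longrightarrow> c \<cdot> x \<in> carrier H \<and> \<kappa> (c \<cdot> x) = pscale c (\<kappa> x)"
    and mult: "x \<in> carrier H \<Longrightarrow> y \<in> carrier H \<Longrightarrow> x \<otimes> y \<in> carrier H \<and> \<kappa> (x \<otimes> y) = \<mu> (\<kappa> x) (\<kappa> y)"
    and zero: "\<zero> \<in> carrier H \<and> \<kappa> \<zero> = 0"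
    and one: "\<one> \<in> carrier H \<and> \<kappa> \<one> = e"
    and comult: "x \<in> carrier H \<Longrightarrow>
      supp (comult H x) \<subseteq> carrier H \<times> carrier H \<and> tcoord \<kappa> (comult H x) = \<Delta> (\<kappa> x)"
    and counit: "x \<in> carrier H \<Longrightarrow> counit H x = lin_form ep (\<kappa> x)"
begin

sublocale coords H \<kappa> I
  by (rule k_algebra_coords[where \<mu> = \<mu> and e = e])
    (use \<kappa>_bij add scale mult zero one \<mu>_bilin \<mu>_assoc \<mu>_unit in auto)

lemma comult_supp: "x \<in> carrier H \<Longrightarrow> (a, b) \<in> supp (comult H x) \<Longrightarrow> a \<in> carrier H \<and> b \<in> carrier H"
  using comult by blast

lemmas \<mu>_rules = plin_rules[OF pbilinD(1)[OF \<mu>_bilin]] plin_rules[OF pbilinD(2)[OF \<mu>_bilin]]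
lemmas \<Delta>_rules = plin_rules[OF \<Delta>_lin]
lemmas S_rules = plin_rules[OF S_lin]

text \<open>The inner sums run over representatives of coproducts of the factors of another
  representative. Replacing both layers by coordinates, inner and outer, reduces the claim to
  coassociativity of the model.\<close>

lemma coassoc_realized:
  assumes x: "x \<in> carrier H"
  shows "tensor3_eq H
      (lin_ext (\<lambda>(a, b). lin_ext (\<lambda>(a', a''). pure (a', a'', b)) (comult H a)) (comult H x))
      (lin_ext (\<lambda>(a, b). lin_ext (\<lambda>(b', b''). pure (a, b', b'')) (comult H b)) (comult H x))"
proof (rule tensor3_eqI)
  have [simp]: "plin (\<lambda>p. lin_ext f (\<Delta> p))" for f :: "_ \<Rightarrow> ('x \<Rightarrow>\<^sub>0 'k)"
    by (rule plin_comp[OF plin_lin_ext \<Delta>_lin])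
  have "t3coord \<kappa> (lin_ext (\<lambda>(a, b). lin_ext (\<lambda>(a', a''). pure (a', a'', b)) (comult H a)) (comult H x))
      = lin_ext (\<lambda>(a, b). lin_ext (\<lambda>(a', a''). tens (\<kappa> a') (tens (\<kappa> a'') (\<kappa> b))) (comult H a)) (comult H x)"
    by (auto simp: t3coord_lin_ext split: prod.split intro!: lin_ext_cong)
  also have "\<dots> = lin_ext (\<lambda>(i, j).
      lin_ext (\<lambda>(a, b). tens (pure a) (tens (pure b) (pure j))) (\<Delta> (pure i))) (tcoord \<kappa> (comult H x))"
  proof (rule lin_ext_tcoord[where \<Phi> = "\<lambda>p r. lin_ext (\<lambda>(a, b). tens (pure a) (tens (pure b) r)) (\<Delta> p)"], goal_cases)
    case 1
    show ?case
      unfolding pbilin_def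
      by (auto intro!: plin_lin_ext_fun plin_comp[OF plin_tens_right] plin_tens_right)
  next
    case (2 a b)
    have bil: "pbilin (\<lambda>p q. tens p (tens q (\<kappa> b)))"
      unfolding pbilin_def by (auto intro!: plin_comp[OF plin_tens_right] plin_tens_left)
    show ?case
      using comult[of a] comult_supp[OF x 2] lin_ext_tcoord[OF bil, of "comult H a"
          "\<lambda>(a', a''). tens (\<kappa> a') (tens (\<kappa> a'') (\<kappa> b))" \<kappa>] by auto
  qed
  also have "\<dots> = lin_ext (\<lambda>(i, j). lin_ext (\<lambda>(a, b). pure (a, b, j)) (\<Delta> (pure i))) (\<Delta> (\<kappa> x))"
    using comult[OF x] by simp
  also have "\<dots> = lin_ext (\<lambda>(i, j). lin_ext (\<lambda>(a, b). pure (i, a, b)) (\<Delta> (pure j))) (\<Delta> (\<kappa> x))"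
    using x by (intro \<Delta>_coassoc \<kappa>_closed)
  also have "\<dots> = lin_ext (\<lambda>(i, j).
      lin_ext (\<lambda>(a, b). tens (pure i) (tens (pure a) (pure b))) (\<Delta> (pure j))) (tcoord \<kappa> (comult H x))"
    using comult[OF x] by simp
  also have "\<dots> = lin_ext (\<lambda>(a, b). lin_ext (\<lambda>(b', b''). tens (\<kappa> a) (tens (\<kappa> b') (\<kappa> b''))) (comult H b)) (comult H x)"
  proof (rule lin_ext_tcoord[where \<Phi> = "\<lambda>r p. lin_ext (\<lambda>(a, b). tens r (tens (pure a) (pure b))) (\<Delta> p)", symmetric], goal_cases)
    case 1
    show ?case
      unfolding pbilin_def
      by (auto intro!: plin_lin_ext_fun plin_tens_left)
  next
    case (2 a b)
    have bil: "pbilin (\<lambda>p q. tens (\<kappa> a) (tens p q))"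
      unfolding pbilin_def by (auto intro!: plin_comp[OF plin_tens_right] plin_tens_left plin_tens_right)
    show ?case
      using comult[of b] comult_supp[OF x 2] lin_ext_tcoord[OF bil, of "comult H b"
          "\<lambda>(b', b''). tens (\<kappa> a) (tens (\<kappa> b') (\<kappa> b''))" \<kappa>] by auto
  qed
  also have "\<dots> = t3coord \<kappa> (lin_ext (\<lambda>(a, b). lin_ext (\<lambda>(b', b''). pure (a, b', b'')) (comult H b)) (comult H x))"
    by (auto simp: t3coord_lin_ext split: prod.split intro!: lin_ext_cong)
  finally show "t3coord \<kappa> (lin_ext (\<lambda>(a, b). lin_ext (\<lambda>(a', a''). pure (a', a'', b)) (comult H a)) (comult H x)) =
    t3coord \<kappa> (lin_ext (\<lambda>(a, b). lin_ext (\<lambda>(b', b''). pure (a, b', b'')) (comult H b)) (comult H x))" .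
next
  have *: "supp (lin_ext (\<lambda>(a', a''). pure (a', a'', b)) (comult H a)) \<subseteq> carrier H \<times> carrier H \<times> carrier H"
    "supp (lin_ext (\<lambda>(b', b''). pure (b, b', b'')) (comult H a)) \<subseteq> carrier H \<times> carrier H \<times> carrier H"
    if "a \<in> carrier H" "b \<in> carrier H" for a b
    using that by (auto intro!: supp_lin_ext_subset dest: comult_supp)
  have ab: "\<exists>a b. z = (a, b) \<and> a \<in> carrier H \<and> b \<in> carrier H" if "z \<in> supp (comult H x)" for z
    using comult_supp[OF x] that by (cases z) blast
  show "supp (lin_ext (\<lambda>(a, b). lin_ext (\<lambda>(a', a''). pure (a', a'', b)) (comult H a)) (comult H x))
      \<subseteq> carrier H \<times> carrier H \<times> carrier H"
    by (rule supp_lin_ext_subset, drule ab) (use *(1) in \<open>elim exE conjE, simp\<close>)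
  show "supp (lin_ext (\<lambda>(a, b). lin_ext (\<lambda>(b', b''). pure (a, b', b'')) (comult H b)) (comult H x))
      \<subseteq> carrier H \<times> carrier H \<times> carrier H"
    by (rule supp_lin_ext_subset, drule ab) (use *(2) in \<open>elim exE conjE, simp\<close>)
qed

lemma tensor_mult_supp:
  assumes "supp s \<subseteq> carrier H \<times> carrier H" "supp t \<subseteq> carrier H \<times> carrier H"
  shows "supp (tensor_mult H s t) \<subseteq> carrier H \<times> carrier H"
  unfolding tensor_mult_def
  using mult subsetD[OF assms(1)] subsetD[OF assms(2)]
  by (auto intro!: supp_lin_ext_subset split: prod.splits)

lemma tcoord_tensor_mult:
  assumes s: "supp s \<subseteq> carrier H \<times> carrier H" and t: "supp t \<subseteq> carrier H \<times> carrier H"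
  shows "tcoord \<kappa> (tensor_mult H s t) =
    lin_ext (\<lambda>(a, b). lin_ext (\<lambda>(c, d). tens (\<mu> (pure a) (pure c)) (\<mu> (pure b) (pure d))) (tcoord \<kappa> t)) (tcoord \<kappa> s)"
proof -
  have "tcoord \<kappa> (tensor_mult H s t) =
      lin_ext (\<lambda>(a, b). lin_ext (\<lambda>(c, d). tens (\<mu> (\<kappa> a) (\<kappa> c)) (\<mu> (\<kappa> b) (\<kappa> d))) t) s"
    unfolding tensor_mult_def tcoord_lin_ext
    using subsetD[OF s] subsetD[OF t]
    by (force simp: tcoord_lin_ext mult split: prod.split intro!: lin_ext_cong)
  also have "\<dots> = lin_ext (\<lambda>(a, b). lin_ext (\<lambda>(c, d). tens (\<mu> (pure a) (\<kappa> c)) (\<mu> (pure b) (\<kappa> d))) t) (tcoord \<kappa> s)"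
    by (rule lin_ext_tcoord[where \<Phi> = "\<lambda>p q. lin_ext (\<lambda>(c, d). tens (\<mu> p (\<kappa> c)) (\<mu> q (\<kappa> d))) t"])
      (auto simp: pbilin_def intro!: plin_lin_ext_fun plin_comp[OF plin_tens_right] plin_comp[OF plin_tens_left]
        pbilinD[OF \<mu>_bilin])
  also have "\<dots> = lin_ext (\<lambda>(a, b). lin_ext (\<lambda>(c, d). tens (\<mu> (pure a) (pure c)) (\<mu> (pure b) (pure d))) (tcoord \<kappa> t)) (tcoord \<kappa> s)"
  proof (rule lin_ext_cong, clarify)
    fix a b
    show "lin_ext (\<lambda>(c, d). tens (\<mu> (pure a) (\<kappa> c)) (\<mu> (pure b) (\<kappa> d))) t =
      lin_ext (\<lambda>(c, d). tens (\<mu> (pure a) (pure c)) (\<mu> (pure b) (pure d))) (tcoord \<kappa> t)"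
      by (rule lin_ext_tcoord[where \<Phi> = "\<lambda>p q. tens (\<mu> (pure a) p) (\<mu> (pure b) q)"])
        (auto simp: pbilin_def intro!: plin_comp[OF plin_tens_right] plin_comp[OF plin_tens_left]
          pbilinD[OF \<mu>_bilin])
  qed
  finally show ?thesis .
qed

definition anti :: "'a \<Rightarrow> 'a"
  where "anti x = elt (S (\<kappa> x))"

lemma anti_closed: "x \<in> carrier H \<Longrightarrow> anti x \<in> carrier H"
  and \<kappa>_anti: "x \<in> carrier H \<Longrightarrow> \<kappa> (anti x) = S (\<kappa> x)"
  by (auto simp: anti_def elt_closed S_in \<kappa>_closed \<kappa>_elt)

lemma hopf_algebra_realized: "hopf_algebra H"
proof -
  have cs: "supp (comult H x) \<subseteq> carrier H \<times> carrier H" if "x \<in> carrier H" for x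
    using comult that by auto
  have ct: "tcoord \<kappa> (comult H x) = \<Delta> (\<kappa> x)" if "x \<in> carrier H" for x
    using comult that by auto
  have bl: "pbilin (\<lambda>p q. pscale (lin_form ep p) q)" "pbilin (\<lambda>p q. pscale (lin_form ep q) p)"
    by (auto simp: pbilin_def plin_def lin_form_simps pscale_add_right pscale_add_left mult_ac)
  show ?thesis
  proof (intro hopf_algebra.intro k_algebra_axioms hopf_algebra_axioms.intro)
    fix x y assume x: "x \<in> carrier H" and y: "y \<in> carrier H"
    show "tensor_eq H H (comult H (x \<oplus> y)) (comult H x + comult H y)"
      by (subst tensor_eq_iff)
        (use x y cs keys_add[of "comult H x" "comult H y"] in \<open>auto simp: ct \<kappa>_add \<Delta>_rules dest!: cs\<close>)
    show "counit H (x \<oplus> y) = counit H x + counit H y"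
      using x y by (simp add: counit \<kappa>_add lin_form_simps)
    show "tensor_eq H H (comult H (x \<otimes> y)) (tensor_mult H (comult H x) (comult H y))"
      by (subst tensor_eq_iff)
        (use x y in \<open>simp_all add: cs tensor_mult_supp tcoord_tensor_mult ct mult \<Delta>_mult \<kappa>_closed\<close>)
    show "counit H (x \<otimes> y) = counit H x * counit H y"
      using x y by (simp add: counit mult ep_mult \<kappa>_closed)
  next
    fix x c assume x: "x \<in> carrier H"
    show "supp (comult H x) \<subseteq> carrier H \<times> carrier H"
      using x by (rule cs)
    show "tensor_eq H H (comult H (c \<cdot> x)) (pscale c (comult H x))"
      by (subst tensor_eq_iff)
        (use x cs supp_pscale_subset[of c "comult H x"] in \<open>auto simp: ct \<kappa>_scale \<Delta>_rules kscale_closed dest!: cs\<close>)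
    show "counit H (c \<cdot> x) = c * counit H x"
      using x by (simp add: counit \<kappa>_scale kscale_closed lin_form_simps)
    show "tensor3_eq H
        (lin_ext (\<lambda>(a, b). lin_ext (\<lambda>(a', a''). pure (a', a'', b)) (comult H a)) (comult H x))
        (lin_ext (\<lambda>(a, b). lin_ext (\<lambda>(b', b''). pure (a, b', b'')) (comult H b)) (comult H x))"
      using x by (rule coassoc_realized)
    have 1: "\<kappa> (lincomb H (\<lambda>(a, b). counit H a \<cdot> b) (comult H x)) =
        lin_ext (\<lambda>x. \<kappa> (case x of (a, b) \<Rightarrow> counit H a \<cdot> b)) (comult H x)"
      by (rule \<kappa>_lincomb) (auto intro!: kscale_closed dest: comult_supp[OF x])
    also have "\<dots> = lin_ext (\<lambda>(i, j). pscale (lin_form ep (pure i)) (pure j)) (tcoord \<kappa> (comult H x))"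
      by (rule lin_ext_tcoord[OF bl(1)]) (auto simp: \<kappa>_scale counit dest: comult_supp[OF x])
    also have "\<dots> = \<kappa> x"
      using x by (simp add: ct \<Delta>_counit \<kappa>_closed)
    finally show "lincomb H (\<lambda>(a, b). counit H a \<cdot> b) (comult H x) = x"
      by (intro \<kappa>_inj lincomb_closed x) (auto intro!: kscale_closed dest: comult_supp[OF x])
    have 1: "\<kappa> (lincomb H (\<lambda>(a, b). counit H b \<cdot> a) (comult H x)) =
        lin_ext (\<lambda>x. \<kappa> (case x of (a, b) \<Rightarrow> counit H b \<cdot> a)) (comult H x)"
      by (rule \<kappa>_lincomb) (auto intro!: kscale_closed dest: comult_supp[OF x])
    also have "\<dots> = lin_ext (\<lambda>(i, j). pscale (lin_form ep (pure j)) (pure i)) (tcoord \<kappa> (comult H x))"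
      by (rule lin_ext_tcoord[OF bl(2)]) (auto simp: \<kappa>_scale counit dest: comult_supp[OF x])
    also have "\<dots> = \<kappa> x"
      using x by (simp add: ct \<Delta>_counit \<kappa>_closed)
    finally show "lincomb H (\<lambda>(a, b). counit H b \<cdot> a) (comult H x) = x"
      by (intro \<kappa>_inj lincomb_closed x) (auto intro!: kscale_closed dest: comult_supp[OF x])
  next
    show "tensor_eq H H (comult H \<one>) (pure (\<one>, \<one>))"
      by (subst tensor_eq_iff) (auto simp: ct one \<Delta>_one dest!: cs[THEN subsetD, rotated])
    show "counit H \<one> = 1"
      by (simp add: counit one ep_one)
  next
    show "\<exists>S\<in>carrier H \<rightarrow> carrier H.
      (\<forall>x\<in>carrier H. \<forall>y\<in>carrier H. S (x \<oplus> y) = S x \<oplus> S y) \<and>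
      (\<forall>c. \<forall>x\<in>carrier H. S (c \<cdot> x) = c \<cdot> S x) \<and>
      (\<forall>x\<in>carrier H. lincomb H (\<lambda>(a, b). S a \<otimes> b) (comult H x) = counit H x \<cdot> \<one>) \<and>
      (\<forall>x\<in>carrier H. lincomb H (\<lambda>(a, b). a \<otimes> S b) (comult H x) = counit H x \<cdot> \<one>)"
    proof (intro bexI[of _ anti] conjI ballI allI)
      fix x assume x: "x \<in> carrier H"
      have "\<kappa> (lincomb H (\<lambda>(a, b). anti a \<otimes> b) (comult H x)) =
          lin_ext (\<lambda>x. \<kappa> (case x of (a, b) \<Rightarrow> anti a \<otimes> b)) (comult H x)"
        by (rule \<kappa>_lincomb) (auto simp: mult anti_closed dest: comult_supp[OF x])
      also have "\<dots> = lin_ext (\<lambda>(i, j). \<mu> (S (pure i)) (pure j)) (tcoord \<kappa> (comult H x))"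
        by (rule lin_ext_tcoord[where \<Phi> = "\<lambda>p q. \<mu> (S p) q"])
          (auto simp: mult \<kappa>_anti anti_closed pbilin_def
            intro!: pbilinD[OF \<mu>_bilin] plin_comp[OF pbilinD(2)[OF \<mu>_bilin]] S_lin dest: comult_supp[OF x])
      also have "\<dots> = \<kappa> (counit H x \<cdot> \<one>)"
        using x by (simp add: ct antipode_left \<kappa>_closed counit \<kappa>_scale one)
      finally show "lincomb H (\<lambda>(a, b). anti a \<otimes> b) (comult H x) = counit H x \<cdot> \<one>"
        using one by (intro \<kappa>_inj lincomb_closed)
          (auto simp: mult scale anti_closed dest: comult_supp[OF x])
      have "\<kappa> (lincomb H (\<lambda>(a, b). a \<otimes> anti b) (comult H x)) =
          lin_ext (\<lambda>x. \<kappa> (case x of (a, b) \<Rightarrow> a \<otimes> anti b)) (comult H x)"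
        by (rule \<kappa>_lincomb) (auto simp: mult anti_closed dest: comult_supp[OF x])
      also have "\<dots> = lin_ext (\<lambda>(i, j). \<mu> (pure i) (S (pure j))) (tcoord \<kappa> (comult H x))"
        by (rule lin_ext_tcoord[where \<Phi> = "\<lambda>p q. \<mu> p (S q)"])
          (auto simp: mult \<kappa>_anti anti_closed pbilin_def
            intro!: pbilinD[OF \<mu>_bilin] plin_comp[OF pbilinD(1)[OF \<mu>_bilin]] S_lin dest: comult_supp[OF x])
      also have "\<dots> = \<kappa> (counit H x \<cdot> \<one>)"
        using x by (simp add: ct antipode_right \<kappa>_closed counit \<kappa>_scale one)
      finally show "lincomb H (\<lambda>(a, b). a \<otimes> anti b) (comult H x) = counit H x \<cdot> \<one>"
        using one by (intro \<kappa>_inj lincomb_closed)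
          (auto simp: mult scale anti_closed dest: comult_supp[OF x])
    qed (auto intro!: anti_closed \<kappa>_inj simp: \<kappa>_anti \<kappa>_add \<kappa>_scale S_rules anti_closed kscale_closed)
  qed
qed

end

text \<open>Passing to coordinates on one side and back on the other respects every operation,
  because both sides compute it by the same structure constants.\<close>

lemma hopf_iso_realizations:
  fixes H :: "('a, 'k::field, 'm) khopf_scheme" and H' :: "('b, 'k, 'n) khopf_scheme"
  assumes "hopf_realization I \<mu> e \<Delta> ep S H \<kappa>" and "hopf_realization I \<mu> e \<Delta> ep S H' \<kappa>'"
  shows "hopf_iso H H' (\<lambda>x. coords.elt H' \<kappa>' (\<kappa> x))"
proof -
  interpret A: hopf_realization I \<mu> e \<Delta> ep S H \<kappa> by fact
  interpret B: hopf_realization I \<mu> e \<Delta> ep S H' \<kappa>' by fact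
  define \<phi> where "\<phi> = (\<lambda>x. B.elt (\<kappa> x))"
  have cl: "\<phi> x \<in> carrier H'" "\<kappa>' (\<phi> x) = \<kappa> x" if "x \<in> carrier H" for x
    using that by (simp_all add: \<phi>_def B.elt_closed B.\<kappa>_elt A.\<kappa>_closed)
  have "\<phi> \<in> ring_iso H H'"
  proof (rule ring_iso_memI)
    show "bij_betw \<phi> (carrier H) (carrier H')"
    proof (rule bij_betw_byWitness[where f' = "\<lambda>y. A.elt (\<kappa>' y)"])
      show "\<forall>a\<in>carrier H. A.elt (\<kappa>' (\<phi> a)) = a"
        by (simp add: cl A.elt_\<kappa>)
      show "\<forall>a\<in>carrier H'. \<phi> (A.elt (\<kappa>' a)) = a"
        by (simp add: \<phi>_def A.\<kappa>_elt B.\<kappa>_closed B.elt_\<kappa>)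
    qed (auto simp: cl A.elt_closed B.\<kappa>_closed)
  next
    fix x y assume xy: "x \<in> carrier H" "y \<in> carrier H"
    then show "\<phi> (x \<otimes>\<^bsub>H\<^esub> y) = \<phi> x \<otimes>\<^bsub>H'\<^esub> \<phi> y" and "\<phi> (x \<oplus>\<^bsub>H\<^esub> y) = \<phi> x \<oplus>\<^bsub>H'\<^esub> \<phi> y"
      by (auto intro!: B.\<kappa>_inj simp: cl A.mult B.mult A.add B.add)
  qed (auto intro!: B.\<kappa>_inj simp: cl A.one B.one)
  moreover have "\<phi> (c \<cdot>\<^bsub>H\<^esub> x) = c \<cdot>\<^bsub>H'\<^esub> \<phi> x" if "x \<in> carrier H" for c x
    using that by (intro B.\<kappa>_inj) (auto simp: cl A.scale B.scale)
  moreover have "tensor_eq H' H' (comult H' (\<phi> x)) (tensor_map \<phi> \<phi> (comult H x))" if x: "x \<in> carrier H" for x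
  proof (subst B.tensor_eq_iff)
    show "supp (comult H' (\<phi> x)) \<subseteq> carrier H' \<times> carrier H'"
      using x by (simp add: B.comult cl)
    show "supp (tensor_map \<phi> \<phi> (comult H x)) \<subseteq> carrier H' \<times> carrier H'"
      unfolding tensor_map_def using A.comult_supp[OF x] by (auto intro!: supp_lin_ext_subset simp: cl)
    have "tcoord \<kappa>' (tensor_map \<phi> \<phi> (comult H x)) = tcoord \<kappa> (comult H x)"
      unfolding tcoord_tensor_map by (rule tcoord_cong) (use A.comult_supp[OF x] in \<open>auto simp: cl\<close>)
    then show "tcoord \<kappa>' (comult H' (\<phi> x)) = tcoord \<kappa>' (tensor_map \<phi> \<phi> (comult H x))"
      using x by (simp add: A.comult B.comult cl)
  qed
  moreover have "counit H' (\<phi> x) = counit H x" if "x \<in> carrier H" for x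
    using that by (simp add: A.counit B.counit cl)
  ultimately show ?thesis
    unfolding hopf_iso_def \<phi>_def[symmetric]
    using A.hopf_algebra_realized B.hopf_algebra_realized by blast
qed

subsection \<open>Spans and dimensions in coordinates\<close>

text \<open>Makes spans, independence and the exchange bound of general linear algebra available for
  coordinate spaces.\<close>

interpretation PV: vector_space "pscale :: 'k::field \<Rightarrow> ('i \<Rightarrow>\<^sub>0 'k) \<Rightarrow> _"
  by unfold_locales (simp_all add: pscale_add_right pscale_add_left)

lemma span_pure: "PV.span ((pure :: 'i \<Rightarrow> ('i \<Rightarrow>\<^sub>0 'k::field)) ` I) = lc I"
proof
  show "PV.span (pure ` I) \<subseteq> lc I"
    by (rule PV.span_minimal) (auto simp: PV.subspace_def lc_intros)
  show "lc I \<subseteq> PV.span ((pure :: 'i \<Rightarrow> ('i \<Rightarrow>\<^sub>0 'k)) ` I)"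
  proof
    fix p :: "'i \<Rightarrow>\<^sub>0 'k" assume "p \<in> lc I"
    then have "supp p \<subseteq> I" by (simp add: lc_def)
    then show "p \<in> PV.span (pure ` I)"
      by (induction p rule: linear_induct)
        (auto intro: PV.span_zero PV.span_add PV.span_scale PV.span_base)
  qed
qed

lemma independent_pure: "PV.independent ((pure :: 'i \<Rightarrow> ('i \<Rightarrow>\<^sub>0 'k::field)) ` I)"
  unfolding PV.dependent_def
proof safe
  fix i assume "i \<in> I" and *: "(pure i :: 'i \<Rightarrow>\<^sub>0 'k) \<in> PV.span (pure ` I - {pure i})"
  have "pure ` I - {pure i :: 'i \<Rightarrow>\<^sub>0 'k} \<subseteq> pure ` (I - {i})" by auto
  then have "PV.span (pure ` I - {pure i :: 'i \<Rightarrow>\<^sub>0 'k}) \<subseteq> lc (I - {i})"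
    unfolding span_pure[symmetric] by (rule PV.span_mono)
  with * show False by auto
qed

lemma inj_pure: "inj (pure :: 'i \<Rightarrow> ('i \<Rightarrow>\<^sub>0 'k::field))"
  by (rule injI) (metis keys_single singletonD singletonI zero_neq_one)

context coords
begin

lemma k_span_subset: "S \<subseteq> carrier A \<Longrightarrow> k_span A S \<subseteq> carrier A"
  unfolding k_span_def by (auto intro!: lincomb_closed)

lemma \<kappa>_lincomb_id: "supp p \<subseteq> S \<Longrightarrow> S \<subseteq> carrier A \<Longrightarrow> \<kappa> (lincomb A id p) = lin_ext \<kappa> p"
  by (subst \<kappa>_lincomb) auto

lemma \<kappa>_k_span:
  assumes S: "S \<subseteq> carrier A"
  shows "\<kappa> ` k_span A S = PV.span (\<kappa> ` S)"
proof -
  have eq: "\<kappa> ` k_span A S = lin_ext \<kappa> ` lc S"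
    unfolding k_span_def lc_def using \<kappa>_lincomb_id[OF _ S]
    by (force simp: image_iff)
  show ?thesis
    unfolding eq
  proof
    show "lin_ext \<kappa> ` lc S \<subseteq> PV.span (\<kappa> ` S)"
      by (clarsimp simp: lin_ext_def lc_def) (rule PV.span_sum, rule PV.span_scale, rule PV.span_base, auto)
    show "PV.span (\<kappa> ` S) \<subseteq> lin_ext \<kappa> ` lc S"
    proof (rule PV.span_minimal)
      show "\<kappa> ` S \<subseteq> lin_ext \<kappa> ` lc S"
        by (metis image_subsetI lc_pure lin_ext_pure image_eqI)
      show "PV.subspace (lin_ext \<kappa> ` lc S)"
        unfolding PV.subspace_def
        by (auto simp flip: lin_ext_simps intro!: imageI lc_intros) (metis image_eqI lc_0 lin_ext_0)
    qed
  qed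
qed

lemma k_span_iff:
  assumes "S \<subseteq> carrier A"
  shows "x \<in> k_span A S \<longleftrightarrow> x \<in> carrier A \<and> \<kappa> x \<in> PV.span (\<kappa> ` S)"
  unfolding \<kappa>_k_span[OF assms, symmetric] using k_span_subset[OF assms] \<kappa>_inj[of x]
  by (auto simp: image_iff subset_iff)

lemma k_span_superset: "S \<subseteq> carrier A \<Longrightarrow> S \<subseteq> k_span A S"
  using PV.span_superset[of "\<kappa> ` S"] by (fastforce simp: k_span_iff)

lemma k_span_eqI:
  assumes "W \<subseteq> carrier A" and "S \<subseteq> carrier A" and "\<kappa> ` W = PV.span (\<kappa> ` S)"
  shows "k_span A S = W"
proof -
  have "x \<in> k_span A S \<longleftrightarrow> x \<in> W" for x
    unfolding k_span_iff[OF assms(2)] assms(3)[symmetric] using assms(1) \<kappa>_inj[of x]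
    by (auto simp: image_iff)
  then show ?thesis by auto
qed

text \<open>One side quantifies over formal combinations of elements of \<open>S\<close>, the other
  over scalar functions on finite subsets of the image. Injectivity of \<open>\<kappa>\<close> on
  \<open>S\<close> prevents two coefficients from being merged.\<close>

lemma k_indep_iff:
  assumes S: "S \<subseteq> carrier A"
  shows "k_indep A S \<longleftrightarrow> PV.independent (\<kappa> ` S)"
proof -
  have inj: "inj_on \<kappa> S" using S \<kappa>_inj by (auto simp: inj_on_def)
  have zero: "lincomb A id p = \<zero> \<longleftrightarrow> lin_ext \<kappa> p = 0" if "supp p \<subseteq> S" for p
  proof -
    have "lincomb A id p \<in> carrier A" using that S by (intro lincomb_closed) auto
    then show ?thesis
      using \<kappa>_lincomb_id[OF that S] \<kappa>_zero \<kappa>_inj[of "lincomb A id p" \<zero>] by auto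
  qed
  show ?thesis
  proof
    assume ind: "k_indep A S"
    show "PV.independent (\<kappa> ` S)"
      unfolding PV.independent_explicit_finite_subsets
    proof safe
      fix T u x assume T: "T \<subseteq> \<kappa> ` S" "finite T" "(\<Sum>v\<in>T. pscale (u v) v) = 0" and v: "x \<in> T"
      from T obtain T' where T': "T' \<subseteq> S" "T = \<kappa> ` T'" by (meson subset_imageE)
      with inj T have fin: "finite T'" and inj': "inj_on \<kappa> T'"
        by (auto dest: finite_imageD inj_on_subset)
      define p where "p = (\<Sum>x\<in>T'. pscale (u (\<kappa> x)) (pure x))"
      have p: "coef p x = (if x \<in> T' then u (\<kappa> x) else 0)" for x
        using fin by (simp add: p_def lookup_sum lookup_single when_def if_distrib cong: if_cong)
      have "supp p \<subseteq> S" using T' by (auto simp: in_keys_iff p split: if_splits)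
      moreover have "lin_ext \<kappa> p = (\<Sum>x\<in>T'. pscale (u (\<kappa> x)) (\<kappa> x))"
        by (simp add: p_def lin_ext_simps)
      moreover have "\<dots> = 0" using T(3) unfolding T'(2) by (simp add: sum.reindex[OF inj'])
      ultimately have "p = 0" using ind zero unfolding k_indep_def by auto
      with v T' show "u x = 0" by (metis (mono_tags) imageE lookup_zero p)
    qed
  next
    assume ind: "PV.independent (\<kappa> ` S)"
    show "k_indep A S"
      unfolding k_indep_def
    proof safe
      fix p assume p: "supp p \<subseteq> S" "lincomb A id p = \<zero>"
      \<comment> \<open>The formal combination \<open>p\<close> is indexed by elements, the required
        scalars by their coordinate vectors; \<open>elt\<close> goes back.\<close>
      define u where "u v = coef p (elt v)" for v
      have inj': "inj_on \<kappa> (supp p)" using inj p(1) by (rule inj_on_subset)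
      have u: "u (\<kappa> x) = coef p x" if "x \<in> supp p" for x
        using that p(1) S by (simp add: u_def elt_\<kappa> subset_iff)
      have "(\<Sum>v\<in>\<kappa> ` supp p. pscale (u v) v) = lin_ext \<kappa> p"
        unfolding lin_ext_def sum.reindex[OF inj'] by (simp add: u)
      also have "\<dots> = 0" using zero[OF p(1)] p(2) by simp
      finally have "\<forall>v\<in>\<kappa> ` supp p. u v = 0"
        using ind p(1) unfolding PV.independent_explicit_finite_subsets by (meson finite_imageI finite_keys image_mono)
      with u show "p = 0" by (metis image_eqI in_keys_iff keys_eq_empty equals0I)
    qed (use S in auto)
  qed
qed

text \<open>An independent set inside the span of \<open>Z\<close> has at most \<open>card Z\<close>
  members; without a finite basis the dimension has the dummy value 0 and the bound is
  trivial.\<close>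

lemma k_dim_le:
  assumes "W \<subseteq> carrier A" and "\<kappa> ` W \<subseteq> lc Z" and "finite Z"
  shows "k_dim A W \<le> card Z"
proof (cases "\<exists>B. finite B \<and> k_basis A W B")
  case True
  define B where "B = (SOME B. finite B \<and> k_basis A W B)"
  from True have B: "finite B" "k_basis A W B" unfolding B_def by (metis (mono_tags, lifting) someI_ex)+
  then have BA: "B \<subseteq> carrier A" and BW: "B \<subseteq> W"
    using k_span_superset[of B] by (auto simp: k_basis_def k_indep_def)
  have "PV.independent (\<kappa> ` B)"
    using B BA k_indep_iff by (auto simp: k_basis_def)
  then have "card (\<kappa> ` B) \<le> card (pure ` Z :: (_ \<Rightarrow>\<^sub>0 'k) set)"
    using PV.independent_span_bound[of "pure ` Z" "\<kappa> ` B"] BW assms by (auto simp: span_pure)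
  moreover have "card (\<kappa> ` B) = card B"
    using BA \<kappa>_inj by (intro card_image) (auto simp: inj_on_def)
  ultimately show ?thesis
    using True card_image_le[OF assms(3), of "pure :: _ \<Rightarrow> (_ \<Rightarrow>\<^sub>0 'k)"] by (simp add: k_dim_def flip: B_def)
next
  case False
  then show ?thesis unfolding k_dim_def by (simp only: if_False)
qed

text \<open>The finite bound \<open>Y\<close> guarantees a finite basis, so that the dimension is
  not the dummy value 0. Given this, the independent vectors indexed by \<open>Z\<close> are no more
  numerous than a basis.\<close>

lemma k_dim_ge:
  assumes S: "S \<subseteq> carrier A" and W: "W = k_span A S"
    and Y: "\<kappa> ` W \<subseteq> lc Y" "finite Y" and Z: "pure ` Z \<subseteq> \<kappa> ` W"
  shows "card Z \<le> k_dim A W"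
proof -
  obtain B where B: "B \<subseteq> \<kappa> ` W" "PV.independent B" "\<kappa> ` W \<subseteq> PV.span B"
    using PV.maximal_independent_subset by blast
  have fin: "finite B"
    using PV.independent_span_bound[of "pure ` Y" B] B Y by (auto simp: span_pure)
  have WA: "W \<subseteq> carrier A" using k_span_subset S W by simp
  have "elt b \<in> carrier A \<and> \<kappa> (elt b) = b" if "b \<in> B" for b
    using that B(1) WA \<kappa>_closed \<kappa>_elt elt_closed by blast
  then have BA: "elt ` B \<subseteq> carrier A" and \<kappa>B: "\<kappa> ` elt ` B = B"
    by (auto simp: image_image)
  have sub: "PV.span B \<subseteq> \<kappa> ` W"
    using B(1) PV.span_minimal[of B "\<kappa> ` W"] PV.subspace_span unfolding W \<kappa>_k_span[OF S] by auto
  have "k_basis A W (elt ` B)"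
    unfolding k_basis_def using k_indep_iff[OF BA] B(2) k_span_eqI[OF WA BA] B(3) sub
    by (simp add: \<kappa>B subset_antisym)
  with fin have ex: "\<exists>B. finite B \<and> k_basis A W B" by blast
  define B' where "B' = (SOME B. finite B \<and> k_basis A W B)"
  from ex have B': "finite B'" "k_basis A W B'" unfolding B'_def by (metis (mono_tags, lifting) someI_ex)+
  then have B'A: "B' \<subseteq> carrier A" by (auto simp: k_basis_def k_indep_def)
  have "\<kappa> ` W = PV.span (\<kappa> ` B')"
    using B' \<kappa>_k_span[OF B'A] by (simp add: k_basis_def)
  then have "card (pure ` Z :: (_ \<Rightarrow>\<^sub>0 'k) set) \<le> card (\<kappa> ` B')"
    using PV.independent_span_bound[of "\<kappa> ` B'" "pure ` Z"] independent_pure Z B'(1) by auto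
  also have "\<dots> \<le> card B'" using B'(1) by (rule card_image_le)
  finally show ?thesis
    using ex card_image[OF inj_on_subset[OF inj_pure[where 'k = 'k]], of Z] by (simp add: k_dim_def flip: B'_def)
qed

end

section \<open>Monoid algebras and quotients\<close>

definition conv :: "('a \<Rightarrow> 'a \<Rightarrow> 'a) \<Rightarrow> ('a \<Rightarrow>\<^sub>0 'k::field) \<Rightarrow> ('a \<Rightarrow>\<^sub>0 'k) \<Rightarrow> ('a \<Rightarrow>\<^sub>0 'k)"
  where "conv f p q = lin_ext (\<lambda>x. lin_ext (\<lambda>y. pure (f x y)) q) p"

lemma conv_pure [simp]: "conv f (pure x) (pure y) = pure (f x y)"
  by (simp add: conv_def)

lemma pbilin_conv: "pbilin (conv f)"
  using pbilin_ext[of "\<lambda>x y. pure (f x y)"] by (simp add: conv_def[abs_def])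

lemmas conv_simps =
  plin_rules[OF pbilinD(1)[OF pbilin_conv]] plin_rules[OF pbilinD(2)[OF pbilin_conv]]

lemma conv_lc: "(\<And>x y. x \<in> M \<Longrightarrow> y \<in> M \<Longrightarrow> f x y \<in> M) \<Longrightarrow> p \<in> lc M \<Longrightarrow> q \<in> lc M \<Longrightarrow> conv f p q \<in> lc M"
  unfolding conv_def by (intro lc_lin_ext) (auto simp: lc_def)

lemma conv_assoc:
  assumes "\<And>x y z. x \<in> M \<Longrightarrow> y \<in> M \<Longrightarrow> z \<in> M \<Longrightarrow> f (f x y) z = f x (f y z)"
    and "p \<in> lc M" "q \<in> lc M" "r \<in> lc M"
  shows "conv f (conv f p q) r = conv f p (conv f q r)"
proof -
  have s: "supp p \<subseteq> M" "supp q \<subseteq> M" "supp r \<subseteq> M" using assms by (auto simp: lc_def)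
  note b = pbilinD[OF pbilin_conv]
  show ?thesis
  proof (rule plin_eq_on[OF s(1)])
    fix x assume x: "x \<in> M"
    show "conv f (conv f (pure x) q) r = conv f (pure x) (conv f q r)"
    proof (rule plin_eq_on[OF s(2)])
      fix y assume y: "y \<in> M"
      show "conv f (conv f (pure x) (pure y)) r = conv f (pure x) (conv f (pure y) r)"
        by (rule plin_eq_on[OF s(3)]) (auto intro: b plin_comp[OF b(1)] simp: assms x y)
    qed (auto intro: b plin_comp[OF b(1)] plin_comp[OF b(2)])
  qed (auto intro: b plin_comp[OF b(2)])
qed

lemma monoid_algebra_simps [simp]:
  "carrier (monoid_algebra M) = lc (carrier M)"
  "monoid.mult (monoid_algebra M) = conv (monoid.mult M)"
  "one (monoid_algebra M) = pure \<one>\<^bsub>M\<^esub>"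
  "zero (monoid_algebra M) = 0"
  "add (monoid_algebra M) = (+)"
  "kscale (monoid_algebra M) = pscale"
  by (auto simp: monoid_algebra_def lc_def conv_def fun_eq_iff)

lemma conv_unit:
  assumes "monoid M" and "p \<in> lc (carrier M)"
  shows "conv (monoid.mult M) (pure \<one>\<^bsub>M\<^esub>) p = p" and "conv (monoid.mult M) p (pure \<one>\<^bsub>M\<^esub>) = p"
proof -
  interpret monoid M by fact
  have s: "supp p \<subseteq> carrier M" using assms by (simp add: lc_def)
  note b = pbilinD[OF pbilin_conv]
  show "conv (monoid.mult M) (pure \<one>\<^bsub>M\<^esub>) p = p"
    by (rule plin_eq_on[OF s]) (auto intro: b)
  show "conv (monoid.mult M) p (pure \<one>\<^bsub>M\<^esub>) = p"
    by (rule plin_eq_on[OF s, of "\<lambda>p. conv _ p _"]) (auto intro: b)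
qed

lemma coords_monoid_algebra:
  assumes "monoid M"
  shows "coords (monoid_algebra M :: (_ \<Rightarrow>\<^sub>0 'k::field, 'k) kalg) id (carrier M)"
proof -
  interpret monoid M by fact
  show ?thesis
    by (rule k_algebra_coords[where \<mu> = "conv (monoid.mult M)" and e = "pure \<one>\<^bsub>M\<^esub>"])
      (auto simp: lc_intros conv_lc pbilin_conv conv_unit[OF assms] m_assoc intro!: conv_assoc[where M = "carrier M"])
qed

lemma monoid_free: "monoid (free_monoid X)"
  by (rule monoidI) (auto simp: free_monoid_def)

lemma free_monoid_simps [simp]:
  "carrier (free_monoid X) = lists X" "monoid.mult (free_monoid X) = (@)" "one (free_monoid X) = []"
  by (auto simp: free_monoid_def)

text \<open>A quotient presented by an additive map with kernel \<open>J\<close>: cosets are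
  compared by comparing values of \<open>q\<close>, and \<open>q\<close> induces coordinates on the
  quotient.\<close>

locale quot_coords = k_algebra A + ideal J A
  for A :: "('a, 'k::field, 'm) kalg_scheme" (structure) and J :: "'a set" +
  fixes q :: "'a \<Rightarrow> 'c::ab_group_add"
  assumes q_add: "x \<in> carrier A \<Longrightarrow> y \<in> carrier A \<Longrightarrow> q (x \<oplus> y) = q x + q y"
    and q_kernel: "x \<in> carrier A \<Longrightarrow> q x = 0 \<longleftrightarrow> x \<in> J"
begin

lemma q_minus: "x \<in> carrier A \<Longrightarrow> y \<in> carrier A \<Longrightarrow> q (x \<ominus> y) = q x - q y"
  using q_add[of "x \<ominus> y" y] by (simp add: a_minus_def a_assoc l_neg)

lemma coset_eq_iff:
  assumes "x \<in> carrier A" and "y \<in> carrier A"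
  shows "J +> x = J +> y \<longleftrightarrow> q x = q y"
proof -
  have "J +> x = J +> y \<longleftrightarrow> x \<ominus> y \<in> J"
    using assms quotient_eq_iff_same_a_r_cos[OF ideal_axioms] by simp
  also have "\<dots> \<longleftrightarrow> q x = q y"
    using q_kernel[of "x \<ominus> y"] q_minus assms by simp
  finally show ?thesis .
qed

lemma coset_self: "x \<in> carrier A \<Longrightarrow> x \<in> J +> x"
  by (rule a_rcos_self)

lemma in_cosetD: "x \<in> carrier A \<Longrightarrow> y \<in> J +> x \<Longrightarrow> y \<in> carrier A \<and> q y = q x"
proof -
  assume x: "x \<in> carrier A" and y: "y \<in> J +> x"
  from y obtain z where z: "z \<in> J" "y = z \<oplus> x"
    unfolding a_r_coset_def' by blast
  then have "z \<in> carrier A" using a_subset by auto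
  with z x show "y \<in> carrier A \<and> q y = q x"
    using q_kernel[of z] by (simp add: q_add)
qed

lemma some_in_coset:
  assumes "x \<in> carrier A"
  shows "(SOME p. p \<in> J +> x) \<in> carrier A" and "q (SOME p. p \<in> J +> x) = q x"
proof -
  have "(SOME p. p \<in> J +> x) \<in> J +> x" using coset_self[OF assms] by (rule someI)
  from in_cosetD[OF assms this]
  show "(SOME p. p \<in> J +> x) \<in> carrier A" and "q (SOME p. p \<in> J +> x) = q x" by auto
qed

text \<open>An ideal of a unital algebra is a subspace, since c x = (c 1) x.\<close>

lemma kscale_ideal: "x \<in> J \<Longrightarrow> c \<cdot> x \<in> J"
  using I_l_closed[of x "c \<cdot> \<one>"] a_subset by (auto simp: kscale_mult_left kscale_closed)

lemma quot_carrier: "carrier (quot_alg A J) = (\<lambda>x. J +> x) ` carrier A"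
  by (auto simp: quot_alg_def ring.defs kalg.defs FactRing_def A_RCOSETS_def')

lemma quot_zero: "zero (quot_alg A J) = J +> \<zero>"
  using a_coset_add_zero[OF a_subset] by (simp add: quot_alg_def ring.defs kalg.defs FactRing_def)

lemma quot_one: "one (quot_alg A J) = J +> \<one>"
  by (simp add: quot_alg_def ring.defs kalg.defs FactRing_def)

lemma quot_add:
  "x \<in> carrier A \<Longrightarrow> y \<in> carrier A \<Longrightarrow> add (quot_alg A J) (J +> x) (J +> y) = J +> (x \<oplus> y)"
  using a_rcos_sum by (simp add: quot_alg_def ring.defs kalg.defs FactRing_def)

lemma quot_mult:
  "x \<in> carrier A \<Longrightarrow> y \<in> carrier A \<Longrightarrow> monoid.mult (quot_alg A J) (J +> x) (J +> y) = J +> (x \<otimes> y)"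
  using rcoset_mult_add by (simp add: quot_alg_def ring.defs kalg.defs FactRing_def)

text \<open>Scaling in the quotient is defined as a union over all representatives; they all
  contribute the same coset.\<close>

lemma coset_scale_eq:
  assumes x: "x \<in> carrier A" and y: "y \<in> J +> x"
  shows "J +> (c \<cdot> y) = J +> (c \<cdot> x)"
proof -
  from y obtain z where z: "z \<in> J" "y = z \<oplus> x"
    unfolding a_r_coset_def' by blast
  then have zc: "z \<in> carrier A" using a_subset by auto
  have "q (c \<cdot> z) = 0" using z zc kscale_ideal q_kernel by (auto simp: kscale_closed)
  with z zc x show ?thesis
    by (subst coset_eq_iff) (auto simp: kscale_closed kscale_add_right q_add)
qed

lemma quot_kscale:
  assumes x: "x \<in> carrier A"
  shows "kscale (quot_alg A J) c (J +> x) = J +> (c \<cdot> x)"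
proof -
  have "kscale (quot_alg A J) c (J +> x) = (\<Union>y\<in>J +> x. J +> (c \<cdot> y))"
    by (simp add: quot_alg_def ring.defs kalg.defs)
  also have "\<dots> = (\<Union>y\<in>J +> x. J +> (c \<cdot> x))"
    using coset_scale_eq[OF x] by simp
  also have "\<dots> = J +> (c \<cdot> x)" using coset_self[OF x] by auto
  finally show ?thesis .
qed

text \<open>The choice of representative is harmless because \<open>q\<close> is constant on
  cosets.\<close>

definition qco :: "'a set \<Rightarrow> 'c"
  where "qco X = q (SOME p. p \<in> X)"

lemma qco: "x \<in> carrier A \<Longrightarrow> qco (J +> x) = q x"
  by (simp add: qco_def some_in_coset)

lemma qco_bij: "bij_betw qco (carrier (quot_alg A J)) (q ` carrier A)"
  unfolding bij_betw_def inj_on_def quot_carrier by (auto simp: qco coset_eq_iff image_image)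

end

section \<open>The algebra \<open>\<UU>\<^sub>\<xi>(\<D>, \<lambda>)\<close> in coordinates\<close>

text \<open>Keeps the simplifier from destroying the generating set \<open>lift_gens G\<close>.\<close>
declare Un_insert_right [simp del]

text \<open>In a nonzero \<open>p\<close> take an index \<open>i\<close> of largest rank. No other
  term of \<open>p\<close> reaches \<open>i\<close>, so the coefficient there survives in the
  image.\<close>

lemma unitriangular_inj:
  assumes tri: "\<And>i. i \<in> I \<Longrightarrow> b i - pure i \<in> lc {j \<in> I. rk j < (rk i :: nat)}"
    and p: "p \<in> lc I" "lin_ext b p = (0 :: 'i \<Rightarrow>\<^sub>0 'k::field)"
  shows "p = 0"
proof (rule ccontr)
  assume "p \<noteq> 0"
  then have ne: "supp p \<noteq> {}" by simp
  then have "Max (rk ` supp p) \<in> rk ` supp p" by (intro Max_in) auto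
  then obtain i where i: "i \<in> supp p" and "rk i = Max (rk ` supp p)" by auto
  then have max: "rk j \<le> rk i" if "j \<in> supp p" for j using that by simp
  have b: "coef (b j) i = (if j = i then 1 else 0)" if "j \<in> supp p" for j
  proof -
    have "j \<in> I" using that p by (auto simp: lc_def)
    from tri[OF this] max[OF that] have "coef (b j - pure j) i = 0"
      by (auto simp: lc_def in_keys_iff)
    then show ?thesis by (simp add: lookup_minus lookup_single when_def)
  qed
  have "coef (lin_ext b p) i = (\<Sum>j\<in>supp p. if j = i then coef p j else 0)"
    unfolding coef_lin_ext by (rule sum.cong) (auto simp: b)
  also have "\<dots> = coef p i" using i by simp
  finally show False using i p by (simp add: in_keys_iff)
qed

text \<open>By induction on the rank: \<open>b i\<close> differs from \<open>pure i\<close> by terms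
  of smaller rank, which are already in the image.\<close>

lemma unitriangular_surj:
  assumes tri: "\<And>i. i \<in> I \<Longrightarrow> b i - pure i \<in> lc {j \<in> I. rk j < (rk i :: nat)}"
  shows "lin_ext b ` lc I = (lc I :: ('i \<Rightarrow>\<^sub>0 'k::field) set)"
proof
  have b: "b i \<in> lc I" if "i \<in> I" for i
  proof -
    have "b i - pure i \<in> lc I"
      using tri[OF that] lc_mono[of "{j \<in> I. rk j < rk i}" I] by blast
    from lc_add[OF this, of "pure i"] that show ?thesis by simp
  qed
  have "lin_ext b p \<in> lc I" if "p \<in> lc I" for p
    by (rule lc_lin_ext) (use that b in \<open>auto simp: lc_def[of I]\<close>)
  then show "lin_ext b ` lc I \<subseteq> lc I" by auto
  have pure: "pure i \<in> lin_ext b ` lc I" if "i \<in> I" for i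
    using that
  proof (induction "rk i" arbitrary: i rule: less_induct)
    case less
    have "p \<in> lin_ext b ` lc I" if "supp p \<subseteq> {j \<in> I. rk j < rk i}" for p
      using that
    proof (induction p rule: linear_induct)
      case zero show ?case by (rule image_eqI[of _ _ 0]) auto
    next
      case (add p q) then show ?case by (auto simp flip: lin_ext_simps intro!: imageI lc_intros)
    next
      case (scale c p) then show ?case by (auto simp flip: lin_ext_simps intro!: imageI lc_intros)
    qed (use less in auto)
    with tri[OF less.prems] have "b i - pure i \<in> lin_ext b ` lc I" by (simp add: lc_def)
    then obtain r :: "'i \<Rightarrow>\<^sub>0 'k" where r: "r \<in> lc I" "b i - pure i = lin_ext b r" by blast
    have "pure i = lin_ext b (pure i - r)" by (simp add: lin_ext_simps flip: r(2))
    moreover have "pure i - r \<in> lc I" by (rule lc_minus[OF _ r(1)]) (simp add: less.prems)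
    ultimately show ?case by (rule image_eqI)
  qed
  show "lc I \<subseteq> lin_ext b ` lc I"
  proof
    fix p :: "'i \<Rightarrow>\<^sub>0 'k" assume "p \<in> lc I"
    then have "supp p \<subseteq> I" by (simp add: lc_def)
    then show "p \<in> lin_ext b ` lc I"
    proof (induction p rule: linear_induct)
      case zero show ?case by (rule image_eqI[of _ _ 0]) auto
    next
      case (add p q) then show ?case by (auto simp flip: lin_ext_simps intro!: imageI lc_intros)
    next
      case (scale c p) then show ?case by (auto simp flip: lin_ext_simps intro!: imageI lc_intros)
    qed (use pure in auto)
  qed
qed

abbreviation fm :: "('x list \<Rightarrow>\<^sub>0 'k::field) \<Rightarrow> ('x list \<Rightarrow>\<^sub>0 'k) \<Rightarrow> ('x list \<Rightarrow>\<^sub>0 'k)" (infixl \<open>\<odot>\<close> 70)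
  where "p \<odot> r \<equiv> conv (@) p r"

lemma fm_assoc: "(p \<odot> q) \<odot> r = p \<odot> (q \<odot> r)"
  by (rule conv_assoc[where M = UNIV]) (auto simp: lc_def)

lemma fm_unit [simp]: "pure [] \<odot> p = p" "p \<odot> pure [] = p"
  using conv_unit[OF monoid_free[of UNIV], of p] by (simp_all add: lc_def)

locale lift_data = group G for G :: "('g, 'm) monoid_scheme" (structure) +
  fixes g :: 'g and \<eta> \<xi> :: "('g \<Rightarrow>\<^sub>0 'k::field_char_0) \<Rightarrow> 'k" and lam :: 'k
  assumes yd: "yd_triple G g \<eta>" and \<xi>: "\<xi> \<in> Der_triv G"
begin

abbreviation E :: "'g \<Rightarrow> 'k" where "E h \<equiv> \<eta> (pure h)"
abbreviation X :: "'g \<Rightarrow> 'k" where "X h \<equiv> \<xi> (pure h)"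

lemma g_closed [simp]: "g \<in> carrier G"
  and g_central: "h \<in> carrier G \<Longrightarrow> h \<otimes> g = g \<otimes> h"
  and E_mult: "h \<in> carrier G \<Longrightarrow> t \<in> carrier G \<Longrightarrow> E (h \<otimes> t) = E h + E t"
  and E_g [simp]: "E g = 1"
  and X_mult: "h \<in> carrier G \<Longrightarrow> t \<in> carrier G \<Longrightarrow> X (h \<otimes> t) = X h + X t"
  using yd \<xi> by (auto simp: yd_triple_def Der_triv_def)

lemma g_central_left: "h \<in> carrier G \<Longrightarrow> k \<in> carrier G \<Longrightarrow> h \<otimes> (g \<otimes> k) = g \<otimes> (h \<otimes> k)"
  by (simp add: g_central flip: m_assoc)

lemma E_one [simp]: "E \<one> = 0"
  using E_mult[of \<one> \<one>] by simp

lemma X_one: "X \<one> = 0"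
  using X_mult[of \<one> \<one>] by simp

text \<open>The index \<open>(m, h, n)\<close> stands for \<open>a\<^sub>1\<^sup>m h a\<^sub>2\<^sup>n\<close>.  On \<open>\<Bbbk>[a\<^sub>1] \<otimes> \<Bbbk>G\<close> the commutator with
  \<open>a\<^sub>2\<close> is a derivation, so that the left regular action is explicit in this basis.\<close>

definition IX :: "(nat \<times> 'g \<times> nat) set"
  where "IX = UNIV \<times> carrier G \<times> UNIV"

definition op1 :: "(nat \<times> 'g \<times> nat \<Rightarrow>\<^sub>0 'k) \<Rightarrow> (nat \<times> 'g \<times> nat \<Rightarrow>\<^sub>0 'k)"
  where "op1 = lin_ext (\<lambda>(m, h, n). pure (Suc m, h, n))"

text \<open>Left multiplication by a2, obtained from a2 a1^m = a1^m a2 - (m/2) a1^(m+1) - m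
  \<lambda> a1^(m-1) (1 - g^2) and a2 h = h a2 - \<eta>(h) a1 h - \<xi>(h) (1 - g) h. For m = 0 the
  truncated exponent \<open>m - 1\<close> comes with the coefficient 0.\<close>

definition op2 :: "(nat \<times> 'g \<times> nat \<Rightarrow>\<^sub>0 'k) \<Rightarrow> (nat \<times> 'g \<times> nat \<Rightarrow>\<^sub>0 'k)"
  where "op2 = lin_ext (\<lambda>(m, h, n). pure (m, h, Suc n)
    - pscale (of_nat m / 2 + E h) (pure (Suc m, h, n))
    - pscale (of_nat m * lam) (pure (m - 1, h, n) - pure (m - 1, g \<otimes> (g \<otimes> h), n))
    - pscale (X h) (pure (m, h, n) - pure (m, g \<otimes> h, n)))"

definition opG :: "'g \<Rightarrow> (nat \<times> 'g \<times> nat \<Rightarrow>\<^sub>0 'k) \<Rightarrow> (nat \<times> 'g \<times> nat \<Rightarrow>\<^sub>0 'k)"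
  where "opG t = lin_ext (\<lambda>(m, h, n). pure (m, t \<otimes> h, n))"

fun op :: "'g gen \<Rightarrow> (nat \<times> 'g \<times> nat \<Rightarrow>\<^sub>0 'k) \<Rightarrow> (nat \<times> 'g \<times> nat \<Rightarrow>\<^sub>0 'k)"
  where "op (Grp t) = opG t" | "op A1 = op1" | "op A2 = op2"

definition act :: "('g gen list \<Rightarrow>\<^sub>0 'k) \<Rightarrow> (nat \<times> 'g \<times> nat \<Rightarrow>\<^sub>0 'k) \<Rightarrow> (nat \<times> 'g \<times> nat \<Rightarrow>\<^sub>0 'k)"
  where "act p v = lin_ext (\<lambda>w. foldr op w v) p"

abbreviation vac :: "nat \<times> 'g \<times> nat \<Rightarrow>\<^sub>0 'k"
  where "vac \<equiv> pure (0, \<one>, 0)"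

text \<open>The vacuum plays the role of the unit, so this is the expansion of the class of
  \<open>p\<close> in the basis a1^m h a2^n.\<close>

definition q :: "('g gen list \<Rightarrow>\<^sub>0 'k) \<Rightarrow> (nat \<times> 'g \<times> nat \<Rightarrow>\<^sub>0 'k)"
  where "q p = act p vac"

definition sw :: "nat \<times> 'g \<times> nat \<Rightarrow> 'g gen list"
  where "sw = (\<lambda>(m, h, n). replicate m A1 @ [Grp h] @ replicate n A2)"

definition \<sigma> :: "(nat \<times> 'g \<times> nat \<Rightarrow>\<^sub>0 'k) \<Rightarrow> ('g gen list \<Rightarrow>\<^sub>0 'k)"
  where "\<sigma> = lin_ext (\<lambda>i. pure (sw i))"

abbreviation W :: "'g gen list set" where "W \<equiv> lists (lift_gens G)"

lemma plin_op1: "plin op1" and plin_op2: "plin op2" and plin_opG: "plin (opG t)"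
  by (simp_all add: op1_def op2_def opG_def)

lemma plin_op: "plin (op x)"
  by (cases x) (simp_all add: plin_op1 plin_op2 plin_opG)

lemmas op_rules = plin_rules[OF plin_op] plin_rules[OF plin_op1] plin_rules[OF plin_op2]
  plin_rules[OF plin_opG]

lemma op_pure [simp]:
  "op1 (pure (m, h, n)) = pure (Suc m, h, n)"
  "opG t (pure (m, h, n)) = pure (m, t \<otimes> h, n)"
  by (simp_all add: op1_def opG_def)

lemma op2_pure:
  "op2 (pure (m, h, n)) = pure (m, h, Suc n)
    - pscale (of_nat m / 2 + E h) (pure (Suc m, h, n))
    - pscale (of_nat m * lam) (pure (m - 1, h, n) - pure (m - 1, g \<otimes> (g \<otimes> h), n))
    - pscale (X h) (pure (m, h, n) - pure (m, g \<otimes> h, n))"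
  by (simp add: op2_def)

lemma op_lc:
  assumes v: "v \<in> lc IX" and x: "x \<in> lift_gens G"
  shows "op x v \<in> lc IX"
  by (rule lc_plin[OF plin_op v])
    (use x in \<open>auto simp: IX_def op2_pure intro!: lc_intros\<close>)

lemma plin_foldr_op: "plin (foldr op w)"
  by (induction w) (auto simp: plin_def op_rules)

lemma foldr_op_lc: "v \<in> lc IX \<Longrightarrow> w \<in> W \<Longrightarrow> foldr op w v \<in> lc IX"
  by (induction w) (auto intro: op_lc)

lemma plin_act: "plin (act p)" "plin (\<lambda>p. act p v)"
  unfolding act_def using plin_lin_ext_fun[of "\<lambda>v w. foldr op w v"] by (simp_all add: plin_foldr_op)

lemma pbilin_act: "pbilin act"
  by (simp add: pbilin_def plin_act)

lemmas act_rules = plin_rules[OF plin_act(1)] plin_rules[OF plin_act(2)]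

lemma act_pure [simp]: "act (pure w) v = foldr op w v"
  by (simp add: act_def)

lemma act_fm: "act (p \<odot> r) v = act p (act r v)"
proof (rule pbilin_eq_on[OF subset_UNIV subset_UNIV, of "\<lambda>p r. act (p \<odot> r) v" "\<lambda>p r. act p (act r v)"])
  show "pbilin (\<lambda>p r. act (p \<odot> r) v)"
    using pbilin_comp[OF pbilin_conv plin_act(2) plin_id plin_id] by simp
  show "pbilin (\<lambda>p r. act p (act r v))"
    using pbilin_comp[OF pbilin_act plin_id plin_id plin_act(2)] by simp
qed simp

lemma act_lc: "p \<in> lc W \<Longrightarrow> v \<in> lc IX \<Longrightarrow> act p v \<in> lc IX"
  unfolding act_def by (rule lc_lin_ext, rule foldr_op_lc) (auto simp: lc_def[of W])

lemma plin_q: "plin q"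
  unfolding q_def by (rule plin_act)

lemmas q_rules = plin_rules[OF plin_q]

lemma q_pure [simp]: "q (pure w) = foldr op w vac"
  by (simp add: q_def)

lemma vac_lc: "vac \<in> lc IX"
  by (simp add: IX_def)

lemma q_lc: "p \<in> lc W \<Longrightarrow> q p \<in> lc IX"
  unfolding q_def by (intro act_lc vac_lc)

lemma q_fm: "q (p \<odot> r) = act p (q r)"
  by (simp add: q_def act_fm)

lemma plin_\<sigma>: "plin \<sigma>"
  by (simp add: \<sigma>_def)

lemmas \<sigma>_rules = plin_rules[OF plin_\<sigma>]

lemma \<sigma>_pure [simp]: "\<sigma> (pure i) = pure (sw i)"
  by (simp add: \<sigma>_def)

lemma sw_W: "i \<in> IX \<Longrightarrow> sw i \<in> W"
  by (cases i) (auto simp: sw_def IX_def in_lists_conv_set simp del: lists.simps)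

lemma \<sigma>_lc: "v \<in> lc IX \<Longrightarrow> \<sigma> v \<in> lc W"
  by (erule lc_plin[OF plin_\<sigma>]) (simp only: \<sigma>_pure lc_pure sw_W)

lemma op1_power [simp]: "(op1 ^^ k) (pure (m, h, n)) = pure (m + k, h, n)"
  by (induction k) auto

lemma op2_power_vac: "(op2 ^^ k) vac = pure (0, \<one>, k)"
  by (induction k) (auto simp: op2_pure X_one)

lemma q_sw: "i \<in> IX \<Longrightarrow> q (pure (sw i)) = pure i"
  by (auto simp: sw_def IX_def foldr_replicate op2_power_vac split: prod.splits)

lemma q_\<sigma>: "v \<in> lc IX \<Longrightarrow> q (\<sigma> v) = v"
  using plin_eq_on[of v IX "\<lambda>v. q (\<sigma> v)" "\<lambda>v. v"] plin_comp[OF plin_q plin_\<sigma>]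
  by (auto simp: lc_def q_sw simp del: q_pure)

subsubsection \<open>The defining relations\<close>

abbreviation F :: "('g gen list \<Rightarrow>\<^sub>0 'k, 'k) kalg"
  where "F \<equiv> free_algebra (lift_gens G)"

sublocale F: coords F id W
  using coords_monoid_algebra[OF monoid_free[of "lift_gens G"]] by simp

abbreviation \<I> :: "('g gen list \<Rightarrow>\<^sub>0 'k) set"
  where "\<I> \<equiv> lift_ideal G g \<eta> \<xi> lam"

abbreviation rels :: "('g gen list \<Rightarrow>\<^sub>0 'k) set"
  where "rels \<equiv> {l - r | l r. (l, r) \<in> lift_relations G g \<eta> \<xi> lam}"

text \<open>The relations with all products in the free algebra multiplied out, so that each later
  check is a computation with explicit words.\<close>

lemma relation_cases [consumes 1, case_names mult one A1 A2 comm]: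
  assumes "(l, r) \<in> lift_relations G g \<eta> \<xi> lam"
  obtains (mult) h t where "h \<in> carrier G" "t \<in> carrier G" "l = pure [Grp h, Grp t]" "r = pure [Grp (h \<otimes> t)]"
  | (one) "l = pure [Grp \<one>]" "r = pure []"
  | (A1) h where "h \<in> carrier G" "l = pure [Grp h, A1]" "r = pure [A1, Grp h]"
  | (A2) h where "h \<in> carrier G" "l = pure [Grp h, A2]"
      "r = pure [A2, Grp h] + pscale (E h) (pure [A1, Grp h]) + pscale (X h) (pure [Grp h] - pure [Grp g, Grp h])"
  | (comm) "l = pure [A1, A2] - pure [A2, A1] - pscale (1/2) (pure [A1, A1])"
      "r = pscale lam (pure [] - pure [Grp g, Grp g])"
  using assms unfolding lift_relations_def Let_def
  by (auto simp: conv_simps)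

lemma rels_lc: "rels \<subseteq> lc W"
proof safe
  fix l r assume "(l, r) \<in> lift_relations G g \<eta> \<xi> lam"
  then show "l - r \<in> lc W"
    by (cases rule: relation_cases) (auto intro!: lc_intros)
qed

sublocale I: ideal \<I> F
  unfolding lift_ideal_def relation_ideal_def
  by (rule F.genideal_ideal) (use rels_lc in simp)

lemma rel_in_\<I>: "(l, r) \<in> lift_relations G g \<eta> \<xi> lam \<Longrightarrow> l - r \<in> \<I>"
  unfolding lift_ideal_def relation_ideal_def using F.genideal_self[of rels] rels_lc by auto

lemma ideal_minimal:
  assumes "ideal J F" and "rels \<subseteq> J"
  shows "\<I> \<subseteq> J"
  unfolding lift_ideal_def relation_ideal_def using assms by (rule F.genideal_minimal)

lemma \<I>_add: "p \<in> \<I> \<Longrightarrow> r \<in> \<I> \<Longrightarrow> p + r \<in> \<I>"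
  using I.a_closed by simp

lemma \<I>_scale: "p \<in> \<I> \<Longrightarrow> pscale c p \<in> \<I>"
  using I.I_l_closed[of p "pscale c (pure [])"] by (simp add: conv_simps lc_intros)

lemma \<I>_0: "0 \<in> \<I>"
  using I.zero_closed by simp

lemma \<I>_mult_left: "p \<in> \<I> \<Longrightarrow> r \<in> lc W \<Longrightarrow> r \<odot> p \<in> \<I>"
  and \<I>_mult_right: "p \<in> \<I> \<Longrightarrow> r \<in> lc W \<Longrightarrow> p \<odot> r \<in> \<I>"
  using I.I_l_closed[of p r] I.I_r_closed[of p r] by auto

lemma F_idealI:
  assumes "J \<subseteq> lc W" "0 \<in> J" "\<And>p r. p \<in> J \<Longrightarrow> r \<in> J \<Longrightarrow> p + r \<in> J" "\<And>c p. p \<in> J \<Longrightarrow> pscale c p \<in> J"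
    and "\<And>p r. p \<in> J \<Longrightarrow> r \<in> lc W \<Longrightarrow> r \<odot> p \<in> J" "\<And>p r. p \<in> J \<Longrightarrow> r \<in> lc W \<Longrightarrow> p \<odot> r \<in> J"
  shows "ideal J F"
proof (rule idealI)
  show "ring F" by (rule F.ring_axioms)
  show "subgroup J (add_monoid F)"
  proof
    fix p assume p: "p \<in> J"
    have "inv\<^bsub>add_monoid F\<^esub> p = pscale (-1) p"
      using p assms(1) F.add.inv_equality[of "pscale (-1) p" p]
      by (auto simp: a_inv_def pscale_minus_left lc_intros)
    with assms(4)[OF p, of "-1"] show "inv\<^bsub>add_monoid F\<^esub> p \<in> J" by simp
  qed (use assms in auto)
qed (use assms in auto)

text \<open>The verification that replaces a confluence argument. The relation between h and a2 uses
  additivity of \<eta> and \<xi> and centrality of g; in the commutator relation the coefficients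
  m/2 and m \<lambda> grow by 1/2 and \<lambda> when a1 is applied.\<close>

lemma act_relation:
  assumes "(l, r) \<in> lift_relations G g \<eta> \<xi> lam" and "v \<in> lc IX"
  shows "act l v = act r v"
proof -
  have s: "supp v \<subseteq> IX" using assms by (simp add: lc_def)
  show ?thesis
  proof (rule plin_eq_on[OF s plin_act(1) plin_act(1)])
    fix i assume "i \<in> IX"
    then obtain m h n where i: "i = (m, h, n)" and h: "h \<in> carrier G" by (auto simp: IX_def)
    from assms(1) show "act l (pure i) = act r (pure i)"
    proof (cases rule: relation_cases)
      case (A2 t)
      with h show ?thesis
        by (simp add: i act_rules op_rules op2_pure E_mult X_mult g_central_left[of t] m_assoc)
          (rule poly_mapping_eqI, simp add: lookup_add lookup_minus algebra_simps)
    next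
      case comm
      \<comment> \<open>The split on \<open>m\<close> resolves the truncated exponent
        \<open>m - 1\<close>.\<close>
      with h show ?thesis
        by (cases m; simp add: i act_rules op_rules op2_pure m_assoc)
          (rule poly_mapping_eqI, simp add: lookup_add lookup_minus field_simps)+
    qed (use h in \<open>auto simp: i m_assoc\<close>)
  qed
qed

text \<open>The annihilator of the whole coordinate space is a two-sided ideal containing the
  relators.\<close>

lemma act_\<I>:
  assumes "p \<in> \<I>" and "v \<in> lc IX"
  shows "act p v = 0"
proof -
  have "ideal {p \<in> lc W. \<forall>v\<in>lc IX. act p v = 0} F"
    by (rule F_idealI) (auto simp: act_rules act_fm lc_intros conv_lc act_lc)
  then have "\<I> \<subseteq> {p \<in> lc W. \<forall>v\<in>lc IX. act p v = 0}"
    by (rule ideal_minimal) (use rels_lc act_relation in \<open>auto simp: act_rules\<close>)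
  with assms show ?thesis by auto
qed

section \<open>Rewriting words to normal form\<close>

definition cg :: "('g gen list \<Rightarrow>\<^sub>0 'k) \<Rightarrow> ('g gen list \<Rightarrow>\<^sub>0 'k) \<Rightarrow> bool" (infix \<open>\<sim>\<close> 50)
  where "p \<sim> r \<longleftrightarrow> p - r \<in> \<I>"

lemma cg_refl [simp]: "p \<sim> p"
  by (simp add: cg_def \<I>_0)

lemma cg_add: "p \<sim> p' \<Longrightarrow> r \<sim> r' \<Longrightarrow> p + r \<sim> p' + r'"
  unfolding cg_def using \<I>_add[of "p - p'" "r - r'"] by (simp add: algebra_simps)

lemma cg_scale: "p \<sim> p' \<Longrightarrow> pscale c p \<sim> pscale c p'"
  unfolding cg_def using \<I>_scale[of "p - p'" c] by (simp add: pscale_diff_right)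

lemma cg_diff: "p \<sim> p' \<Longrightarrow> r \<sim> r' \<Longrightarrow> p - r \<sim> p' - r'"
  using cg_add[of p p' "pscale (-1) r" "pscale (-1) r'"] cg_scale[of r r' "-1"]
  by (simp add: pscale_minus_left)

lemma cg_trans [trans]: "p \<sim> r \<Longrightarrow> r \<sim> s \<Longrightarrow> p \<sim> s"
  unfolding cg_def using \<I>_add[of "p - r" "r - s"] by simp

lemma cg_sym: "p \<sim> r \<Longrightarrow> r \<sim> p"
  unfolding cg_def using \<I>_scale[of "p - r" "-1"] by (simp add: pscale_minus_left)

lemma cg_mult_left: "p \<sim> r \<Longrightarrow> s \<in> lc W \<Longrightarrow> s \<odot> p \<sim> s \<odot> r"
  unfolding cg_def using \<I>_mult_left[of "p - r" s] by (simp add: conv_simps)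

lemma cg_mult_right: "p \<sim> r \<Longrightarrow> s \<in> lc W \<Longrightarrow> p \<odot> s \<sim> r \<odot> s"
  unfolding cg_def using \<I>_mult_right[of "p - r" s] by (simp add: conv_simps)

lemma cg_lin:
  assumes "plin f" "plin f'" "v \<in> lc J" "\<And>j. j \<in> J \<Longrightarrow> f (pure j) \<sim> f' (pure j)"
  shows "f v \<sim> f' v"
proof -
  from assms(3) have "supp v \<subseteq> J" by (simp add: lc_def)
  then show ?thesis
    by (induction v rule: linear_induct)
      (auto simp: plin_rules[OF assms(1)] plin_rules[OF assms(2)] assms(4) intro: cg_add cg_scale)
qed

lemma cg_relation:
  assumes "(l, r) \<in> lift_relations G g \<eta> \<xi> lam" and "w \<in> W"
  shows "l \<odot> pure w \<sim> r \<odot> pure w"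
  by (rule cg_mult_right) (use assms rel_in_\<I> in \<open>auto simp: cg_def\<close>)

lemma
  assumes w: "w \<in> W"
  shows cg_mult: "h \<in> carrier G \<Longrightarrow> t \<in> carrier G \<Longrightarrow> pure (Grp h # Grp t # w) \<sim> pure (Grp (h \<otimes> t) # w)"
    and cg_one: "pure (Grp \<one> # w) \<sim> pure w"
    and cg_Grp_A1: "h \<in> carrier G \<Longrightarrow> pure (Grp h # A1 # w) \<sim> pure (A1 # Grp h # w)"
    and cg_Grp_A2: "h \<in> carrier G \<Longrightarrow> pure (Grp h # A2 # w) \<sim> pure (A2 # Grp h # w)
      + pscale (E h) (pure (A1 # Grp h # w)) + pscale (X h) (pure (Grp h # w) - pure (Grp g # Grp h # w))"
    and cg_comm: "pure (A1 # A2 # w) - pure (A2 # A1 # w) - pscale (1/2) (pure (A1 # A1 # w)) \<sim>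
      pscale lam (pure w - pure (Grp g # Grp g # w))"
proof -
  note R = lift_relations_def Let_def
  show "pure (Grp h # Grp t # w) \<sim> pure (Grp (h \<otimes> t) # w)" if "h \<in> carrier G" "t \<in> carrier G"
    using cg_relation[OF _ w, of "pure [Grp h, Grp t]" "pure [Grp (h \<otimes> t)]"] that by (auto simp: R)
  show "pure (Grp \<one> # w) \<sim> pure w"
    using cg_relation[OF _ w, of "pure [Grp \<one>]" "pure []"] by (auto simp: R)
  show "pure (Grp h # A1 # w) \<sim> pure (A1 # Grp h # w)" if "h \<in> carrier G"
    using cg_relation[OF _ w, of "pure [Grp h, A1]" "pure [A1, Grp h]"] that by (auto simp: R)
  show "pure (Grp h # A2 # w) \<sim> pure (A2 # Grp h # w)
      + pscale (E h) (pure (A1 # Grp h # w)) + pscale (X h) (pure (Grp h # w) - pure (Grp g # Grp h # w))"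
    if "h \<in> carrier G"
    using cg_relation[OF _ w, of "pure [Grp h, A2]" "(pure [A2] + pscale (E h) (pure [A1]) +
      pscale (X h) (pure [] - pure [Grp g])) \<odot> pure [Grp h]"] that
    by (auto simp: R conv_simps)
  show "pure (A1 # A2 # w) - pure (A2 # A1 # w) - pscale (1/2) (pure (A1 # A1 # w)) \<sim>
      pscale lam (pure w - pure (Grp g # Grp g # w))"
    using cg_relation[OF _ w, of "pure [A1, A2] - pure [A2, A1] - pscale (1/2) (pure [A1, A1])"
        "pscale lam (pure [] - pure [Grp g, Grp g])"]
    by (auto simp: R conv_simps)
qed

lemma cg_Cons: "pure u \<sim> p \<Longrightarrow> x \<in> lift_gens G \<Longrightarrow> pure (x # u) \<sim> pure [x] \<odot> p"
  using cg_mult_left[of "pure u" p "pure [x]"] by simp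

lemma replicate_W: "w \<in> W \<Longrightarrow> replicate m A1 @ w \<in> W" "w \<in> W \<Longrightarrow> replicate m A2 @ w \<in> W"
  by (auto simp: in_lists_conv_set)

lemma cg_Grp_A1s: "h \<in> carrier G \<Longrightarrow> w \<in> W \<Longrightarrow>
    pure (Grp h # replicate m A1 @ w) \<sim> pure (replicate m A1 @ Grp h # w)"
proof (induction m)
  case (Suc m)
  have "pure (Grp h # A1 # replicate m A1 @ w) \<sim> pure (A1 # Grp h # replicate m A1 @ w)"
    using Suc.prems by (intro cg_Grp_A1 replicate_W)
  also have "\<dots> \<sim> pure (A1 # replicate m A1 @ Grp h # w)"
    using cg_Cons[of "Grp h # replicate m A1 @ w" "pure (replicate m A1 @ Grp h # w)" A1] Suc by auto
  finally show ?case by simp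
qed simp

text \<open>The commutator with a2 acts as a derivation, so each of the \<open>m\<close> letters
  contributes one correction term; these are collected after moving g past the remaining letters
  a1.\<close>

lemma cg_A2_A1s: "w \<in> W \<Longrightarrow>
    pure (A2 # replicate m A1 @ w) \<sim> pure (replicate m A1 @ A2 # w)
      - pscale (of_nat m / 2) (pure (replicate (Suc m) A1 @ w))
      - pscale (of_nat m * lam) (pure (replicate (m - 1) A1 @ w) - pure (replicate (m - 1) A1 @ Grp g # Grp g # w))"
proof (induction m)
  case (Suc m)
  let ?r = "\<lambda>m w. pure (replicate m A1 @ w) :: _ \<Rightarrow>\<^sub>0 'k"
  have rw: "replicate m A1 @ w \<in> W" using Suc.prems by (rule replicate_W)
  have "pure (A2 # A1 # replicate m A1 @ w) \<sim> pure (A1 # A2 # replicate m A1 @ w)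
      - pscale (1/2) (?r (Suc (Suc m)) w) - pscale lam (?r m w - pure (Grp g # Grp g # replicate m A1 @ w))"
    using cg_diff[OF cg_refl[of "pure (A1 # A2 # replicate m A1 @ w) - pscale (1/2) (?r (Suc (Suc m)) w)"] cg_comm[OF rw]]
    by (simp add: algebra_simps)
  also have "\<dots> \<sim> (?r (Suc m) (A2 # w) - pscale (of_nat m / 2) (?r (Suc (Suc m)) w)
      - pscale (of_nat m * lam) (?r m w - ?r m (Grp g # Grp g # w)))
      - pscale (1/2) (?r (Suc (Suc m)) w) - pscale lam (?r m w - ?r m (Grp g # Grp g # w))"
  proof (intro cg_diff cg_scale cg_refl)
    have "pure (A1 # A2 # replicate m A1 @ w) \<sim> ?r (Suc m) (A2 # w) - pscale (of_nat m / 2) (?r (Suc (Suc m)) w)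
      - pscale (of_nat m * lam) (?r (Suc (m - 1)) w - ?r (Suc (m - 1)) (Grp g # Grp g # w))"
      using cg_Cons[OF Suc.IH[OF Suc.prems], of A1] by (simp add: conv_simps)
    \<comment> \<open>\<open>Suc (m - 1)\<close> equals \<open>m\<close> except for
      \<open>m = 0\<close>, where the coefficient vanishes.\<close>
    then show "pure (A1 # A2 # replicate m A1 @ w) \<sim> ?r (Suc m) (A2 # w) - pscale (of_nat m / 2) (?r (Suc (Suc m)) w)
      - pscale (of_nat m * lam) (?r m w - ?r m (Grp g # Grp g # w))"
      by (cases m) auto
    have "pure (Grp g # Grp g # replicate m A1 @ w) \<sim> pure (Grp g # replicate m A1 @ Grp g # w)"
      using cg_Cons[OF cg_Grp_A1s[of g w m], of "Grp g"] Suc.prems by simp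
    also have "\<dots> \<sim> ?r m (Grp g # Grp g # w)"
      using cg_Grp_A1s[of g "Grp g # w" m] Suc.prems by simp
    finally show "pure (Grp g # Grp g # replicate m A1 @ w) \<sim> ?r m (Grp g # Grp g # w)" .
  qed
  also have "\<dots> = ?r (Suc m) (A2 # w) - pscale (of_nat (Suc m) / 2) (?r (Suc (Suc m)) w)
      - pscale (of_nat (Suc m) * lam) (?r m w - ?r m (Grp g # Grp g # w))"
    by (simp add: pscale_add_left pscale_diff_right add_divide_distrib algebra_simps)
  finally show ?case by simp
qed simp

lemma cg_A1s: "pure u \<sim> p \<Longrightarrow> pure (replicate m A1 @ u) \<sim> pure (replicate m A1) \<odot> p"
  using cg_mult_left[of "pure u" p "pure (replicate m A1)"] by (auto simp: in_lists_conv_set)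

text \<open>The operators were read off from these rewritings: prefixing a standard word by a
  generator is, modulo the ideal, the application of its operator.\<close>

lemma cg_op_sw:
  assumes x: "x \<in> lift_gens G" and i: "i \<in> IX"
  shows "pure (x # sw i) \<sim> \<sigma> (op x (pure i))"
proof -
  obtain m h n where mhn: "i = (m, h, n)" and h: "h \<in> carrier G" using i by (auto simp: IX_def)
  define w where "w = replicate n (A2 :: 'g gen)"
  have w: "w \<in> W" by (auto simp: w_def in_lists_conv_set)
  have sw: "sw (k, t, n) = replicate k A1 @ Grp t # w" for k t by (simp add: sw_def w_def)
  show ?thesis
  proof (cases x)
    case (Grp t)
    with x have t: "t \<in> carrier G" by auto
    have "pure (x # sw i) \<sim> pure (replicate m A1 @ Grp t # Grp h # w)"
      using cg_Grp_A1s[OF t, of "Grp h # w" m] h w by (simp add: Grp mhn sw)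
    also have "\<dots> \<sim> pure (replicate m A1 @ Grp (t \<otimes> h) # w)"
      using cg_A1s[OF cg_mult[OF w t h], of m] by simp
    finally show ?thesis by (simp add: Grp mhn sw)
  next
    case A1
    then show ?thesis by (simp add: mhn sw_def)
  next
    case A2
    let ?r = "\<lambda>m w. pure (replicate m A1 @ w) :: _ \<Rightarrow>\<^sub>0 'k"
    have "pure (x # sw i) \<sim> ?r m (A2 # Grp h # w)
      - pscale (of_nat m / 2) (?r (Suc m) (Grp h # w))
      - pscale (of_nat m * lam) (?r (m - 1) (Grp h # w) - ?r (m - 1) (Grp g # Grp g # Grp h # w))"
      using cg_A2_A1s[of "Grp h # w" m] h w by (simp add: A2 mhn sw)
    also have "\<dots> \<sim> (?r m (Grp h # A2 # w) - pscale (E h) (?r (Suc m) (Grp h # w))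
        - pscale (X h) (?r m (Grp h # w) - ?r m (Grp (g \<otimes> h) # w)))
      - pscale (of_nat m / 2) (?r (Suc m) (Grp h # w))
      - pscale (of_nat m * lam) (?r (m - 1) (Grp h # w) - ?r (m - 1) (Grp (g \<otimes> (g \<otimes> h)) # w))"
    proof (intro cg_diff cg_scale cg_refl)
      have "pure (A2 # Grp h # w) \<sim> pure (Grp h # A2 # w) - pscale (E h) (pure (A1 # Grp h # w))
        - pscale (X h) (pure (Grp h # w) - pure (Grp g # Grp h # w))"
        using cg_diff[OF cg_sym[OF cg_Grp_A2[OF w h]]
            cg_refl[of "pscale (E h) (pure (A1 # Grp h # w)) + pscale (X h) (pure (Grp h # w) - pure (Grp g # Grp h # w))"]]
        by (simp add: algebra_simps)
      also have "\<dots> \<sim> pure (Grp h # A2 # w) - pscale (E h) (pure (A1 # Grp h # w))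
        - pscale (X h) (pure (Grp h # w) - pure (Grp (g \<otimes> h) # w))"
        by (intro cg_diff cg_scale cg_refl cg_mult w h g_closed)
      finally show "?r m (A2 # Grp h # w) \<sim> ?r m (Grp h # A2 # w) - pscale (E h) (?r (Suc m) (Grp h # w))
        - pscale (X h) (?r m (Grp h # w) - ?r m (Grp (g \<otimes> h) # w))"
        using cg_A1s[of "A2 # Grp h # w" _ m] by (fastforce simp: conv_simps replicate_app_Cons_same)
      have "pure (Grp g # Grp g # Grp h # w) \<sim> pure (Grp g # Grp (g \<otimes> h) # w)"
        using cg_Cons[OF cg_mult[OF w g_closed h], of "Grp g"] by simp
      also have "\<dots> \<sim> pure (Grp (g \<otimes> (g \<otimes> h)) # w)"
        using cg_mult[OF w g_closed, of "g \<otimes> h"] h by simp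
      finally show "?r (m - 1) (Grp g # Grp g # Grp h # w) \<sim> ?r (m - 1) (Grp (g \<otimes> (g \<otimes> h)) # w)"
        using cg_A1s[of "Grp g # Grp g # Grp h # w" _ "m - 1"] by fastforce
    qed
    also have "\<dots> = \<sigma> (op x (pure i))"
      by (simp add: A2 mhn op2_pure \<sigma>_rules sw pscale_add_left algebra_simps)
        (simp add: sw_def w_def)
    finally show ?thesis .
  qed
qed

text \<open>Letters are processed from the right end of the word; the part already read is a
  combination of standard words, to which the next letter is applied.\<close>

lemma cg_normal_form: "p \<in> lc W \<Longrightarrow> p \<sim> \<sigma> (q p)"
proof (rule cg_lin[of "\<lambda>p. p" "\<lambda>p. \<sigma> (q p)" p W])
  fix w assume "w \<in> W"
  then show "pure w \<sim> \<sigma> (q (pure w))"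
  proof (induction w)
    case Nil
    \<comment> \<open>A standard word always contains one group letter, so the empty word is
      rewritten to the letter of the neutral element.\<close>
    show ?case using cg_sym[OF cg_one[of "[]"]] by (simp add: sw_def)
  next
    case (Cons x w)
    then have x: "x \<in> lift_gens G" and w: "w \<in> W" by auto
    have "pure (x # w) \<sim> pure [x] \<odot> \<sigma> (q (pure w))"
      by (rule cg_Cons) (use Cons x in auto)
    also have "\<dots> \<sim> \<sigma> (op x (q (pure w)))"
    proof (rule cg_lin[of "\<lambda>v. pure [x] \<odot> \<sigma> v" "\<lambda>v. \<sigma> (op x v)" _ IX])
      show "q (pure w) \<in> lc IX" using w by (intro q_lc) simp
    qed (use x cg_op_sw in \<open>auto intro: plin_comp[OF pbilinD(1)[OF pbilin_conv] plin_\<sigma>] plin_comp[OF plin_\<sigma> plin_op]\<close>)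
    finally show ?case by simp
  qed
qed (auto intro: plin_comp[OF plin_\<sigma> plin_q])

text \<open>Rewriting shows that an element killed by \<open>q\<close> lies in the ideal; the action
  shows the converse. This is linear independence and spanning of the standard words at
  once.\<close>

lemma q_kernel: "p \<in> lc W \<Longrightarrow> q p = 0 \<longleftrightarrow> p \<in> \<I>"
  using cg_normal_form[of p] act_\<I>[of p vac] vac_lc by (auto simp: cg_def \<sigma>_rules q_def)

sublocale U: quot_coords F \<I> q
  by unfold_locales (auto simp: q_rules q_kernel)

text \<open>The product of the quotient in coordinates: lift the left factor to standard words and
  let it act.\<close>

definition \<mu> :: "(nat \<times> 'g \<times> nat \<Rightarrow>\<^sub>0 'k) \<Rightarrow> (nat \<times> 'g \<times> nat \<Rightarrow>\<^sub>0 'k) \<Rightarrow> (nat \<times> 'g \<times> nat \<Rightarrow>\<^sub>0 'k)"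
  where "\<mu> p r = act (\<sigma> p) r"

lemma pbilin_\<mu>: "pbilin \<mu>"
  unfolding \<mu>_def using pbilin_comp[OF pbilin_act plin_id plin_\<sigma> plin_id] by simp

text \<open>An element and its normal form differ by a member of the ideal, which acts as zero.
  Hence the action of the free algebra descends to coordinates.\<close>

lemma act_q:
  assumes "p \<in> lc W" and "v \<in> lc IX"
  shows "act (\<sigma> (q p)) v = act p v"
  using act_\<I>[of "p - \<sigma> (q p)" v] cg_normal_form[of p] assms by (simp add: cg_def act_rules)

lemma q_mult: "p \<in> lc W \<Longrightarrow> r \<in> lc W \<Longrightarrow> q (p \<odot> r) = \<mu> (q p) (q r)"
  by (simp add: q_fm \<mu>_def act_q q_lc)

lemma \<mu>_lc: "p \<in> lc IX \<Longrightarrow> r \<in> lc IX \<Longrightarrow> \<mu> p r \<in> lc IX"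
  unfolding \<mu>_def by (intro act_lc \<sigma>_lc)

lemma fm_W: "p \<in> lc W \<Longrightarrow> r \<in> lc W \<Longrightarrow> p \<odot> r \<in> lc W"
  by (intro conv_lc) auto

lemma q_surj: "v \<in> lc IX \<Longrightarrow> \<exists>p\<in>lc W. q p = v"
  using q_\<sigma> \<sigma>_lc by metis

lemma \<mu>_assoc: "p \<in> lc IX \<Longrightarrow> r \<in> lc IX \<Longrightarrow> s \<in> lc IX \<Longrightarrow> \<mu> (\<mu> p r) s = \<mu> p (\<mu> r s)"
proof -
  assume "p \<in> lc IX" "r \<in> lc IX" "s \<in> lc IX"
  then obtain p' r' s' where "p' \<in> lc W" "r' \<in> lc W" "s' \<in> lc W" "p = q p'" "r = q r'" "s = q s'"
    using q_surj by metis
  then show ?thesis by (simp only: q_mult[symmetric] fm_W fm_assoc)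
qed

lemma \<mu>_unit: "p \<in> lc IX \<Longrightarrow> \<mu> vac p = p" "p \<in> lc IX \<Longrightarrow> \<mu> p vac = p"
proof -
  have vac: "vac = q (pure [])" by simp
  show "\<mu> vac p = p" "\<mu> p vac = p" if "p \<in> lc IX"
    using q_mult[of "pure []"] q_mult[of _ "pure []"] q_surj[OF that] unfolding vac by auto
qed

abbreviation U :: "(('g gen list \<Rightarrow>\<^sub>0 'k) set, 'k) kalg"
  where "U \<equiv> lift_alg G g \<eta> \<xi> lam"

abbreviation cls :: "('g gen list \<Rightarrow>\<^sub>0 'k) \<Rightarrow> ('g gen list \<Rightarrow>\<^sub>0 'k) set"
  where "cls p \<equiv> \<I> +>\<^bsub>F\<^esub> p"

lemma U_carrier: "carrier U = cls ` lc W"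
  and U_zero: "\<zero>\<^bsub>U\<^esub> = cls 0" and U_one: "\<one>\<^bsub>U\<^esub> = cls (pure [])"
  and U_add: "p \<in> lc W \<Longrightarrow> r \<in> lc W \<Longrightarrow> cls p \<oplus>\<^bsub>U\<^esub> cls r = cls (p + r)"
  and U_mult: "p \<in> lc W \<Longrightarrow> r \<in> lc W \<Longrightarrow> cls p \<otimes>\<^bsub>U\<^esub> cls r = cls (p \<odot> r)"
  and U_scale: "p \<in> lc W \<Longrightarrow> c \<cdot>\<^bsub>U\<^esub> cls p = cls (pscale c p)"
  using U.quot_carrier U.quot_zero U.quot_one U.quot_add[of p r] U.quot_mult[of p r] U.quot_kscale[of p c]
  by (auto simp: lift_alg_def)

lemma qco_cls: "p \<in> lc W \<Longrightarrow> U.qco (cls p) = q p"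
  using U.qco[of p] by simp

lemma q_image: "q ` lc W = lc IX"
  using q_surj q_lc by (auto simp: image_iff)

lemma coords_U: "coords U U.qco IX"
proof (rule k_algebra_coords[where \<mu> = \<mu> and e = vac])
  show "bij_betw U.qco (carrier U) (lc IX)"
    using U.qco_bij by (simp add: lift_alg_def q_image)
qed (auto simp: U_carrier U_zero U_one U_add U_mult U_scale qco_cls q_rules q_mult pbilin_\<mu> \<mu>_assoc \<mu>_unit
    fm_W lc_add lc_pscale)

sublocale UC: coords U U.qco IX
  by (rule coords_U)

lemma elt_q: "p \<in> lc W \<Longrightarrow> UC.elt (q p) = cls p"
  using UC.elt_\<kappa>[of "cls p"] by (simp add: U_carrier qco_cls)

subsection \<open>The basis of monomials\<close>

text \<open>Vectors in which a2 occurs with exponent less than \<open>n\<close>; the error terms of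
  commuting a group element past a2 land here.\<close>

definition low :: "nat \<Rightarrow> (nat \<times> 'g \<times> nat \<Rightarrow>\<^sub>0 'k) set"
  where "low n = lc {j \<in> IX. snd (snd j) < n}"

lemma op1_low: "v \<in> low n \<Longrightarrow> op1 v \<in> low n"
  unfolding low_def by (erule lc_plin[OF plin_op1]) (auto simp: IX_def)

lemma op2_low: "v \<in> low n \<Longrightarrow> op2 v \<in> low (Suc n)"
  unfolding low_def by (erule lc_plin[OF plin_op2]) (auto simp: IX_def op2_pure intro!: lc_intros)

lemma opG_low: "t \<in> carrier G \<Longrightarrow> v \<in> low n \<Longrightarrow> opG t v \<in> low n"
  unfolding low_def by (erule lc_plin[OF plin_opG]) (auto simp: IX_def)

lemma op1_power_low: "v \<in> low n \<Longrightarrow> (op1 ^^ k) v \<in> low n"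
  by (induction k) (auto intro: op1_low)

lemma plin_power: "plin f \<Longrightarrow> plin (f ^^ k)"
  for f :: "('i \<Rightarrow>\<^sub>0 'k) \<Rightarrow> ('i \<Rightarrow>\<^sub>0 'k)"
  by (induction k) (auto simp: plin_def)

text \<open>Of the terms of \<open>op2\<close> only one raises the exponent of a2, and it has
  coefficient 1.\<close>

lemma op2_power_leading:
  assumes h: "h \<in> carrier G"
  shows "(op2 ^^ k) (pure (m, h, n)) - pure (m, h, n + k) \<in> low (n + k)"
proof (induction k)
  case (Suc k)
  have "op2 ((op2 ^^ k) (pure (m, h, n)) - pure (m, h, n + k)) \<in> low (n + Suc k)"
    using op2_low[OF Suc] by simp
  moreover have "op2 (pure (m, h, n + k)) - pure (m, h, n + Suc k) \<in> low (n + Suc k)"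
    using h by (auto simp: op2_pure low_def IX_def intro!: lc_intros)
  ultimately have "op2 ((op2 ^^ k) (pure (m, h, n)) - pure (m, h, n + k))
      + (op2 (pure (m, h, n + k)) - pure (m, h, n + Suc k)) \<in> low (n + Suc k)"
    unfolding low_def by (rule lc_add)
  then show ?case by (simp add: op_rules)
qed (simp add: low_def)

text \<open>The coordinates of a1^m a2^n h, with the exponents in the index order of
  \<open>IX\<close>.\<close>

definition mon :: "nat \<times> 'g \<times> nat \<Rightarrow> (nat \<times> 'g \<times> nat \<Rightarrow>\<^sub>0 'k)"
  where "mon = (\<lambda>(m, h, n). (op1 ^^ m) ((op2 ^^ n) (pure (0, h, 0))))"

text \<open>Moving h to the left through a2^n costs only terms with a smaller exponent of a2. This
  links the basis of the statement to the basis used for computing.\<close>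

lemma mon_triangular:
  assumes "i \<in> IX"
  shows "mon i - pure i \<in> lc {j \<in> IX. snd (snd j) < snd (snd i)}"
proof -
  obtain m h n where i: "i = (m, h, n)" and h: "h \<in> carrier G" using assms by (auto simp: IX_def)
  have "(op1 ^^ m) ((op2 ^^ n) (pure (0, h, 0)) - pure (0, h, n)) \<in> low n"
    using op1_power_low[OF op2_power_leading[OF h, of n 0 0]] by simp
  then show ?thesis
    by (simp add: i mon_def low_def plin_rules[OF plin_power[OF plin_op1]])
qed

lemma mon_lc: "i \<in> IX \<Longrightarrow> mon i \<in> lc IX"
  using mon_triangular[of i] lc_add[of "mon i - pure i" IX "pure i"]
    lc_mono[of "{j \<in> IX. snd (snd j) < snd (snd i)}" IX] by auto

lemma cls_pow: "x \<in> lift_gens G \<Longrightarrow> cls (var x) [^]\<^bsub>U\<^esub> (n::nat) = cls (pure (replicate n x))"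
proof (induction n)
  case (Suc n)
  then have "replicate n x \<in> W" by (auto simp: in_lists_conv_set)
  with Suc show ?case by (simp add: U_mult replicate_append_same)
qed (simp add: U_one)

lemma lift_monomial_eq:
  assumes "h \<in> carrier G"
  shows "lift_monomial G g \<eta> \<xi> lam (m, n, h) = cls (pure (replicate m A1 @ replicate n A2 @ [Grp h]))"
proof -
  have "replicate m A1 \<in> W" "replicate n A2 \<in> W" "replicate m A1 @ replicate n A2 \<in> W"
    by (auto simp: in_lists_conv_set)
  with assms show ?thesis
    by (simp add: lift_monomial_def Let_def lift_gen_def cls_pow U_mult)
qed

lemma lift_monomial_closed: "h \<in> carrier G \<Longrightarrow> lift_monomial G g \<eta> \<xi> lam (m, n, h) \<in> carrier U"
  by (auto simp: lift_monomial_eq U_carrier in_lists_conv_set intro!: imageI)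

lemma qco_lift_monomial:
  "h \<in> carrier G \<Longrightarrow> U.qco (lift_monomial G g \<eta> \<xi> lam (m, n, h)) = mon (m, h, n)"
proof -
  assume h: "h \<in> carrier G"
  then have "replicate m A1 @ replicate n A2 @ [Grp h] \<in> W" by (auto simp: in_lists_conv_set)
  with h show ?thesis by (simp add: lift_monomial_eq qco_cls mon_def foldr_replicate)
qed

lemma mon_inj: "inj_on mon IX"
proof (rule inj_onI)
  fix i j assume ij: "i \<in> IX" "j \<in> IX" "mon i = mon j"
  have "lin_ext mon (pure i - pure j) = 0" using ij by (simp add: lin_ext_simps)
  then have "pure i - pure j = (0 :: _ \<Rightarrow>\<^sub>0 'k)"
    using ij unitriangular_inj[of IX mon "\<lambda>i. snd (snd i)" "pure i - pure j", OF mon_triangular]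
    by (simp add: lc_minus)
  then show "i = j" using inj_pure[where 'k = 'k] by (auto dest: injD)
qed

abbreviation monomials :: "('g gen list \<Rightarrow>\<^sub>0 'k) set set"
  where "monomials \<equiv> lift_monomial G g \<eta> \<xi> lam ` (UNIV \<times> UNIV \<times> carrier G)"

lemma lift_monomial_inj: "inj_on (lift_monomial G g \<eta> \<xi> lam) (UNIV \<times> UNIV \<times> carrier G)"
proof (rule inj_onI)
  fix i i' :: "nat \<times> nat \<times> 'g"
  assume i: "i \<in> UNIV \<times> UNIV \<times> carrier G" "i' \<in> UNIV \<times> UNIV \<times> carrier G"
    and eq: "lift_monomial G g \<eta> \<xi> lam i = lift_monomial G g \<eta> \<xi> lam i'"
  obtain m n h m' n' h' where mnh: "i = (m, n, h)" "i' = (m', n', h')" by (metis prod_cases3)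
  with i have h: "h \<in> carrier G" "h' \<in> carrier G" by auto
  have "mon (m, h, n) = mon (m', h', n')"
    using eq qco_lift_monomial[of h m n] qco_lift_monomial[of h' m' n'] h by (simp add: mnh)
  with h inj_onD[OF mon_inj, of "(m, h, n)" "(m', h', n')"] show "i = i'"
    by (simp add: IX_def mnh)
qed

text \<open>The monomials have unitriangular coordinates with respect to the exponent of a2, hence
  are independent and span.\<close>

lemma lift_monomial_basis: "k_basis U (carrier U) monomials"
proof -
  have sub: "monomials \<subseteq> carrier U" using lift_monomial_closed by auto
  have "UNIV \<times> UNIV \<times> carrier G = (\<lambda>(m, h, n). (m, n, h)) ` IX"
    by (force simp: IX_def)
  then have im: "U.qco ` monomials = mon ` IX"
    by (simp only: image_image) (rule image_cong, auto simp: IX_def qco_lift_monomial)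
  have "PV.independent (mon ` IX)"
    unfolding PV.independent_explicit_finite_subsets
  proof safe
    fix T u x assume T: "T \<subseteq> mon ` IX" "finite T" "(\<Sum>v\<in>T. pscale (u v) v) = 0" and v: "x \<in> T"
    from T obtain T' where T': "T' \<subseteq> IX" "T = mon ` T'" by (meson subset_imageE)
    with T mon_inj have fin: "finite T'" and inj': "inj_on mon T'"
      by (auto dest: finite_imageD inj_on_subset)
    define p where "p = (\<Sum>x\<in>T'. pscale (u (mon x)) (pure x))"
    have p: "coef p x = (if x \<in> T' then u (mon x) else 0)" for x
      using fin by (simp add: p_def lookup_sum lookup_single when_def if_distrib cong: if_cong)
    have "p \<in> lc IX" using T' by (auto simp: lc_def in_keys_iff p split: if_splits)
    moreover have "lin_ext mon p = 0"
      using T(3) unfolding T'(2) by (simp add: sum.reindex[OF inj'] p_def lin_ext_simps)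
    ultimately have "p = 0"
      using unitriangular_inj[of IX mon "\<lambda>i. snd (snd i)" p, OF mon_triangular] by blast
    with v T' show "u x = 0" by (metis (mono_tags) imageE lookup_zero p)
  qed
  moreover have "PV.span (mon ` IX) = lc IX"
  proof
    show "PV.span (mon ` IX) \<subseteq> lc IX"
      by (rule PV.span_minimal) (auto simp: PV.subspace_def lc_intros mon_lc)
    have "lin_ext mon p \<in> PV.span (mon ` IX)" if "p \<in> lc IX" for p
      unfolding lin_ext_def
      by (rule PV.span_sum, rule PV.span_scale, rule PV.span_base) (use that in \<open>auto simp: lc_def\<close>)
    then have "lin_ext mon ` lc IX \<subseteq> PV.span (mon ` IX)" by (rule image_subsetI)
    then show "lc IX \<subseteq> PV.span (mon ` IX)"
      by (simp only: unitriangular_surj[of IX mon "\<lambda>i. snd (snd i)", OF mon_triangular])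
  qed
  ultimately have "k_indep U monomials" and "k_span U monomials = carrier U"
    using UC.k_indep_iff[OF sub] UC.k_span_eqI[OF subset_refl sub] UC.\<kappa>_bij
    by (simp_all only: im bij_betw_def simp_thms)
  then show ?thesis by (simp add: k_basis_def)
qed

end

section \<open>The Hopf algebra structure\<close>

text \<open>On the free algebra the comultiplication and the counit are given by formulas that satisfy
  the coalgebra axioms on the nose; it remains to see that they, and the antipode, respect
  the defining relations.\<close>

abbreviation fm2 :: "('x list \<times> 'x list \<Rightarrow>\<^sub>0 'k::field) \<Rightarrow> ('x list \<times> 'x list \<Rightarrow>\<^sub>0 'k) \<Rightarrow> ('x list \<times> 'x list \<Rightarrow>\<^sub>0 'k)"
  where "fm2 \<equiv> conv (\<lambda>(a, b) (c, d). (a @ c, b @ d))"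

abbreviation fm3 :: "('x list \<times> 'x list \<times> 'x list \<Rightarrow>\<^sub>0 'k::field) \<Rightarrow> _ \<Rightarrow> _"
  where "fm3 \<equiv> conv (\<lambda>(a, b, c) (a', b', c'). (a @ a', b @ b', c @ c'))"

lemma fm2_assoc: "fm2 (fm2 p q) r = fm2 p (fm2 q r)"
  by (rule conv_assoc[where M = UNIV]) (auto simp: lc_def)

lemma fm2_unit [simp]: "fm2 (pure ([], [])) p = p"
  by (rule plin_eq_on[OF subset_UNIV, of "fm2 _" "\<lambda>p. p"]) (auto intro: pbilinD pbilin_conv)

lemma multiplicative_ext:
  assumes "plin f" "pbilin m" "pbilin m'"
    and "\<And>x y. f (m (pure x) (pure y)) = m' (f (pure x)) (f (pure y))"
  shows "f (m p q) = m' (f p) (f q)"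
  by (rule pbilin_eq_on[OF subset_UNIV subset_UNIV, of "\<lambda>p q. f (m p q)" "\<lambda>p q. m' (f p) (f q)"])
    (use assms pbilin_comp[OF assms(2) assms(1) plin_id plin_id] pbilin_comp[OF assms(3) plin_id assms(1) assms(1)]
      in auto)

fun gen_counit :: "'g gen \<Rightarrow> 'k::field"
  where "gen_counit (Grp h) = 1" | "gen_counit A1 = 0" | "gen_counit A2 = 0"

definition word_counit :: "'g gen list \<Rightarrow> 'k::field"
  where "word_counit w = prod_list (map gen_counit w)"

context lift_data
begin

fun gen_comult :: "'g gen \<Rightarrow> ('g gen list \<times> 'g gen list \<Rightarrow>\<^sub>0 'k)"
  where "gen_comult (Grp h) = pure ([Grp h], [Grp h])"
  | "gen_comult A1 = pure ([A1], []) + pure ([Grp g], [A1])"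
  | "gen_comult A2 = pure ([A2], []) + pure ([Grp g], [A2])"

primrec wd :: "'g gen list \<Rightarrow> ('g gen list \<times> 'g gen list \<Rightarrow>\<^sub>0 'k)"
  where "wd [] = pure ([], [])" | "wd (x # w) = fm2 (gen_comult x) (wd w)"

definition D :: "('g gen list \<Rightarrow>\<^sub>0 'k) \<Rightarrow> ('g gen list \<times> 'g gen list \<Rightarrow>\<^sub>0 'k)"
  where "D = lin_ext wd"

lemma plin_D: "plin D" and D_pure [simp]: "D (pure w) = wd w"
  by (simp_all add: D_def)

lemmas D_rules = plin_rules[OF plin_D]

lemma wd_append: "wd (u @ v) = fm2 (wd u) (wd v)"
  by (induction u) (auto simp: fm2_assoc)

lemma D_fm: "D (p \<odot> r) = fm2 (D p) (D r)"
  by (rule multiplicative_ext) (auto simp: plin_D pbilin_conv wd_append)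

lemma gen_comult_lc: "x \<in> lift_gens G \<Longrightarrow> gen_comult x \<in> lc (W \<times> W)"
  by (cases x) (auto intro!: lc_intros)

lemma fm2_W: "s \<in> lc (W \<times> W) \<Longrightarrow> t \<in> lc (W \<times> W) \<Longrightarrow> fm2 s t \<in> lc (W \<times> W)"
  by (rule conv_lc) auto

lemma wd_lc: "w \<in> W \<Longrightarrow> wd w \<in> lc (W \<times> W)"
  by (induction w) (auto intro!: fm2_W gen_comult_lc)

lemma D_lc: "p \<in> lc W \<Longrightarrow> D p \<in> lc (W \<times> W)"
  by (erule lc_plin[OF plin_D]) (simp only: D_pure wd_lc)

definition D_left :: "('g gen list \<times> 'g gen list \<Rightarrow>\<^sub>0 'k) \<Rightarrow> ('g gen list \<times> 'g gen list \<times> 'g gen list \<Rightarrow>\<^sub>0 'k)"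
  where "D_left = lin_ext (\<lambda>(a, b). lin_ext (\<lambda>(a', a''). pure (a', a'', b)) (wd a))"

definition D_right :: "('g gen list \<times> 'g gen list \<Rightarrow>\<^sub>0 'k) \<Rightarrow> ('g gen list \<times> 'g gen list \<times> 'g gen list \<Rightarrow>\<^sub>0 'k)"
  where "D_right = lin_ext (\<lambda>(a, b). lin_ext (\<lambda>(b', b''). pure (a, b', b'')) (wd b))"

text \<open>The coproduct applied to the left factor is an algebra map from the tensor square to the
  tensor cube; together with its counterpart on the right this reduces coassociativity to
  generators.\<close>

lemma D_left_mult: "D_left (fm2 s t) = fm3 (D_left s) (D_left t)"
proof (rule multiplicative_ext[of D_left fm2 fm3])
  have *: "lin_ext (\<lambda>(a', a''). pure (a', a'', b @ d)) (fm2 s t) =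
      fm3 (lin_ext (\<lambda>(a', a''). pure (a', a'', b)) s) (lin_ext (\<lambda>(a', a''). pure (a', a'', d)) t)"
    for b d :: "'g gen list" and s t :: "'g gen list \<times> 'g gen list \<Rightarrow>\<^sub>0 'k"
    by (rule pbilin_eq_on[OF subset_UNIV subset_UNIV, of "\<lambda>s t. lin_ext _ (fm2 s t)" "\<lambda>s t. fm3 (lin_ext _ s) (lin_ext _ t)"])
      (auto simp: pbilin_comp[OF pbilin_conv plin_lin_ext plin_id plin_id]
        pbilin_comp[OF pbilin_conv plin_id plin_lin_ext plin_lin_ext])
  fix x y :: "'g gen list \<times> 'g gen list"
  show "D_left (fm2 (pure x) (pure y)) = fm3 (D_left (pure x)) (D_left (pure y))"
    by (cases x; cases y) (simp add: D_left_def wd_append *)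
qed (auto simp: D_left_def pbilin_conv)

lemma D_right_mult: "D_right (fm2 s t) = fm3 (D_right s) (D_right t)"
proof (rule multiplicative_ext[of D_right fm2 fm3])
  have *: "lin_ext (\<lambda>(b', b''). pure (a @ c, b', b'')) (fm2 s t) =
      fm3 (lin_ext (\<lambda>(b', b''). pure (a, b', b'')) s) (lin_ext (\<lambda>(b', b''). pure (c, b', b'')) t)"
    for a c :: "'g gen list" and s t :: "'g gen list \<times> 'g gen list \<Rightarrow>\<^sub>0 'k"
    by (rule pbilin_eq_on[OF subset_UNIV subset_UNIV, of "\<lambda>s t. lin_ext _ (fm2 s t)" "\<lambda>s t. fm3 (lin_ext _ s) (lin_ext _ t)"])
      (auto simp: pbilin_comp[OF pbilin_conv plin_lin_ext plin_id plin_id]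
        pbilin_comp[OF pbilin_conv plin_id plin_lin_ext plin_lin_ext])
  fix x y :: "'g gen list \<times> 'g gen list"
  show "D_right (fm2 (pure x) (pure y)) = fm3 (D_right (pure x)) (D_right (pure y))"
    by (cases x; cases y) (simp add: D_right_def wd_append *)
qed (auto simp: D_right_def pbilin_conv)

text \<open>Both iterated coproducts are multiplicative, and on generators they agree by
  inspection.\<close>

lemma D_coassoc_word: "D_left (wd w) = D_right (wd w)"
proof (induction w)
  case (Cons x w)
  have "D_left (gen_comult x) = D_right (gen_comult x)"
    by (cases x) (auto simp: D_left_def D_right_def lin_ext_simps conv_simps)
  with Cons show ?case by (simp add: D_left_mult D_right_mult)
qed (simp add: D_left_def D_right_def)

lemma D_coassoc: "D_left (D p) = D_right (D p)"
  using plin_eq_on[OF subset_UNIV, of "\<lambda>p. D_left (D p)" "\<lambda>p. D_right (D p)" p]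
    plin_comp[OF plin_lin_ext plin_D] D_coassoc_word by (auto simp: D_left_def D_right_def)

lemma word_counit_simps [simp]: "word_counit [] = 1" "word_counit (x # w) = gen_counit x * word_counit w"
  "word_counit (u @ v) = word_counit u * word_counit v"
  by (simp_all add: word_counit_def)

lemma D_counit_left: "lin_ext (\<lambda>(a, b). pscale (word_counit a) (pure b)) (D p) = p"
proof -
  have "lin_ext (\<lambda>(a, b). pscale (word_counit a) (pure b)) (wd w) = pure w" for w
  proof (induction w)
    case (Cons x w)
    have "lin_ext (\<lambda>(a, b). pscale (word_counit a) (pure b)) (fm2 s t) =
      lin_ext (\<lambda>(a, b). pscale (word_counit a) (pure b)) s \<odot> lin_ext (\<lambda>(a, b). pscale (word_counit a) (pure b)) t"
      for s t :: "'g gen list \<times> 'g gen list \<Rightarrow>\<^sub>0 'k"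
      by (rule multiplicative_ext) (auto simp: pbilin_conv conv_simps)
    moreover have "lin_ext (\<lambda>(a, b). pscale (word_counit a) (pure b)) (gen_comult x) = pure [x]"
      by (cases x) (auto simp: lin_ext_simps)
    ultimately show ?case using Cons by simp
  qed simp
  then show ?thesis
    using plin_eq_on[OF subset_UNIV, of "\<lambda>p. lin_ext (\<lambda>(a, b). pscale (word_counit a) (pure b)) (D p)" "\<lambda>p. p" p]
      plin_comp[OF plin_lin_ext plin_D] by auto
qed

lemma D_counit_right: "lin_ext (\<lambda>(a, b). pscale (word_counit b) (pure a)) (D p) = p"
proof -
  have "lin_ext (\<lambda>(a, b). pscale (word_counit b) (pure a)) (wd w) = pure w" for w
  proof (induction w)
    case (Cons x w)
    have "lin_ext (\<lambda>(a, b). pscale (word_counit b) (pure a)) (fm2 s t) =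
      lin_ext (\<lambda>(a, b). pscale (word_counit b) (pure a)) s \<odot> lin_ext (\<lambda>(a, b). pscale (word_counit b) (pure a)) t"
      for s t :: "'g gen list \<times> 'g gen list \<Rightarrow>\<^sub>0 'k"
      by (rule multiplicative_ext) (auto simp: pbilin_conv conv_simps)
    moreover have "lin_ext (\<lambda>(a, b). pscale (word_counit b) (pure a)) (gen_comult x) = pure [x]"
      by (cases x) (auto simp: lin_ext_simps)
    ultimately show ?case using Cons by simp
  qed simp
  then show ?thesis
    using plin_eq_on[OF subset_UNIV, of "\<lambda>p. lin_ext (\<lambda>(a, b). pscale (word_counit b) (pure a)) (D p)" "\<lambda>p. p" p]
      plin_comp[OF plin_lin_ext plin_D] by auto
qed

text \<open>Applying the antipode axiom to \<Delta>(a) = a \<otimes> 1 + g \<otimes> a forces S(a) +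
  S(g) a = 0, whence the value -g^(-1) a.\<close>

fun gen_anti :: "'g gen \<Rightarrow> ('g gen list \<Rightarrow>\<^sub>0 'k)"
  where "gen_anti (Grp h) = pure [Grp (inv h)]"
  | "gen_anti A1 = - pure [Grp (inv g), A1]"
  | "gen_anti A2 = - pure [Grp (inv g), A2]"

primrec ws :: "'g gen list \<Rightarrow> ('g gen list \<Rightarrow>\<^sub>0 'k)"
  where "ws [] = pure []" | "ws (x # w) = ws w \<odot> gen_anti x"

definition Sf :: "('g gen list \<Rightarrow>\<^sub>0 'k) \<Rightarrow> ('g gen list \<Rightarrow>\<^sub>0 'k)"
  where "Sf = lin_ext ws"

lemma plin_Sf: "plin Sf" and Sf_pure [simp]: "Sf (pure w) = ws w"
  by (simp_all add: Sf_def)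

lemmas Sf_rules = plin_rules[OF plin_Sf]

lemma ws_append: "ws (u @ v) = ws v \<odot> ws u"
  by (induction u) (auto simp: fm_assoc)

lemma Sf_fm: "Sf (p \<odot> r) = Sf r \<odot> Sf p"
proof (rule pbilin_eq_on[OF subset_UNIV subset_UNIV, of "\<lambda>p r. Sf (p \<odot> r)" "\<lambda>p r. Sf r \<odot> Sf p"])
  show "pbilin (\<lambda>p r. Sf (p \<odot> r))"
    by (rule pbilin_comp[OF pbilin_conv plin_Sf plin_id plin_id])
  show "pbilin (\<lambda>p r. Sf r \<odot> Sf p)"
    using pbilin_comp[OF pbilin_conv plin_id plin_Sf plin_Sf] by (auto simp: pbilin_def)
qed (simp add: ws_append)

lemma gen_anti_lc: "x \<in> lift_gens G \<Longrightarrow> gen_anti x \<in> lc W"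
  by (cases x) (auto intro!: lc_intros)

lemma ws_lc: "w \<in> W \<Longrightarrow> ws w \<in> lc W"
  by (induction w) (auto intro!: fm_W gen_anti_lc)

lemma Sf_lc: "p \<in> lc W \<Longrightarrow> Sf p \<in> lc W"
  by (erule lc_plin[OF plin_Sf]) (simp only: Sf_pure ws_lc)

section \<open>Descent of the coalgebra structure to the quotient\<close>

abbreviation qq :: "('g gen list \<times> 'g gen list \<Rightarrow>\<^sub>0 'k) \<Rightarrow> ((nat \<times> 'g \<times> nat) \<times> (nat \<times> 'g \<times> nat) \<Rightarrow>\<^sub>0 'k)"
  where "qq \<equiv> tcoord (\<lambda>w. q (pure w))"

lemma plin_tcoord: "plin (tcoord \<kappa>)"
  by (simp add: tcoord_def)

text \<open>The factorwise product of the tensor square of the quotient, in coordinates.\<close>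

definition \<mu>2 :: "((nat \<times> 'g \<times> nat) \<times> (nat \<times> 'g \<times> nat) \<Rightarrow>\<^sub>0 'k) \<Rightarrow> _ \<Rightarrow> _"
  where "\<mu>2 s t = lin_ext (\<lambda>(a, b). lin_ext (\<lambda>(c, d). tens (\<mu> (pure a) (pure c)) (\<mu> (pure b) (pure d))) t) s"

lemma pbilin_\<mu>2: "pbilin \<mu>2"
proof -
  have "\<mu>2 = (\<lambda>s t. lin_ext (\<lambda>x. lin_ext (\<lambda>y. tens (\<mu> (pure (fst x)) (pure (fst y))) (\<mu> (pure (snd x)) (pure (snd y)))) t) s)"
    by (simp add: \<mu>2_def fun_eq_iff case_prod_unfold)
  then show ?thesis using pbilin_ext by simp
qed

lemma \<mu>2_tens: "\<mu>2 (tens p r) (tens p' r') = tens (\<mu> p p') (\<mu> r r')"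
proof -
  have 1: "lin_ext (\<lambda>(c, d). tens (\<mu> a (pure c)) (\<mu> b (pure d))) (tens p' r') = tens (\<mu> a p') (\<mu> b r')" for a b
    by (rule bilin_tens[of "\<lambda>p r. tens (\<mu> a p) (\<mu> b r)"])
      (rule pbilin_comp[OF pbilin_tens plin_id pbilinD(1)[OF pbilin_\<mu>] pbilinD(1)[OF pbilin_\<mu>]])
  show ?thesis
    unfolding \<mu>2_def 1
    by (rule bilin_tens[of "\<lambda>p r. tens (\<mu> p p') (\<mu> r r')"])
      (rule pbilin_comp[OF pbilin_tens plin_id pbilinD(2)[OF pbilin_\<mu>] pbilinD(2)[OF pbilin_\<mu>]])
qed

lemma qq_fm2:
  assumes "s \<in> lc (W \<times> W)" and "t \<in> lc (W \<times> W)"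
  shows "qq (fm2 s t) = \<mu>2 (qq s) (qq t)"
proof (rule pbilin_eq_on[where A = "W \<times> W" and B = "W \<times> W" and f = "\<lambda>s t. qq (fm2 s t)" and h = "\<lambda>s t. \<mu>2 (qq s) (qq t)"])
  show "pbilin (\<lambda>s t. qq (fm2 s t))"
    by (rule pbilin_comp[OF pbilin_conv plin_tcoord plin_id plin_id])
  show "pbilin (\<lambda>s t. \<mu>2 (qq s) (qq t))"
    by (rule pbilin_comp[OF pbilin_\<mu>2 plin_id plin_tcoord plin_tcoord])
  fix x y :: "'g gen list \<times> 'g gen list"
  assume "x \<in> W \<times> W" "y \<in> W \<times> W"
  then show "qq (fm2 (pure x) (pure y)) = \<mu>2 (qq (pure x)) (qq (pure y))"
    by (cases x; cases y) (simp add: \<mu>2_tens q_mult[symmetric] del: q_pure)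
qed (use assms in \<open>auto simp: lc_def\<close>)

definition \<Delta> :: "(nat \<times> 'g \<times> nat \<Rightarrow>\<^sub>0 'k) \<Rightarrow> ((nat \<times> 'g \<times> nat) \<times> (nat \<times> 'g \<times> nat) \<Rightarrow>\<^sub>0 'k)"
  where "\<Delta> v = qq (D (\<sigma> v))"

definition ep :: "nat \<times> 'g \<times> nat \<Rightarrow> 'k"
  where "ep i = word_counit (sw i)"

definition S :: "(nat \<times> 'g \<times> nat \<Rightarrow>\<^sub>0 'k) \<Rightarrow> (nat \<times> 'g \<times> nat \<Rightarrow>\<^sub>0 'k)"
  where "S v = q (Sf (\<sigma> v))"

lemma plin_\<Delta>: "plin \<Delta>"
  unfolding \<Delta>_def by (rule plin_comp[OF plin_tcoord plin_comp[OF plin_D plin_\<sigma>]])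

lemma plin_S: "plin S"
  unfolding S_def by (rule plin_comp[OF plin_q plin_comp[OF plin_Sf plin_\<sigma>]])

lemma lin_form_ep: "lin_form ep v = lin_form word_counit (\<sigma> v)"
  by (simp add: \<sigma>_def lin_form_lin_ext ep_def[abs_def])

lemma E_inv: "h \<in> carrier G \<Longrightarrow> E (inv h) = - E h"
  using E_mult[of h "inv h"] by (simp add: eq_neg_iff_add_eq_0 add.commute)

lemma X_inv: "h \<in> carrier G \<Longrightarrow> X (inv h) = - X h"
  using X_mult[of h "inv h"] by (simp add: X_one eq_neg_iff_add_eq_0 add.commute)

lemma inv_g_central: "h \<in> carrier G \<Longrightarrow> h \<otimes> inv g = inv g \<otimes> h"
  by (metis g_central g_closed inv_closed inv_solve_left' inv_solve_right m_assoc m_closed)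

lemma word_counit_fm: "lin_form word_counit (p \<odot> r) = (lin_form word_counit p * lin_form word_counit r :: 'k)"
proof -
  have "lin_form word_counit (pure w \<odot> r) = (word_counit w * lin_form word_counit r :: 'k)" for w
    by (induction r rule: linear_induct[OF subset_UNIV])
      (auto simp: conv_simps lin_form_simps algebra_simps)
  then show ?thesis
    by (induction p rule: linear_induct[OF subset_UNIV])
      (auto simp: conv_simps lin_form_simps algebra_simps)
qed

text \<open>The kernel of the multiplicative counit of the free algebra is an ideal, and it contains
  the relators.\<close>

lemma counit_\<I>: "p \<in> \<I> \<Longrightarrow> lin_form word_counit p = 0"
proof -
  have "ideal {p \<in> lc W. lin_form word_counit p = 0} F"
    by (rule F_idealI) (auto simp: lin_form_simps word_counit_fm lc_intros fm_W)
  then have "\<I> \<subseteq> {p \<in> lc W. lin_form word_counit p = 0}"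
  proof (rule ideal_minimal, safe)
    fix l r assume "(l, r) \<in> lift_relations G g \<eta> \<xi> lam"
    then show "lin_form word_counit (l - r) = 0"
      by (cases rule: relation_cases) (auto simp: lin_form_simps)
  qed (use rels_lc in auto)
  then show "p \<in> \<I> \<Longrightarrow> lin_form word_counit p = 0" by auto
qed

end

locale lift_hopf_data = lift_data G g \<eta> \<xi> lam
  for G :: "('g, 'm) monoid_scheme" (structure)
    and g :: 'g and \<eta> \<xi> :: "('g \<Rightarrow>\<^sub>0 'k::field_char_0) \<Rightarrow> 'k" and lam :: 'k +
  assumes Xg: "\<xi> (pure g) = 0"
begin

text \<open>In the commutator relation the mixed terms collect to (g a2 - a2 g - a1 g) \<otimes> a1.
  They cancel because \<eta>(g) = 1 and \<xi>(g) = 0 give g a2 = (a2 + a1) g.\<close>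

lemma qq_D_relation:
  assumes "(l, r) \<in> lift_relations G g \<eta> \<xi> lam"
  shows "qq (D l) = qq (D r)"
  using assms
proof (cases rule: relation_cases)
  case (mult h t)
  then show ?thesis by (simp add: conv_simps)
next
  case one
  then show ?thesis by (simp add: conv_simps)
next
  case (A1 h)
  then show ?thesis by (simp add: conv_simps g_central)
next
  case (A2 h)
  then show ?thesis
    by (simp add: conv_simps D_rules op2_pure X_one Xg op_rules g_central[of h] tens_simps)
      (rule poly_mapping_eqI, simp add: lookup_add lookup_minus algebra_simps)
next
  case comm
  then show ?thesis
    by (simp add: conv_simps D_rules op2_pure X_one Xg op_rules tens_simps)
      (rule poly_mapping_eqI, simp add: lookup_add lookup_minus field_simps)
qed

lemma q_Sf_relation:
  assumes "(l, r) \<in> lift_relations G g \<eta> \<xi> lam"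
  shows "q (Sf l) = q (Sf r)"
  using assms
proof (cases rule: relation_cases)
  case (mult h t)
  then show ?thesis by (simp add: conv_simps inv_mult_group)
next
  case (A1 h)
  then show ?thesis by (simp add: conv_simps Sf_rules q_rules op_rules inv_g_central[of "inv h"])
next
  case (A2 h)
  then show ?thesis
    by (simp add: conv_simps Sf_rules q_rules op2_pure X_one Xg op_rules E_inv X_inv inv_g_central[of "inv h"] flip: m_assoc)
      (rule poly_mapping_eqI, simp add: lookup_add lookup_minus algebra_simps)
next
  case comm
  then show ?thesis
    by (simp add: conv_simps Sf_rules q_rules op2_pure X_one Xg op_rules E_inv X_inv flip: m_assoc)
      (rule poly_mapping_eqI, simp add: lookup_add lookup_minus field_simps)
qed simp

text \<open>The coproduct of the free algebra followed by the projection is multiplicative, so its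
  kernel is an ideal; it contains the relators.\<close>

lemma qq_D_\<I>: "p \<in> \<I> \<Longrightarrow> qq (D p) = 0"
proof -
  have "ideal {p \<in> lc W. qq (D p) = 0} F"
    by (rule F_idealI)
      (auto simp: D_rules D_fm qq_fm2 D_lc lc_intros fm_W plin_rules[OF pbilinD(1)[OF pbilin_\<mu>2]]
        plin_rules[OF pbilinD(2)[OF pbilin_\<mu>2]] simp del: q_pure)
  then have "\<I> \<subseteq> {p \<in> lc W. qq (D p) = 0}"
    by (rule ideal_minimal) (use rels_lc qq_D_relation in \<open>auto simp: D_rules simp del: q_pure\<close>)
  then show "p \<in> \<I> \<Longrightarrow> qq (D p) = 0" by auto
qed

lemma q_Sf_\<I>: "p \<in> \<I> \<Longrightarrow> q (Sf p) = 0"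
proof -
  have "ideal {p \<in> lc W. q (Sf p) = 0} F"
    by (rule F_idealI)
      (auto simp: Sf_rules q_rules Sf_fm q_mult Sf_lc lc_intros fm_W plin_rules[OF pbilinD(1)[OF pbilin_\<mu>]]
        plin_rules[OF pbilinD(2)[OF pbilin_\<mu>]])
  then have "\<I> \<subseteq> {p \<in> lc W. q (Sf p) = 0}"
    by (rule ideal_minimal) (use rels_lc q_Sf_relation in \<open>auto simp: Sf_rules q_rules\<close>)
  then show "p \<in> \<I> \<Longrightarrow> q (Sf p) = 0" by auto
qed

text \<open>The coproduct may be computed from any lift and not only from the standard one.\<close>

lemma \<Delta>_q: "p \<in> lc W \<Longrightarrow> \<Delta> (q p) = qq (D p)"
  using qq_D_\<I>[of "p - \<sigma> (q p)"] cg_normal_form[of p] by (simp add: \<Delta>_def cg_def D_rules)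

lemma S_q: "p \<in> lc W \<Longrightarrow> S (q p) = q (Sf p)"
  using q_Sf_\<I>[of "p - \<sigma> (q p)"] cg_normal_form[of p] by (simp add: S_def cg_def Sf_rules q_rules)

lemma ep_q: "p \<in> lc W \<Longrightarrow> lin_form ep (q p) = lin_form word_counit p"
  using counit_\<I>[of "p - \<sigma> (q p)"] cg_normal_form[of p] by (simp add: lin_form_ep cg_def lin_form_simps)

lemma supp_D: "p \<in> lc W \<Longrightarrow> (u, v) \<in> supp (D p) \<Longrightarrow> u \<in> W \<and> v \<in> W"
  using D_lc[of p] by (auto simp: lc_def)

lemma q_pure_lc: "w \<in> W \<Longrightarrow> q (pure w) \<in> lc IX"
  by (rule q_lc) simp

lemma \<Delta>_q_pure: "w \<in> W \<Longrightarrow> \<Delta> (q (pure w)) = qq (wd w)"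
  by (subst \<Delta>_q) auto

text \<open>Coassociativity is exact on the free algebra. Applying \<open>q\<close> to the three
  factors of that identity turns the inner coproducts of words into \<open>\<Delta>\<close> of their
  classes.\<close>

lemma coassoc_model:
  assumes P: "P \<in> lc W"
  shows "lin_ext (\<lambda>(i, j). lin_ext (\<lambda>(a, b). pure (a, b, j)) (\<Delta> (pure i))) (\<Delta> (q P)) =
      lin_ext (\<lambda>(i, j). lin_ext (\<lambda>(a, b). pure (i, a, b)) (\<Delta> (pure j))) (\<Delta> (q P))"
proof -
  let ?q = "\<lambda>w. q (pure w)"
  have "lin_ext (\<lambda>(i, j). lin_ext (\<lambda>(a, b). tens (pure a) (tens (pure b) (pure j))) (\<Delta> (pure i))) (qq (D P)) =
      lin_ext (\<lambda>(u, v). lin_ext (\<lambda>(a, b). tens (pure a) (tens (pure b) (?q v))) (\<Delta> (?q u))) (D P)"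
    by (rule lin_ext_tcoord[where \<Phi> = "\<lambda>p r. lin_ext (\<lambda>(a, b). tens (pure a) (tens (pure b) r)) (\<Delta> p)", symmetric])
      (auto simp: pbilin_def intro!: plin_lin_ext_fun plin_comp[OF plin_tens_right] plin_tens_right
        plin_comp[OF plin_lin_ext plin_\<Delta>])
  also have "\<dots> = lin_ext (\<lambda>(u, v). lin_ext (\<lambda>(a, b). tens (?q a) (tens (?q b) (?q v))) (wd u)) (D P)"
  proof (rule lin_ext_cong, clarify)
    fix u v assume "(u, v) \<in> supp (D P)"
    then have "\<Delta> (?q u) = qq (wd u)" using supp_D[OF P] \<Delta>_q_pure by blast
    moreover have "lin_ext (\<lambda>(a, b). tens (?q a) (tens (?q b) (?q v))) (wd u) =
        lin_ext (\<lambda>(a, b). tens (pure a) (tens (pure b) (?q v))) (qq (wd u))"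
      by (rule lin_ext_tcoord[where \<Phi> = "\<lambda>p r. tens p (tens r (?q v))"])
        (auto simp: pbilin_def intro!: plin_comp[OF plin_tens_right] plin_tens_left)
    ultimately show "lin_ext (\<lambda>(a, b). tens (pure a) (tens (pure b) (?q v))) (\<Delta> (?q u)) =
        lin_ext (\<lambda>(a, b). tens (?q a) (tens (?q b) (?q v))) (wd u)" by simp
  qed
  also have "\<dots> = t3coord ?q (D_left (D P))"
    unfolding D_left_def t3coord_lin_ext
    by (rule lin_ext_cong) (auto simp: t3coord_lin_ext simp del: q_pure split: prod.split intro!: lin_ext_cong)
  also have "\<dots> = t3coord ?q (D_right (D P))" by (simp only: D_coassoc)
  also have "\<dots> = lin_ext (\<lambda>(u, v). lin_ext (\<lambda>(a, b). tens (?q u) (tens (?q a) (?q b))) (wd v)) (D P)"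
    unfolding D_right_def t3coord_lin_ext
    by (rule lin_ext_cong) (auto simp: t3coord_lin_ext simp del: q_pure split: prod.split intro!: lin_ext_cong)
  also have "\<dots> = lin_ext (\<lambda>(u, v). lin_ext (\<lambda>(a, b). tens (?q u) (tens (pure a) (pure b))) (\<Delta> (?q v))) (D P)"
  proof (rule lin_ext_cong, clarify)
    fix u v assume "(u, v) \<in> supp (D P)"
    then have "\<Delta> (?q v) = qq (wd v)" using supp_D[OF P] \<Delta>_q_pure by blast
    moreover have "lin_ext (\<lambda>(a, b). tens (?q u) (tens (?q a) (?q b))) (wd v) =
        lin_ext (\<lambda>(a, b). tens (?q u) (tens (pure a) (pure b))) (qq (wd v))"
      by (rule lin_ext_tcoord[where \<Phi> = "\<lambda>p r. tens (?q u) (tens p r)"])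
        (auto simp: pbilin_def intro!: plin_comp[OF plin_tens_right] plin_tens_left plin_tens_right)
    ultimately show "lin_ext (\<lambda>(a, b). tens (?q u) (tens (?q a) (?q b))) (wd v) =
        lin_ext (\<lambda>(a, b). tens (?q u) (tens (pure a) (pure b))) (\<Delta> (?q v))" by simp
  qed
  also have "\<dots> = lin_ext (\<lambda>(i, j). lin_ext (\<lambda>(a, b). tens (pure i) (tens (pure a) (pure b))) (\<Delta> (pure j))) (qq (D P))"
    by (rule lin_ext_tcoord[where \<Phi> = "\<lambda>r p. lin_ext (\<lambda>(a, b). tens r (tens (pure a) (pure b))) (\<Delta> p)"])
      (auto simp: pbilin_def intro!: plin_lin_ext_fun plin_tens_left plin_comp[OF plin_lin_ext plin_\<Delta>])
  finally show ?thesis using P by (simp add: \<Delta>_q)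
qed

definition anti_left :: "('g gen list \<times> 'g gen list \<Rightarrow>\<^sub>0 'k) \<Rightarrow> ('g gen list \<Rightarrow>\<^sub>0 'k)"
  where "anti_left = lin_ext (\<lambda>(u, v). ws u \<odot> pure v)"

definition anti_right :: "('g gen list \<times> 'g gen list \<Rightarrow>\<^sub>0 'k) \<Rightarrow> ('g gen list \<Rightarrow>\<^sub>0 'k)"
  where "anti_right = lin_ext (\<lambda>(u, v). pure u \<odot> ws v)"

lemma anti_gen:
  assumes "x \<in> lift_gens G"
  shows "anti_left (gen_comult x) \<sim> pscale (gen_counit x) (pure [])"
    and "anti_right (gen_comult x) \<sim> pscale (gen_counit x) (pure [])"
  using assms
proof -
  have 1: "pure [Grp h, Grp (inv h)] \<sim> pure []" "pure [Grp (inv h), Grp h] \<sim> pure []" if "h \<in> carrier G" for h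
    using that cg_trans[OF cg_mult[of "[]" h "inv h"]] cg_trans[OF cg_mult[of "[]" "inv h" h]] cg_one[of "[]"] by auto
  have 2: "pure [a] - pure [Grp g, Grp (inv g), a] \<sim> 0" if "a \<in> lift_gens G" for a
    using cg_diff[OF cg_refl cg_trans[OF cg_mult[of "[a]" g "inv g"]], of "pure [a]" "pure [a]"] cg_one[of "[a]"] that
    by auto
  show "anti_left (gen_comult x) \<sim> pscale (gen_counit x) (pure [])"
    by (cases x) (use assms 1 in \<open>auto simp: anti_left_def lin_ext_simps conv_simps\<close>)
  show "anti_right (gen_comult x) \<sim> pscale (gen_counit x) (pure [])"
    by (cases x) (use assms 1 2[of A1] 2[of A2] in \<open>auto simp: anti_right_def lin_ext_simps conv_simps\<close>)
qed

text \<open>The antipode reverses products, so for the legs x1, x2 of a letter and w1, w2 of a word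
  S(x1 w1) x2 w2 = S(w1) (S(x1) x2) w2; the inner product collapses to the counit of the letter,
  leaving the shorter word.\<close>

lemma anti_left_wd: "w \<in> W \<Longrightarrow> anti_left (wd w) \<sim> pscale (word_counit w) (pure [])"
proof (induction w)
  case (Cons x w)
  then have x: "x \<in> lift_gens G" and w: "w \<in> W" by auto
  have "anti_left (fm2 s t) = lin_ext (\<lambda>(u, v). ws u \<odot> anti_left s \<odot> pure v) t" for s t
    by (rule pbilin_eq_on[OF subset_UNIV subset_UNIV, of "\<lambda>s t. anti_left (fm2 s t)"
          "\<lambda>s t. lin_ext (\<lambda>(u, v). ws u \<odot> anti_left s \<odot> pure v) t"])
      (auto simp: anti_left_def ws_append fm_assoc pbilin_def intro!: plin_lin_ext_fun
        plin_comp[OF plin_lin_ext pbilinD(1)[OF pbilin_conv]] plin_comp[OF plin_lin_ext pbilinD(2)[OF pbilin_conv]]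
        plin_comp[OF pbilinD(2)[OF pbilin_conv] plin_lin_ext]
        plin_comp[OF pbilinD(1)[OF pbilin_conv] plin_comp[OF pbilinD(2)[OF pbilin_conv] plin_lin_ext]])
  then have "anti_left (wd (x # w)) = lin_ext (\<lambda>(u, v). ws u \<odot> anti_left (gen_comult x) \<odot> pure v) (wd w)"
    by simp
  also have "\<dots> \<sim> lin_ext (\<lambda>(u, v). ws u \<odot> pscale (gen_counit x) (pure []) \<odot> pure v) (wd w)"
  proof (rule cg_lin[OF plin_lin_ext plin_lin_ext wd_lc[OF w]])
    fix j :: "'g gen list \<times> 'g gen list" assume "j \<in> W \<times> W"
    then obtain u v where j: "j = (u, v)" "u \<in> W" "v \<in> W" by (cases j) blast
    show "lin_ext (\<lambda>(u, v). ws u \<odot> anti_left (gen_comult x) \<odot> pure v) (pure j) \<sim>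
        lin_ext (\<lambda>(u, v). ws u \<odot> pscale (gen_counit x) (pure []) \<odot> pure v) (pure j)"
      using cg_mult_right[OF cg_mult_left[OF anti_gen(1)[OF x] ws_lc[OF j(2)]], of "pure v"] j by simp
  qed
  also have "\<dots> = pscale (gen_counit x) (anti_left (wd w))"
    unfolding anti_left_def lin_ext_fun_pscale[symmetric] by (rule lin_ext_cong) (auto simp: conv_simps)
  also have "\<dots> \<sim> pscale (gen_counit x) (pscale (word_counit w) (pure []))"
    using Cons.IH[OF w] by (rule cg_scale)
  finally show ?case by simp
qed (simp add: anti_left_def)

text \<open>Mirror image of the left case with the nesting exchanged: x1 w1 S(x2 w2) = x1 (w1 S(w2))
  S(x2), so the shorter word collapses inside and the letter remains.\<close>

lemma anti_right_wd: "w \<in> W \<Longrightarrow> anti_right (wd w) \<sim> pscale (word_counit w) (pure [])"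
proof (induction w)
  case (Cons x w)
  then have x: "x \<in> lift_gens G" and w: "w \<in> W" by auto
  have "anti_right (fm2 s t) = lin_ext (\<lambda>(u, v). pure u \<odot> anti_right t \<odot> ws v) s" for s t
    by (rule pbilin_eq_on[OF subset_UNIV subset_UNIV, of "\<lambda>s t. anti_right (fm2 s t)"
          "\<lambda>s t. lin_ext (\<lambda>(u, v). pure u \<odot> anti_right t \<odot> ws v) s"])
      (auto simp: anti_right_def ws_append fm_assoc[symmetric] pbilin_def intro!: plin_lin_ext_fun
        plin_comp[OF plin_lin_ext pbilinD(1)[OF pbilin_conv]] plin_comp[OF plin_lin_ext pbilinD(2)[OF pbilin_conv]]
        plin_comp[OF pbilinD(1)[OF pbilin_conv] plin_lin_ext]
        plin_comp[OF pbilinD(2)[OF pbilin_conv] plin_comp[OF pbilinD(1)[OF pbilin_conv] plin_lin_ext]])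
  then have "anti_right (wd (x # w)) = lin_ext (\<lambda>(u, v). pure u \<odot> anti_right (wd w) \<odot> ws v) (gen_comult x)"
    by simp
  also have "\<dots> \<sim> lin_ext (\<lambda>(u, v). pure u \<odot> pscale (word_counit w) (pure []) \<odot> ws v) (gen_comult x)"
  proof (rule cg_lin[OF plin_lin_ext plin_lin_ext gen_comult_lc[OF x]])
    fix j :: "'g gen list \<times> 'g gen list" assume "j \<in> W \<times> W"
    then obtain u v where j: "j = (u, v)" "u \<in> W" "v \<in> W" by (cases j) blast
    show "lin_ext (\<lambda>(u, v). pure u \<odot> anti_right (wd w) \<odot> ws v) (pure j) \<sim>
        lin_ext (\<lambda>(u, v). pure u \<odot> pscale (word_counit w) (pure []) \<odot> ws v) (pure j)"
      using cg_mult_right[OF cg_mult_left[OF Cons.IH[OF w], of "pure u"] ws_lc[OF j(3)]] j by simp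
  qed
  also have "\<dots> = pscale (word_counit w) (anti_right (gen_comult x))"
    unfolding anti_right_def lin_ext_fun_pscale[symmetric] by (rule lin_ext_cong) (auto simp: conv_simps)
  also have "\<dots> \<sim> pscale (word_counit w) (pscale (gen_counit x) (pure []))"
    using anti_gen(2)[OF x] by (rule cg_scale)
  finally show ?case by (simp add: mult.commute)
qed (simp add: anti_right_def)

lemma q_cg: "p \<in> lc W \<Longrightarrow> r \<in> lc W \<Longrightarrow> p \<sim> r \<Longrightarrow> q p = q r"
  using q_kernel[of "p - r"] by (simp add: cg_def q_rules lc_minus)

lemma anti_lc: "s \<in> lc (W \<times> W) \<Longrightarrow> anti_left s \<in> lc W" "s \<in> lc (W \<times> W) \<Longrightarrow> anti_right s \<in> lc W"
proof -
  assume s: "s \<in> lc (W \<times> W)"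
  have "ws u \<odot> pure v \<in> lc W" "pure u \<odot> ws v \<in> lc W" if "u \<in> W" "v \<in> W" for u v
    using that by (auto intro!: fm_W ws_lc simp del: in_lists_conv_set)
  then show "anti_left s \<in> lc W" "anti_right s \<in> lc W"
    unfolding anti_left_def anti_right_def
    by (auto intro!: lc_lin_ext s dest!: subsetD[OF s[unfolded lc_def, simplified]] simp del: in_lists_conv_set)
qed

lemma anti_D:
  assumes "P \<in> lc W"
  shows "q (anti_left (D P)) = pscale (lin_form word_counit P) vac"
    and "q (anti_right (D P)) = pscale (lin_form word_counit P) vac"
proof -
  have "supp P \<subseteq> W" using assms by (simp add: lc_def)
  then have "q (anti_left (D P)) = pscale (lin_form word_counit P) vac
    \<and> q (anti_right (D P)) = pscale (lin_form word_counit P) vac"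
  proof (induction P rule: linear_induct)
    case (pure w)
    then show ?case
      using q_cg[OF anti_lc(1)[OF wd_lc] _ anti_left_wd, of w] q_cg[OF anti_lc(2)[OF wd_lc] _ anti_right_wd, of w]
      by (simp add: lc_pscale q_rules)
  qed (simp_all add: anti_left_def anti_right_def D_rules lin_ext_simps q_rules lin_form_simps pscale_add_left)
  then show "q (anti_left (D P)) = pscale (lin_form word_counit P) vac"
    and "q (anti_right (D P)) = pscale (lin_form word_counit P) vac" by auto
qed

sublocale hopf_model IX \<mu> vac \<Delta> ep S
proof
  show "pbilin \<mu>" "plin \<Delta>" "plin S" "vac \<in> lc IX"
    by (rule pbilin_\<mu> plin_\<Delta> plin_S vac_lc)+
  note bl = plin_comp[OF plin_lin_ext]
  have pb1: "pbilin (\<lambda>p r. pscale (lin_form ep p) r)" and pb2: "pbilin (\<lambda>p r. pscale (lin_form ep r) p)"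
    by (auto simp: pbilin_def plin_def lin_form_simps pscale_add_left pscale_add_right mult_ac)
  have pb3: "pbilin (\<lambda>p r. \<mu> (S p) r)" and pb4: "pbilin (\<lambda>p r. \<mu> p (S r))"
    using pbilin_comp[OF pbilin_\<mu> plin_id plin_S plin_id] pbilin_comp[OF pbilin_\<mu> plin_id plin_id plin_S] by auto
  have vac: "vac = q (pure [])" by simp
  show "\<Delta> vac = tens vac vac" unfolding vac by (subst \<Delta>_q) auto
  show "lin_form ep vac = 1" by (simp add: ep_def sw_def)
  fix p r s :: "nat \<times> 'g \<times> nat \<Rightarrow>\<^sub>0 'k" assume p: "p \<in> lc IX"
  then obtain P where P: "P \<in> lc W" "p = q P" using q_surj by blast
  show "S p \<in> lc IX" using P by (simp add: S_q q_lc Sf_lc)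
  show "\<mu> vac p = p" "\<mu> p vac = p" using p by (rule \<mu>_unit)+
  show "lin_ext (\<lambda>(i, j). lin_ext (\<lambda>(a, b). pure (a, b, j)) (\<Delta> (pure i))) (\<Delta> p) =
      lin_ext (\<lambda>(i, j). lin_ext (\<lambda>(a, b). pure (i, a, b)) (\<Delta> (pure j))) (\<Delta> p)"
    unfolding P(2) by (rule coassoc_model[OF P(1)])
  have "lin_ext (\<lambda>(i, j). pscale (lin_form ep (pure i)) (pure j)) (qq (D P)) =
      lin_ext (\<lambda>(u, v). pscale (word_counit u) (q (pure v))) (D P)"
    by (rule lin_ext_tcoord[OF pb1, symmetric]) (use supp_D[OF P(1)] in \<open>auto simp: ep_q simp del: q_pure\<close>)
  also have "\<dots> = q (lin_ext (\<lambda>(u, v). pscale (word_counit u) (pure v)) (D P))"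
    unfolding plin_lin_ext_comp[OF plin_q] by (rule lin_ext_cong) (auto simp: q_rules)
  finally show "lin_ext (\<lambda>(i, j). pscale (ep i) (pure j)) (\<Delta> p) = p"
    using P by (simp add: D_counit_left \<Delta>_q)
  have "lin_ext (\<lambda>(i, j). pscale (lin_form ep (pure j)) (pure i)) (qq (D P)) =
      lin_ext (\<lambda>(u, v). pscale (word_counit v) (q (pure u))) (D P)"
    by (rule lin_ext_tcoord[OF pb2, symmetric]) (use supp_D[OF P(1)] in \<open>auto simp: ep_q simp del: q_pure\<close>)
  also have "\<dots> = q (lin_ext (\<lambda>(u, v). pscale (word_counit v) (pure u)) (D P))"
    unfolding plin_lin_ext_comp[OF plin_q] by (rule lin_ext_cong) (auto simp: q_rules)
  finally show "lin_ext (\<lambda>(i, j). pscale (ep j) (pure i)) (\<Delta> p) = p"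
    using P by (simp add: D_counit_right \<Delta>_q)
  have "lin_ext (\<lambda>(i, j). \<mu> (S (pure i)) (pure j)) (qq (D P)) =
      lin_ext (\<lambda>(u, v). q (ws u \<odot> pure v)) (D P)"
    by (rule lin_ext_tcoord[OF pb3, symmetric])
      (use supp_D[OF P(1)] in \<open>auto simp: S_q q_mult ws_lc simp del: q_pure in_lists_conv_set\<close>)
  also have "\<dots> = q (anti_left (D P))"
    unfolding anti_left_def plin_lin_ext_comp[OF plin_q] by (rule lin_ext_cong) auto
  finally show "lin_ext (\<lambda>(i, j). \<mu> (S (pure i)) (pure j)) (\<Delta> p) = pscale (lin_form ep p) vac"
    using P by (simp add: \<Delta>_q ep_q anti_D)
  have "lin_ext (\<lambda>(i, j). \<mu> (pure i) (S (pure j))) (qq (D P)) =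
      lin_ext (\<lambda>(u, v). q (pure u \<odot> ws v)) (D P)"
    by (rule lin_ext_tcoord[OF pb4, symmetric])
      (use supp_D[OF P(1)] in \<open>auto simp: S_q q_mult ws_lc simp del: q_pure in_lists_conv_set\<close>)
  also have "\<dots> = q (anti_right (D P))"
    unfolding anti_right_def plin_lin_ext_comp[OF plin_q] by (rule lin_ext_cong) auto
  finally show "lin_ext (\<lambda>(i, j). \<mu> (pure i) (S (pure j))) (\<Delta> p) = pscale (lin_form ep p) vac"
    using P by (simp add: \<Delta>_q ep_q anti_D)
  assume r: "r \<in> lc IX"
  then obtain R where R: "R \<in> lc W" "r = q R" using q_surj by blast
  show "\<mu> p r \<in> lc IX" using p r by (rule \<mu>_lc)
  have "\<Delta> (\<mu> p r) = \<mu>2 (\<Delta> p) (\<Delta> r)"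
    using P R by (simp add: q_mult[symmetric] \<Delta>_q fm_W D_fm qq_fm2 D_lc del: q_pure)
  then show "\<Delta> (\<mu> p r) = lin_ext (\<lambda>(a, b). lin_ext (\<lambda>(c, d). tens (\<mu> (pure a) (pure c)) (\<mu> (pure b) (pure d))) (\<Delta> r)) (\<Delta> p)"
    by (simp add: \<mu>2_def)
  show "lin_form ep (\<mu> p r) = lin_form ep p * lin_form ep r"
    using P R by (simp add: q_mult[symmetric] ep_q fm_W word_counit_fm)
  assume "s \<in> lc IX"
  with p r show "\<mu> (\<mu> p r) s = \<mu> p (\<mu> r s)" by (rule \<mu>_assoc)
qed

text \<open>The Hopf algebra that witnesses the existence claim. Coproduct and counit of a class are
  computed from a chosen representative; independence of the choice is only needed after passing to
  coordinates.\<close>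

definition H :: "(('g gen list \<Rightarrow>\<^sub>0 'k) set, 'k) khopf"
  where "H = kalg.extend U (khopf.fields
    (\<lambda>X. tensor_map (\<lambda>w. cls (pure w)) (\<lambda>w. cls (pure w)) (D (SOME p. p \<in> X)))
    (\<lambda>X. lin_form word_counit (SOME p. p \<in> X)))"

lemma H_simps [simp]:
  "carrier H = carrier U" "monoid.mult H = monoid.mult U" "one H = one U" "add H = add U" "zero H = zero U"
  "kscale H = kscale U" "kalg.truncate H = U"
  by (simp_all add: H_def kalg.defs khopf.defs)

lemma comult_H: "comult H Y = tensor_map (\<lambda>w. cls (pure w)) (\<lambda>w. cls (pure w)) (D (SOME p. p \<in> Y))"
  and counit_H: "counit H Y = lin_form word_counit (SOME p. p \<in> Y)"
  by (simp_all add: H_def kalg.defs khopf.defs)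

sublocale H: hopf_realization IX \<mu> vac \<Delta> ep S H U.qco
proof unfold_locales
  show "bij_betw U.qco (carrier H) (lc IX)" using UC.\<kappa>_bij by simp
  fix Y assume "Y \<in> carrier H"
  then obtain p where p: "Y = cls p" "p \<in> lc W" by (auto simp: U_carrier)
  define r where "r = (SOME r. r \<in> Y)"
  have r: "r \<in> lc W" "q r = q p"
    using U.some_in_coset[of p] p by (auto simp: r_def)
  have "tcoord U.qco (comult H Y) = tcoord (\<lambda>w. q (pure w)) (D r)"
    unfolding comult_H tcoord_tensor_map r_def[symmetric]
    by (rule tcoord_cong) (use supp_D[OF r(1)] in \<open>auto simp: qco_cls simp del: q_pure\<close>)
  also have "\<dots> = \<Delta> (U.qco Y)" using \<Delta>_q[OF r(1)] p r(2) by (simp only: qco_cls)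
  finally show "supp (comult H Y) \<subseteq> carrier H \<times> carrier H \<and> tcoord U.qco (comult H Y) = \<Delta> (U.qco Y)"
    unfolding comult_H tensor_map_def r_def[symmetric]
    using supp_D[OF r(1)] by (auto simp: U_carrier intro!: supp_lin_ext_subset)
  show "counit H Y = lin_form ep (U.qco Y)"
    unfolding counit_H r_def[symmetric] using p r ep_q by (metis qco_cls)
qed (auto simp: U_carrier U_one U_zero U_add U_scale U_mult q_rules q_mult qco_cls fm_W lc_add lc_pscale)

end

section \<open>The coradical filtration\<close>

lemma pscale_2: "pscale 2 p = p + p"
  by (rule poly_mapping_eqI) (simp add: lookup_add)

text \<open>The map f \<otimes> id, evaluating a functional on the left tensor factor. Subcoalgebras
  are stable under it after the coproduct, which is how degrees get lowered inside them.\<close>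

definition contract :: "('i \<Rightarrow> 'k) \<Rightarrow> ('i \<times> 'j \<Rightarrow>\<^sub>0 'k::field) \<Rightarrow> ('j \<Rightarrow>\<^sub>0 'k)"
  where "contract f = lin_ext (\<lambda>(i, j). pscale (f i) (pure j))"

lemma plin_contract: "plin (contract f)"
  by (simp add: contract_def)

lemmas contract_rules = plin_rules[OF plin_contract]

lemma contract_pure [simp]: "contract f (pure (i, j)) = pscale (f i) (pure j)"
  by (simp add: contract_def)

lemma contract_tens: "contract f (tens p r) = pscale (lin_form f p) r"
proof -
  have "pbilin (\<lambda>p r. pscale (lin_form f p) r)"
    by (auto simp: pbilin_def plin_def lin_form_simps pscale_add_left pscale_add_right mult_ac)
  from bilin_tens[OF this] show ?thesis by (simp add: contract_def)
qed

lemma contract_tcoord: "contract f (tcoord \<kappa> s) = lin_ext (\<lambda>(a, b). pscale (lin_form f (\<kappa> a)) (\<kappa> b)) s"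
  unfolding tcoord_def plin_lin_ext_comp[OF plin_contract]
  by (rule lin_ext_cong) (auto simp: contract_tens)

lemma coef_contract: "coef (contract f t) j = (\<Sum>x\<in>supp t. coef t x * (if snd x = j then f (fst x) else 0))"
  unfolding contract_def coef_lin_ext
  by (rule sum.cong) (auto simp: lookup_single when_def split: prod.split)

fun deg :: "nat \<times> 'g \<times> nat \<Rightarrow> nat"
  where "deg (m, h, n) = m + n"

fun wdeg :: "'g gen list \<Rightarrow> nat"
  where "wdeg [] = 0" | "wdeg (Grp h # w) = wdeg w" | "wdeg (A1 # w) = Suc (wdeg w)" | "wdeg (A2 # w) = Suc (wdeg w)"

lemma wdeg_append [simp]: "wdeg (u @ v) = wdeg u + wdeg v"
  by (induction u rule: wdeg.induct) auto

lemma wdeg_replicate [simp]: "wdeg (replicate m A1) = m" "wdeg (replicate m A2) = m"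
  by (induction m) auto

text \<open>These functionals add up coefficients over all group elements. Contracting with them
  reads off the parts of a coproduct whose left factor is h, a1 h or a2 h, irrespective of
  h.\<close>

definition unit_part :: "nat \<times> 'g \<times> nat \<Rightarrow> 'k::field"
  where "unit_part = (\<lambda>(m, h, n). if m = 0 \<and> n = 0 then 1 else 0)"
definition a1_part :: "nat \<times> 'g \<times> nat \<Rightarrow> 'k::field"
  where "a1_part = (\<lambda>(m, h, n). if m = 1 \<and> n = 0 then 1 else 0)"
definition a2_part :: "nat \<times> 'g \<times> nat \<Rightarrow> 'k::field"
  where "a2_part = (\<lambda>(m, h, n). if m = 0 \<and> n = 1 then 1 else 0)"

lemmas part_defs = unit_part_def a1_part_def a2_part_def

context lift_data
begin

abbreviation Le :: "nat \<Rightarrow> (nat \<times> 'g \<times> nat \<Rightarrow>\<^sub>0 'k) set"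
  where "Le n \<equiv> lc {i \<in> IX. deg i \<le> n}"
abbreviation Lt :: "nat \<Rightarrow> (nat \<times> 'g \<times> nat \<Rightarrow>\<^sub>0 'k) set"
  where "Lt n \<equiv> lc {i \<in> IX. deg i < n}"

lemma op_Le: "x \<in> lift_gens G \<Longrightarrow> v \<in> Le n \<Longrightarrow> op x v \<in> Le (n + wdeg [x])"
  by (erule lc_plin[OF plin_op]) (auto simp: IX_def op2_pure intro!: lc_intros)

lemma op_Lt: "x \<in> lift_gens G \<Longrightarrow> v \<in> Lt n \<Longrightarrow> op x v \<in> Lt (n + wdeg [x])"
  by (erule lc_plin[OF plin_op]) (auto simp: IX_def op2_pure intro!: lc_intros)

lemma wdeg_Cons: "wdeg (x # w) = wdeg w + wdeg [x]"
  by (cases x) auto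

lemma q_Le: "w \<in> W \<Longrightarrow> q (pure w) \<in> Le (wdeg w)"
proof (induction w)
  case (Cons x w)
  then show ?case using op_Le[of x "q (pure w)" "wdeg w"] wdeg_Cons[of x w] by auto
qed (simp add: IX_def)

lemma wdeg_sw: "wdeg (sw i) = deg i"
  by (cases i) (simp add: sw_def)

lemma wd_degree: "w \<in> W \<Longrightarrow> wd w \<in> lc {(u, v). u \<in> W \<and> v \<in> W \<and> wdeg u + wdeg v = wdeg w}"
proof (induction w)
  case (Cons x w)
  define J where "J n = {(u, v). u \<in> W \<and> v \<in> W \<and> wdeg u + wdeg v = n}" for n
  have "gen_comult x \<in> lc (J (wdeg [x]))"
    using Cons.prems by (cases x) (auto simp: J_def intro!: lc_intros)
  moreover have "wd w \<in> lc (J (wdeg w))" using Cons by (simp add: J_def)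
  ultimately have "fm2 (gen_comult x) (wd w) \<in> lc (J (wdeg (x # w)))"
    unfolding conv_def wdeg_Cons[of x w]
    by (intro lc_lin_ext) (auto simp: lc_def J_def simp del: lists.simps dest!: subsetD)
  then show ?case by (simp add: J_def)
qed simp

lemma \<mu>_q_pure: "w \<in> W \<Longrightarrow> v \<in> lc IX \<Longrightarrow> \<mu> (q (pure w)) v = foldr op w v"
  using act_q[of "pure w" v] by (simp add: \<mu>_def)

text \<open>\<open>T x\<close> is the left multiplication by \<open>\<Delta>(x)\<close>.\<close>

definition T :: "'g gen \<Rightarrow> ((nat \<times> 'g \<times> nat) \<times> (nat \<times> 'g \<times> nat) \<Rightarrow>\<^sub>0 'k) \<Rightarrow> _"
  where "T x t = \<mu>2 (qq (gen_comult x)) t"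

lemma plin_T: "plin (T x)"
  unfolding T_def by (rule pbilinD(1)[OF pbilin_\<mu>2])

lemma qq_wd_Cons: "x \<in> lift_gens G \<Longrightarrow> w \<in> W \<Longrightarrow> qq (wd (x # w)) = T x (qq (wd w))"
  unfolding T_def wd.simps by (rule qq_fm2) (auto intro: gen_comult_lc wd_lc)

lemma T_Grp:
  assumes "h \<in> carrier G" "i \<in> IX" "j \<in> IX"
  shows "T (Grp h) (pure (i, j)) = tens (opG h (pure i)) (opG h (pure j))"
  using assms \<mu>_q_pure[of "[Grp h]"] \<mu>2_tens[of "q (pure [Grp h])" "q (pure [Grp h])" "pure i" "pure j"]
  by (simp add: T_def del: q_pure)

lemma T_A:
  assumes "x = A1 \<or> x = A2" "i \<in> IX" "j \<in> IX"
  shows "T x (pure (i, j)) = tens (op x (pure i)) (pure j) + tens (opG g (pure i)) (op x (pure j))"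
proof -
  have "gen_comult x = pure ([x], []) + pure ([Grp g], [x])" using assms(1) by auto
  then have "T x (pure (i, j)) = \<mu>2 (tens (q (pure [x])) (q (pure []))) (tens (pure i) (pure j))
      + \<mu>2 (tens (q (pure [Grp g])) (q (pure [x]))) (tens (pure i) (pure j))"
    by (simp add: T_def plin_rules[OF pbilinD(2)[OF pbilin_\<mu>2]] del: q_pure)
  then show ?thesis
    using assms \<mu>_q_pure[of "[x]"] \<mu>_q_pure[of "[]"] \<mu>_q_pure[of "[Grp g]"]
    by (auto simp add: \<mu>2_tens simp del: q_pure tens_pure)
qed

lemma qq_wd_lc: "w \<in> W \<Longrightarrow> qq (wd w) \<in> lc (IX \<times> IX)"
  by (erule lc_plin[OF plin_tcoord wd_lc])
    (simp only: mem_Times_iff tcoord_def lin_ext_pure case_prod_unfold, intro lc_tens q_lc, simp_all only: lc_pure)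

lemma contract_T_eq:
  assumes "t \<in> lc (IX \<times> IX)" "plin h"
    and "\<And>i j. i \<in> IX \<Longrightarrow> j \<in> IX \<Longrightarrow> contract f (T x (pure (i, j))) = h (pure (i, j))"
  shows "contract f (T x t) = h t"
  by (rule plin_eq_on[OF _ plin_comp[OF plin_contract plin_T] assms(2)])
    (use assms in \<open>auto simp: lc_def\<close>)

lemmas \<Delta>_rules = plin_rules[OF plin_\<Delta>]

text \<open>The degree 0 functional weighted by \<eta>. It is forced by the term -\<eta>(h) a1 h of
  a2 h, through which a2 contributes to the contraction with \<open>a1_part\<close>.\<close>

definition eta_part :: "nat \<times> 'g \<times> nat \<Rightarrow> 'k"
  where "eta_part = (\<lambda>(m, h, n). if m = 0 \<and> n = 0 then E h else 0)"

end

text \<open>The case \<xi> = 0, \<lambda> = 0, in which all structure maps are homogeneous for the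
  degree.\<close>

locale jordan_data = lift_hopf_data G g \<eta> "\<lambda>_. 0" 0
  for G :: "('g, 'm) monoid_scheme" (structure) and g :: 'g and \<eta> :: "('g \<Rightarrow>\<^sub>0 'k::field_char_0) \<Rightarrow> 'k"
begin

lemma op2_jordan: "op2 (pure (m, h, n)) = pure (m, h, Suc n) - pscale (of_nat m / 2 + E h) (pure (Suc m, h, n))"
  by (simp add: op2_pure)

text \<open>In \<Delta>(x) t = (x \<otimes> 1) t + (g \<otimes> x) t the first summand has positive
  degree on the left and is killed, while left multiplication by g does not affect
  \<open>unit_part\<close>.\<close>

lemma contract_unit:
  assumes t: "t \<in> lc (IX \<times> IX)"
  shows "h \<in> carrier G \<Longrightarrow> contract unit_part (T (Grp h) t) = opG h (contract unit_part t)"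
    and "x = A1 \<or> x = A2 \<Longrightarrow> contract unit_part (T x t) = op x (contract unit_part t)"
proof -
  show "contract unit_part (T (Grp h) t) = opG h (contract unit_part t)" if "h \<in> carrier G"
    by (rule contract_T_eq[OF t plin_comp[OF plin_opG plin_contract]])
      (use that in \<open>auto simp: T_Grp part_defs IX_def op_rules\<close>)
  show "contract unit_part (T x t) = op x (contract unit_part t)" if "x = A1 \<or> x = A2"
    by (rule contract_T_eq[OF t plin_comp[OF plin_op plin_contract]])
      (use that in \<open>auto simp: T_A contract_rules contract_tens op2_jordan lin_form_simps part_defs IX_def op_rules
        simp del: tens_pure\<close>)
qed

lemma contract_eta:
  assumes t: "t \<in> lc (IX \<times> IX)"
  shows "contract eta_part (T A2 t) = op2 (contract eta_part t + contract unit_part t)"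
  by (rule contract_T_eq[OF t plin_comp[OF plin_op2 plin_plus[OF plin_contract plin_contract]]])
    (auto simp: T_A contract_rules contract_tens op2_jordan lin_form_simps part_defs eta_part_def IX_def op_rules E_mult
      pscale_add_left add.commute simp del: tens_pure)

lemma contract_a2:
  assumes t: "t \<in> lc (IX \<times> IX)"
  shows "h \<in> carrier G \<Longrightarrow> contract a2_part (T (Grp h) t) = opG h (contract a2_part t)"
    and "contract a2_part (T A1 t) = op1 (contract a2_part t)"
    and "contract a2_part (T A2 t) = contract unit_part t + op2 (contract a2_part t)"
proof -
  show "contract a2_part (T (Grp h) t) = opG h (contract a2_part t)" if "h \<in> carrier G"
    by (rule contract_T_eq[OF t plin_comp[OF plin_opG plin_contract]])
      (use that in \<open>auto simp: T_Grp part_defs IX_def op_rules\<close>)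
  show "contract a2_part (T A1 t) = op1 (contract a2_part t)"
    by (rule contract_T_eq[OF t plin_comp[OF plin_op1 plin_contract]])
      (auto simp: T_A contract_rules contract_tens op2_jordan lin_form_simps part_defs IX_def op_rules
        simp del: tens_pure)
  show "contract a2_part (T A2 t) = contract unit_part t + op2 (contract a2_part t)"
    by (rule contract_T_eq[OF t plin_plus[OF plin_contract plin_comp[OF plin_op2 plin_contract]]])
      (auto simp: T_A contract_rules contract_tens op2_jordan lin_form_simps part_defs IX_def op_rules
        simp del: tens_pure)
qed

text \<open>Multiplying the left factor by a1 turns \<open>a1_part\<close> into
  \<open>unit_part\<close>; multiplying it by a2 turns \<open>a1_part\<close> into
  \<open>- eta_part\<close>, because a2 h contains -\<eta>(h) a1 h.\<close>

lemma contract_a1: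
  assumes t: "t \<in> lc (IX \<times> IX)"
  shows "h \<in> carrier G \<Longrightarrow> contract a1_part (T (Grp h) t) = opG h (contract a1_part t)"
    and "contract a1_part (T A1 t) = contract unit_part t + op1 (contract a1_part t)"
    and "contract a1_part (T A2 t) = op2 (contract a1_part t) - contract eta_part t"
proof -
  show "contract a1_part (T (Grp h) t) = opG h (contract a1_part t)" if "h \<in> carrier G"
    by (rule contract_T_eq[OF t plin_comp[OF plin_opG plin_contract]])
      (use that in \<open>auto simp: T_Grp part_defs IX_def op_rules\<close>)
  show "contract a1_part (T A1 t) = contract unit_part t + op1 (contract a1_part t)"
    by (rule contract_T_eq[OF t plin_plus[OF plin_contract plin_comp[OF plin_op1 plin_contract]]])
      (auto simp: T_A contract_rules contract_tens op2_jordan lin_form_simps part_defs IX_def op_rules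
        simp del: tens_pure)
  show "contract a1_part (T A2 t) = op2 (contract a1_part t) - contract eta_part t"
    by (rule contract_T_eq[OF t plin_minus[OF plin_comp[OF plin_op2 plin_contract] plin_contract]])
      (auto simp: T_A contract_rules contract_tens op2_jordan lin_form_simps part_defs eta_part_def IX_def op_rules
        pscale_minus_left simp del: tens_pure)
qed

text \<open>Each further a2 multiplies the left factor by g, and \<eta>(g) = 1, so the weighted
  contraction grows by one per step. The contraction with \<open>a1_part\<close> subtracts these
  weights successively, and 0 + 1 + ... + (k - 1) is \<open>k choose 2\<close>.\<close>

lemma contract_A2s:
  "contract unit_part (qq (wd (replicate k A2))) = pure (0, \<one>, k)"
  "contract eta_part (qq (wd (replicate k A2))) = pscale (of_nat k) (pure (0, \<one>, k))"
  "contract a2_part (qq (wd (replicate k A2))) = pscale (of_nat k) (pure (0, \<one>, k - 1))"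
  "contract a1_part (qq (wd (replicate k A2))) = - pscale (of_nat (k choose 2)) (pure (0, \<one>, k - 1))"
proof (induction k)
  case (Suc k)
  have w: "replicate k A2 \<in> W" by (auto simp: in_lists_conv_set)
  note t = qq_wd_lc[OF w]
  have eq: "qq (wd (replicate (Suc k) A2)) = T A2 (qq (wd (replicate k A2)))"
    using qq_wd_Cons[OF _ w, of A2] by simp
  show "contract unit_part (qq (wd (replicate (Suc k) A2))) = pure (0, \<one>, Suc k)"
    unfolding eq contract_unit(2)[OF t disjI2[OF refl]] Suc by (simp add: op2_jordan)
  show "contract eta_part (qq (wd (replicate (Suc k) A2))) = pscale (of_nat (Suc k)) (pure (0, \<one>, Suc k))"
    unfolding eq contract_eta[OF t] Suc by (simp add: op2_jordan op_rules pscale_add_left)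
  show "contract a2_part (qq (wd (replicate (Suc k) A2))) = pscale (of_nat (Suc k)) (pure (0, \<one>, Suc k - 1))"
    unfolding eq contract_a2[OF t] Suc
    by (cases k) (simp_all add: op2_jordan op_rules pscale_add_left pscale_2)
  show "contract a1_part (qq (wd (replicate (Suc k) A2))) =
      - pscale (of_nat (Suc k choose 2)) (pure (0, \<one>, Suc k - 1))"
    unfolding eq contract_a1[OF t] Suc
    by (rule poly_mapping_eqI, cases k)
      (simp_all add: op2_jordan op_rules pscale_2 lookup_add lookup_minus numeral_2_eq_2 algebra_simps)
qed (auto simp: part_defs eta_part_def)

text \<open>The powers of a2 are multiplied from the left by h and by a1^m, each step changing the
  contractions by a known amount. Truncated exponents occur only with coefficient 0.\<close>

lemma contract_\<Delta>:
  assumes h: "h \<in> carrier G"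
  shows "contract a2_part (\<Delta> (pure (m, h, k))) = pscale (of_nat k) (pure (m, h, k - 1))"
    and "contract a1_part (\<Delta> (pure (m, h, k))) =
      pscale (of_nat m) (pure (m - 1, h, k)) - pscale (of_nat (k choose 2)) (pure (m, h, k - 1))"
proof -
  define w where "w m = replicate m A1 @ [Grp h] @ replicate k A2" for m
  have W: "replicate k A2 \<in> W" "w m \<in> W" for m
    using h by (auto simp: w_def in_lists_conv_set)
  have "contract unit_part (qq (wd (w m))) = pure (m, h, k) \<and>
    contract a2_part (qq (wd (w m))) = pscale (of_nat k) (pure (m, h, k - 1)) \<and>
    contract a1_part (qq (wd (w m))) =
      pscale (of_nat m) (pure (m - 1, h, k)) - pscale (of_nat (k choose 2)) (pure (m, h, k - 1))"
  proof (induction m)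
    case 0
    have "qq (wd (w 0)) = T (Grp h) (qq (wd (replicate k A2)))"
      using qq_wd_Cons[OF _ W(1), of "Grp h"] h by (simp add: w_def)
    then show ?case
      using h by (simp add: contract_unit contract_a2 contract_a1 qq_wd_lc[OF W(1)] contract_A2s op_rules del: q_pure)
  next
    case (Suc m)
    have "qq (wd (w (Suc m))) = T A1 (qq (wd (w m)))"
      using qq_wd_Cons[OF _ W(2), of A1 m] by (simp add: w_def)
    then show ?case
      using Suc by (cases m)
        (simp_all add: contract_unit contract_a2 contract_a1 qq_wd_lc[OF W(2)] op_rules pscale_add_left pscale_2 del: q_pure)
  qed
  moreover have "\<Delta> (pure (m, h, k)) = qq (wd (w m))"
    by (simp add: \<Delta>_def w_def sw_def)
  ultimately show "contract a2_part (\<Delta> (pure (m, h, k))) = pscale (of_nat k) (pure (m, h, k - 1))"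
    and "contract a1_part (\<Delta> (pure (m, h, k))) =
      pscale (of_nat m) (pure (m - 1, h, k)) - pscale (of_nat (k choose 2)) (pure (m, h, k - 1))"
    by auto
qed

lemma coef_contract_\<Delta>:
  assumes v: "v \<in> lc IX"
  shows "coef (contract a2_part (\<Delta> v)) (m, h, k) = of_nat (Suc k) * coef v (m, h, Suc k)"
    and "coef (contract a1_part (\<Delta> v)) (m, h, k) =
      of_nat (Suc m) * coef v (Suc m, h, k) - of_nat (Suc k choose 2) * coef v (m, h, Suc k)"
proof -
  from v have "supp v \<subseteq> IX" by (simp add: lc_def)
  then have "coef (contract a2_part (\<Delta> v)) (m, h, k) = of_nat (Suc k) * coef v (m, h, Suc k) \<and>
    coef (contract a1_part (\<Delta> v)) (m, h, k) =
      of_nat (Suc m) * coef v (Suc m, h, k) - of_nat (Suc k choose 2) * coef v (m, h, Suc k)"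
  proof (induction v rule: linear_induct)
    case (pure i)
    obtain m' h' k' where i: "i = (m', h', k')" by (metis prod_cases3)
    with pure have "h' \<in> carrier G" by (simp add: IX_def)
    then show ?case
      by (cases m'; cases k') (auto simp: i contract_\<Delta> lookup_minus lookup_single when_def)
  next
    case (scale c p)
    then show ?case
      by (simp add: \<Delta>_rules contract_rules right_diff_distrib mult.left_commute[of c])
  qed (auto simp: \<Delta>_rules contract_rules lookup_add algebra_simps)
  then show "coef (contract a2_part (\<Delta> v)) (m, h, k) = of_nat (Suc k) * coef v (m, h, Suc k)"
    and "coef (contract a1_part (\<Delta> v)) (m, h, k) =
      of_nat (Suc m) * coef v (Suc m, h, k) - of_nat (Suc k choose 2) * coef v (m, h, Suc k)" by auto
qed

end

lemma lc_coef: "p \<in> lc I \<Longrightarrow> i \<notin> I \<Longrightarrow> coef p i = 0"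
  by (auto simp: lc_def in_keys_iff)

lemma lcI: "(\<And>i. coef p i \<noteq> 0 \<Longrightarrow> i \<in> I) \<Longrightarrow> p \<in> lc I"
  by (auto simp: lc_def in_keys_iff)

text \<open>The algebra together with its graded companion \<open>Z\<close> for the same group, g
  and \<eta>. Index set and standard words are literally shared, so coefficients can be
  compared.\<close>

locale lift_pair = lift_hopf_data G g \<eta> \<xi> lam + Z: jordan_data G g \<eta>
  for G :: "('g, 'm) monoid_scheme" (structure)
    and g :: 'g and \<eta> \<xi> :: "('g \<Rightarrow>\<^sub>0 'k::field_char_0) \<Rightarrow> 'k" and lam :: 'k
begin

subsection \<open>Comparison with the graded case\<close>

text \<open>The terms with \<lambda> and \<xi> do not reach the degree of the leading terms of
  \<open>op2\<close>; the two families of operators differ only by them.\<close>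

lemma op_minus_Z: "x \<in> lift_gens G \<Longrightarrow> v \<in> Le n \<Longrightarrow> op x v - Z.op x v \<in> Lt (n + wdeg [x])"
proof (rule lc_plin[OF plin_minus[OF plin_op Z.plin_op]])
  fix i assume x: "x \<in> lift_gens G" and i: "i \<in> {i \<in> IX. deg i \<le> n}"
  obtain m h k where mhk: "i = (m, h, k)" by (metis prod_cases3)
  have "op2 (pure i) - Z.op2 (pure i) =
      - pscale (of_nat m * lam) (pure (m - 1, h, k) - pure (m - 1, g \<otimes> (g \<otimes> h), k))
      - pscale (X h) (pure (m, h, k) - pure (m, g \<otimes> h, k))"
    by (simp add: mhk op2_pure Z.op2_jordan)
  also have "\<dots> \<in> Lt (n + 1)"
    using i by (intro lc_intros) (auto simp: mhk IX_def)
  finally show "op x (pure i) - Z.op x (pure i) \<in> Lt (n + wdeg [x])"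
    using x by (cases x) (auto simp: mhk)
qed

lemma Z_op_eq_deg: "x \<in> lift_gens G \<Longrightarrow> v \<in> lc {i \<in> IX. deg i = n} \<Longrightarrow>
    Z.op x v \<in> lc {i \<in> IX. deg i = n + wdeg [x]}"
  by (erule lc_plin[OF Z.plin_op]) (auto simp: IX_def Z.op2_jordan intro!: lc_intros)

lemma q_minus_Z: "w \<in> W \<Longrightarrow> q (pure w) - Z.q (pure w) \<in> Lt (wdeg w)"
proof (induction w)
  case (Cons x w)
  then have x: "x \<in> lift_gens G" and w: "w \<in> W" by auto
  have "op x (q (pure w) - Z.q (pure w)) \<in> Lt (wdeg w + wdeg [x])"
    by (rule op_Lt[OF x]) (use Cons w in blast)
  moreover have "op x (Z.q (pure w)) - Z.op x (Z.q (pure w)) \<in> Lt (wdeg w + wdeg [x])"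
    by (rule op_minus_Z[OF x Z.q_Le[OF w]])
  ultimately have "op x (q (pure w) - Z.q (pure w)) + (op x (Z.q (pure w)) - Z.op x (Z.q (pure w)))
      \<in> Lt (wdeg w + wdeg [x])" by (rule lc_add)
  then show ?case by (simp add: op_rules wdeg_Cons[of x w])
qed simp

lemma Z_q_deg: "w \<in> W \<Longrightarrow> Z.q (pure w) \<in> lc {i \<in> IX. deg i = wdeg w}"
proof (induction w)
  case (Cons x w)
  then show ?case using Z_op_eq_deg[of x "Z.q (pure w)" "wdeg w"] wdeg_Cons[of x w] by auto
qed (simp add: IX_def)

lemma coef_q:
  assumes "w \<in> W"
  shows "wdeg w < deg i \<Longrightarrow> coef (q (pure w)) i = 0" and "wdeg w \<noteq> deg i \<Longrightarrow> coef (Z.q (pure w)) i = 0"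
    and "wdeg w = deg i \<Longrightarrow> coef (q (pure w)) i = coef (Z.q (pure w)) i"
proof -
  show "coef (q (pure w)) i = 0" if "wdeg w < deg i"
    by (rule lc_coef[OF q_Le[OF assms]]) (use that in auto)
  show "coef (Z.q (pure w)) i = 0" if "wdeg w \<noteq> deg i"
    by (rule lc_coef[OF Z_q_deg[OF assms]]) (use that in auto)
  show "coef (q (pure w)) i = coef (Z.q (pure w)) i" if "wdeg w = deg i"
  proof -
    have "coef (q (pure w) - Z.q (pure w)) i = 0"
      by (rule lc_coef[OF q_minus_Z[OF assms]]) (use that in auto)
    then show ?thesis by (simp add: lookup_minus)
  qed
qed

lemma q_top:
  assumes "P \<in> lc {w \<in> W. wdeg w \<le> N}" and "deg i = N"
  shows "coef (q P) i = coef (Z.q P) i"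
proof -
  have "supp P \<subseteq> {w \<in> W. wdeg w \<le> N}" using assms by (simp add: lc_def)
  then show ?thesis
  proof (induction P rule: linear_induct)
    case (pure w)
    then show ?case
      using coef_q[of w i] assms(2) by (cases "wdeg w = N") (auto simp del: q_pure Z.q_pure)
  qed (auto simp: q_rules Z.q_rules lookup_add)
qed

text \<open>The coproducts of words are the same in both algebras; only the expansion of words in
  the basis differs, and it does so below the top degree.\<close>

lemma coef_qq:
  assumes "s \<in> lc {(u, v). u \<in> W \<and> v \<in> W \<and> wdeg u + wdeg v \<le> deg i + deg j}"
  shows "coef (qq s) (i, j) = coef (Z.qq s) (i, j)"
proof -
  have "supp s \<subseteq> {(u, v). u \<in> W \<and> v \<in> W \<and> wdeg u + wdeg v \<le> deg i + deg j}"
    using assms by (simp add: lc_def)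
  then show ?thesis
  proof (induction s rule: linear_induct)
    case (pure x)
    then obtain u v where x: "x = (u, v)" and uv: "u \<in> W" "v \<in> W" "wdeg u + wdeg v \<le> deg i + deg j" by auto
    \<comment> \<open>A word contributes nothing in degrees above its own, and in the graded case
      only in its own. Unless both degrees match exactly, some factor vanishes on either
      side.\<close>
    consider "wdeg u < deg i" | "wdeg u = deg i \<and> (wdeg v = deg j \<or> wdeg v < deg j)" | "wdeg u > deg i \<and> wdeg v < deg j"
      using uv(3) by linarith
    then show ?case
      using coef_q[OF uv(1), of i] coef_q[OF uv(2), of j]
      by cases (auto simp: x coef_tens simp del: q_pure Z.q_pure)
  qed (auto simp: lookup_add)
qed

lemma coef_qq_0:
  assumes "s \<in> lc {(u, v). u \<in> W \<and> v \<in> W \<and> wdeg u + wdeg v < deg i + deg j}"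
  shows "coef (qq s) (i, j) = 0"
proof -
  have "supp s \<subseteq> {(u, v). u \<in> W \<and> v \<in> W \<and> wdeg u + wdeg v < deg i + deg j}"
    using assms by (simp add: lc_def)
  then show ?thesis
  proof (induction s rule: linear_induct)
    case (pure x)
    then obtain u v where x: "x = (u, v)" and uv: "u \<in> W" "v \<in> W" "wdeg u + wdeg v < deg i + deg j" by auto
    then have "wdeg u < deg i \<or> wdeg v < deg j" by linarith
    then show ?case
      using coef_q[OF uv(1), of i] coef_q[OF uv(2), of j] by (auto simp: x coef_tens simp del: q_pure)
  qed (auto simp: lookup_add)
qed

lemma D_degree:
  assumes "P \<in> lc {w \<in> W. wdeg w \<le> N}"
  shows "D P \<in> lc {(u, v). u \<in> W \<and> v \<in> W \<and> wdeg u + wdeg v \<le> N}"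
proof (rule lc_plin[OF plin_D assms])
  fix w assume w: "w \<in> {w \<in> W. wdeg w \<le> N}"
  then have "{(u, v). u \<in> W \<and> v \<in> W \<and> wdeg u + wdeg v = wdeg w}
      \<subseteq> {(u, v). u \<in> W \<and> v \<in> W \<and> wdeg u + wdeg v \<le> N}" by auto
  from lc_mono[OF this] wd_degree[of w] w show "D (pure w) \<in> lc {(u, v). u \<in> W \<and> v \<in> W \<and> wdeg u + wdeg v \<le> N}"
    unfolding D_pure by blast
qed

lemma \<sigma>_degree: "v \<in> Le N \<Longrightarrow> \<sigma> v \<in> lc {w \<in> W. wdeg w \<le> N}"
  by (erule lc_plin[OF plin_\<sigma>]) (use sw_W in \<open>simp add: wdeg_sw del: lists.simps in_lists_conv_set\<close>)

lemma \<Delta>_top: "v \<in> Le N \<Longrightarrow> deg i + deg j = N \<Longrightarrow> coef (\<Delta> v) (i, j) = coef (Z.\<Delta> v) (i, j)"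
  unfolding \<Delta>_def Z.\<Delta>_def by (rule coef_qq) (use D_degree[OF \<sigma>_degree] in auto)

lemma \<Delta>_above:
  assumes v: "v \<in> Le N" and "N < deg i + deg j"
  shows "coef (\<Delta> v) (i, j) = 0"
  unfolding \<Delta>_def
proof (rule coef_qq_0)
  have "{(u, v). u \<in> W \<and> v \<in> W \<and> wdeg u + wdeg v \<le> N}
      \<subseteq> {(u, v). u \<in> W \<and> v \<in> W \<and> wdeg u + wdeg v < deg i + deg j}" using assms(2) by auto
  from lc_mono[OF this] D_degree[OF \<sigma>_degree[OF v]]
  show "D (\<sigma> v) \<in> lc {(u, v). u \<in> W \<and> v \<in> W \<and> wdeg u + wdeg v < deg i + deg j}" by blast
qed

lemma \<Delta>_in: "v \<in> lc IX \<Longrightarrow> \<Delta> v \<in> lc (IX \<times> IX)"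
  unfolding \<Delta>_def by (rule lc_plin[OF plin_tcoord D_lc[OF \<sigma>_lc]])
    (simp_all only: mem_Times_iff tcoord_def lin_ext_pure case_prod_unfold, intro lc_tens q_lc, simp_all only: lc_pure)

lemma \<Delta>_degree: "v \<in> Le N \<Longrightarrow> \<Delta> v \<in> lc {(i, j). i \<in> IX \<and> j \<in> IX \<and> deg i + deg j \<le> N}"
proof -
  assume v: "v \<in> Le N"
  then have "v \<in> lc IX" using lc_mono[of "{i \<in> IX. deg i \<le> N}" IX] by blast
  note in_IX = lc_coef[OF \<Delta>_in[OF this]]
  show ?thesis
  proof (rule lcI)
    fix z assume z: "coef (\<Delta> v) z \<noteq> 0"
    obtain i j where ij: "z = (i, j)" by (cases z)
    have "z \<in> IX \<times> IX" using in_IX[of z] z by blast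
    moreover have "deg i + deg j \<le> N" using \<Delta>_above[OF v, of i j] z unfolding ij by (meson not_le)
    ultimately show "z \<in> {(i, j). i \<in> IX \<and> j \<in> IX \<and> deg i + deg j \<le> N}" by (simp add: ij)
  qed
qed

text \<open>Contraction with \<open>a1_part\<close> and \<open>a2_part\<close> reads off the bidegree \<open>(1, N - 1)\<close> part of \<open>\<Delta>(v)\<close>.\<close>

lemma contract_leading:
  assumes v: "v \<in> Le N" and i: "i \<in> supp v" "deg i = N" "N \<ge> 1"
  obtains f j where "f = a1_part \<or> f = a2_part" "deg j = N - 1" "coef (contract f (\<Delta> v)) j \<noteq> 0"
proof -
  have vIX: "v \<in> lc IX" using v lc_mono[of "{i \<in> IX. deg i \<le> N}" IX] by blast
  \<comment> \<open>The functional sees only left factors of degree 1; with a right factor of degree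
    N - 1 this is the top total degree, where the two coproducts agree.\<close>
  have eq: "coef (contract f (\<Delta> v)) j = coef (contract f (Z.\<Delta> v)) j"
    if f: "f = a1_part \<or> f = a2_part" and j: "deg j = N - 1" for f :: "nat \<times> 'g \<times> nat \<Rightarrow> 'k" and j
  proof -
    define A where "A = supp (\<Delta> v) \<union> supp (Z.\<Delta> v)"
    have "coef (contract f t) j = (\<Sum>x\<in>A. coef t x * (if snd x = j then f (fst x) else 0))" if "supp t \<subseteq> A" for t
      unfolding coef_contract by (rule sum.mono_neutral_left) (use that in \<open>auto simp: A_def in_keys_iff\<close>)
    moreover have "coef (\<Delta> v) x * (if snd x = j then f (fst x) else 0) =
        coef (Z.\<Delta> v) x * (if snd x = j then f (fst x) else 0)" for x
    proof (cases "snd x = j \<and> deg (fst x) = 1")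
      case True
      then show ?thesis using \<Delta>_top[OF v, of "fst x" "snd x"] j i(3) by (cases x) simp
    next
      case False
      then have "snd x \<noteq> j \<or> f (fst x) = 0"
        using f by (cases "fst x") (auto simp: part_defs split: if_splits)
      then show ?thesis by auto
    qed
    ultimately show ?thesis unfolding A_def by (metis (no_types, lifting) Un_upper1 Un_upper2 sum.cong)
  qed
  obtain m h k where mhk: "i = (m, h, k)" by (metis prod_cases3)
  have c: "coef v (m, h, k) \<noteq> 0" using i by (simp add: mhk in_keys_iff)
  show thesis
  proof (cases k)
    case (Suc k')
    have "coef (contract a2_part (Z.\<Delta> v)) (m, h, k') \<noteq> 0"
      using c unfolding Z.coef_contract_\<Delta>[OF vIX] by (simp add: Suc del: of_nat_Suc)
    then show thesis
      using that[of a2_part "(m, h, k')"] eq[of a2_part "(m, h, k')"] i by (auto simp: mhk Suc)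
  next
    case 0
    then obtain m' where m: "m = Suc m'" using i by (cases m) (auto simp: mhk)
    \<comment> \<open>With exponent 0 of a2 on the right the correction term carries the factor
      \<open>1 choose 2\<close>, which is 0, so the coefficient is \<open>Suc m'\<close> times that
      of \<open>v\<close>.\<close>
    have "coef (contract a1_part (Z.\<Delta> v)) (m', h, 0) \<noteq> 0"
      using c unfolding Z.coef_contract_\<Delta>[OF vIX] by (simp add: 0 m numeral_2_eq_2 del: of_nat_Suc)
    then show thesis
      using that[of a1_part "(m', h, 0)"] eq[of a1_part "(m', h, 0)"] i by (auto simp: mhk 0 m)
  qed
qed

text \<open>The \<open>N\<close> obtained is the exact degree of \<open>v\<close>, attained at
  \<open>i\<close>.\<close>

lemma min_degree:
  assumes "v \<in> lc IX" "v \<noteq> 0"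
  obtains N i where "v \<in> Le N" "i \<in> supp v" "deg i = N"
proof -
  have "Max (deg ` supp v) \<in> deg ` supp v" using assms by (intro Max_in) auto
  then obtain i where "i \<in> supp v" "deg i = Max (deg ` supp v)" by auto
  moreover have "deg j \<le> Max (deg ` supp v)" if "j \<in> supp v" for j using that by (intro Max_ge) auto
  then have "v \<in> Le (Max (deg ` supp v))" using assms by (auto simp: lc_def simp del: deg.simps)
  ultimately show thesis using that by blast
qed

lemma contract_\<Delta>_degree:
  assumes "v \<in> Le N" "f = a1_part \<or> f = a2_part"
  shows "contract f (\<Delta> v) \<in> Le (N - 1)"
  unfolding contract_def
proof (rule lc_lin_ext, clarify)
  fix i j assume "(i, j) \<in> supp (\<Delta> v)"
  with \<Delta>_degree[OF assms(1)] have ij: "j \<in> IX" "deg i + deg j \<le> N" by (auto simp: lc_def)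
  show "pscale (f i) (pure j) \<in> Le (N - 1)"
  proof (cases "deg i = 1")
    case True
    with ij show ?thesis by (auto intro!: lc_pscale)
  next
    case False
    then have "f i = 0" using assms(2) by (cases i) (auto simp: part_defs)
    then show ?thesis by simp
  qed
qed

subsection \<open>Subcoalgebras, group-likes and the coradical filtration\<close>

abbreviation gl :: "'g \<Rightarrow> ('g gen list \<Rightarrow>\<^sub>0 'k) set"
  where "gl h \<equiv> cls (var (Grp h))"

lemma gl_closed: "h \<in> carrier G \<Longrightarrow> gl h \<in> carrier H"
  by (auto simp: U_carrier intro!: imageI)

lemma \<kappa>_gl: "h \<in> carrier G \<Longrightarrow> U.qco (gl h) = pure (0, h, 0)"
  by (simp add: qco_cls)

lemma \<Delta>_gl: "h \<in> carrier G \<Longrightarrow> \<Delta> (pure (0, h, 0)) = pure ((0, h, 0), (0, h, 0))"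
  by (simp add: \<Delta>_def sw_def)

lemma subcoalgebra_subspace:
  assumes C: "subcoalgebra H C"
  shows "C \<subseteq> carrier H" and "PV.subspace (U.qco ` C)" and "x \<in> carrier H \<Longrightarrow> U.qco x \<in> U.qco ` C \<Longrightarrow> x \<in> C"
proof -
  show C': "C \<subseteq> carrier H" using C by (simp add: subcoalgebra_def)
  have "U.qco ` C = PV.span (U.qco ` C)"
    using C H.\<kappa>_k_span[OF C'] by (simp add: subcoalgebra_def)
  then show "PV.subspace (U.qco ` C)" by (metis PV.subspace_span)
  show "x \<in> C" if "x \<in> carrier H" "U.qco x \<in> U.qco ` C"
    using that C' H.\<kappa>_inj[of x] by blast
qed

text \<open>The coproduct of \<open>x\<close> has a representative with all factors in
  \<open>C\<close>, and a functional on the left factors leaves a combination of the right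
  ones.\<close>

lemma subcoalgebra_contract:
  assumes C: "subcoalgebra H C" and x: "x \<in> C"
  shows "contract f (\<Delta> (U.qco x)) \<in> U.qco ` C"
proof -
  note sub = subcoalgebra_subspace[OF C]
  obtain s where s: "supp s \<subseteq> C \<times> C" "tensor_eq H H (comult H x) s"
    using C x by (auto simp: subcoalgebra_def)
  have "x \<in> carrier H" using sub x by auto
  then have "\<Delta> (U.qco x) = tcoord U.qco s"
    using H.comult[of x] H.tensor_eq_tcoord[OF s(2)] by simp
  then have "contract f (\<Delta> (U.qco x)) = lin_ext (\<lambda>(a, b). pscale (lin_form f (U.qco a)) (U.qco b)) s"
    by (simp add: contract_tcoord)
  also have "\<dots> \<in> U.qco ` C"
    unfolding lin_ext_def
    by (intro PV.subspace_sum[OF sub(2)] PV.subspace_scale[OF sub(2)])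
      (use s(1) in \<open>auto intro!: PV.subspace_scale[OF sub(2)]\<close>)
  finally show ?thesis .
qed

text \<open>A nonzero element of least degree must have degree 0, since a contraction would produce
  a nonzero element of smaller degree. In degree 0 the coproduct is diagonal on the group elements,
  so a single one can be split off.\<close>

lemma subcoalgebra_contains_grouplike:
  assumes C: "subcoalgebra H C" and ne: "C \<noteq> {\<zero>\<^bsub>H\<^esub>}"
  obtains h where "h \<in> carrier G" "gl h \<in> C"
proof -
  note sub = subcoalgebra_subspace[OF C]
  have "0 \<in> U.qco ` C" using sub(2) by (rule PV.subspace_0)
  then have "\<zero>\<^bsub>H\<^esub> \<in> C" by (intro sub(3) H.zero_closed) (simp only: H.\<kappa>_zero)
  with ne obtain x where x: "x \<in> C" "x \<noteq> \<zero>\<^bsub>H\<^esub>" by blast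
  have "\<exists>v N. v \<in> U.qco ` C \<and> v \<noteq> 0 \<and> v \<in> Le N"
  proof -
    have xc: "x \<in> carrier H" using x sub by auto
    then have "U.qco x \<noteq> 0" using x H.\<kappa>_inj[of x "\<zero>\<^bsub>H\<^esub>"] H.\<kappa>_zero by auto
    moreover from min_degree[OF H.\<kappa>_closed[OF xc] this] obtain M i where "U.qco x \<in> Le M" .
    ultimately show ?thesis using imageI[OF x(1), of U.qco] by (intro exI conjI)
  qed
  then obtain N0 where N0: "\<exists>v. v \<in> U.qco ` C \<and> v \<noteq> 0 \<and> v \<in> Le N0" by blast
  define N where "N = (LEAST N. \<exists>v. v \<in> U.qco ` C \<and> v \<noteq> 0 \<and> v \<in> Le N)"
  have "\<exists>v. v \<in> U.qco ` C \<and> v \<noteq> 0 \<and> v \<in> Le N"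
    unfolding N_def by (rule LeastI[where P = "\<lambda>N. \<exists>v. v \<in> U.qco ` C \<and> v \<noteq> 0 \<and> v \<in> Le N", OF N0])
  then obtain y where y: "y \<in> C" "U.qco y \<noteq> 0" "U.qco y \<in> Le N" by blast
  have min: "N \<le> M" if "v \<in> U.qco ` C" "v \<noteq> 0" "v \<in> Le M" for v M
    unfolding N_def by (rule Least_le) (use that in blast)
  have yIX: "U.qco y \<in> lc IX" using y sub H.\<kappa>_closed by auto
  \<comment> \<open>The contraction with a degree 1 functional is nonzero, stays in \<open>C\<close>
    and has degree at most N - 1, against minimality.\<close>
  have N: "N = 0"
  proof (rule ccontr)
    assume "N \<noteq> 0"
    from min_degree[OF yIX y(2)] obtain M i where M: "U.qco y \<in> Le M" "i \<in> supp (U.qco y)" "deg i = M" .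
    with y(3) have "M \<le> N" by (auto simp: lc_def)
    with min[of "U.qco y" M] y M have "M = N" by auto
    with \<open>N \<noteq> 0\<close> have "1 \<le> M" by simp
    from contract_leading[OF M this] obtain f :: "nat \<times> 'g \<times> nat \<Rightarrow> 'k" and j where f: "f = a1_part \<or> f = a2_part"
      and "coef (contract f (\<Delta> (U.qco y))) j \<noteq> 0" .
    then have "contract f (\<Delta> (U.qco y)) \<noteq> 0" by auto
    with min[OF subcoalgebra_contract[OF C y(1)] _ contract_\<Delta>_degree[OF y(3) f]] \<open>N \<noteq> 0\<close>
    show False by simp
  qed
  obtain i where i: "i \<in> supp (U.qco y)" using y(2) by (metis ex_in_conv keys_eq_empty)
  with y(3) N obtain h where h: "i = (0, h, 0)" "h \<in> carrier G" by (cases i) (auto simp: lc_def IX_def)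
  \<comment> \<open>The coordinate functional of h; contracting with it isolates the h-part of the
    element.\<close>
  define f where "f j = (if j = (0, h, 0) then 1 else 0 :: 'k)" for j :: "nat \<times> 'g \<times> nat"
  define v where "v = U.qco y"
  have "contract f (\<Delta> v) = pscale (coef v (0, h, 0)) (pure (0, h, 0))"
  proof -
    have "supp v \<subseteq> {i \<in> IX. deg i \<le> 0}" using y(3) N by (simp add: lc_def v_def)
    then show ?thesis
    proof (induction v rule: linear_induct)
      case (pure i)
      then obtain t where "i = (0, t, 0)" "t \<in> carrier G" by (cases i) (auto simp: IX_def)
      then show ?case by (simp add: \<Delta>_gl f_def lookup_single)
    qed (auto simp: \<Delta>_rules contract_rules lookup_add pscale_add_left)
  qed
  then have "pscale (coef v (0, h, 0)) (pure (0, h, 0)) \<in> U.qco ` C"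
    using subcoalgebra_contract[OF C y(1), of f] by (simp add: v_def)
  then have "pscale (inverse (coef v (0, h, 0))) (pscale (coef v (0, h, 0)) (pure (0, h, 0))) \<in> U.qco ` C"
    by (rule PV.subspace_scale[OF sub(2)])
  moreover have "coef v (0, h, 0) \<noteq> 0" using i by (simp add: h v_def in_keys_iff)
  ultimately have "gl h \<in> C" by (intro sub(3)) (use h gl_closed[OF h(2)] in \<open>simp_all add: \<kappa>_gl\<close>)
  with h(2) show thesis by (rule that)
qed

lemma line_iff:
  assumes "x \<in> carrier H"
  shows "y \<in> k_span H {x} \<longleftrightarrow> (\<exists>c. y = c \<cdot>\<^bsub>H\<^esub> x)"
proof -
  have "y \<in> k_span H {x} \<longleftrightarrow> y \<in> carrier H \<and> (\<exists>c. U.qco y = pscale c (U.qco x))"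
    using H.k_span_iff[of "{x}" y] assms by (auto simp: PV.span_singleton)
  also have "\<dots> \<longleftrightarrow> (\<exists>c. y = c \<cdot>\<^bsub>H\<^esub> x)"
    using assms H.\<kappa>_inj[of y] H.scale[OF assms] by metis
  finally show ?thesis .
qed

lemma line_subcoalgebra:
  assumes x: "x \<in> carrier H" and gr: "tensor_eq H H (comult H x) (pure (x, x))"
  shows "subcoalgebra H (k_span H {x})"
  unfolding subcoalgebra_def
proof (intro conjI ballI)
  have sub: "k_span H {x} \<subseteq> carrier H" by (rule H.k_span_subset) (use x in simp)
  then show "k_span H {x} \<subseteq> carrier H" .
  show "k_span H (k_span H {x}) = k_span H {x}"
    by (rule H.k_span_eqI[OF sub sub]) (use x in \<open>simp add: H.\<kappa>_k_span PV.span_span\<close>)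
  fix y assume "y \<in> k_span H {x}"
  then obtain c where y: "y = c \<cdot>\<^bsub>H\<^esub> x" using line_iff[OF x] by auto
  have xx: "x \<in> k_span H {x}" using H.k_span_superset[of "{x}"] x by auto
  have "tensor_eq H H (comult H y) (pscale c (pure (x, x)))"
  proof (subst H.tensor_eq_iff)
    have "tcoord U.qco (comult H x) = tens (U.qco x) (U.qco x)"
      using H.tensor_eq_tcoord[OF gr] by simp
    then show "tcoord U.qco (comult H y) = tcoord U.qco (pscale c (pure (x, x)))"
      using x H.comult[of x] H.comult[of y] by (simp add: y H.scale \<Delta>_rules del: H_simps)
    show "supp (comult H y) \<subseteq> carrier H \<times> carrier H"
      using x H.comult[of y] by (simp add: y H.scale del: H_simps)
    show "supp (pscale c (pure (x, x))) \<subseteq> carrier H \<times> carrier H"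
      using x by (simp add: supp_pscale)
  qed
  moreover have "supp (pscale c (pure (x, x))) \<subseteq> k_span H {x} \<times> k_span H {x}"
    using xx by (simp add: supp_pscale)
  ultimately show "\<exists>s. supp s \<subseteq> k_span H {x} \<times> k_span H {x} \<and> tensor_eq H H (comult H y) s" by blast
qed

lemma comult_gl: "h \<in> carrier G \<Longrightarrow> tensor_eq H H (comult H (gl h)) (pure (gl h, gl h))"
  by (subst H.tensor_eq_iff)
    (use H.comult[OF gl_closed[of h]] gl_closed[of h] in \<open>simp_all add: \<kappa>_gl \<Delta>_gl del: H_simps\<close>)

lemma line_simple:
  assumes h: "h \<in> carrier G"
  shows "simple_subcoalgebra H (k_span H {gl h})"
  unfolding simple_subcoalgebra_def
proof (intro conjI allI impI)
  note sc = line_subcoalgebra[OF gl_closed[OF h] comult_gl[OF h]]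
  then show "subcoalgebra H (k_span H {gl h})" .
  have "gl h \<in> k_span H {gl h}" using H.k_span_superset[of "{gl h}"] gl_closed[OF h] by auto
  moreover have "gl h \<noteq> \<zero>\<^bsub>H\<^esub>" using \<kappa>_gl[OF h] H.\<kappa>_zero by auto
  ultimately show "k_span H {gl h} \<noteq> {\<zero>\<^bsub>H\<^esub>}" by auto
  fix Q assume Q: "subcoalgebra H Q" "Q \<subseteq> k_span H {gl h}"
  show "Q = {\<zero>\<^bsub>H\<^esub>} \<or> Q = k_span H {gl h}"
  proof (rule disjCI)
    assume "Q \<noteq> k_span H {gl h}"
    show "Q = {\<zero>\<^bsub>H\<^esub>}"
    proof (rule ccontr)
      assume "Q \<noteq> {\<zero>\<^bsub>H\<^esub>}"
      from subcoalgebra_contains_grouplike[OF Q(1) this] obtain t where t: "t \<in> carrier G" "gl t \<in> Q" .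
      with Q(2) line_iff[OF gl_closed[OF h]] obtain c where "gl t = c \<cdot>\<^bsub>H\<^esub> gl h" by blast
      then have "U.qco (gl t) = pscale c (U.qco (gl h))"
        using H.scale[OF gl_closed[OF h], of c] by (simp only:)
      then have "pure (0 :: nat, t, 0 :: nat) = pscale c (pure (0, h, 0) :: _ \<Rightarrow>\<^sub>0 'k)"
        by (simp only: \<kappa>_gl[OF h] \<kappa>_gl[OF t(1)])
      from arg_cong[OF this, of "\<lambda>p. coef p (0, t, 0)"] have "t = h"
        by (auto simp: lookup_single when_def split: if_splits)
      with t(2) have "PV.span (U.qco ` {gl h}) \<subseteq> U.qco ` Q"
        using subcoalgebra_subspace[OF Q(1)] by (intro PV.span_minimal) auto
      then have "k_span H {gl h} \<subseteq> Q"
        using H.k_span_iff[of "{gl h}"] gl_closed[OF h] subcoalgebra_subspace(3)[OF Q(1)] by auto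
      with Q(2) \<open>Q \<noteq> k_span H {gl h}\<close> show False by auto
    qed
  qed
qed

lemma simple_iff: "simple_subcoalgebra H C \<longleftrightarrow> (\<exists>h\<in>carrier G. C = k_span H {gl h})"
proof
  assume C: "simple_subcoalgebra H C"
  then have sub: "subcoalgebra H C" "C \<noteq> {\<zero>\<^bsub>H\<^esub>}" by (auto simp: simple_subcoalgebra_def)
  from subcoalgebra_contains_grouplike[OF this] obtain h where h: "h \<in> carrier G" "gl h \<in> C" .
  have "PV.span (U.qco ` {gl h}) \<subseteq> U.qco ` C"
    using subcoalgebra_subspace[OF sub(1)] h by (intro PV.span_minimal) auto
  then have "k_span H {gl h} \<subseteq> C"
    using H.k_span_iff[of "{gl h}"] gl_closed[OF h(1)] subcoalgebra_subspace(3)[OF sub(1)] by auto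
  with C line_simple[OF h(1)] h(1) show "\<exists>h\<in>carrier G. C = k_span H {gl h}"
    unfolding simple_subcoalgebra_def by metis
qed (use line_simple in auto)

text \<open>Both bounds are needed, as \<open>k_dim\<close> is a dummy without a finite basis: the
  lower one certifies that the line has dimension exactly 1.\<close>

lemma pointed_H: "pointed H"
  unfolding pointed_def
proof (intro allI impI)
  fix C assume "simple_subcoalgebra H C"
  then obtain h where h: "h \<in> carrier G" "C = k_span H {gl h}" using simple_iff by auto
  have S: "{gl h} \<subseteq> carrier H" using gl_closed[OF h(1)] by auto
  have im: "U.qco ` C = lc {(0, h, 0)}"
    unfolding h(2) H.\<kappa>_k_span[OF S] using span_pure[of "{(0, h, 0)}"] \<kappa>_gl[OF h(1)] by simp
  have "k_dim H C \<le> card {(0 :: nat, h, 0 :: nat)}"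
    by (rule H.k_dim_le) (use im H.k_span_subset[OF S] in \<open>auto simp: h(2)\<close>)
  moreover have "card {(0 :: nat, h, 0 :: nat)} \<le> k_dim H C"
    by (rule H.k_dim_ge[OF S h(2), where Y = "{(0, h, 0)}"]) (use im in auto)
  ultimately show "k_dim H C = 1" by simp
qed

text \<open>A group-like x spans a one-dimensional subcoalgebra, which contains some h = c x.
  Comparing coefficients in \<Delta>(x) = x \<otimes> x gives 1/c = 1/c^2, so c = 1.\<close>

lemma grouplikes_H: "grouplikes H = gl ` carrier G"
proof safe
  fix h assume h: "h \<in> carrier G"
  have "gl h \<noteq> \<zero>\<^bsub>H\<^esub>" using \<kappa>_gl[OF h] H.\<kappa>_zero by auto
  then show "gl h \<in> grouplikes H"
    using gl_closed[OF h] comult_gl[OF h] by (simp add: grouplikes_def del: H_simps)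
next
  fix x assume "x \<in> grouplikes H"
  then have x: "x \<in> carrier H" "x \<noteq> \<zero>\<^bsub>H\<^esub>" "tensor_eq H H (comult H x) (pure (x, x))"
    by (auto simp: grouplikes_def simp del: H_simps)
  have "x \<in> k_span H {x}" using H.k_span_superset[of "{x}"] x by auto
  with x have "k_span H {x} \<noteq> {\<zero>\<^bsub>H\<^esub>}" by auto
  from subcoalgebra_contains_grouplike[OF line_subcoalgebra[OF x(1,3)] this]
  obtain h where h: "h \<in> carrier G" "gl h \<in> k_span H {x}" .
  then obtain c where c: "gl h = c \<cdot>\<^bsub>H\<^esub> x" using line_iff[OF x(1)] by auto
  then have "pure (0, h, 0) = pscale c (U.qco x)"
    using \<kappa>_gl[OF h(1)] H.scale[OF x(1), of c] by simp
  then have "pscale (inverse c) (pure (0, h, 0)) = U.qco x" and c0: "c \<noteq> 0"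
    by (metis pscale_eq_0_iff pscale_one pscale_pscale pure_neq_0 left_inverse) (use \<open>pure (0, h, 0) = _\<close> in auto)
  then have kx: "U.qco x = pscale (inverse c) (pure (0, h, 0))" by simp
  have "\<Delta> (U.qco x) = tens (U.qco x) (U.qco x)"
    using H.comult[OF x(1)] H.tensor_eq_tcoord[OF x(3)] by simp
  then have "pscale (inverse c) (pure ((0, h, 0), (0, h, 0))) =
      pscale (inverse c * inverse c) (pure ((0 :: nat, h, 0 :: nat), (0 :: nat, h, 0 :: nat)) :: _ \<Rightarrow>\<^sub>0 'k)"
    by (simp add: kx \<Delta>_rules \<Delta>_gl[OF h(1)] tens_simps)
  then have "coef (pscale (inverse c) (pure ((0, h, 0), (0, h, 0)))) ((0, h, 0), (0, h, 0)) =
      coef (pscale (inverse c * inverse c) (pure ((0 :: nat, h, 0 :: nat), (0 :: nat, h, 0 :: nat)) :: _ \<Rightarrow>\<^sub>0 'k)) ((0, h, 0), (0, h, 0))"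
    by simp
  then have "c = 1" using c0 by simp
  then have "x = gl h" using kx \<kappa>_gl[OF h(1)] gl_closed[OF h(1)] x(1) by (intro H.\<kappa>_inj) simp_all
  with h(1) show "x \<in> gl ` carrier G" by auto
qed

lemma coradical_H: "x \<in> coradical H \<longleftrightarrow> x \<in> carrier H \<and> U.qco x \<in> Le 0"
proof -
  define B where "B = \<Union>{C. simple_subcoalgebra H C}"
  have BE: "B = (\<Union>h\<in>carrier G. k_span H {gl h})" unfolding B_def using simple_iff by auto
  have sub: "B \<subseteq> carrier H" unfolding BE using H.k_span_subset gl_closed by blast
  have Le0: "{i \<in> IX. deg i \<le> 0} = (\<lambda>h. (0, h, 0)) ` carrier G" by (force simp: IX_def)
  have "PV.span (U.qco ` B) = Le 0"
  proof
    show "PV.span (U.qco ` B) \<subseteq> Le 0"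
    proof (rule PV.span_minimal)
      have "c \<cdot>\<^bsub>H\<^esub> gl h \<in> carrier H \<and> U.qco (c \<cdot>\<^bsub>H\<^esub> gl h) \<in> Le 0" if "h \<in> carrier G" for c h
        using H.scale[OF gl_closed[OF that]] that \<kappa>_gl[OF that] by (auto simp: IX_def intro!: lc_pscale)
      then show "U.qco ` B \<subseteq> Le 0" unfolding BE using line_iff[OF gl_closed] by auto
    qed (auto simp: PV.subspace_def intro!: lc_intros)
    have "gl h \<in> B" if "h \<in> carrier G" for h
      unfolding BE using that H.k_span_superset[of "{gl h}"] gl_closed[OF that] by auto
    then have "pure ` (\<lambda>h. (0, h, 0)) ` carrier G \<subseteq> U.qco ` B"
      using \<kappa>_gl by (force simp: image_iff)
    from PV.span_mono[OF this] show "Le 0 \<subseteq> PV.span (U.qco ` B)" unfolding Le0 span_pure .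
  qed
  then show ?thesis
    unfolding coradical_def B_def[symmetric] H.k_span_iff[OF sub] by simp
qed

text \<open>An element of degree above n + 1 has a nonzero part in bidegree (1, N - 1), which the
  condition on representatives excludes. Conversely, if the bidegrees of the coproduct sum to at
  most n + 1, every term has left degree 0 or right degree at most n.\<close>

lemma corad_filt_H: "x \<in> corad_filt H n \<longleftrightarrow> x \<in> carrier H \<and> U.qco x \<in> Le n"
proof (induction n arbitrary: x)
  case 0
  show ?case by (simp only: corad_filt.simps coradical_H)
next
  case (Suc n)
  show ?case
  proof (intro iffI conjI)
    assume "x \<in> corad_filt H (Suc n)"
    then show "x \<in> carrier H" by simp
  next
    assume "x \<in> corad_filt H (Suc n)"
    then obtain s where x: "x \<in> carrier H" and s: "supp s \<subseteq> carrier H \<times> corad_filt H n \<union> coradical H \<times> carrier H"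
      "tensor_eq H H (comult H x) s" by auto
    show "U.qco x \<in> Le (Suc n)"
    proof (cases "U.qco x = 0")
      case False
      from min_degree[OF H.\<kappa>_closed[OF x] False] obtain N i where
        N: "U.qco x \<in> Le N" "i \<in> supp (U.qco x)" "deg i = N" .
      have "N \<le> Suc n"
      proof (rule ccontr)
        assume "\<not> N \<le> Suc n"
        then have "1 \<le> N" by simp
        from contract_leading[OF N this] obtain f :: "nat \<times> 'g \<times> nat \<Rightarrow> 'k" and j
          where f: "f = a1_part \<or> f = a2_part" "deg j = N - 1" "coef (contract f (\<Delta> (U.qco x))) j \<noteq> 0" .
        have "\<Delta> (U.qco x) = tcoord U.qco s"
          using H.comult[OF x] H.tensor_eq_tcoord[OF s(2)] by simp
        then have "coef (contract f (\<Delta> (U.qco x))) j =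
            (\<Sum>y\<in>supp s. coef s y * (lin_form f (U.qco (fst y)) * coef (U.qco (snd y)) j))"
          by (simp add: contract_tcoord coef_lin_ext case_prod_unfold)
        \<comment> \<open>Each tensor of \<open>s\<close> has a right factor of degree at most n,
          below N - 1, or a left factor of degree 0, on which \<open>f\<close> vanishes.\<close>
        also have "\<dots> = 0"
        proof (rule sum.neutral, rule ballI)
          fix y assume "y \<in> supp s"
          with s(1) have "U.qco (snd y) \<in> Le n \<or> U.qco (fst y) \<in> Le 0"
            using Suc.IH coradical_H by auto
          then show "coef s y * (lin_form f (U.qco (fst y)) * coef (U.qco (snd y)) j) = 0"
          proof
            assume "U.qco (snd y) \<in> Le n"
            then have "coef (U.qco (snd y)) j = 0"
              by (rule lc_coef) (use f(2) \<open>\<not> N \<le> Suc n\<close> in auto)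
            then show ?thesis by simp
          next
            assume "U.qco (fst y) \<in> Le 0"
            then have "lin_form f (U.qco (fst y)) = 0"
              unfolding lin_form_def using f(1)
              by (intro sum.neutral) (auto simp: lc_def part_defs dest!: subsetD)
            then show ?thesis by simp
          qed
        qed
        finally show False using f(3) by simp
      qed
      then show ?thesis using N(1) lc_mono[of "{i \<in> IX. deg i \<le> N}" "{i \<in> IX. deg i \<le> Suc n}"] by fastforce
    qed simp
  next
    assume "x \<in> carrier H \<and> U.qco x \<in> Le (Suc n)"
    then have x: "x \<in> carrier H" "U.qco x \<in> Le (Suc n)" by auto
    define s where "s = H.basis_rep (\<Delta> (U.qco x))"
    have "tensor_eq H H (comult H x) s"
      using H.tensor_null_basis_rep[of "comult H x"] H.comult[OF x(1)] by (simp add: s_def tensor_eq_def)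
    moreover have "supp s \<subseteq> carrier H \<times> corad_filt H n \<union> coradical H \<times> carrier H"
      unfolding s_def H.basis_rep_def
    proof (rule supp_lin_ext_subset)
      fix z assume "z \<in> supp (\<Delta> (U.qco x))"
      then obtain i j where z: "z = (i, j)" and ij: "i \<in> IX" "j \<in> IX" "deg i + deg j \<le> Suc n"
        using \<Delta>_degree[OF x(2)] by (cases z) (auto simp: lc_def)
      define a b where ab: "a = H.elt (pure i)" "b = H.elt (pure j)"
      have cl: "a \<in> carrier H" "b \<in> carrier H" unfolding ab using ij by (intro H.elt_pure_closed; blast)+
      have \<kappa>: "U.qco a = pure i" "U.qco b = pure j" unfolding ab using ij by (simp_all add: H.\<kappa>_elt)
      \<comment> \<open>If the left degree is positive, the right one is at most n.\<close>
      have "a \<in> coradical H \<or> b \<in> corad_filt H n"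
      proof (cases "deg i = 0")
        case True
        then have "a \<in> coradical H" using coradical_H[of a] cl \<kappa> ij by simp
        then show ?thesis ..
      next
        case False
        then have "b \<in> corad_filt H n" using Suc.IH[of b] cl \<kappa> ij by simp
        then show ?thesis ..
      qed
      with cl show "supp (case z of (i, j) \<Rightarrow> pure (H.elt (pure i), H.elt (pure j)))
          \<subseteq> carrier H \<times> corad_filt H n \<union> coradical H \<times> carrier H"
        by (auto simp: z ab[symmetric])
    qed
    ultimately show "x \<in> corad_filt H (Suc n)" using x(1) by auto
  qed
qed

end

section \<open>Existence and uniqueness of the Hopf structure\<close>

context lift_pair
begin

lemma lift_gen_eq: "lift_gen G g \<eta> \<xi> lam x = cls (var x)"
  by (simp add: lift_gen_def)

lemma skew_primitive_H:
  assumes "x = A1 \<or> x = A2"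
  shows "cls (var x) \<in> skew_primitives H (gl g) \<one>\<^bsub>H\<^esub>"
proof -
  have x: "x \<in> lift_gens G" using assms by auto
  have cl: "cls (var x) \<in> carrier H" using x by (auto simp: U_carrier intro!: imageI)
  have "gen_comult x = pure ([x], []) + pure ([Grp g], [x])" using assms by auto
  then have "\<Delta> (q (pure [x])) = tens (q (pure [x])) (q (pure [])) + tens (q (pure [Grp g])) (q (pure [x]))"
    using \<Delta>_q_pure[of "[x]"] x by (simp add: conv_simps del: q_pure)
  then have "tcoord U.qco (comult H (cls (var x))) = tcoord U.qco (pure (cls (var x), \<one>\<^bsub>H\<^esub>) + pure (gl g, cls (var x)))"
    using H.comult[OF cl] x by (simp add: qco_cls U_one del: q_pure)
  moreover have "supp (pure (cls (var x), \<one>\<^bsub>H\<^esub>) + pure (gl g, cls (var x)) :: _ \<Rightarrow>\<^sub>0 'k) \<subseteq> carrier H \<times> carrier H"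
    by (rule order_trans[OF keys_add]) (use cl H.one gl_closed in auto)
  ultimately have "tensor_eq H H (comult H (cls (var x))) (pure (cls (var x), \<one>\<^bsub>H\<^esub>) + pure (gl g, cls (var x)))"
    using H.comult[OF cl] by (subst H.tensor_eq_iff) auto
  with cl show ?thesis by (simp add: skew_primitives_def del: H_simps)
qed

lemma lift_hopf_H: "lift_hopf G g \<eta> \<xi> lam H"
  unfolding lift_hopf_def Let_def lift_gen_eq
  using H.hopf_algebra_realized grouplikes_H skew_primitive_H by simp

text \<open>The conditions fix the coproduct on generators, and multiplicativity extends this to
  words, hence to all classes. The counit is then forced by the counit axioms.\<close>

lemma lift_hopf_unique:
  assumes H': "lift_hopf G g \<eta> \<xi> lam H'"
  shows "same_coalgebra H H'"
proof -
  have hopf: "hopf_algebra H'" and trunc: "kalg.truncate H' = U"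
    and gr: "grouplikes H' = gl ` carrier G"
    and skew: "\<And>x. x = A1 \<or> x = A2 \<Longrightarrow> cls (var x) \<in> skew_primitives H' (gl g) \<one>\<^bsub>H'\<^esub>"
    using H' unfolding lift_hopf_def Let_def lift_gen_eq by auto
  interpret K: hopf_algebra H' by (rule hopf)
  have "f (kalg.truncate H') = f U" for f :: "_ \<Rightarrow> 'z" using trunc by simp
  then have U: "carrier H' = carrier U" "monoid.mult H' = monoid.mult U" "one H' = one U" "add H' = add U"
    "zero H' = zero U" "kscale H' = kscale U"
    unfolding trunc[symmetric] by (simp_all add: kalg.truncate_def)
  interpret K: coords H' U.qco IX
    by unfold_locales (use UC.\<kappa>_bij UC.\<kappa>_add UC.\<kappa>_scale in \<open>simp_all add: U\<close>)
  have supp: "supp (comult H' x) \<subseteq> carrier H \<times> carrier H" if "x \<in> carrier U" for x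
    using K.comult_closed[of x] that by (simp add: U)
  have one: "U.qco \<one>\<^bsub>H'\<^esub> = vac" using H.one by (simp add: U)
  have gens: "tcoord U.qco (comult H' (cls (var x))) = qq (gen_comult x)" if x: "x \<in> lift_gens G" for x
  proof (cases x)
    case (Grp h)
    then have "gl h \<in> grouplikes H'" using x by (auto simp: gr)
    then have "tensor_eq H' H' (comult H' (gl h)) (pure (gl h, gl h))" by (simp add: grouplikes_def)
    from K.tensor_eq_tcoord[OF this] show ?thesis using Grp x by (simp add: qco_cls del: q_pure)
  next
    case A1
    have "tensor_eq H' H' (comult H' (cls (var x))) (pure (cls (var x), \<one>\<^bsub>H'\<^esub>) + pure (gl g, cls (var x)))"
      using skew[of A1] by (simp add: A1 skew_primitives_def)
    from K.tensor_eq_tcoord[OF this] show ?thesis by (simp add: A1 qco_cls one)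
  next
    case A2
    have "tensor_eq H' H' (comult H' (cls (var x))) (pure (cls (var x), \<one>\<^bsub>H'\<^esub>) + pure (gl g, cls (var x)))"
      using skew[of A2] by (simp add: A2 skew_primitives_def)
    from K.tensor_eq_tcoord[OF this] show ?thesis by (simp add: A2 qco_cls one)
  qed
  have words: "tcoord U.qco (comult H' (cls (pure w))) = qq (wd w)" if "w \<in> W" for w
    using that
  proof (induction w)
    case Nil
    from K.tensor_eq_tcoord[OF K.comult_one] show ?case
      using one by (simp add: U U_one)
  next
    case (Cons x w)
    then have x: "x \<in> lift_gens G" and w: "w \<in> W" by auto
    have cl: "cls (var x) \<in> carrier U" "cls (pure w) \<in> carrier U"
      using x w by (auto simp: U_carrier simp del: lists.simps in_lists_conv_set)
    have "cls (pure (x # w)) = cls (var x) \<otimes>\<^bsub>H'\<^esub> cls (pure w)"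
      using x w by (simp add: U U_mult del: lists.simps in_lists_conv_set)
    moreover have "tensor_mult H' = tensor_mult H"
      by (simp add: tensor_mult_def fun_eq_iff U)
    ultimately have "tcoord U.qco (comult H' (cls (pure (x # w)))) =
        tcoord U.qco (tensor_mult H (comult H' (cls (var x))) (comult H' (cls (pure w))))"
      using K.tensor_eq_tcoord[OF K.comult_mult[of "cls (var x)" "cls (pure w)"]] cl by (simp add: U)
    also have "\<dots> = \<mu>2 (qq (gen_comult x)) (qq (wd w))"
      using H.tcoord_tensor_mult[OF supp[OF cl(1)] supp[OF cl(2)]] gens[OF x] Cons.IH by (simp add: \<mu>2_def)
    also have "\<dots> = qq (wd (x # w))"
      using qq_wd_Cons[OF x w] by (simp add: T_def)
    finally show ?case .
  qed
  have \<Delta>': "tcoord U.qco (comult H' x) = \<Delta> (U.qco x)" if x: "x \<in> carrier U" for x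
  proof -
    have "tcoord U.qco (comult H' (UC.elt v)) = \<Delta> v" if v: "v \<in> lc IX" for v
    proof -
      have ind: "p \<in> lc W \<and> tcoord U.qco (comult H' (UC.elt (q p))) = qq (D p)" if "supp p \<subseteq> W" for p
        using that
      proof (induction p rule: linear_induct)
        case zero
        \<comment> \<open>That the coproduct of zero is null is extracted from compatibility with
          scaling by 0.\<close>
        have "tensor_eq H' H' (comult H' (0 \<cdot>\<^bsub>H'\<^esub> \<zero>\<^bsub>H'\<^esub>)) (pscale 0 (comult H' \<zero>\<^bsub>H'\<^esub>))"
          by (rule K.comult_scale) simp
        from K.tensor_eq_tcoord[OF this] show ?case
          using K.kscale_zero[of "\<zero>\<^bsub>H'\<^esub>"] by (simp add: q_rules D_rules UC.elt_zero U[symmetric])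
      next
        case (add p r)
        then have c: "q p \<in> lc IX" "q r \<in> lc IX" by (auto intro: q_lc)
        from K.tensor_eq_tcoord[OF K.comult_add[of "UC.elt (q p)" "UC.elt (q r)"]] UC.elt_closed[OF c(1)] UC.elt_closed[OF c(2)]
        show ?case using add by (simp add: U q_rules D_rules UC.elt_add[OF c] lc_add)
      next
        case (scale c p)
        then have p: "q p \<in> lc IX" by (auto intro: q_lc)
        from K.tensor_eq_tcoord[OF K.comult_scale[of "UC.elt (q p)" c]] UC.elt_closed[OF p]
        show ?case using scale by (simp add: U q_rules D_rules UC.elt_pscale[OF p] lc_pscale)
      next
        case (pure w)
        then show ?case using words[of w] elt_q[of "pure w"] by (simp del: q_pure lists.simps in_lists_conv_set)
      qed
      obtain p where p: "p \<in> lc W" "q p = v" using q_surj[OF v] by blast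
      with ind[of p] \<Delta>_q[OF p(1)] show ?thesis by (simp add: lc_def del: lists.simps in_lists_conv_set)
    qed
    then show ?thesis using x UC.\<kappa>_closed[OF x] UC.elt_\<kappa>[OF x] by metis
  qed
  show ?thesis
    unfolding same_coalgebra_def
  proof (intro ballI conjI)
    fix x assume x: "x \<in> carrier H"
    show "tensor_eq H H (comult H x) (comult H' x)"
      using H.comult[OF x] supp[of x] \<Delta>'[of x] x by (subst H.tensor_eq_iff) auto
    define e' where "e' i = counit H' (UC.elt (pure i))" for i
    have e': "counit H' y = lin_form e' (U.qco y)" if y: "y \<in> carrier U" for y
    proof -
      have "supp v \<subseteq> IX \<Longrightarrow> v \<in> lc IX \<and> counit H' (UC.elt v) = lin_form e' v" for v
      proof (induction v rule: linear_induct)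
        case zero
        have "counit H' (0 \<cdot>\<^bsub>H'\<^esub> \<zero>\<^bsub>H'\<^esub>) = 0 * counit H' \<zero>\<^bsub>H'\<^esub>" by (rule K.counit_scale) simp
        then show ?case using K.kscale_zero[of "\<zero>\<^bsub>H'\<^esub>"] by (simp add: U UC.elt_zero)
      next
        case (add v w)
        then show ?case
          using K.counit_add[of "UC.elt v" "UC.elt w"] UC.elt_closed by (simp add: U UC.elt_add lin_form_simps lc_add)
      next
        case (scale c v)
        then show ?case
          using K.counit_scale[of "UC.elt v" c] UC.elt_closed by (simp add: U UC.elt_pscale lin_form_simps lc_pscale)
      qed (simp add: e'_def)
      from this[of "U.qco y"] UC.\<kappa>_closed[OF y] UC.elt_\<kappa>[OF y] show ?thesis by (simp add: lc_def)
    qed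
    have "x = lincomb H' (\<lambda>(a, b). counit H' a \<cdot>\<^bsub>H'\<^esub> b) (comult H' x)"
      using K.counit_left[of x] x by (simp add: U)
    also have "U.qco \<dots> = lin_ext (\<lambda>y. U.qco (case y of (a, b) \<Rightarrow> counit H' a \<cdot>\<^bsub>H'\<^esub> b)) (comult H' x)"
      by (rule K.\<kappa>_lincomb) (use supp[of x] x in \<open>auto simp: U intro!: UC.kscale_closed\<close>)
    also have "\<dots> = lin_ext (\<lambda>(a, b). pscale (lin_form e' (U.qco a)) (U.qco b)) (comult H' x)"
      by (rule lin_ext_cong) (use supp[of x] x in \<open>auto simp: U e' UC.\<kappa>_scale\<close>)
    also have "\<dots> = contract e' (\<Delta> (U.qco x))"
      using \<Delta>'[of x] x by (simp add: contract_tcoord[symmetric])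
    finally have 1: "U.qco x = contract e' (\<Delta> (U.qco x))" .
    \<comment> \<open>Applying both counits to the two factors of the coproduct of x gives one
      counit of x when summed in one order and the other one in the other order.\<close>
    have 2: "lin_form ep (contract e' t) = lin_form e' (lin_ext (\<lambda>(i, j). pscale (ep j) (pure i)) t)" for t
      by (induction t rule: linear_induct[OF subset_UNIV])
        (auto simp: contract_rules lin_form_simps lin_ext_simps mult.commute)
    have "counit H x = lin_form ep (U.qco x)" using H.counit[OF x] .
    also have "\<dots> = lin_form e' (U.qco x)"
      using 2[of "\<Delta> (U.qco x)"] 1 \<Delta>_counit(2)[OF H.\<kappa>_closed[OF x]] by simp
    also have "\<dots> = counit H' x" using e'[of x] x by simp
    finally show "counit H x = counit H' x" .
  qed
qed

end

section \<open>The associated graded Hopf algebra\<close>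

definition hc :: "nat \<Rightarrow> (nat \<times> 'g \<times> nat \<Rightarrow>\<^sub>0 'k::field) \<Rightarrow> (nat \<times> 'g \<times> nat \<Rightarrow>\<^sub>0 'k)"
  where "hc n = lin_ext (\<lambda>i. if deg i = n then pure i else 0)"

lemma plin_hc: "plin (hc n)"
  by (simp add: hc_def)

lemmas hc_rules = plin_rules[OF plin_hc]

lemma hc_pure [simp]: "hc n (pure i) = (if deg i = n then pure i else 0)"
  by (simp add: hc_def)

lemma coef_hc: "coef (hc n v) i = (if deg i = n then coef v i else 0)"
  by (induction v rule: linear_induct[OF subset_UNIV])
    (auto simp: hc_rules lookup_add lookup_single when_def)

lemma hc_lc: "v \<in> lc I \<Longrightarrow> hc n v \<in> lc {i \<in> I. deg i = n}"
  by (auto simp: lc_def in_keys_iff coef_hc split: if_splits)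

lemma hc_eq_0_iff: "hc n v = 0 \<longleftrightarrow> (\<forall>i. deg i = n \<longrightarrow> coef v i = 0)"
  by (auto simp: poly_mapping_eq_iff fun_eq_iff coef_hc)

text \<open>Projection of a tensor onto the part of total degree \<open>n\<close>.\<close>

definition tp :: "nat \<Rightarrow> ((nat \<times> 'g \<times> nat) \<times> (nat \<times> 'g \<times> nat) \<Rightarrow>\<^sub>0 'k::field) \<Rightarrow> _"
  where "tp n = lin_ext (\<lambda>(i, j). if deg i + deg j = n then pure (i, j) else 0)"

lemma plin_tp: "plin (tp n)"
  by (simp add: tp_def)

lemmas tp_rules = plin_rules[OF plin_tp]

lemma coef_tp: "coef (tp n t) (i, j) = (if deg i + deg j = n then coef t (i, j) else 0)"
proof (induction t rule: linear_induct[OF subset_UNIV])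
  case (4 x)
  show ?case
    by (cases x, cases "deg (fst x) + deg (snd x) = n")
      (auto simp: tp_def lookup_single when_def)
qed (auto simp: tp_def lin_ext_simps lookup_add)

lemma tp_tens: "tp n (tens v w) = (\<Sum>i\<le>n. tens (hc i v) (hc (n - i) w))"
proof (rule poly_mapping_eqI)
  fix x :: "(nat \<times> 'a \<times> nat) \<times> (nat \<times> 'a \<times> nat)"
  obtain a b where x: "x = (a, b)" by (cases x)
  have "coef (\<Sum>i\<le>n. tens (hc i v) (hc (n - i) w)) x =
      (\<Sum>i\<le>n. if i = deg a then (if deg b = n - deg a then coef v a * coef w b else 0) else 0)"
    unfolding lookup_sum x coef_tens coef_hc by (rule sum.cong) auto
  also have "\<dots> = coef (tp n (tens v w)) x"
    by (auto simp: x coef_tp coef_tens)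
  finally show "coef (tp n (tens v w)) x = coef (\<Sum>i\<le>n. tens (hc i v) (hc (n - i) w)) x" by simp
qed

context lift_pair
begin

lemma \<mu>_degree: "v \<in> Le a \<Longrightarrow> w \<in> Le b \<Longrightarrow> \<mu> v w \<in> Le (a + b)"
proof -
  assume v: "v \<in> Le a" and w: "w \<in> Le b"
  have "foldr op u w \<in> Le (wdeg u + b)" if "u \<in> W" for u
    using that
  proof (induction u)
    case (Cons x u)
    then show ?case using op_Le[of x "foldr op u w" "wdeg u + b"] wdeg_Cons[of x u] by (simp add: ac_simps)
  qed (use w in simp)
  then have "foldr op u w \<in> Le (a + b)" if "u \<in> W" "wdeg u \<le> a" for u
    using lc_mono[of "{i \<in> IX. deg i \<le> wdeg u + b}" "{i \<in> IX. deg i \<le> a + b}"] that by force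
  then show ?thesis
    unfolding \<mu>_def act_def using \<sigma>_degree[OF v]
    by (intro lc_lin_ext) (auto simp: lc_def[of "{w \<in> W. wdeg w \<le> a}"] simp del: lists.simps in_lists_conv_set)
qed

lemma Z_\<mu>_degree_eq:
  assumes "i \<in> IX" "j \<in> IX"
  shows "Z.\<mu> (pure i) (pure j) \<in> lc {l \<in> IX. deg l = deg i + deg j}"
proof -
  have "foldr Z.op u (pure j) \<in> lc {l \<in> IX. deg l = wdeg u + deg j}" if "u \<in> W" for u
    using that
  proof (induction u)
    case (Cons x u)
    then show ?case using Z_op_eq_deg[of x "foldr Z.op u (pure j)" "wdeg u + deg j"] wdeg_Cons[of x u]
      by (simp add: ac_simps)
  qed (use assms in simp)
  from this[OF sw_W[OF assms(1)]] show ?thesis by (simp add: Z.\<mu>_def wdeg_sw)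
qed

text \<open>Both products are the expansions of the same concatenated words, and expansions of words
  agree in the top degree.\<close>

lemma \<mu>_top:
  assumes v: "v \<in> Le a" and w: "w \<in> Le b" and i: "deg i = a + b"
  shows "coef (\<mu> v w) i = coef (Z.\<mu> v w) i"
proof -
  have vw: "v \<in> lc IX" "w \<in> lc IX" using v w by (auto simp: lc_def)
  have s: "\<sigma> v \<in> lc W" "\<sigma> w \<in> lc W" using vw by (auto intro: \<sigma>_lc)
  have "\<sigma> v \<odot> \<sigma> w \<in> lc {u \<in> W. wdeg u \<le> a + b}"
    using \<sigma>_degree[OF v] \<sigma>_degree[OF w] unfolding conv_def
    by (intro lc_lin_ext) (auto simp: lc_def simp del: lists.simps dest!: subsetD)
  from q_top[OF this i] show ?thesis
    using q_mult[OF s] Z.q_mult[OF s] q_\<sigma>[OF vw(1)] q_\<sigma>[OF vw(2)] Z.q_\<sigma>[OF vw(1)] Z.q_\<sigma>[OF vw(2)] by simp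
qed

text \<open>The graded product adds degrees, so in degree \<open>n\<close> only complementary
  components of the factors meet.\<close>

lemma Z_\<mu>_graded:
  assumes "v \<in> lc IX" "w \<in> lc IX" and i: "deg i = n"
  shows "coef (Z.\<mu> v w) i = (\<Sum>a\<le>n. coef (Z.\<mu> (hc a v) (hc (n - a) w)) i)"
proof -
  have s: "supp v \<subseteq> IX" "supp w \<subseteq> IX" using assms by (auto simp: lc_def)
  note b = plin_rules[OF pbilinD(1)[OF Z.pbilin_\<mu>]] plin_rules[OF pbilinD(2)[OF Z.pbilin_\<mu>]]
  show ?thesis
    using s(1)
  proof (induction v rule: linear_induct)
    case (pure j)
    show ?case
      using s(2)
    proof (induction w rule: linear_induct)
      case (pure l)
      have "(\<Sum>a\<le>n. coef (Z.\<mu> (hc a (pure j)) (hc (n - a) (pure l))) i) =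
          (\<Sum>a\<le>n. if a = deg j then (if deg l = n - deg j then coef (Z.\<mu> (pure j) (pure l)) i else 0) else 0)"
        by (rule sum.cong) (auto simp: b)
      also have "\<dots> = (if deg j \<le> n \<and> deg l = n - deg j then coef (Z.\<mu> (pure j) (pure l)) i else 0)"
        by simp
      also have "\<dots> = coef (Z.\<mu> (pure j) (pure l)) i"
        using lc_coef[OF Z_\<mu>_degree_eq[OF \<open>j \<in> IX\<close> pure], of i] i by (cases "deg i = deg j + deg l") auto
      finally show ?case by simp
    qed (auto simp: b hc_rules lookup_add sum.distrib sum_distrib_left)
  qed (auto simp: b hc_rules lookup_add sum.distrib sum_distrib_left)
qed

lemma Z_\<Delta>_degree_eq: "v \<in> lc {i \<in> IX. deg i = n} \<Longrightarrow> tp n (Z.\<Delta> v) = Z.\<Delta> v"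
proof -
  assume "v \<in> lc {i \<in> IX. deg i = n}"
  then have s: "supp v \<subseteq> {i \<in> IX. deg i = n}" by (simp add: lc_def)
  show ?thesis
  proof (rule plin_eq_on[OF s plin_comp[OF plin_tp Z.plin_\<Delta>] Z.plin_\<Delta>])
    fix i assume i: "i \<in> {i \<in> IX. deg i = n}"
    then have "supp (wd (sw i)) \<subseteq> {(u, v). u \<in> W \<and> v \<in> W \<and> wdeg u + wdeg v = n}"
      using wd_degree[OF sw_W[of i]] by (auto simp: lc_def wdeg_sw simp del: lists.simps in_lists_conv_set)
    then have "tp n (Z.qq (wd (sw i))) = Z.qq (wd (sw i))"
    proof (rule plin_eq_on[OF _ plin_comp[OF plin_tp plin_tcoord] plin_tcoord])
      fix x assume "x \<in> {(u, v). u \<in> W \<and> v \<in> W \<and> wdeg u + wdeg v = n}"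
      then obtain u v where x: "x = (u, v)" "u \<in> W" "v \<in> W" "wdeg u + wdeg v = n" by auto
      have "coef (Z.q (pure u)) a * coef (Z.q (pure v)) b = 0" if "deg a + deg b \<noteq> n" for a b
        using coef_q(2)[OF x(2), of a] coef_q(2)[OF x(3), of b] that x(4) by (cases "wdeg u = deg a") (auto simp del: Z.q_pure)
      then show "tp n (Z.qq (pure x)) = Z.qq (pure x)"
        by (intro poly_mapping_eqI) (auto simp: x(1) coef_tp coef_tens simp del: Z.q_pure)
    qed
    then show "tp n (Z.\<Delta> (pure i)) = Z.\<Delta> (pure i)" by (simp add: Z.\<Delta>_def)
  qed
qed

section \<open>Coordinates on the associated graded algebra\<close>

abbreviation Fil :: "nat \<Rightarrow> ('g gen list \<Rightarrow>\<^sub>0 'k) set set"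
  where "Fil \<equiv> corad_filt H"

lemma corad_below_H: "x \<in> corad_below H n \<longleftrightarrow> x \<in> carrier H \<and> U.qco x \<in> Lt n"
proof (cases n)
  case 0
  have "Lt 0 = {0}" by (auto simp: lc_def)
  then show ?thesis
    using H.\<kappa>_inj[of x "\<zero>\<^bsub>H\<^esub>"] H.\<kappa>_zero 0 H.zero_closed by (auto simp del: H_simps)
next
  case (Suc m)
  have "{i \<in> IX. deg i < Suc m} = {i \<in> IX. deg i \<le> m}" by auto
  then show ?thesis by (simp add: Suc corad_filt_H del: H_simps)
qed

lemma gr_class_eq:
  assumes x: "x \<in> carrier H"
  shows "gr_class H n x = {y \<in> carrier H. U.qco y - U.qco x \<in> Lt n}"
proof (intro equalityI subsetI)
  fix y assume "y \<in> gr_class H n x"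
  then obtain h where h: "h \<in> corad_below H n" "y = h \<oplus>\<^bsub>H\<^esub> x"
    unfolding gr_class_def a_r_coset_def' by blast
  then show "y \<in> {y \<in> carrier H. U.qco y - U.qco x \<in> Lt n}"
    using x H.add[of h x] corad_below_H[of h n] by simp
next
  fix y assume y: "y \<in> {y \<in> carrier H. U.qco y - U.qco x \<in> Lt n}"
  then have "y \<ominus>\<^bsub>H\<^esub> x \<in> corad_below H n"
    using x H.\<kappa>_minus[of y x] H.minus_closed[of y x] corad_below_H[of _ n] by simp
  moreover have "y = (y \<ominus>\<^bsub>H\<^esub> x) \<oplus>\<^bsub>H\<^esub> x"
    using x y H.minus_closed[of y x] H.\<kappa>_minus[of y x] H.add[of "y \<ominus>\<^bsub>H\<^esub> x" x] by (intro H.\<kappa>_inj) auto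
  ultimately show "y \<in> gr_class H n x" unfolding gr_class_def a_r_coset_def' by blast
qed

lemma FilD: "x \<in> Fil n \<Longrightarrow> x \<in> carrier H" "x \<in> Fil n \<Longrightarrow> U.qco x \<in> Le n"
  using corad_filt_H by blast+

lemma Lt_iff: "v \<in> Le n \<Longrightarrow> v \<in> Lt n \<longleftrightarrow> hc n v = 0"
proof
  assume v: "v \<in> Le n" and "hc n v = 0"
  then have top: "coef v i = 0" if "deg i = n" for i using that unfolding hc_eq_0_iff by blast
  show "v \<in> Lt n"
  proof (rule lcI)
    fix i assume "coef v i \<noteq> 0"
    then have "i \<in> {i \<in> IX. deg i \<le> n}" "deg i \<noteq> n" using lc_coef[OF v, of i] top by blast+
    then show "i \<in> {i \<in> IX. deg i < n}" by auto
  qed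
next
  assume "v \<in> Lt n"
  from lc_coef[OF this] show "hc n v = 0" unfolding hc_eq_0_iff by blast
qed

text \<open>Within the n-th filtration term, lying in the preceding one means that the degree n
  component vanishes. Graded pieces are thereby identified with homogeneous vectors.\<close>

lemma gr_class_eq_iff:
  assumes "x \<in> Fil n" "y \<in> Fil n"
  shows "gr_class H n x = gr_class H n y \<longleftrightarrow> hc n (U.qco x) = hc n (U.qco y)"
proof -
  have d: "U.qco x - U.qco y \<in> Lt n \<longleftrightarrow> hc n (U.qco x) = hc n (U.qco y)"
    using Lt_iff[of "U.qco x - U.qco y" n] FilD assms by (simp add: lc_minus hc_rules)
  have eq: "gr_class H n z = {w \<in> carrier H. U.qco w - U.qco z \<in> Lt n}" if "z \<in> {x, y}" for z
    using gr_class_eq that FilD assms by auto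
  show ?thesis
  proof
    assume "gr_class H n x = gr_class H n y"
    moreover have "x \<in> gr_class H n x" using eq[of x] FilD assms by auto
    ultimately show "hc n (U.qco x) = hc n (U.qco y)" using eq[of y] d by auto
  next
    assume "hc n (U.qco x) = hc n (U.qco y)"
    with d have *: "U.qco x - U.qco y \<in> Lt n" by simp
    have "U.qco w - U.qco x \<in> Lt n \<longleftrightarrow> U.qco w - U.qco y \<in> Lt n" for w
      using lc_add[OF _ *, of "U.qco w - U.qco x"] lc_minus[OF _ *, of "U.qco w - U.qco y"] by auto
    then show "gr_class H n x = gr_class H n y" using eq[of x] eq[of y] by auto
  qed
qed

lemma below_eq_class: "corad_below H n = gr_class H n \<zero>\<^bsub>H\<^esub>"
  using gr_class_eq[OF H.zero_closed, of n] corad_below_H by (auto simp: H.\<kappa>_zero simp del: H_simps)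

lemma zero_Fil: "\<zero>\<^bsub>H\<^esub> \<in> Fil n"
  unfolding corad_filt_H using H.zero_closed by (simp add: H.\<kappa>_zero del: H_simps)

abbreviation GR :: "(nat \<Rightarrow> ('g gen list \<Rightarrow>\<^sub>0 'k) set set, 'k) khopf"
  where "GR \<equiv> gr_hopf H"

lemma gr_carrier: "f \<in> carrier GR \<longleftrightarrow> (\<forall>n. \<exists>x\<in>Fil n. f n = gr_class H n x) \<and> finite (gr_degrees H f)"
  by (simp add: gr_hopf_def)

lemma gr_rep:
  assumes "\<exists>x\<in>Fil n. f n = gr_class H n x"
  shows "gr_rep f n \<in> Fil n" "f n = gr_class H n (gr_rep f n)"
proof -
  from assms obtain x where x: "x \<in> Fil n" "f n = gr_class H n x" by blast
  have f: "f n = {y \<in> carrier H. U.qco y - U.qco x \<in> Lt n}" using gr_class_eq FilD x by auto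
  then have "x \<in> f n" using FilD x by auto
  then have r: "gr_rep f n \<in> f n" unfolding gr_rep_def by (rule someI)
  then have r': "gr_rep f n \<in> carrier H" "U.qco (gr_rep f n) - U.qco x \<in> Lt n" using f by auto
  have le: "U.qco (gr_rep f n) - U.qco x \<in> Le n"
    using r'(2) by (auto simp: lc_def)
  from lc_add[OF le FilD(2)[OF x(1)]] r'(1) show F: "gr_rep f n \<in> Fil n"
    unfolding corad_filt_H by simp
  show "f n = gr_class H n (gr_rep f n)"
    unfolding x(2) gr_class_eq_iff[OF x(1) F]
    using Lt_iff[of "U.qco (gr_rep f n) - U.qco x" n] le r'(2) by (simp add: hc_rules)
qed

text \<open>Each component of a graded element is a coset; its coordinate is the top degree part of
  any representative, here a chosen one.\<close>

definition \<kappa>g :: "(nat \<Rightarrow> ('g gen list \<Rightarrow>\<^sub>0 'k) set set) \<Rightarrow> (nat \<times> 'g \<times> nat \<Rightarrow>\<^sub>0 'k)"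
  where "\<kappa>g f = (\<Sum>n\<in>gr_degrees H f. hc n (U.qco (gr_rep f n)))"

lemma gr_degrees_iff:
  assumes "f n = gr_class H n x" "x \<in> Fil n"
  shows "n \<in> gr_degrees H f \<longleftrightarrow> hc n (U.qco x) \<noteq> 0"
  unfolding gr_degrees_def below_eq_class
  using assms gr_class_eq_iff[OF assms(2) zero_Fil] H.\<kappa>_zero by (simp add: hc_rules)

text \<open>The coordinates can be read off from an arbitrary representative \<open>x\<close> of the
  n-th component, so the choice in \<open>gr_rep\<close> disappears from later computations.\<close>

lemma coef_\<kappa>g:
  assumes f: "f \<in> carrier GR" and x: "f n = gr_class H n x" "x \<in> Fil n" and i: "deg i = n"
  shows "coef (\<kappa>g f) i = coef (U.qco x) i"
proof -
  have fin: "finite (gr_degrees H f)" and ex: "\<exists>x\<in>Fil m. f m = gr_class H m x" for m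
    using f gr_carrier by blast+
  note r = gr_rep[where f = f and n = n, OF ex]
  have eq: "hc n (U.qco (gr_rep f n)) = hc n (U.qco x)"
    using r x gr_class_eq_iff by metis
  have "coef (\<kappa>g f) i = (\<Sum>m\<in>gr_degrees H f. if m = n then coef (hc n (U.qco x)) i else 0)"
    unfolding \<kappa>g_def lookup_sum by (rule sum.cong) (auto simp: coef_hc i eq[symmetric])
  also have "\<dots> = (if n \<in> gr_degrees H f then coef (hc n (U.qco x)) i else 0)"
    using fin by simp
  also have "\<dots> = coef (hc n (U.qco x)) i"
    using gr_degrees_iff[where f = f and n = n, OF x] by auto
  finally show ?thesis by (simp add: coef_hc i)
qed

lemma hc_\<kappa>g:
  assumes "f \<in> carrier GR" "f n = gr_class H n x" "x \<in> Fil n"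
  shows "hc n (\<kappa>g f) = hc n (U.qco x)"
  by (rule poly_mapping_eqI) (use coef_\<kappa>g[OF assms] in \<open>auto simp: coef_hc\<close>)

lemma gr_rep_carrier:
  assumes "f \<in> carrier GR"
  shows "gr_rep f n \<in> Fil n" "f n = gr_class H n (gr_rep f n)"
  using assms gr_rep[of n f] by (auto simp: gr_carrier)

lemma gr_carrierI:
  assumes "\<And>n. x n \<in> Fil n" "\<And>n. f n = gr_class H n (x n)" and "finite J" "\<And>n. n \<notin> J \<Longrightarrow> hc n (U.qco (x n)) = 0"
  shows "f \<in> carrier GR"
  unfolding gr_carrier
proof (intro conjI allI)
  have "gr_degrees H f \<subseteq> J" using gr_degrees_iff[of f _ "x _"] assms by blast
  with assms(3) show "finite (gr_degrees H f)" by (rule finite_subset[rotated])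
qed (use assms in blast)

lemma \<kappa>g_eqI:
  assumes f: "f \<in> carrier GR" and x: "\<And>n. x n \<in> Fil n" "\<And>n. f n = gr_class H n (x n)"
    and eq: "\<And>i. coef (U.qco (x (deg i))) i = coef v i"
  shows "\<kappa>g f = v"
  by (rule poly_mapping_eqI) (use coef_\<kappa>g[OF f x(2) x(1) refl] eq in metis)

lemma elt_Fil: "v \<in> lc IX \<Longrightarrow> H.elt (hc n v) \<in> Fil n"
  and \<kappa>_elt_hc: "v \<in> lc IX \<Longrightarrow> U.qco (H.elt (hc n v)) = hc n v"
  for v :: "nat \<times> 'g \<times> nat \<Rightarrow>\<^sub>0 'k"
proof -
  assume v: "v \<in> lc IX"
  have h: "hc n v \<in> lc {i \<in> IX. deg i = n}" using v by (rule hc_lc)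
  then have h': "hc n v \<in> lc IX" "hc n v \<in> Le n" by (auto simp: lc_def)
  show "U.qco (H.elt (hc n v)) = hc n v" using h' by (simp add: H.\<kappa>_elt)
  with h' H.elt_closed[OF h'(1)] show "H.elt (hc n v) \<in> Fil n" unfolding corad_filt_H by simp
qed

lemma hc_eventually_0: "finite {n. hc n v \<noteq> 0}"
proof (rule finite_subset)
  show "{n. hc n v \<noteq> 0} \<subseteq> deg ` supp v"
  proof safe
    fix n assume "hc n v \<noteq> 0"
    then obtain i where "deg i = n" "coef v i \<noteq> 0" unfolding hc_eq_0_iff by blast
    then show "n \<in> deg ` supp v" by (metis image_eqI in_keys_iff)
  qed
qed simp

lemma \<kappa>g_bij: "bij_betw \<kappa>g (carrier GR) (lc IX)"
  unfolding bij_betw_def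
proof (intro conjI inj_onI equalityI subsetI)
  fix f f' assume f: "f \<in> carrier GR" and f': "f' \<in> carrier GR" and eq: "\<kappa>g f = \<kappa>g f'"
  show "f = f'"
  proof
    fix n
    note r = gr_rep_carrier[OF f, of n] and r' = gr_rep_carrier[OF f', of n]
    have "hc n (U.qco (gr_rep f n)) = hc n (U.qco (gr_rep f' n))"
      using hc_\<kappa>g[OF f r(2,1)] hc_\<kappa>g[OF f' r'(2,1)] eq by simp
    with r r' gr_class_eq_iff[OF r(1) r'(1)] show "f n = f' n" by simp
  qed
next
  fix v assume "v \<in> \<kappa>g ` carrier GR"
  then obtain f where f: "f \<in> carrier GR" "v = \<kappa>g f" by blast
  have "hc n (U.qco (gr_rep f n)) \<in> lc IX" for n
    using hc_lc[OF H.\<kappa>_closed[OF FilD(1)[OF gr_rep_carrier(1)[OF f(1)]]], of n n] by (auto simp: lc_def)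
  then show "v \<in> lc IX" unfolding f(2) \<kappa>g_def by (intro lc_sum)
next
  fix v :: "nat \<times> 'g \<times> nat \<Rightarrow>\<^sub>0 'k" assume v: "v \<in> lc IX"
  define f where "f n = gr_class H n (H.elt (hc n v))" for n
  have f: "f \<in> carrier GR"
    by (rule gr_carrierI[where x = "\<lambda>n. H.elt (hc n v)" and J = "{n. hc n v \<noteq> 0}"])
      (use elt_Fil[OF v] \<kappa>_elt_hc[OF v] hc_eventually_0 in \<open>auto simp: f_def hc_eq_0_iff coef_hc\<close>)
  moreover have "\<kappa>g f = v"
    by (rule \<kappa>g_eqI[OF f, where x = "\<lambda>n. H.elt (hc n v)"]) (use elt_Fil[OF v] \<kappa>_elt_hc[OF v] in \<open>auto simp: f_def coef_hc\<close>)
  ultimately show "v \<in> \<kappa>g ` carrier GR" by blast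
qed

lemma Fil_add: "x \<in> Fil n \<Longrightarrow> y \<in> Fil n \<Longrightarrow> x \<oplus>\<^bsub>H\<^esub> y \<in> Fil n"
  unfolding corad_filt_H using H.add[of x y] by (auto intro: lc_add)

lemma Fil_scale: "x \<in> Fil n \<Longrightarrow> c \<cdot>\<^bsub>H\<^esub> x \<in> Fil n"
  unfolding corad_filt_H using H.scale[of x c] by (auto intro: lc_pscale)

lemma Fil_mult: "x \<in> Fil a \<Longrightarrow> y \<in> Fil b \<Longrightarrow> x \<otimes>\<^bsub>H\<^esub> y \<in> Fil (a + b)"
  unfolding corad_filt_H using H.mult[of x y] \<mu>_degree[of "U.qco x" a "U.qco y" b] by auto

lemma Fil_sum: "finite J \<Longrightarrow> (\<And>j. j \<in> J \<Longrightarrow> h j \<in> Fil n) \<Longrightarrow> finsum H h J \<in> Fil n"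
proof -
  assume J: "finite J" "\<And>j. j \<in> J \<Longrightarrow> h j \<in> Fil n"
  then have h: "h \<in> J \<rightarrow> carrier H" using FilD by auto
  have "U.qco (finsum H h J) = (\<Sum>j\<in>J. U.qco (h j))" by (rule H.\<kappa>_finsum[OF h])
  also have "\<dots> \<in> Le n" using J FilD by (intro lc_sum) auto
  finally show ?thesis unfolding corad_filt_H using H.finsum_closed[OF h] by simp
qed

lemma gr_hom_class:
  assumes "x \<in> Fil n"
  shows "gr_hom H n x \<in> carrier GR" "\<kappa>g (gr_hom H n x) = hc n (U.qco x)"
proof -
  define y where "y m = (if m = n then x else \<zero>\<^bsub>H\<^esub>)" for m
  have y: "y m \<in> Fil m" "gr_hom H n x m = gr_class H m (y m)" for m
    using assms zero_Fil by (auto simp: y_def gr_hom_def below_eq_class)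
  show c: "gr_hom H n x \<in> carrier GR"
    by (rule gr_carrierI[OF y, of "{n}"]) (auto simp: y_def H.\<kappa>_zero hc_rules simp del: H_simps)
  show "\<kappa>g (gr_hom H n x) = hc n (U.qco x)"
    by (rule \<kappa>g_eqI[OF c y]) (auto simp: y_def H.\<kappa>_zero coef_hc simp del: H_simps)
qed

lemma gr_component: "\<kappa>g ` gr_component H n = lc {i \<in> IX. deg i = n}" "gr_component H n \<subseteq> carrier GR"
proof -
  show "gr_component H n \<subseteq> carrier GR" by (auto simp: gr_component_def gr_hom_class)
  have "v \<in> \<kappa>g ` gr_component H n" if v: "v \<in> lc {i \<in> IX. deg i = n}" for v
  proof -
    have "hc n v = v" by (rule poly_mapping_eqI) (use lc_coef[OF v] in \<open>auto simp: coef_hc\<close>)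
    moreover have vIX: "v \<in> lc IX" using v by (auto simp: lc_def)
    ultimately have "v = \<kappa>g (gr_hom H n (H.elt v))"
      using gr_hom_class(2)[OF elt_Fil[OF vIX, of n]] \<kappa>_elt_hc[OF vIX, of n] by simp
    moreover have "gr_hom H n (H.elt v) \<in> gr_component H n"
      unfolding gr_component_def using elt_Fil[OF vIX, of n] \<open>hc n v = v\<close> by simp
    ultimately show ?thesis by blast
  qed
  moreover have "\<kappa>g f \<in> lc {i \<in> IX. deg i = n}" if "f \<in> gr_component H n" for f
    using that gr_hom_class(2) hc_lc[OF H.\<kappa>_closed[OF FilD(1)]] by (auto simp: gr_component_def)
  ultimately show "\<kappa>g ` gr_component H n = lc {i \<in> IX. deg i = n}" by auto
qed

text \<open>The definition picks some representative of the coproduct that is adapted to the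
  filtration. One exists because coproducts respect degrees, and its projection is the part of total
  degree n of the coproduct, hence the same for every choice.\<close>

lemma tcoord_gr_comult_hom:
  assumes x: "x \<in> Fil n"
  shows "supp (gr_comult_hom H n x) \<subseteq> carrier GR \<times> carrier GR"
    and "tcoord \<kappa>g (gr_comult_hom H n x) = Z.\<Delta> (hc n (U.qco x))"
proof -
  let ?P = "\<lambda>s. supp s \<subseteq> (\<Union>i\<le>n. Fil i \<times> Fil (n - i)) \<and> tensor_eq H H (comult H x) s"
  define s where "s = (SOME s. ?P s)"
  note xc = FilD[OF x]
  have "?P (H.basis_rep (\<Delta> (U.qco x)))"
  proof
    show "tensor_eq H H (comult H x) (H.basis_rep (\<Delta> (U.qco x)))"
      using H.tensor_null_basis_rep[of "comult H x"] H.comult[OF xc(1)] by (simp add: tensor_eq_def)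
    show "supp (H.basis_rep (\<Delta> (U.qco x))) \<subseteq> (\<Union>i\<le>n. Fil i \<times> Fil (n - i))"
      unfolding H.basis_rep_def
    proof (rule supp_lin_ext_subset)
      fix z assume "z \<in> supp (\<Delta> (U.qco x))"
      then obtain i j where z: "z = (i, j)" and ij: "i \<in> IX" "j \<in> IX" "deg i + deg j \<le> n"
        using \<Delta>_degree[OF xc(2)] by (cases z) (auto simp: lc_def)
      have "H.elt (pure i) \<in> Fil (deg i)" "H.elt (pure j) \<in> Fil (n - deg i)"
        unfolding corad_filt_H using ij H.elt_pure_closed[of i] H.elt_pure_closed[of j] by (simp_all add: H.\<kappa>_elt)
      then show "supp (case z of (i, j) \<Rightarrow> pure (H.elt (pure i), H.elt (pure j))) \<subseteq> (\<Union>i\<le>n. Fil i \<times> Fil (n - i))"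
        using ij by (auto simp: z)
    qed
  qed
  then have s: "supp s \<subseteq> (\<Union>i\<le>n. Fil i \<times> Fil (n - i))" "tensor_eq H H (comult H x) s"
    using someI[of ?P] unfolding s_def by blast+
  define f where "f = (\<lambda>(a, b). \<Sum>i | i \<le> n \<and> a \<in> Fil i \<and> b \<in> Fil (n - i). pure (gr_hom H i a, gr_hom H (n - i) b) :: _ \<Rightarrow>\<^sub>0 'k)"
  have g: "gr_comult_hom H n x = lin_ext f s" by (simp add: gr_comult_hom_def f_def s_def)
  show "supp (gr_comult_hom H n x) \<subseteq> carrier GR \<times> carrier GR"
    unfolding g
  proof (rule supp_lin_ext_subset)
    fix z assume "z \<in> supp s"
    show "supp (f z) \<subseteq> carrier GR \<times> carrier GR"
      unfolding f_def by (cases z) (auto simp: gr_hom_class dest!: subsetD[OF supp_sum])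
  qed
  have "tcoord \<kappa>g (f z) = tp n (tens (U.qco (fst z)) (U.qco (snd z)))" if "z \<in> supp s" for z
  proof -
    obtain a b where z: "z = (a, b)" by (cases z)
    from that s(1) obtain i0 where i0: "i0 \<le> n" "a \<in> Fil i0" "b \<in> Fil (n - i0)" by (auto simp: z)
    \<comment> \<open>Moving the split point away from \<open>i0\<close> asks one of the factors for
      a component above its filtration degree.\<close>
    have zero: "hc i (U.qco a) = 0 \<or> hc (n - i) (U.qco b) = 0" if "i \<le> n" "i \<noteq> i0" for i
    proof (cases "i0 < i")
      case True
      then show ?thesis using lc_coef[OF FilD(2)[OF i0(2)]] by (auto simp: hc_eq_0_iff)
    next
      case False
      then have "n - i0 < n - i" using that i0 by auto
      then show ?thesis using lc_coef[OF FilD(2)[OF i0(3)]] by (auto simp: hc_eq_0_iff)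
    qed
    have "tcoord \<kappa>g (f z) = (\<Sum>i | i \<le> n \<and> a \<in> Fil i \<and> b \<in> Fil (n - i). tens (hc i (U.qco a)) (hc (n - i) (U.qco b)))"
      unfolding f_def z prod.case tcoord_sum by (rule sum.cong) (auto simp: gr_hom_class)
    also have "\<dots> = (\<Sum>i\<le>n. tens (hc i (U.qco a)) (hc (n - i) (U.qco b)))"
    proof (rule sum.mono_neutral_left)
      show "\<forall>i\<in>{..n} - {i. i \<le> n \<and> a \<in> Fil i \<and> b \<in> Fil (n - i)}. tens (hc i (U.qco a)) (hc (n - i) (U.qco b)) = 0"
      proof
        fix i assume i: "i \<in> {..n} - {i. i \<le> n \<and> a \<in> Fil i \<and> b \<in> Fil (n - i)}"
        then have "i \<noteq> i0" using i0 by blast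
        with zero[of i] i show "tens (hc i (U.qco a)) (hc (n - i) (U.qco b)) = 0" by auto
      qed
    qed auto
    also have "\<dots> = tp n (tens (U.qco a) (U.qco b))" by (simp add: tp_tens)
    finally show ?thesis by (simp add: z)
  qed
  then have "tcoord \<kappa>g (gr_comult_hom H n x) = lin_ext (\<lambda>z. tp n (tens (U.qco (fst z)) (U.qco (snd z)))) s"
    unfolding g tcoord_lin_ext by (rule lin_ext_cong)
  also have "\<dots> = tp n (tcoord U.qco s)"
    unfolding tcoord_def plin_lin_ext_comp[OF plin_tp] by (rule lin_ext_cong) auto
  also have "tcoord U.qco s = \<Delta> (U.qco x)"
    using H.comult[OF xc(1)] H.tensor_eq_tcoord[OF s(2)] by simp
  also have "tp n (\<Delta> (U.qco x)) = tp n (Z.\<Delta> (U.qco x))"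
    by (rule poly_mapping_eqI) (use \<Delta>_top[OF xc(2)] in \<open>auto simp: coef_tp\<close>)
  \<comment> \<open>The graded coproduct preserves degree, so the lower part of \<open>x\<close>
    contributes nothing in total degree n.\<close>
  also have "\<dots> = tp n (Z.\<Delta> (hc n (U.qco x)))"
  proof -
    have d: "U.qco x - hc n (U.qco x) \<in> Lt n"
    proof (rule lcI)
      fix i assume i: "coef (U.qco x - hc n (U.qco x)) i \<noteq> 0"
      then have "deg i \<noteq> n" "coef (U.qco x) i \<noteq> 0" by (auto simp: lookup_minus coef_hc simp del: deg.simps split: if_splits)
      with lc_coef[OF xc(2), of i] show "i \<in> {i \<in> IX. deg i < n}" by force
    qed
    then have "supp (U.qco x - hc n (U.qco x)) \<subseteq> {i \<in> IX. deg i < n}" by (simp add: lc_def)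
    then have "tp n (Z.\<Delta> (U.qco x - hc n (U.qco x))) = 0"
    proof (rule plin_eq_on[OF _ plin_comp[OF plin_tp Z.plin_\<Delta>], of _ _ "\<lambda>_. 0"])
      fix i assume i: "i \<in> {i \<in> IX. deg i < n}"
      then have "tp (deg i) (Z.\<Delta> (pure i)) = Z.\<Delta> (pure i)" by (intro Z_\<Delta>_degree_eq) auto
      then show "tp n (Z.\<Delta> (pure i)) = 0"
        using i by (intro poly_mapping_eqI) (metis (mono_tags, lifting) coef_tp lookup_zero mem_Collect_eq nat_neq_iff surj_pair)
    qed (simp add: plin_def)
    then show ?thesis by (simp add: Z.\<Delta>_rules tp_rules)
  qed
  also have "\<dots> = Z.\<Delta> (hc n (U.qco x))"
    by (rule Z_\<Delta>_degree_eq[OF hc_lc[OF H.\<kappa>_closed[OF xc(1)]]])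
  finally show "tcoord \<kappa>g (gr_comult_hom H n x) = Z.\<Delta> (hc n (U.qco x))" .
qed

text \<open>The counit vanishes on every basis element of positive degree.\<close>

lemma lin_form_ep_deg0:
  assumes "\<And>i. deg i = 0 \<Longrightarrow> coef v i = coef w i"
  shows "lin_form ep v = lin_form ep w"
proof -
  have "coef (v - w) i * ep i = 0" for i
  proof (cases "deg i = 0")
    case False
    then have "ep i = 0" by (cases i) (auto simp: ep_def sw_def word_counit_def)
    then show ?thesis by simp
  qed (use assms in \<open>simp add: lookup_minus\<close>)
  then have "lin_form ep (v - w) = 0" unfolding lin_form_def by (intro sum.neutral) blast
  then show ?thesis by (simp add: lin_form_simps)
qed

text \<open>The structure constants are those of the graded companion: taking top degree parts
  discards exactly the contributions of \<xi> and \<lambda>.\<close>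

lemma gr_realization: "hopf_realization IX Z.\<mu> vac Z.\<Delta> Z.ep Z.S GR \<kappa>g"
proof unfold_locales
  show "bij_betw \<kappa>g (carrier GR) (lc IX)" by (rule \<kappa>g_bij)
  fix f f' c assume f: "f \<in> carrier GR"
  define r where "r = gr_rep f"
  have r: "r n \<in> Fil n" "f n = gr_class H n (r n)" for n
    unfolding r_def by (rule gr_rep_carrier[OF f])+
  have deg_f: "finite (gr_degrees H f)" and nd: "n \<notin> gr_degrees H f \<Longrightarrow> hc n (U.qco (r n)) = 0" for n
    using f gr_degrees_iff[of f n "r n"] r by (auto simp: gr_carrier)
  have sc: "(c \<cdot>\<^bsub>GR\<^esub> f) n = gr_class H n (c \<cdot>\<^bsub>H\<^esub> r n)" for n by (simp add: gr_hopf_def r_def)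
  have scc: "c \<cdot>\<^bsub>GR\<^esub> f \<in> carrier GR"
    by (rule gr_carrierI[OF Fil_scale[OF r(1)] sc deg_f]) (use H.scale[OF FilD(1)[OF r(1)]] nd in \<open>simp add: hc_rules\<close>)
  moreover have "\<kappa>g (c \<cdot>\<^bsub>GR\<^esub> f) = pscale c (\<kappa>g f)"
    by (rule \<kappa>g_eqI[OF scc Fil_scale[OF r(1)] sc])
      (use H.scale[OF FilD(1)[OF r(1)]] coef_\<kappa>g[OF f r(2) r(1) refl] in simp)
  ultimately show "c \<cdot>\<^bsub>GR\<^esub> f \<in> carrier GR \<and> \<kappa>g (c \<cdot>\<^bsub>GR\<^esub> f) = pscale c (\<kappa>g f)" by blast
  have com: "comult GR f = (\<Sum>n\<in>gr_degrees H f. gr_comult_hom H n (r n))" by (simp add: gr_hopf_def r_def)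
  have "supp (comult GR f) \<subseteq> carrier GR \<times> carrier GR"
    unfolding com by (rule order_trans[OF supp_sum]) (use tcoord_gr_comult_hom(1)[OF r(1)] in blast)
  moreover have "tcoord \<kappa>g (comult GR f) = Z.\<Delta> (\<kappa>g f)"
  proof -
    have "tcoord \<kappa>g (comult GR f) = (\<Sum>n\<in>gr_degrees H f. Z.\<Delta> (hc n (U.qco (r n))))"
      unfolding com tcoord_sum by (simp only: tcoord_gr_comult_hom(2)[OF r(1)])
    then show ?thesis by (simp add: \<kappa>g_def plin_sum[OF Z.plin_\<Delta>] r_def)
  qed
  ultimately show "supp (comult GR f) \<subseteq> carrier GR \<times> carrier GR \<and> tcoord \<kappa>g (comult GR f) = Z.\<Delta> (\<kappa>g f)" by blast
  have "counit GR f = lin_form ep (U.qco (r 0))"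
    using H.counit[OF FilD(1)[OF r(1)]] by (simp add: gr_hopf_def r_def)
  also have "\<dots> = lin_form ep (\<kappa>g f)"
    by (rule lin_form_ep_deg0) (rule coef_\<kappa>g[OF f r(2) r(1), symmetric])
  finally show "counit GR f = lin_form Z.ep (\<kappa>g f)" .
  assume f': "f' \<in> carrier GR"
  define r' where "r' = gr_rep f'"
  have r': "r' n \<in> Fil n" "f' n = gr_class H n (r' n)" for n
    unfolding r'_def by (rule gr_rep_carrier[OF f'])+
  have deg_f': "finite (gr_degrees H f')" and nd': "n \<notin> gr_degrees H f' \<Longrightarrow> hc n (U.qco (r' n)) = 0" for n
    using f' gr_degrees_iff[of f' n "r' n"] r' by (auto simp: gr_carrier)
  \<comment> \<open>Addition of graded elements is the setwise sum of cosets, which has to be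
    recognised as the coset of the sum of representatives.\<close>
  have ad: "(f \<oplus>\<^bsub>GR\<^esub> f') n = gr_class H n (r n \<oplus>\<^bsub>H\<^esub> r' n)" for n
  proof -
    note c = FilD(1)[OF r(1)[of n]] FilD(1)[OF r'(1)[of n]]
    have "(f \<oplus>\<^bsub>GR\<^esub> f') n = {y \<oplus>\<^bsub>H\<^esub> y' | y y'. y \<in> f n \<and> y' \<in> f' n}"
      by (auto simp: gr_hopf_def set_add_def')
    also have "\<dots> = gr_class H n (r n \<oplus>\<^bsub>H\<^esub> r' n)"
    proof (intro equalityI subsetI)
      fix z assume "z \<in> {y \<oplus>\<^bsub>H\<^esub> y' | y y'. y \<in> f n \<and> y' \<in> f' n}"
      then obtain y y' where y: "z = y \<oplus>\<^bsub>H\<^esub> y'" "y \<in> carrier H" "y' \<in> carrier H"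
        "U.qco y - U.qco (r n) \<in> Lt n" "U.qco y' - U.qco (r' n) \<in> Lt n"
        unfolding r(2) r'(2) gr_class_eq[OF c(1)] gr_class_eq[OF c(2)] by blast
      have "U.qco z - U.qco (r n \<oplus>\<^bsub>H\<^esub> r' n) = (U.qco y - U.qco (r n)) + (U.qco y' - U.qco (r' n))"
        using y c H.add by simp
      then show "z \<in> gr_class H n (r n \<oplus>\<^bsub>H\<^esub> r' n)"
        using y c H.add lc_add[OF y(4,5)] by (subst gr_class_eq) (auto simp: add_diff_add)
    next
      fix z assume "z \<in> gr_class H n (r n \<oplus>\<^bsub>H\<^esub> r' n)"
      then have z: "z \<in> carrier H" "U.qco z - U.qco (r n \<oplus>\<^bsub>H\<^esub> r' n) \<in> Lt n"
        using gr_class_eq[of "r n \<oplus>\<^bsub>H\<^esub> r' n" n] c H.add by auto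
      have m: "z \<ominus>\<^bsub>H\<^esub> r' n \<in> carrier H" "U.qco (z \<ominus>\<^bsub>H\<^esub> r' n) = U.qco z - U.qco (r' n)"
        using z c H.\<kappa>_minus[of z "r' n"] H.minus_closed[of z "r' n"] by auto
      have "z = (z \<ominus>\<^bsub>H\<^esub> r' n) \<oplus>\<^bsub>H\<^esub> r' n"
        using z c m H.add[of "z \<ominus>\<^bsub>H\<^esub> r' n" "r' n"] by (intro H.\<kappa>_inj) auto
      moreover have "z \<ominus>\<^bsub>H\<^esub> r' n \<in> f n"
        unfolding r(2) gr_class_eq[OF c(1)] using z m c H.add[of "r n" "r' n"] by (simp add: diff_diff_eq add.commute)
      moreover have "r' n \<in> f' n" unfolding r'(2) gr_class_eq[OF c(2)] using c by simp
      ultimately show "z \<in> {y \<oplus>\<^bsub>H\<^esub> y' | y y'. y \<in> f n \<and> y' \<in> f' n}" by blast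
    qed
    finally show ?thesis .
  qed
  have adc: "f \<oplus>\<^bsub>GR\<^esub> f' \<in> carrier GR"
    by (rule gr_carrierI[OF Fil_add[OF r(1) r'(1)] ad finite_UnI[OF deg_f deg_f']])
      (use H.add[OF FilD(1)[OF r(1)] FilD(1)[OF r'(1)]] nd nd' in \<open>simp add: hc_rules\<close>)
  moreover have "\<kappa>g (f \<oplus>\<^bsub>GR\<^esub> f') = \<kappa>g f + \<kappa>g f'"
    by (rule \<kappa>g_eqI[OF adc Fil_add[OF r(1) r'(1)] ad])
      (use H.add[OF FilD(1)[OF r(1)] FilD(1)[OF r'(1)]] coef_\<kappa>g[OF f r(2) r(1) refl] coef_\<kappa>g[OF f' r'(2) r'(1) refl]
        in \<open>simp add: lookup_add\<close>)
  ultimately show "f \<oplus>\<^bsub>GR\<^esub> f' \<in> carrier GR \<and> \<kappa>g (f \<oplus>\<^bsub>GR\<^esub> f') = \<kappa>g f + \<kappa>g f'" by blast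
  define y where "y n = (\<Oplus>\<^bsub>H\<^esub>i\<in>{..n}. r i \<otimes>\<^bsub>H\<^esub> r' (n - i))" for n
  have mu: "(f \<otimes>\<^bsub>GR\<^esub> f') n = gr_class H n (y n)" for n by (simp add: gr_hopf_def y_def r_def r'_def)
  have yt: "r i \<otimes>\<^bsub>H\<^esub> r' (n - i) \<in> Fil n" if "i \<le> n" for i n
    using Fil_mult[OF r(1)[of i] r'(1)[of "n - i"]] that by simp
  have y: "y n \<in> Fil n" for n unfolding y_def by (rule Fil_sum) (use yt in auto)
  have \<kappa>fc: "\<kappa>g f \<in> lc IX" "\<kappa>g f' \<in> lc IX" using f f' \<kappa>g_bij by (auto simp: bij_betw_def)
  \<comment> \<open>In degree n the product of representatives may be replaced by the graded
    product, and then representatives by their homogeneous components.\<close>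
  have \<kappa>y: "coef (U.qco (y n)) i = coef (Z.\<mu> (\<kappa>g f) (\<kappa>g f')) i" if "deg i = n" for n i
  proof -
    have "U.qco (y n) = (\<Sum>a\<le>n. U.qco (r a \<otimes>\<^bsub>H\<^esub> r' (n - a)))"
      unfolding y_def by (rule H.\<kappa>_finsum) (use yt FilD(1) in auto)
    then have "coef (U.qco (y n)) i = (\<Sum>a\<le>n. coef (\<mu> (U.qco (r a)) (U.qco (r' (n - a)))) i)"
      using H.mult[OF FilD(1)[OF r(1)] FilD(1)[OF r'(1)]] by (simp add: lookup_sum)
    also have "\<dots> = (\<Sum>a\<le>n. coef (Z.\<mu> (hc a (\<kappa>g f)) (hc (n - a) (\<kappa>g f'))) i)"
    proof (rule sum.cong[OF refl])
      fix a assume a: "a \<in> {..n}"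
      let ?v = "U.qco (r a)" and ?w = "U.qco (r' (n - a))"
      note vw = FilD(2)[OF r(1), of a] FilD(2)[OF r'(1), of "n - a"]
      have vwc: "?v \<in> lc IX" "?w \<in> lc IX" using vw by (auto simp: lc_def)
      have "coef (\<mu> ?v ?w) i = coef (Z.\<mu> ?v ?w) i"
        by (rule \<mu>_top[OF vw]) (use that a in auto)
      also have "\<dots> = (\<Sum>b\<le>n. coef (Z.\<mu> (hc b ?v) (hc (n - b) ?w)) i)"
        by (rule Z_\<mu>_graded[OF vwc that])
      also have "\<dots> = (\<Sum>b\<le>n. if b = a then coef (Z.\<mu> (hc a ?v) (hc (n - a) ?w)) i else 0)"
      proof (rule sum.cong[OF refl])
        fix b assume b: "b \<in> {..n}"
        \<comment> \<open>For b > a the left factor has no component of degree b, for b < a the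
          right one none of degree n - b.\<close>
        have "hc b ?v = 0 \<or> hc (n - b) ?w = 0" if "b \<noteq> a"
        proof (cases "a < b")
          case True
          then show ?thesis using lc_coef[OF vw(1)] by (auto simp: hc_eq_0_iff)
        next
          case False
          then have "n - a < n - b" using a b that by auto
          then show ?thesis using lc_coef[OF vw(2)] by (auto simp: hc_eq_0_iff)
        qed
        then show "coef (Z.\<mu> (hc b ?v) (hc (n - b) ?w)) i = (if b = a then coef (Z.\<mu> (hc a ?v) (hc (n - a) ?w)) i else 0)"
          using plin_0[OF pbilinD(1)[OF Z.pbilin_\<mu>]] plin_0[OF pbilinD(2)[OF Z.pbilin_\<mu>]] by auto
      qed
      also have "\<dots> = coef (Z.\<mu> (hc a ?v) (hc (n - a) ?w)) i" using a by simp
      finally show "coef (\<mu> ?v ?w) i = coef (Z.\<mu> (hc a (\<kappa>g f)) (hc (n - a) (\<kappa>g f'))) i"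
        using hc_\<kappa>g[OF f r(2) r(1)] hc_\<kappa>g[OF f' r'(2) r'(1)] by simp
    qed
    also have "\<dots> = coef (Z.\<mu> (\<kappa>g f) (\<kappa>g f')) i"
      by (rule Z_\<mu>_graded[OF \<kappa>fc that, symmetric])
    finally show ?thesis .
  qed
  have muc: "f \<otimes>\<^bsub>GR\<^esub> f' \<in> carrier GR"
  proof (rule gr_carrierI[OF y mu])
    show "finite {n. hc n (Z.\<mu> (\<kappa>g f) (\<kappa>g f')) \<noteq> 0}" by (rule hc_eventually_0)
    fix n assume "n \<notin> {n. hc n (Z.\<mu> (\<kappa>g f) (\<kappa>g f')) \<noteq> 0}"
    then show "hc n (U.qco (y n)) = 0" using \<kappa>y by (auto simp: hc_eq_0_iff)
  qed
  moreover have "\<kappa>g (f \<otimes>\<^bsub>GR\<^esub> f') = Z.\<mu> (\<kappa>g f) (\<kappa>g f')"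
    by (rule \<kappa>g_eqI[OF muc y mu]) (rule \<kappa>y[OF refl])
  ultimately show "f \<otimes>\<^bsub>GR\<^esub> f' \<in> carrier GR \<and> \<kappa>g (f \<otimes>\<^bsub>GR\<^esub> f') = Z.\<mu> (\<kappa>g f) (\<kappa>g f')" by blast
next
  have z: "\<zero>\<^bsub>GR\<^esub> n = gr_class H n \<zero>\<^bsub>H\<^esub>" for n by (simp add: gr_hopf_def below_eq_class del: H_simps)
  have zc: "\<zero>\<^bsub>GR\<^esub> \<in> carrier GR"
    by (rule gr_carrierI[OF zero_Fil z, of "{}"]) (auto simp: H.\<kappa>_zero hc_rules simp del: H_simps)
  moreover have "\<kappa>g \<zero>\<^bsub>GR\<^esub> = 0"
    by (rule \<kappa>g_eqI[OF zc zero_Fil z]) (simp add: H.\<kappa>_zero del: H_simps)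
  ultimately show "\<zero>\<^bsub>GR\<^esub> \<in> carrier GR \<and> \<kappa>g \<zero>\<^bsub>GR\<^esub> = 0" by blast
  have "\<one>\<^bsub>H\<^esub> \<in> Fil 0" unfolding corad_filt_H using H.one by (simp add: IX_def)
  from gr_hom_class[OF this] show "\<one>\<^bsub>GR\<^esub> \<in> carrier GR \<and> \<kappa>g \<one>\<^bsub>GR\<^esub> = vac"
    using H.one by (simp add: gr_hopf_def)
qed

end

section \<open>The Nichols algebra of \<open>\<V>(1,2)\<close>\<close>

text \<open>The braiding sends x \<otimes> y to (g y) \<otimes> x. The chain carries the letter
  \<open>x\<close> to the right end, and every letter it passes is acted on by g.\<close>

lemma fold_braid_at:
  assumes c: "c = yd_braiding (\<lambda>_. g) \<alpha>"
  shows "fold (braid_at c) [length u..<length u + length v] (pure (u @ x # v)) =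
    lin_ext (\<lambda>v'. pure (u @ v' @ [x])) (word_act \<alpha> g v)"
proof (induction v arbitrary: u)
  case (Cons y v)
  have lin: "plin (fold (braid_at c) js)" for js
    by (induction js) (auto simp: braid_at_def plin_def lin_ext_simps)
  have "[length u..<length u + length (y # v)] = length u # [length (u @ [z])..<length (u @ [z]) + length v]" for z
    by (simp add: upt_conv_Cons del: upt_Suc)
  note up = this[of y]
  have "braid_at c (length u) (pure (u @ x # y # v)) = lin_ext (\<lambda>z. pure ((u @ [z]) @ x # v)) (\<alpha> g y)"
    by (simp add: braid_at_def c yd_braiding_def nth_append plin_lin_ext_comp[OF plin_lin_ext])
  then have "fold (braid_at c) [length u..<length u + length (y # v)] (pure (u @ x # y # v)) =
      lin_ext (\<lambda>z. fold (braid_at c) [length (u @ [z])..<length (u @ [z]) + length v] (pure ((u @ [z]) @ x # v))) (\<alpha> g y)"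
    unfolding up fold_simps by (simp add: plin_lin_ext_comp[OF lin])
  also have "\<dots> = lin_ext (\<lambda>z. lin_ext (\<lambda>v'. pure ((u @ [z]) @ v' @ [x])) (word_act \<alpha> g v)) (\<alpha> g y)"
    by (simp only: Cons.IH)
  also have "\<dots> = lin_ext (\<lambda>v'. pure (u @ v' @ [x])) (word_act \<alpha> g (y # v))"
    by (simp add: conv_def plin_lin_ext_comp[OF plin_lin_ext])
  finally show ?case .
qed simp

lemma word_act_length: "word_act \<alpha> h w \<in> lc {v. length v = length w}"
proof (induction w)
  case (Cons x w)
  have "lin_ext var (\<alpha> h x) \<in> lc {v. length v = 1}" by (rule lc_lin_ext) simp
  with Cons show ?case
    unfolding word_act.simps monoid_algebra_simps free_monoid_simps conv_def
    by (intro lc_lin_ext) (auto simp: lc_def dest!: subsetD)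
qed simp

text \<open>The skew derivations: the coefficient of the last letter in the factor
  \<open>\<Sum>\<^sub>j c\<^sub>n\<^sub>-\<^sub>1 \<cdots> c\<^sub>j\<close> of the quantum symmetrizer.\<close>

primrec skew :: "('g \<Rightarrow> 'x \<Rightarrow> ('x \<Rightarrow>\<^sub>0 'k::field)) \<Rightarrow> 'g \<Rightarrow> 'x \<Rightarrow> 'x list \<Rightarrow> ('x list \<Rightarrow>\<^sub>0 'k)"
  where "skew \<alpha> g y [] = 0"
  | "skew \<alpha> g y (x # w) = (if x = y then word_act \<alpha> g w else 0) + var x \<odot> skew \<alpha> g y w"

lemma skew_length: "skew \<alpha> g y w \<in> lc {v. Suc (length v) = length w}"
proof (induction w)
  case (Cons x w)
  have "var x \<odot> skew \<alpha> g y w \<in> lc {v. Suc (length v) = length (x # w)}"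
    using Cons unfolding conv_def by (intro lc_lin_ext) (auto simp: lc_def dest!: subsetD)
  moreover have "word_act \<alpha> g w \<in> lc {v. Suc (length v) = length (x # w)}"
    using word_act_length[of \<alpha> g w] by simp
  ultimately show ?case by (auto intro!: lc_add)
qed simp

text \<open>The j-th summand moves the j-th letter of \<open>w\<close> to the end. Grouping by the
  letter that ends up last yields the skew derivations; the prefix \<open>u\<close> makes the
  induction on \<open>w\<close> possible, as positions are counted from its start.\<close>

lemma sum_fold_braid_at:
  fixes w :: "block list"
  assumes c: "c = yd_braiding (\<lambda>_. g) \<alpha>"
  shows "(\<Sum>j<length w. fold (braid_at c) [length u + j..<length u + length w - 1] (pure (u @ w))) =
    pure u \<odot> (\<Sum>y\<in>{X1, X2}. skew \<alpha> g y w \<odot> var y)"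
proof (induction w arbitrary: u)
  case (Cons x w)
  have "{..<length (x # w)} = insert 0 (Suc ` {..<length w})" by (auto simp: lessThan_Suc_eq_insert_0)
  then have "(\<Sum>j<length (x # w). fold (braid_at c) [length u + j..<length u + length (x # w) - 1] (pure (u @ x # w))) =
      fold (braid_at c) [length u..<length u + length w] (pure (u @ x # w)) +
      (\<Sum>j<length w. fold (braid_at c) [length (u @ [x]) + j..<length (u @ [x]) + length w - 1] (pure ((u @ [x]) @ w)))"
    by (simp add: sum.reindex)
  also have "\<dots> = lin_ext (\<lambda>v'. pure (u @ v' @ [x])) (word_act \<alpha> g w) +
      pure (u @ [x]) \<odot> (\<Sum>y\<in>{X1, X2}. skew \<alpha> g y w \<odot> var y)"
    by (simp only: fold_braid_at[OF c] Cons.IH)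
  also have "lin_ext (\<lambda>v'. pure (u @ v' @ [x])) (word_act \<alpha> g w) = pure u \<odot> word_act \<alpha> g w \<odot> var x"
    unfolding fm_assoc by (simp add: conv_def plin_lin_ext_comp[OF plin_lin_ext])
  also have "pure (u @ [x]) = pure u \<odot> var x" by simp
  finally show ?case
    by (cases x) (simp_all add: conv_simps fm_assoc add_ac del: conv_pure)
qed (simp add: conv_simps)

lemma lc_skew: "p \<in> lc {w. length w = Suc n} \<Longrightarrow> lin_ext (skew \<alpha> g y) p \<in> lc {w. length w = n}"
proof (rule lc_plin[OF plin_lin_ext])
  fix w :: "'a list" assume "w \<in> {w. length w = Suc n}"
  then show "lin_ext (skew \<alpha> g y) (pure w) \<in> lc {w. length w = n}"
    using skew_length[of \<alpha> g y w] by simp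
qed

lemma plin_braid_at: "plin (braid_at c i)"
  by (simp add: braid_at_def)

lemma plin_fold_braid_at: "plin (fold (braid_at c) js)"
  by (induction js) (auto simp: braid_at_def plin_def lin_ext_simps)

lemma plin_qs: "plin (quantum_symmetrizer c n)"
proof (induction n)
  case (Suc n)
  have "plin (\<lambda>p. \<Sum>j\<le>n. fold (braid_at c) [j..<n] p)"
    by (rule plinI) (simp_all add: plin_rules[OF plin_fold_braid_at] sum.distrib pscale_sum)
  from plin_comp[OF Suc this] show ?case by simp
qed simp

lemma braid_at_length:
  assumes "p \<in> lc {w. length w = n}" "Suc i < n"
  shows "braid_at c i p \<in> lc {w. length w = n}"
  by (rule lc_plin[OF plin_braid_at assms(1)])
    (use assms(2) in \<open>auto simp: braid_at_def intro!: lc_lin_ext\<close>)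

lemma braid_at_snoc:
  fixes p :: "'a list \<Rightarrow>\<^sub>0 'k::field"
  assumes "p \<in> lc {w. length w = n}" "Suc i < n"
  shows "braid_at c i (p \<odot> var y) = braid_at c i p \<odot> var y"
proof -
  have s: "supp p \<subseteq> {w. length w = n}" using assms by (simp add: lc_def)
  show ?thesis
  proof (rule plin_eq_on[OF s])
    show "plin (\<lambda>p. braid_at c i (p \<odot> var y))"
      by (rule plin_comp[OF plin_braid_at pbilinD(2)[OF pbilin_conv]])
    show "plin (\<lambda>p. braid_at c i p \<odot> var y)"
      using plin_comp[OF pbilinD(2)[OF pbilin_conv] plin_braid_at] .
    fix w :: "'a list" assume w: "w \<in> {w. length w = n}"
    show "braid_at c i (pure w \<odot> var y) = braid_at c i (pure w) \<odot> var y"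
      using w assms(2)
      by (auto simp: braid_at_def nth_append plin_lin_ext_comp[OF pbilinD(2)[OF pbilin_conv]] intro!: lin_ext_cong)
  qed
qed

lemma fold_braid_at_snoc:
  assumes "p \<in> lc {w. length w = n}" "\<forall>i\<in>set js. Suc i < n"
  shows "fold (braid_at c) js p \<in> lc {w. length w = n} \<and>
    fold (braid_at c) js (p \<odot> var y) = fold (braid_at c) js p \<odot> var y"
  using assms
  by (induction js arbitrary: p) (auto simp: braid_at_length braid_at_snoc)

lemma qs_snoc:
  assumes "p \<in> lc {w. length w = m}" "n \<le> m"
  shows "quantum_symmetrizer c n (p \<odot> var y) = quantum_symmetrizer c n p \<odot> var y"
  using assms
proof (induction n arbitrary: p)
  case (Suc n)
  have f: "fold (braid_at c) [j..<n] p \<in> lc {w. length w = m} \<and>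
      fold (braid_at c) [j..<n] (p \<odot> var y) = fold (braid_at c) [j..<n] p \<odot> var y" for j
    using Suc.prems by (intro fold_braid_at_snoc) auto
  then have "(\<Sum>j\<le>n. fold (braid_at c) [j..<n] (p \<odot> var y)) = (\<Sum>j\<le>n. fold (braid_at c) [j..<n] p) \<odot> var y"
    by (simp add: conv_simps)
  moreover have "(\<Sum>j\<le>n. fold (braid_at c) [j..<n] p) \<in> lc {w. length w = m}"
    using f by (intro lc_sum) auto
  ultimately show ?case using Suc by simp
qed simp

text \<open>The remaining symmetrizer acts on the first n letters only, so it passes by the
  split-off last letter. The kernel of the symmetrizer can therefore be studied by iterated skew
  derivation.\<close>

lemma qs_Suc:
  fixes p :: "block list \<Rightarrow>\<^sub>0 'k::field"
  assumes c: "c = yd_braiding (\<lambda>_. g) \<alpha>" and p: "p \<in> lc {w. length w = Suc n}"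
  shows "quantum_symmetrizer c (Suc n) p =
    (\<Sum>y\<in>{X1, X2}. quantum_symmetrizer c n (lin_ext (skew \<alpha> g y) p) \<odot> var y)"
proof -
  have s: "supp p \<subseteq> {w. length w = Suc n}" using p by (simp add: lc_def)
  have l1: "plin (\<lambda>p. \<Sum>j\<le>n. fold (braid_at c) [j..<n] p)"
    by (rule plinI) (simp_all add: plin_rules[OF plin_fold_braid_at] sum.distrib pscale_sum)
  have l2: "plin (\<lambda>p. \<Sum>y\<in>{X1, X2}. lin_ext (skew \<alpha> g y) p \<odot> var y)"
    by (rule plinI) (simp_all add: lin_ext_simps conv_simps pscale_add_right add_ac)
  have "(\<Sum>j\<le>n. fold (braid_at c) [j..<n] p) = (\<Sum>y\<in>{X1, X2}. lin_ext (skew \<alpha> g y) p \<odot> var y)"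
  proof (rule plin_eq_on[OF s l1 l2])
    fix w :: "block list" assume "w \<in> {w. length w = Suc n}"
    then show "(\<Sum>j\<le>n. fold (braid_at c) [j..<n] (pure w)) =
        (\<Sum>y\<in>{X1, X2}. lin_ext (skew \<alpha> g y) (pure w) \<odot> var y)"
      using sum_fold_braid_at[OF c, where u = "[]" and w = w] by (simp add: lessThan_Suc_atMost conv_simps)
  qed
  moreover have "lin_ext (skew \<alpha> g y) p \<in> lc {w. length w = n}" for y
    by (rule lc_skew[OF p])
  then have "quantum_symmetrizer c n (lin_ext (skew \<alpha> g y) p \<odot> var y) =
      quantum_symmetrizer c n (lin_ext (skew \<alpha> g y) p) \<odot> var y" for y
    by (rule qs_snoc) simp
  ultimately show ?thesis by (simp add: plin_rules[OF plin_qs])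
qed

text \<open>Words ending in different letters cannot cancel.\<close>

lemma snoc_sum_eq_0:
  fixes a b :: "block list \<Rightarrow>\<^sub>0 'k::field"
  assumes "a \<odot> var X1 + b \<odot> var X2 = 0"
  shows "a = 0 \<and> b = 0"
proof -
  have c: "coef (p \<odot> var y) (w @ [z]) = (if z = y then coef p w else 0)" for p :: "block list \<Rightarrow>\<^sub>0 'k" and y z w
    by (induction p rule: linear_induct[OF subset_UNIV]) (auto simp: conv_simps lookup_add lookup_single when_def)
  have "coef a w = 0 \<and> coef b w = 0" for w
    using arg_cong[OF assms, of "\<lambda>p. coef p (w @ [X1])"] arg_cong[OF assms, of "\<lambda>p. coef p (w @ [X2])"]
    by (simp add: lookup_add c)
  then show ?thesis by (auto intro: poly_mapping_eqI)
qed

definition contract_right :: "('j \<Rightarrow> 'k) \<Rightarrow> ('i \<times> 'j \<Rightarrow>\<^sub>0 'k::field) \<Rightarrow> ('i \<Rightarrow>\<^sub>0 'k)"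
  where "contract_right f = lin_ext (\<lambda>(i, j). pscale (f j) (pure i))"

lemma plin_contract_right: "plin (contract_right f)"
  by (simp add: contract_right_def)

lemmas contract_right_rules = plin_rules[OF plin_contract_right]

lemma contract_right_tens: "contract_right f (tens p r) = pscale (lin_form f r) p"
proof -
  have "pbilin (\<lambda>p r. pscale (lin_form f r) p)"
    by (auto simp: pbilin_def plin_def lin_form_simps pscale_add_left pscale_add_right mult_ac)
  from bilin_tens[OF this] show ?thesis by (simp add: contract_right_def)
qed

section \<open>From the tensor algebra to the Jordan plane inside the bosonization\<close>

fun block_gen :: "block \<Rightarrow> 'g gen"
  where "block_gen X1 = A1" | "block_gen X2 = A2"

context jordan_data
begin

abbreviation \<alpha> :: "'g \<Rightarrow> block \<Rightarrow> (block \<Rightarrow>\<^sub>0 'k)" where "\<alpha> \<equiv> block_act \<eta>"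

definition \<iota> :: "(block list \<Rightarrow>\<^sub>0 'k) \<Rightarrow> ('g gen list \<Rightarrow>\<^sub>0 'k)"
  where "\<iota> = lin_ext (\<lambda>w. pure (map block_gen w))"

text \<open>The algebra map from the tensor algebra with x1, x2 sent to a1, a2. Its kernel turns out
  to be the Nichols ideal.\<close>

definition qJ :: "(block list \<Rightarrow>\<^sub>0 'k) \<Rightarrow> (nat \<times> 'g \<times> nat \<Rightarrow>\<^sub>0 'k)"
  where "qJ p = q (\<iota> p)"

lemma plin_\<iota>: "plin \<iota>" and \<iota>_pure [simp]: "\<iota> (pure w) = pure (map block_gen w)"
  by (simp_all add: \<iota>_def)

lemma \<iota>_fm: "\<iota> (p \<odot> r) = \<iota> p \<odot> \<iota> r"
  by (rule multiplicative_ext) (auto simp: plin_\<iota> pbilin_conv)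

lemma block_gen_gens: "block_gen x \<in> lift_gens G"
  by (cases x) auto

lemma map_block_gen_W: "map block_gen w \<in> W"
  using block_gen_gens by (auto simp: in_lists_conv_set)

lemma \<iota>_lc: "\<iota> p \<in> lc W"
  unfolding \<iota>_def by (rule lc_lin_ext) (simp only: lc_pure map_block_gen_W)

lemma plin_qJ: "plin qJ"
  unfolding qJ_def by (rule plin_comp[OF plin_q plin_\<iota>])

lemmas qJ_rules = plin_rules[OF plin_qJ]

lemma qJ_lc: "qJ p \<in> lc IX"
  unfolding qJ_def by (rule q_lc[OF \<iota>_lc])

lemma qJ_fm: "qJ (p \<odot> r) = \<mu> (qJ p) (qJ r)"
  unfolding qJ_def \<iota>_fm by (rule q_mult[OF \<iota>_lc \<iota>_lc])

lemma qJ_Nil [simp]: "qJ (pure []) = vac"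
  by (simp add: qJ_def)

lemma qJ_Cons: "qJ (pure (x # w)) = op (block_gen x) (qJ (pure w))"
  by (simp add: qJ_def)

lemma qJ_var_fm: "qJ (var x \<odot> p) = op (block_gen x) (qJ p)"
  by (rule plin_eq_on[OF subset_UNIV, of "\<lambda>p. qJ (var x \<odot> p)" "\<lambda>p. op (block_gen x) (qJ p)"])
    (auto intro: plin_comp[OF plin_qJ pbilinD(1)[OF pbilin_conv]] plin_comp[OF plin_op plin_qJ] simp: qJ_Cons)

text \<open>Right multiplication by h. It commutes with all left multiplications and accounts for
  the group factors that coproducts and commutations leave on the right.\<close>

definition rt :: "'g \<Rightarrow> (nat \<times> 'g \<times> nat \<Rightarrow>\<^sub>0 'k) \<Rightarrow> (nat \<times> 'g \<times> nat \<Rightarrow>\<^sub>0 'k)"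
  where "rt h v = \<mu> v (pure (0, h, 0))"

lemma plin_rt: "plin (rt h)"
  unfolding rt_def by (rule pbilinD(2)[OF pbilin_\<mu>])

lemmas rt_rules = plin_rules[OF plin_rt]

lemma pure_h_lc: "h \<in> carrier G \<Longrightarrow> pure (0, h, 0) \<in> lc IX"
  by (simp add: IX_def)

lemma rt_lc: "h \<in> carrier G \<Longrightarrow> v \<in> lc IX \<Longrightarrow> rt h v \<in> lc IX"
  unfolding rt_def by (intro \<mu>_lc pure_h_lc)

lemma \<mu>_h: "h \<in> carrier G \<Longrightarrow> v \<in> lc IX \<Longrightarrow> \<mu> (pure (0, h, 0)) v = opG h v"
  using \<mu>_q_pure[of "[Grp h]" v] by simp

lemma \<mu>_gen: "x \<in> lift_gens G \<Longrightarrow> v \<in> lc IX \<Longrightarrow> \<mu> (q (var x)) v = op x v"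
  using \<mu>_q_pure[of "[x]" v] by simp

lemma rt_op: "x \<in> lift_gens G \<Longrightarrow> h \<in> carrier G \<Longrightarrow> v \<in> lc IX \<Longrightarrow> rt h (op x v) = op x (rt h v)"
  using \<mu>_gen[of x v] \<mu>_gen[of x "rt h v"] \<mu>_assoc[of "q (var x)" v "pure (0, h, 0)"] q_pure_lc[of "[x]"]
    pure_h_lc[of h] rt_lc[of h v]
  by (simp add: rt_def del: q_pure lc_pure)

lemma rt_rt: "h \<in> carrier G \<Longrightarrow> t \<in> carrier G \<Longrightarrow> v \<in> lc IX \<Longrightarrow> rt t (rt h v) = rt (h \<otimes> t) v"
  using \<mu>_assoc[of v "pure (0, h, 0)" "pure (0, t, 0)"] \<mu>_h[of h "pure (0, t, 0)"] by (simp add: rt_def IX_def)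

lemma rt_one: "v \<in> lc IX \<Longrightarrow> rt \<one> v = v"
  unfolding rt_def by (rule \<mu>_unit(2))

text \<open>Right multiplication by the inverse of h undoes it.\<close>

lemma rt_eq_0: "h \<in> carrier G \<Longrightarrow> v \<in> lc IX \<Longrightarrow> rt h v = 0 \<longleftrightarrow> v = 0"
  using rt_rt[of h "inv h" v] rt_one[of v] rt_rules(4) by auto

lemma rt_inj: "h \<in> carrier G \<Longrightarrow> v \<in> lc IX \<Longrightarrow> w \<in> lc IX \<Longrightarrow> rt h v = rt h w \<Longrightarrow> v = w"
  using rt_eq_0[of h "v - w"] by (simp add: lc_minus rt_rules)

lemma rt_vac: "h \<in> carrier G \<Longrightarrow> rt h vac = pure (0, h, 0)"
  unfolding rt_def by (rule \<mu>_unit(1)[OF pure_h_lc])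

text \<open>The smash product rule h v = (h . v) h, proved letter by letter from the relations
  between h and the generators.\<close>

lemma word_act_comm:
  assumes h: "h \<in> carrier G"
  shows "opG h (qJ (pure w)) = rt h (qJ (word_act \<alpha> h w))"
proof (induction w)
  case Nil
  show ?case using h by (simp add: rt_vac)
next
  case (Cons x w)
  let ?v = "qJ (pure w)" and ?v' = "qJ (word_act \<alpha> h w)"
  have "opG h (op (block_gen x) ?v) = op (block_gen x) (opG h ?v) +
      (if x = X2 then pscale (E h) (op1 (opG h ?v)) else 0)"
  proof (cases x)
    case X1
    have "(pure [Grp h, A1], pure [A1, Grp h]) \<in> lift_relations G g \<eta> (\<lambda>_. 0) (0 :: 'k)"
      using h by (auto simp: lift_relations_def Let_def)
    from act_relation[OF this qJ_lc, of "pure w"] show ?thesis by (simp add: X1)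
  next
    case X2
    have "(pure [Grp h, A2], (pure [A2] + pscale (E h) (pure [A1]) + pscale 0 (pure [] - pure [Grp g])) \<odot> pure [Grp h])
        \<in> lift_relations G g \<eta> (\<lambda>_. 0) (0 :: 'k)"
      using h unfolding lift_relations_def Let_def by auto
    from act_relation[OF this qJ_lc, of "pure w"] show ?thesis by (simp add: X2 conv_simps act_rules)
  qed
  then have "opG h (qJ (pure (x # w))) = op (block_gen x) (rt h ?v') +
      (if x = X2 then pscale (E h) (op1 (rt h ?v')) else 0)"
    by (simp add: qJ_Cons Cons)
  also have "\<dots> = rt h (op (block_gen x) ?v' + (if x = X2 then pscale (E h) (op1 ?v') else 0))"
    using rt_op[OF block_gen_gens h qJ_lc] rt_op[of A1 h ?v'] h qJ_lc by (simp add: rt_rules)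
  also have "\<dots> = rt h (qJ (word_act \<alpha> h (x # w)))"
    by (cases x) (simp_all add: lin_ext_simps conv_simps qJ_rules qJ_var_fm)
  finally show ?case .
qed

lemma tensor_act_comm:
  assumes h: "h \<in> carrier G"
  shows "opG h (qJ p) = rt h (qJ (tensor_act \<alpha> h p))"
  by (rule plin_eq_on[OF subset_UNIV, of "\<lambda>p. opG h (qJ p)" "\<lambda>p. rt h (qJ (tensor_act \<alpha> h p))"])
    (auto simp: tensor_act_def word_act_comm[OF h] intro: plin_comp[OF plin_opG plin_qJ]
      plin_comp[OF plin_rt plin_comp[OF plin_qJ plin_lin_ext]])

lemma op_eq_deg: "x \<in> lift_gens G \<Longrightarrow> v \<in> lc {i \<in> IX. deg i = n} \<Longrightarrow>
    op x v \<in> lc {i \<in> IX. deg i = n + wdeg [x]}"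
  by (erule lc_plin[OF plin_op]) (auto simp: IX_def op2_jordan intro!: lc_intros)

lemma qJ_deg: "qJ (pure w) \<in> lc {i \<in> IX. deg i = length w}"
proof (induction w)
  case (Cons x w)
  have "wdeg [block_gen x :: 'g gen] = 1" by (cases x) auto
  then show ?case using op_eq_deg[OF block_gen_gens Cons, of x] by (simp add: qJ_Cons)
qed (simp add: IX_def)

lemma qJ_lc_one: "qJ p \<in> lc {i \<in> IX. fst (snd i) = \<one>}"
proof (rule lc_plin[OF plin_qJ, of p UNIV])
  fix w
  show "qJ (pure w) \<in> lc {i \<in> IX. fst (snd i) = \<one>}"
  proof (induction w)
    case (Cons x w)
    have "op (block_gen x) v \<in> lc {i \<in> IX. fst (snd i) = \<one>}" if "v \<in> lc {i \<in> IX. fst (snd i) = \<one>}" for v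
      using that by (rule lc_plin[OF plin_op]) (cases x, auto simp: IX_def op2_jordan intro!: lc_intros)
    from this[OF Cons] show ?case by (simp add: qJ_Cons)
  qed (simp add: IX_def)
qed (simp add: lc_def)

text \<open>Of \<Delta>(x) = x \<otimes> 1 + g \<otimes> x only the second summand changes the right
  factor. For the functionals in use, composing \<open>f\<close> with left multiplication by x gives
  a multiple of a functional \<open>f'\<close> of lower degree.\<close>

lemma contract_right_T:
  assumes t: "t \<in> lc (IX \<times> IX)" and x: "x = A1 \<or> x = A2"
    and f: "\<And>j. j \<in> IX \<Longrightarrow> lin_form f (op x (pure j)) = c * f' j"
  shows "contract_right f (T x t) = op x (contract_right f t) + pscale c (opG g (contract_right f' t))"
proof -
  have s: "supp t \<subseteq> IX \<times> IX" using t by (simp add: lc_def)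
  show ?thesis
  proof (rule plin_eq_on[OF s plin_comp[OF plin_contract_right plin_T]])
    show "plin (\<lambda>t. op x (contract_right f t) + pscale c (opG g (contract_right f' t)))"
      by (intro plin_plus plin_scale plin_comp[OF plin_op plin_contract_right] plin_comp[OF plin_opG plin_contract_right])
    fix z assume "z \<in> IX \<times> IX"
    then obtain i j where z: "z = (i, j)" "i \<in> IX" "j \<in> IX" by blast
    show "contract_right f (T x (pure z)) =
        op x (contract_right f (pure z)) + pscale c (opG g (contract_right f' (pure z)))"
      using x z by (simp add: T_A contract_right_rules contract_right_tens f op_rules del: tens_pure)
        (simp add: contract_right_def op_rules)
  qed
qed

lemma \<Delta>_qJ_Cons: "\<Delta> (qJ (pure (x # w))) = T (block_gen x) (\<Delta> (qJ (pure w)))"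
  using \<Delta>_q_pure[OF map_block_gen_W, of "x # w"] \<Delta>_q_pure[OF map_block_gen_W, of w]
    qq_wd_Cons[OF block_gen_gens[of x] map_block_gen_W[of w]] by (simp add: qJ_def del: q_pure)

lemma \<Delta>_qJ_lc: "\<Delta> (qJ (pure w)) \<in> lc (IX \<times> IX)"
  using \<Delta>_q_pure[OF map_block_gen_W, of w] qq_wd_lc[OF map_block_gen_W, of w] by (simp add: qJ_def del: q_pure)

lemma unit_part_ep: "unit_part = ep"
proof
  fix i :: "nat \<times> 'g \<times> nat"
  show "unit_part i = ep i" by (cases i) (auto simp: unit_part_def ep_def sw_def word_counit_def)
qed

lemma contract_right_unit: "v \<in> lc IX \<Longrightarrow> contract_right unit_part (\<Delta> v) = v"
  unfolding unit_part_ep contract_right_def by (rule \<Delta>_counit(2))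

text \<open>The right factors in the coproduct of a word in a1, a2 contain no group element, and
  \<eta> vanishes at the neutral element. So the \<eta>-correction seen on the left has no
  counterpart here.\<close>

lemma contract_right_eta: "contract_right eta_part (\<Delta> (qJ (pure w))) = 0"
proof (induction w)
  case Nil
  have "\<Delta> vac = tens vac vac" by (rule \<Delta>_one)
  then show ?case by (simp add: contract_right_tens eta_part_def del: tens_pure)
next
  case (Cons x w)
  have "lin_form eta_part (op (block_gen x) (pure j)) = 0 * eta_part j" if "j \<in> IX" for j
    by (cases x; cases j) (auto simp: op2_jordan lin_form_simps eta_part_def)
  from contract_right_T[OF \<Delta>_qJ_lc _ this] Cons show ?case
    by (cases x) (simp_all add: \<Delta>_qJ_Cons op_rules)
qed

fun part :: "block \<Rightarrow> nat \<times> 'g \<times> nat \<Rightarrow> 'k"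
  where "part X1 = a1_part" | "part X2 = a2_part"

lemma contract_right_\<Delta>_Cons:
  "contract_right (part y) (\<Delta> (qJ (pure (x # w)))) =
    op (block_gen x) (contract_right (part y) (\<Delta> (qJ (pure w)))) + (if x = y then opG g (qJ (pure w)) else 0)"
proof -
  note t = \<Delta>_qJ_lc[of w]
  have 11: "lin_form a1_part (op A1 (pure j)) = 1 * unit_part j" and 12: "lin_form a2_part (op A1 (pure j)) = 0 * unit_part j"
    and 21: "lin_form a1_part (op A2 (pure j)) = (- 1) * eta_part j" and 22: "lin_form a2_part (op A2 (pure j)) = 1 * unit_part j"
    for j by (cases j, auto simp: op2_jordan lin_form_simps part_defs eta_part_def)+
  have u: "contract_right unit_part (\<Delta> (qJ (pure w))) = qJ (pure w)" by (rule contract_right_unit[OF qJ_lc])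
  show ?thesis
    using contract_right_T[OF t disjI1[OF refl] 11] contract_right_T[OF t disjI1[OF refl] 12]
      contract_right_T[OF t disjI2[OF refl] 21] contract_right_T[OF t disjI2[OF refl] 22]
    by (cases x; cases y) (simp_all add: \<Delta>_qJ_Cons u contract_right_eta op_rules)
qed

text \<open>The part of bidegree (N - 1, 1) of the coproduct is the sum of d_y(p) g \<otimes> y over
  the two letters, where d_y is the skew derivation. Both sides satisfy the same recursion along the
  word; the g comes from the summand g \<otimes> y.\<close>

lemma contract_right_skew: "contract_right (part y) (\<Delta> (qJ p)) = rt g (qJ (lin_ext (skew \<alpha> g y) p))"
proof (rule plin_eq_on[OF subset_UNIV, of "\<lambda>p. contract_right (part y) (\<Delta> (qJ p))"
      "\<lambda>p. rt g (qJ (lin_ext (skew \<alpha> g y) p))"])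
  show "plin (\<lambda>p. contract_right (part y) (\<Delta> (qJ p)))"
    by (intro plin_comp[OF plin_contract_right plin_comp[OF plin_\<Delta> plin_qJ]])
  show "plin (\<lambda>p. rt g (qJ (lin_ext (skew \<alpha> g y) p)))"
    by (intro plin_comp[OF plin_rt plin_comp[OF plin_qJ plin_lin_ext]])
  fix w
  have "contract_right (part y) (\<Delta> (qJ (pure w))) = rt g (qJ (skew \<alpha> g y w))"
  proof (induction w)
    case Nil
    have "\<Delta> vac = tens vac vac" by (rule \<Delta>_one)
    then show ?case by (cases y) (simp_all add: contract_right_tens part_defs qJ_rules rt_rules del: tens_pure)
  next
    case (Cons x w)
    show ?case
      unfolding contract_right_\<Delta>_Cons Cons
      using word_act_comm[OF g_closed, of w] rt_op[OF block_gen_gens g_closed qJ_lc]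
      by (simp add: qJ_rules rt_rules qJ_var_fm)
  qed
  then show "contract_right (part y) (\<Delta> (qJ (pure w))) = rt g (qJ (lin_ext (skew \<alpha> g y) (pure w)))" by simp
qed

definition xw :: "nat \<times> 'g \<times> nat \<Rightarrow> block list"
  where "xw = (\<lambda>(m, h, n). replicate m X1 @ replicate n X2)"

lemma foldr_block_replicate:
  "qJ (pure (replicate m X1 @ w)) = (op1 ^^ m) (qJ (pure w))" "qJ (pure (replicate n X2 @ w)) = (op2 ^^ n) (qJ (pure w))"
  by (induction m, auto simp: qJ_Cons) (induction n, auto simp: qJ_Cons)

lemma qJ_xw: "qJ (pure (xw (m, \<one>, n))) = mon (m, \<one>, n)"
  using foldr_block_replicate(2)[of n "[]"] by (simp add: xw_def foldr_block_replicate mon_def)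

text \<open>The leading term in the exponent of a2 behaves as under differentiation by a2: the
  factor is k and a2 is lost once. Commuting g past a2 produces only lower exponents.\<close>

lemma contract_right_mon2:
  "contract_right a2_part (\<Delta> (mon (m, \<one>, k))) - pscale (of_nat k) (pure (m, g, k - 1)) \<in> low (k - 1)"
proof -
  let ?e = "\<lambda>k. contract_right a2_part (\<Delta> (qJ (pure (replicate k X2))))"
  have mon0: "qJ (pure (replicate k X2)) = mon (0, \<one>, k)" for k
    using qJ_xw[of 0 k] by (simp add: xw_def)
  have e: "?e k - pscale (of_nat k) (pure (0, g, k - 1)) \<in> low (k - 1)" for k
  proof (induction k)
    case 0
    have "\<Delta> vac = tens vac vac" by (rule \<Delta>_one)
    then show ?case by (simp add: contract_right_tens part_defs low_def del: tens_pure)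
  next
    case (Suc k)
    have eS: "?e (Suc k) = op2 (?e k) + opG g (mon (0, \<one>, k))"
      using contract_right_\<Delta>_Cons[of X2 X2 "replicate k X2"] by (simp add: mon0)
    have "mon (0, \<one>, k) - pure (0, \<one>, k) \<in> low k"
      using mon_triangular[of "(0, \<one>, k)"] by (simp add: low_def IX_def)
    from opG_low[OF g_closed this] have 1: "opG g (mon (0, \<one>, k)) - pure (0, g, k) \<in> low k"
      by (simp add: op_rules)
    have 2: "op2 (?e k) - pscale (of_nat k) (pure (0, g, k)) \<in> low k"
    proof (cases k)
      case 0
      have "\<Delta> vac = tens vac vac" by (rule \<Delta>_one)
      then show ?thesis by (simp add: 0 contract_right_tens part_defs low_def op_rules del: tens_pure)
    next
      case (Suc k')
      have "op2 (?e k - pscale (of_nat k) (pure (0, g, k - 1))) \<in> low k"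
        using op2_low[OF Suc.IH] by (simp add: Suc)
      moreover have "pscale (of_nat k) (op2 (pure (0, g, k - 1)) - pure (0, g, k)) \<in> low k"
        by (auto simp: Suc op2_jordan low_def IX_def intro!: lc_pscale lc_uminus)
      ultimately have "op2 (?e k - pscale (of_nat k) (pure (0, g, k - 1))) +
          pscale (of_nat k) (op2 (pure (0, g, k - 1)) - pure (0, g, k)) \<in> low k"
        unfolding low_def by (rule lc_add)
      then show ?thesis by (simp add: op_rules pscale_diff_right)
    qed
    have "(op2 (?e k) - pscale (of_nat k) (pure (0, g, k))) + (opG g (mon (0, \<one>, k)) - pure (0, g, k)) \<in> low k"
      using 1 2 unfolding low_def by (intro lc_add)
    then show ?case unfolding eS by (simp add: pscale_add_left algebra_simps)
  qed
  have "contract_right a2_part (\<Delta> (mon (m, \<one>, k))) = (op1 ^^ m) (?e k)"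
  proof -
    have "contract_right a2_part (\<Delta> (qJ (pure (replicate m X1 @ replicate k X2)))) = (op1 ^^ m) (?e k)"
      using contract_right_\<Delta>_Cons[of X2 X1] by (induction m) auto
    then show ?thesis using qJ_xw[of m k] by (simp add: xw_def)
  qed
  moreover have "(op1 ^^ m) (?e k - pscale (of_nat k) (pure (0, g, k - 1))) \<in> low (k - 1)"
    using e by (rule op1_power_low)
  ultimately show ?thesis by (simp add: plin_rules[OF plin_power[OF plin_op1]])
qed

lemma contract_right_mon1: "contract_right a1_part (\<Delta> (pure (m, \<one>, 0))) = pscale (of_nat m) (pure (m - 1, g, 0))"
proof -
  have q: "qJ (pure (replicate m X1)) = pure (m, \<one>, 0)" for m
    using foldr_block_replicate(1)[of m "[]"] by simp
  show ?thesis
  proof (induction m)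
    case 0
    have "\<Delta> vac = tens vac vac" by (rule \<Delta>_one)
    then show ?case by (simp add: contract_right_tens part_defs del: tens_pure)
  next
    case (Suc m)
    have "contract_right a1_part (\<Delta> (pure (Suc m, \<one>, 0))) =
        op1 (contract_right a1_part (\<Delta> (pure (m, \<one>, 0)))) + opG g (pure (m, \<one>, 0))"
      using contract_right_\<Delta>_Cons[of X1 X1 "replicate m X1"] q[of m] q[of "Suc m"] by simp
    then show ?case using Suc by (cases m) (simp_all add: op_rules pscale_add_left pscale_2)
  qed
qed

text \<open>Expand \<open>v\<close> in the monomials a1^m a2^k and look at the largest k that
  occurs. If k is positive, the contraction for a2 retains k times its coefficient; otherwise
  \<open>v\<close> is a multiple of a power of a1, and the contraction for a1 multiplies by the
  exponent. Both factors are nonzero in characteristic 0.\<close>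

lemma joint_kernel:
  assumes v: "v \<in> lc {i \<in> IX. fst (snd i) = \<one> \<and> deg i = Suc n}"
    and zero: "\<And>y. contract_right (part y) (\<Delta> v) = 0"
  shows "v = 0"
proof -
  define I where "I = {i \<in> IX. fst (snd i) = \<one> \<and> deg i = Suc n}"
  have tri: "mon i - pure i \<in> lc {j \<in> I. snd (snd j) < snd (snd i)}" if i: "i \<in> I" for i
  proof -
    obtain m k where mk: "i = (m, \<one>, k)" "m + k = Suc n" using i by (cases i) (auto simp: I_def)
    have "mon i \<in> lc {i \<in> IX. fst (snd i) = \<one>}" "mon i \<in> lc {i \<in> IX. deg i = Suc n}"
      using qJ_lc_one[of "pure (xw i)"] qJ_deg[of "xw i"] mk qJ_xw[of m k] by (auto simp: xw_def)
    from lc_coef[OF this(1)] lc_coef[OF this(2)] have "mon i \<in> lc I"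
      by (intro lcI) (use I_def in blast)
    then have "mon i - pure i \<in> lc I" using i by (intro lc_minus) auto
    from lc_coef[OF this] lc_coef[OF mon_triangular[of i]] i show ?thesis
      by (intro lcI) (use I_def in blast)
  qed
  have "v \<in> lin_ext mon ` lc I"
    using v unitriangular_surj[of I mon "\<lambda>i. snd (snd i)", OF tri] by (simp add: I_def)
  then obtain c where c: "c \<in> lc I" "v = lin_ext mon c" by blast
  have form: "\<exists>m k. i = (m, \<one>, k) \<and> m + k = Suc n" if "i \<in> supp c" for i
    using c(1) that by (cases i) (auto simp: lc_def I_def)
  have "c = 0"
  proof (rule ccontr)
    assume "c \<noteq> 0"
    then have "Max ((\<lambda>i. snd (snd i)) ` supp c) \<in> (\<lambda>i. snd (snd i)) ` supp c" by (intro Max_in) auto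
    then obtain i where i: "i \<in> supp c" and "snd (snd i) = Max ((\<lambda>i. snd (snd i)) ` supp c)" by auto
    then have max: "snd (snd j) \<le> snd (snd i)" if "j \<in> supp c" for j using that by simp
    obtain m k where mk: "i = (m, \<one>, k)" "m + k = Suc n" using form[OF i] by blast
    have ci: "coef c i \<noteq> 0" using i by (simp add: in_keys_iff)
    have lin: "contract_right f (\<Delta> v) = lin_ext (\<lambda>i. contract_right f (\<Delta> (mon i))) c" for f
      unfolding c(2) by (rule plin_lin_ext_comp[OF plin_comp[OF plin_contract_right plin_\<Delta>]])
    show False
    proof (cases k)
      case (Suc k')
      \<comment> \<open>By maximality of \<open>k\<close> any other monomial has a smaller exponent
        of a2, so neither its leading term nor its error terms reach k - 1.\<close>
      have "coef (contract_right a2_part (\<Delta> (mon j))) (m, g, k') = (if j = i then of_nat k else 0)" if j: "j \<in> supp c" for j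
      proof -
        obtain m' l where ml: "j = (m', \<one>, l)" "m' + l = Suc n" using form[OF j] by blast
        have "l \<le> k" using max[OF j] by (simp add: ml mk)
        then have "coef (contract_right a2_part (\<Delta> (mon j)) - pscale (of_nat l) (pure (m', g, l - 1))) (m, g, k') = 0"
          using contract_right_mon2[of m' l] Suc unfolding ml(1) low_def by (intro lc_coef) auto
        then have "coef (contract_right a2_part (\<Delta> (mon j))) (m, g, k') =
            of_nat l * coef (pure (m', g, l - 1)) (m, g, k')" by (simp add: lookup_minus)
        moreover have "j = i \<longleftrightarrow> l = k" using ml mk by auto
        ultimately show ?thesis using Suc ml mk \<open>l \<le> k\<close> by (auto simp: lookup_single when_def)
      qed
      then have "coef (contract_right a2_part (\<Delta> v)) (m, g, k') = (\<Sum>j\<in>supp c. coef c j * (if j = i then of_nat k else 0))"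
        unfolding lin coef_lin_ext by (intro sum.cong) auto
      also have "\<dots> = (\<Sum>j\<in>supp c. if j = i then coef c i * of_nat k else 0)" by (rule sum.cong) auto
      also have "\<dots> = coef c i * of_nat k" using i by simp
      finally show False using zero[of X2] ci Suc by (simp del: of_nat_Suc)
    next
      case 0
      \<comment> \<open>All monomials have the same total degree, so exponent 0 of a2 leaves only
        one of them.\<close>
      have "j = i" if j: "j \<in> supp c" for j
      proof -
        obtain m' l where ml: "j = (m', \<one>, l)" "m' + l = Suc n" using form[OF j] by blast
        then show ?thesis using max[OF j] mk 0 by simp
      qed
      then have "supp c = {i}" using i by blast
      then have "v = pscale (coef c i) (mon i)" unfolding c(2) lin_ext_def by simp
      moreover have "mon i = pure (Suc n, \<one>, 0)" using mk 0 by (simp add: mon_def)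
      ultimately have "contract_right a1_part (\<Delta> v) = pscale (coef c i * of_nat (Suc n)) (pure (n, g, 0))"
        by (simp add: \<Delta>_rules contract_right_rules contract_right_mon1 del: of_nat_Suc)
      with zero[of X1] ci show False by (simp del: of_nat_Suc)
    qed
  qed
  then show ?thesis by (simp add: c(2))
qed

text \<open>Induction on the length: the symmetrizer kills \<open>p\<close> iff the shorter one
  kills both skew derivatives, iff their images in the Jordan plane vanish, iff the (N - 1, 1) part
  of the coproduct of the image of \<open>p\<close> vanishes, iff that image is zero.\<close>

lemma qs_kernel:
  assumes "p \<in> lc {w. length w = n}"
  shows "quantum_symmetrizer block_braiding n p = 0 \<longleftrightarrow> qJ p = 0"
  using assms
proof (induction n arbitrary: p)
  case 0
  have "p = pscale (coef p []) (pure [])"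
    using lc_coef[OF 0] by (intro poly_mapping_eqI) (auto simp: lookup_single when_def)
  then have "qJ p = pscale (coef p []) vac" using qJ_rules(3) by (metis qJ_Nil)
  with \<open>p = _\<close> show ?case by (metis pscale_eq_0_iff pure_neq_0 quantum_symmetrizer.simps(1))
next
  case (Suc n)
  \<comment> \<open>The given braiding is that of the Yetter-Drinfeld module because \<eta>(g) =
    1.\<close>
  have c: "block_braiding = yd_braiding (\<lambda>_. g) \<alpha>" by (rule block_braiding_eq_yd_braiding[where \<eta> = \<eta> and g = g, OF E_g, symmetric])
  have sk: "lin_ext (skew \<alpha> g y) p \<in> lc {w. length w = n}" for y
    by (rule lc_skew[OF Suc.prems])
  have deg: "qJ p \<in> lc {i \<in> IX. deg i = Suc n}"
    proof (rule lc_plin[OF plin_qJ Suc.prems])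
    fix w :: "block list" assume "w \<in> {w. length w = Suc n}"
    then show "qJ (pure w) \<in> lc {i \<in> IX. deg i = Suc n}" using qJ_deg[of w] by simp
  qed
  have "quantum_symmetrizer block_braiding (Suc n) p = 0 \<longleftrightarrow>
      (\<forall>y. quantum_symmetrizer block_braiding n (lin_ext (skew \<alpha> g y) p) = 0)"
  proof -
    let ?s = "\<lambda>y. quantum_symmetrizer block_braiding n (lin_ext (skew \<alpha> g y) p)"
    have e: "quantum_symmetrizer block_braiding (Suc n) p = ?s X1 \<odot> var X1 + ?s X2 \<odot> var X2"
      unfolding qs_Suc[OF c Suc.prems] by (subst sum.insert) simp_all
    show ?thesis
    proof
      assume "quantum_symmetrizer block_braiding (Suc n) p = 0"
      then have "?s X1 \<odot> var X1 + ?s X2 \<odot> var X2 = 0" unfolding e .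
      then have "?s X1 = 0 \<and> ?s X2 = 0" by (rule snoc_sum_eq_0)
      then show "\<forall>y. ?s y = 0" by (metis block.exhaust)
    next
      assume 0: "\<forall>y. ?s y = 0"
      show "quantum_symmetrizer block_braiding (Suc n) p = 0"
        unfolding e 0[rule_format] by (simp add: conv_simps)
    qed
  qed
  also have "\<dots> \<longleftrightarrow> (\<forall>y. qJ (lin_ext (skew \<alpha> g y) p) = 0)" using Suc.IH[OF sk] by simp
  also have "\<dots> \<longleftrightarrow> (\<forall>y. contract_right (part y) (\<Delta> (qJ p)) = 0)"
    unfolding contract_right_skew using rt_eq_0[OF g_closed qJ_lc] by simp
  also have "\<dots> \<longleftrightarrow> qJ p = 0"
  proof
    assume "\<forall>y. contract_right (part y) (\<Delta> (qJ p)) = 0"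
    moreover have "qJ p \<in> lc {i \<in> IX. fst (snd i) = \<one> \<and> deg i = Suc n}"
      using lc_coef[OF deg] lc_coef[OF qJ_lc_one[of p]] by (intro lcI) blast
    ultimately show "qJ p = 0" using joint_kernel by blast
  qed (simp add: \<Delta>_rules contract_right_rules)
  finally show ?case .
qed

lemma coef_word_component: "coef (word_component n p) w = (if length w = n then coef p w else 0)"
  by (induction p rule: linear_induct[OF subset_UNIV])
    (auto simp: word_component_def lin_ext_simps lookup_add lookup_single when_def)

lemma qJ_word_component: "qJ (word_component n p) = hc n (qJ p)"
proof (rule plin_eq_on[OF subset_UNIV, of "\<lambda>p. qJ (word_component n p)" "\<lambda>p. hc n (qJ p)"])
  show "plin (\<lambda>p. qJ (word_component n p))"
    unfolding word_component_def by (rule plin_comp[OF plin_qJ plin_lin_ext])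
  show "plin (\<lambda>p. hc n (qJ p))" by (rule plin_comp[OF plin_hc plin_qJ])
  fix w
  show "qJ (word_component n (pure w)) = hc n (qJ (pure w))"
  proof (rule poly_mapping_eqI)
    fix i
    show "coef (qJ (word_component n (pure w))) i = coef (hc n (qJ (pure w))) i"
      using lc_coef[OF qJ_deg[of w], of i]
      by (cases "length w = n"; cases "deg i = n") (auto simp: word_component_def coef_hc qJ_rules)
  qed
qed

text \<open>The ideal is defined degree by degree, and \<open>qJ\<close> preserves degrees, so the
  statements for the single lengths combine.\<close>

lemma nichols_ideal_eq: "nichols_ideal block_braiding = {p. qJ p = 0}"
proof -
  have "p \<in> nichols_ideal block_braiding \<longleftrightarrow> qJ p = 0" for p
  proof -
    have "word_component n p \<in> lc {w. length w = n}" for n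
      by (rule lcI) (auto simp: coef_word_component split: if_splits)
    then have "p \<in> nichols_ideal block_braiding \<longleftrightarrow> (\<forall>n. hc n (qJ p) = 0)"
      unfolding nichols_ideal_def by (simp add: qs_kernel qJ_word_component)
    also have "\<dots> \<longleftrightarrow> qJ p = 0"
      unfolding hc_eq_0_iff by (metis lookup_zero poly_mapping_eqI)
    finally show ?thesis .
  qed
  then show ?thesis by auto
qed

end

section \<open>The bosonization of the Jordan plane\<close>

context jordan_data
begin

abbreviation Tn :: "('g, block list \<Rightarrow>\<^sub>0 'k, 'k) yd_hopf"
  where "Tn \<equiv> tensor_yd G (\<lambda>_. g) \<alpha>"

abbreviation NJ :: "(block list \<Rightarrow>\<^sub>0 'k) set"
  where "NJ \<equiv> nichols_ideal block_braiding"

lemma Tn_simps [simp]: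
  "carrier Tn = UNIV" "monoid.mult Tn = conv (@)" "one Tn = pure []" "zero Tn = 0" "add Tn = (+)"
  "kscale Tn = pscale" "comult Tn = lin_ext (word_comult G (\<lambda>_. g) \<alpha>)" "counit Tn p = coef p []"
  "yd_act Tn = tensor_act \<alpha>" "yd_coact Tn = tensor_coact G (\<lambda>_. g)"
  by (simp_all add: tensor_yd_def khopf.defs kalg.defs yd_hopf.defs lc_def free_monoid_simps lists_UNIV)

lemma coords_Tn: "coords Tn id UNIV"
  by (rule k_algebra_coords[where \<mu> = "conv (@)" and e = "pure []"])
    (auto simp: lc_def pbilin_conv fm_assoc fm_unit)

sublocale Tn: coords Tn id UNIV
  by (rule coords_Tn)

lemma NJ_iff: "p \<in> NJ \<longleftrightarrow> qJ p = 0"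
  by (simp add: nichols_ideal_eq)

lemma ideal_NJ: "ideal NJ Tn"
proof (rule idealI[OF Tn.ring_axioms])
  show "subgroup NJ (add_monoid Tn)"
  proof (rule subgroup.intro)
    fix x assume "x \<in> NJ"
    moreover have "\<ominus>\<^bsub>Tn\<^esub> x + x = 0"
      using Tn.l_neg[of x] by simp
    then have "qJ (\<ominus>\<^bsub>Tn\<^esub> x) + qJ x = 0" by (metis qJ_rules(1,4))
    ultimately show "inv\<^bsub>add_monoid Tn\<^esub> x \<in> NJ" unfolding a_inv_def[symmetric] by (simp add: NJ_iff)
  qed (auto simp: NJ_iff qJ_rules)
  note m = plin_rules(4)[OF pbilinD(1)[OF pbilin_\<mu>]] plin_rules(4)[OF pbilinD(2)[OF pbilin_\<mu>]]
  show "x \<otimes>\<^bsub>Tn\<^esub> a \<in> NJ" if "a \<in> NJ" for a x using that by (simp add: NJ_iff qJ_fm m)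
  show "a \<otimes>\<^bsub>Tn\<^esub> x \<in> NJ" if "a \<in> NJ" for a x using that by (simp add: NJ_iff qJ_fm m)
qed

sublocale NJ: quot_coords Tn NJ qJ
  by (intro quot_coords.intro Tn.k_algebra_axioms ideal_NJ quot_coords_axioms.intro)
    (auto simp: qJ_rules NJ_iff)

abbreviation R :: "('g, (block list \<Rightarrow>\<^sub>0 'k) set, 'k) yd_hopf"
  where "R \<equiv> block_nichols G g \<eta>"

abbreviation nc :: "(block list \<Rightarrow>\<^sub>0 'k) \<Rightarrow> (block list \<Rightarrow>\<^sub>0 'k) set"
  where "nc p \<equiv> NJ +>\<^bsub>Tn\<^esub> p"

abbreviation rep :: "(block list \<Rightarrow>\<^sub>0 'k) set \<Rightarrow> (block list \<Rightarrow>\<^sub>0 'k)"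
  where "rep Y \<equiv> SOME p. p \<in> Y"

lemma nc_eq_iff: "nc p = nc r \<longleftrightarrow> qJ p = qJ r"
  by (rule NJ.coset_eq_iff) auto

lemma qJ_rep [simp]: "qJ (rep (nc p)) = qJ p"
  using NJ.some_in_coset(2)[of p] by simp

lemma R_fields:
  "carrier R = carrier (quot_alg Tn NJ)" "monoid.mult R = monoid.mult (quot_alg Tn NJ)" "one R = one (quot_alg Tn NJ)"
  "zero R = zero (quot_alg Tn NJ)" "add R = add (quot_alg Tn NJ)" "kscale R = kscale (quot_alg Tn NJ)"
  by (simp_all add: block_nichols_def quot_yd_def Let_def khopf.defs kalg.defs yd_hopf.defs)

lemma R_simps [simp]:
  "carrier R = range nc" "monoid.mult R (nc p) (nc r) = nc (p \<odot> r)" "one R = nc (pure [])"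
  "zero R = nc 0" "add R (nc p) (nc r) = nc (p + r)" "kscale R c (nc p) = nc (pscale c p)"
  using NJ.quot_carrier NJ.quot_mult[of p r] NJ.quot_add[of p r] NJ.quot_kscale[of p c]
  by (simp_all add: R_fields NJ.quot_zero NJ.quot_one)

lemma R_hopf_simps:
  "comult R Y = tensor_map nc nc (lin_ext (word_comult G (\<lambda>_. g) \<alpha>) (rep Y))" "counit R Y = coef (rep Y) []"
  "yd_act R h Y = nc (tensor_act \<alpha> h (rep Y))" "yd_coact R Y = tensor_map id nc (tensor_coact G (\<lambda>_. g) (rep Y))"
  by (simp_all add: block_nichols_def quot_yd_def Let_def khopf.defs kalg.defs yd_hopf.defs)

lemma R_monoid: "abelian_monoid R"
  by (rule abelian_monoidI) (auto simp: ac_simps)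

definition qR :: "(block list \<Rightarrow>\<^sub>0 'k) set \<Rightarrow> (nat \<times> 'g \<times> nat \<Rightarrow>\<^sub>0 'k)"
  where "qR Y = qJ (rep Y)"

lemma qR_nc [simp]: "qR (nc p) = qJ p"
  by (simp add: qR_def)

lemma qR_lc: "qR Y \<in> lc IX"
  unfolding qR_def by (rule qJ_lc)

lemma qR_finsum: "h \<in> A \<rightarrow> carrier R \<Longrightarrow> qR (finsum R h A) = (\<Sum>x\<in>A. qR (h x))"
  by (rule finsum_hom[OF R_monoid]) (auto simp: qJ_rules)

subsubsection \<open>Right translates\<close>

lemma rt_qJ_word:
  assumes h: "h \<in> carrier G"
  shows "rt h (qJ (pure w)) = q (pure (map block_gen w @ [Grp h]))"
proof (induction w)
  case Nil
  show ?case using h by (simp add: rt_vac)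
next
  case (Cons x w)
  then show ?case using rt_op[OF block_gen_gens h qJ_lc] by (simp add: qJ_Cons)
qed

lemma word_Grp_W: "h \<in> carrier G \<Longrightarrow> map block_gen w @ [Grp h] \<in> W"
  using block_gen_gens by (auto simp: in_lists_conv_set)

text \<open>Words in a1, a2 followed by h only involve indices with group component h. Different
  group elements thus occupy disjoint coordinates, which makes the coordinates on the bosonization
  injective.\<close>

lemma rt_qJ_component: "h \<in> carrier G \<Longrightarrow> rt h (qJ p) \<in> lc {i \<in> IX. fst (snd i) = h}"
proof (rule lc_plin[OF plin_comp[OF plin_rt plin_qJ], of p UNIV])
  fix w assume h: "h \<in> carrier G"
  show "rt h (qJ (pure w)) \<in> lc {i \<in> IX. fst (snd i) = h}"
  proof (induction w)
    case Nil
    show ?case using h by (simp add: rt_vac IX_def)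
  next
    case (Cons x w)
    have "op (block_gen x) v \<in> lc {i \<in> IX. fst (snd i) = h}" if "v \<in> lc {i \<in> IX. fst (snd i) = h}" for v
      using that by (rule lc_plin[OF plin_op]) (cases x, auto simp: IX_def op2_jordan intro!: lc_intros)
    from this[OF Cons] show ?case using rt_op[OF block_gen_gens h qJ_lc] by (simp add: qJ_Cons)
  qed
qed (simp add: lc_def)

lemma rt_qJ_degree: "h \<in> carrier G \<Longrightarrow> rt h (qJ (pure w)) \<in> lc {i \<in> IX. deg i = length w}"
proof (induction w)
  case Nil
  then show ?case by (simp add: rt_vac IX_def)
next
  case (Cons x w)
  have "wdeg [block_gen x :: 'g gen] = 1" by (cases x) auto
  then show ?case
    using op_eq_deg[OF block_gen_gens Cons.IH[OF Cons.prems], of x]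
    by (simp add: qJ_Cons rt_op[OF block_gen_gens Cons.prems qJ_lc])
qed

lemma rt_qJ_hc:
  assumes h: "h \<in> carrier G"
  shows "rt h (qJ (word_component n p)) = hc n (rt h (qJ p))"
proof (rule plin_eq_on[OF subset_UNIV, of "\<lambda>p. rt h (qJ (word_component n p))" "\<lambda>p. hc n (rt h (qJ p))"])
  show "plin (\<lambda>p. rt h (qJ (word_component n p)))"
    unfolding word_component_def by (rule plin_comp[OF plin_rt plin_comp[OF plin_qJ plin_lin_ext]])
  show "plin (\<lambda>p. hc n (rt h (qJ p)))" by (rule plin_comp[OF plin_hc plin_comp[OF plin_rt plin_qJ]])
  fix w
  show "rt h (qJ (word_component n (pure w))) = hc n (rt h (qJ (pure w)))"
  proof (rule poly_mapping_eqI)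
    fix i
    show "coef (rt h (qJ (word_component n (pure w)))) i = coef (hc n (rt h (qJ (pure w)))) i"
      using lc_coef[OF rt_qJ_degree[OF h, of w], of i]
      by (cases "length w = n"; cases "deg i = n") (auto simp: word_component_def coef_hc qJ_rules rt_rules)
  qed
qed

lemma rt_mon: "h \<in> carrier G \<Longrightarrow> rt h (qJ (pure (xw (m, h, n)))) = mon (m, h, n)"
  by (simp add: rt_qJ_word xw_def mon_def foldr_replicate)

lemma ep_rt_qJ: "h \<in> carrier G \<Longrightarrow> lin_form ep (rt h (qJ p)) = coef p []"
proof (induction p rule: linear_induct[OF subset_UNIV])
  case (4 w)
  have "word_counit (map block_gen w @ [Grp h]) = (if w = [] then 1 else 0)"
    by (cases w; cases "hd w") (auto simp: word_counit_def)
  with 4 show ?case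
    using ep_q[of "pure (map block_gen w @ [Grp h])"] word_Grp_W[of h w]
    by (simp add: rt_qJ_word lookup_single when_def lin_form_simps del: q_pure)
qed (auto simp: qJ_rules rt_rules lin_form_simps lookup_add)

subsubsection \<open>The coordinates of the bosonization\<close>

abbreviation K :: "('g \<Rightarrow> (block list \<Rightarrow>\<^sub>0 'k) set, 'k) khopf"
  where "K \<equiv> block_bosonization G g \<eta>"

text \<open>Sends r # h to the coordinates of the product r h in the graded algebra.\<close>

definition \<kappa>K :: "('g \<Rightarrow> (block list \<Rightarrow>\<^sub>0 'k) set) \<Rightarrow> (nat \<times> 'g \<times> nat \<Rightarrow>\<^sub>0 'k)"
  where "\<kappa>K f = (\<Sum>h\<in>smash_supp R f. rt h (qR (f h)))"

lemma carrier_K: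
  "f \<in> carrier K \<longleftrightarrow> (\<forall>h. f h \<in> range nc) \<and> smash_supp R f \<subseteq> carrier G \<and> finite (smash_supp R f)"
  by (auto simp: block_bosonization_def bosonization_def)

lemma K_rep:
  assumes "f \<in> carrier K"
  obtains p where "f h = nc p"
proof -
  have "f h \<in> range nc" using assms unfolding carrier_K by (elim conjE allE)
  then show ?thesis using that by blast
qed

lemma smash_suppD: "h \<notin> smash_supp R f \<Longrightarrow> f h = nc 0"
  by (simp add: smash_supp_def)

lemma \<kappa>K_superset: "finite A \<Longrightarrow> smash_supp R f \<subseteq> A \<Longrightarrow> \<kappa>K f = (\<Sum>h\<in>A. rt h (qR (f h)))"
  unfolding \<kappa>K_def by (rule sum.mono_neutral_left) (auto dest: smash_suppD simp: qJ_rules rt_rules)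

lemma smash_K:
  assumes h: "h \<in> carrier G"
  shows "smash R (nc p) h \<in> carrier K" "\<kappa>K (smash R (nc p) h) = rt h (qJ p)"
proof -
  have s: "smash_supp R (smash R (nc p) h) \<subseteq> {h}" by (auto simp: smash_supp_def smash_def)
  then show "smash R (nc p) h \<in> carrier K"
    using h finite_subset[OF s] by (auto simp: carrier_K smash_def)
  show "\<kappa>K (smash R (nc p) h) = rt h (qJ p)"
    using \<kappa>K_superset[OF _ s] by (simp add: smash_def)
qed

lemma \<kappa>K_lc: "f \<in> carrier K \<Longrightarrow> \<kappa>K f \<in> lc IX"
  unfolding \<kappa>K_def carrier_K by (intro lc_sum rt_lc qR_lc) auto

lemma coef_\<kappa>K:
  assumes f: "f \<in> carrier K" and t: "t \<in> carrier G" "fst (snd i) = t"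
  shows "coef (\<kappa>K f) i = coef (rt t (qR (f t))) i"
proof -
  let ?A = "insert t (smash_supp R f)"
  have "coef (\<kappa>K f) i = (\<Sum>h\<in>?A. coef (rt h (qR (f h))) i)"
    using f by (subst \<kappa>K_superset[of ?A]) (auto simp: carrier_K lookup_sum)
  also have "\<dots> = (\<Sum>h\<in>?A. if h = t then coef (rt t (qR (f t))) i else 0)"
  proof (rule sum.cong[OF refl])
    fix h assume "h \<in> ?A"
    then have h: "h \<in> carrier G" using f t by (auto simp: carrier_K)
    show "coef (rt h (qR (f h))) i = (if h = t then coef (rt t (qR (f t))) i else 0)"
      unfolding qR_def using lc_coef[OF rt_qJ_component[OF h]] t by auto
  qed
  also have "\<dots> = coef (rt t (qR (f t))) i" using f by (simp add: carrier_K)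
  finally show ?thesis .
qed

lemma \<kappa>K_inj:
  assumes f: "f \<in> carrier K" "f' \<in> carrier K" and eq: "\<kappa>K f = \<kappa>K f'"
  shows "f = f'"
proof
  fix t
  show "f t = f' t"
  proof (cases "t \<in> carrier G")
    case True
    have "coef (rt t (qR (f t))) i = coef (rt t (qR (f' t))) i" for i
    proof (cases "fst (snd i) = t")
      case False
      then show ?thesis unfolding qR_def using lc_coef[OF rt_qJ_component[OF True]] by auto
    next
      case t: True
      show ?thesis using coef_\<kappa>K[OF f(1) True t] coef_\<kappa>K[OF f(2) True t] eq by simp
    qed
    then have "rt t (qR (f t)) = rt t (qR (f' t))" by (rule poly_mapping_eqI)
    then have "qR (f t) = qR (f' t)" by (rule rt_inj[OF True qR_lc qR_lc])
    moreover obtain p where "f t = nc p" using f(1) by (rule K_rep)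
    moreover obtain p' where "f' t = nc p'" using f(2) by (rule K_rep)
    ultimately show ?thesis by (simp add: nc_eq_iff)
  next
    case False
    then have "f t = nc 0" "f' t = nc 0" using f by (auto simp: carrier_K dest!: smash_suppD)
    then show ?thesis by simp
  qed
qed

lemma K_add:
  assumes f: "f \<in> carrier K" "f' \<in> carrier K"
  shows "f \<oplus>\<^bsub>K\<^esub> f' \<in> carrier K \<and> \<kappa>K (f \<oplus>\<^bsub>K\<^esub> f') = \<kappa>K f + \<kappa>K f'"
proof -
  let ?A = "smash_supp R f \<union> smash_supp R f'"
  have K: "(f \<oplus>\<^bsub>K\<^esub> f') = (\<lambda>h. f h \<oplus>\<^bsub>R\<^esub> f' h)" by (simp add: block_bosonization_def bosonization_def)
  have rep: "\<exists>p p'. f h = nc p \<and> f' h = nc p'" for h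
    by (rule K_rep[OF f(1), of h], rule K_rep[OF f(2), of h]) blast
  have s: "smash_supp R (f \<oplus>\<^bsub>K\<^esub> f') \<subseteq> ?A"
  proof
    fix h assume h: "h \<in> smash_supp R (f \<oplus>\<^bsub>K\<^esub> f')"
    show "h \<in> ?A"
    proof (rule ccontr)
      assume "h \<notin> ?A"
      then have "f h = nc 0" "f' h = nc 0" by (auto dest: smash_suppD)
      then have "(f \<oplus>\<^bsub>K\<^esub> f') h = nc 0" by (simp add: K)
      with h show False by (simp add: smash_supp_def)
    qed
  qed
  have fin: "finite ?A" using f by (simp add: carrier_K)
  have r: "(f \<oplus>\<^bsub>K\<^esub> f') h \<in> range nc \<and> qR ((f \<oplus>\<^bsub>K\<^esub> f') h) = qR (f h) + qR (f' h)" for h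
    using rep[of h] by (auto simp: K qJ_rules)
  have "f \<oplus>\<^bsub>K\<^esub> f' \<in> carrier K"
    using f by (simp add: carrier_K r finite_subset[OF s fin] order_trans[OF s])
  moreover have "\<kappa>K (f \<oplus>\<^bsub>K\<^esub> f') = \<kappa>K f + \<kappa>K f'"
    using \<kappa>K_superset[OF fin s] \<kappa>K_superset[OF fin, of f] \<kappa>K_superset[OF fin, of f']
    by (simp add: r rt_rules sum.distrib)
  ultimately show ?thesis ..
qed

lemma K_scale:
  assumes f: "f \<in> carrier K"
  shows "c \<cdot>\<^bsub>K\<^esub> f \<in> carrier K \<and> \<kappa>K (c \<cdot>\<^bsub>K\<^esub> f) = pscale c (\<kappa>K f)"
proof -
  have K: "(c \<cdot>\<^bsub>K\<^esub> f) = (\<lambda>h. c \<cdot>\<^bsub>R\<^esub> f h)" by (simp add: block_bosonization_def bosonization_def)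
  have rep: "\<exists>p. f h = nc p" for h by (rule K_rep[OF f]) blast
  have s: "smash_supp R (c \<cdot>\<^bsub>K\<^esub> f) \<subseteq> smash_supp R f"
  proof
    fix h assume "h \<in> smash_supp R (c \<cdot>\<^bsub>K\<^esub> f)"
    then have "c \<cdot>\<^bsub>R\<^esub> f h \<noteq> nc 0" by (simp add: smash_supp_def K)
    then have "f h \<noteq> nc 0" using R_simps(6)[of c 0] by (auto simp del: R_simps(6))
    then show "h \<in> smash_supp R f" by (simp add: smash_supp_def)
  qed
  have fin: "finite (smash_supp R f)" using f by (simp add: carrier_K)
  have r: "(c \<cdot>\<^bsub>K\<^esub> f) h \<in> range nc \<and> qR ((c \<cdot>\<^bsub>K\<^esub> f) h) = pscale c (qR (f h))" for h
    using rep[of h] by (auto simp: K qJ_rules)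
  have "c \<cdot>\<^bsub>K\<^esub> f \<in> carrier K"
    using f by (simp add: carrier_K r finite_subset[OF s fin] order_trans[OF s])
  moreover have "\<kappa>K (c \<cdot>\<^bsub>K\<^esub> f) = pscale c (\<kappa>K f)"
    using \<kappa>K_superset[OF fin s] \<kappa>K_superset[OF fin, of f] by (simp add: r rt_rules pscale_sum)
  ultimately show ?thesis ..
qed

lemma K_zero: "\<zero>\<^bsub>K\<^esub> \<in> carrier K \<and> \<kappa>K \<zero>\<^bsub>K\<^esub> = 0"
proof -
  have K: "\<zero>\<^bsub>K\<^esub> = (\<lambda>_. nc 0)" by (simp add: block_bosonization_def bosonization_def)
  then have "smash_supp R \<zero>\<^bsub>K\<^esub> = {}" by (simp add: smash_supp_def)
  then show ?thesis by (auto simp: carrier_K \<kappa>K_def K)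
qed

text \<open>Surjectivity uses the monomials a1^m a2^n h, which are the images of x1^m x2^n # h and
  span by triangularity.\<close>

lemma \<kappa>K_bij: "bij_betw \<kappa>K (carrier K) (lc IX)"
proof -
  have "v \<in> \<kappa>K ` carrier K" if "v \<in> lc IX" for v
  proof -
    have "v \<in> lin_ext mon ` lc IX"
      using unitriangular_surj[of IX mon "\<lambda>i. snd (snd i)", OF mon_triangular] that by blast
    then obtain c where c: "supp c \<subseteq> IX" "v = lin_ext mon c" by (auto simp: lc_def)
    have "\<exists>f\<in>carrier K. \<kappa>K f = lin_ext mon c"
      using c(1)
    proof (induction c rule: linear_induct)
      case zero
      show ?case using K_zero by (auto simp: lin_ext_simps)
    next
      case (add p r)
      then show ?case using K_add by (metis lin_ext_simps(1))
    next
      case (scale a p)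
      then show ?case using K_scale by (metis lin_ext_simps(3))
    next
      case (pure i)
      obtain m h n where i: "i = (m, h, n)" by (cases i)
      then have "h \<in> carrier G" using pure by (simp add: IX_def)
      from smash_K[OF this, of "pure (xw i)"] rt_mon[OF this, of m n] show ?case by (auto simp: i)
    qed
    then show ?thesis using c by (metis imageI)
  qed
  then show ?thesis using \<kappa>K_inj \<kappa>K_lc by (auto simp: bij_betw_def inj_on_def)
qed

lemma K_one: "\<one>\<^bsub>K\<^esub> \<in> carrier K \<and> \<kappa>K \<one>\<^bsub>K\<^esub> = vac"
proof -
  have "\<one>\<^bsub>K\<^esub> = smash R (nc (pure [])) \<one>" by (simp add: block_bosonization_def bosonization_def)
  then show ?thesis using smash_K[of \<one> "pure []"] rt_one[of vac] vac_lc by simp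
qed

end

context jordan_data
begin

lemma qR_act: "h \<in> carrier G \<Longrightarrow> rt h (qR (yd_act R h Y)) = opG h (qR Y)"
  by (simp add: R_hopf_simps qR_def tensor_act_comm)

text \<open>The product r (h . s) # h t of the smash product corresponds to r h s t, by
  associativity and h s = (h . s) h.\<close>

lemma rt_mult:
  assumes h: "h \<in> carrier G" and t: "t \<in> carrier G" and Y: "Y \<in> carrier R"
  shows "rt (h \<otimes> t) (qR (Y \<otimes>\<^bsub>R\<^esub> yd_act R h Y')) = \<mu> (rt h (qR Y)) (rt t (qR Y'))"
proof -
  obtain p where p: "Y = nc p" using Y by auto
  define b where "b = qR (yd_act R h Y')"
  have b: "b \<in> lc IX" "rt h b = opG h (qR Y')" by (simp_all add: b_def qR_lc qR_act[OF h])
  have "qR (Y \<otimes>\<^bsub>R\<^esub> yd_act R h Y') = \<mu> (qR Y) b"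
    by (simp add: p b_def R_hopf_simps qJ_fm)
  then have "rt (h \<otimes> t) (qR (Y \<otimes>\<^bsub>R\<^esub> yd_act R h Y')) = \<mu> (\<mu> (qR Y) b) (pure (0, h \<otimes> t, 0))"
    by (simp add: rt_def)
  also have "\<dots> = \<mu> (qR Y) (rt (h \<otimes> t) b)"
    unfolding rt_def using h t by (intro \<mu>_assoc qR_lc b pure_h_lc) simp
  also have "rt (h \<otimes> t) b = rt t (opG h (qR Y'))"
    using rt_rt[OF h t b(1)] b(2) by simp
  also have "\<dots> = opG h (rt t (qR Y'))"
    using rt_op[of "Grp h" t "qR Y'"] h t qR_lc by simp
  also have "\<dots> = \<mu> (pure (0, h, 0)) (rt t (qR Y'))"
    using \<mu>_h[OF h rt_lc[OF t qR_lc]] by simp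
  also have "\<mu> (qR Y) (\<mu> (pure (0, h, 0)) (rt t (qR Y'))) = \<mu> (rt h (qR Y)) (rt t (qR Y'))"
    unfolding rt_def using h t rt_lc[OF t qR_lc, of Y']
    by (intro \<mu>_assoc[symmetric] qR_lc pure_h_lc) (simp_all add: rt_def)
  finally show ?thesis .
qed

lemma K_mult:
  assumes f: "f \<in> carrier K" "f' \<in> carrier K"
  shows "f \<otimes>\<^bsub>K\<^esub> f' \<in> carrier K \<and> \<kappa>K (f \<otimes>\<^bsub>K\<^esub> f') = \<mu> (\<kappa>K f) (\<kappa>K f')"
proof -
  interpret R: abelian_monoid R by (rule R_monoid)
  define Sf where "Sf = smash_supp R f"
  define Sf' where "Sf' = smash_supp R f'"
  define A where "A = (\<lambda>(h, t). h \<otimes> t) ` (Sf \<times> Sf')"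
  have fin: "finite Sf" "finite Sf'" "finite A" and G: "Sf \<subseteq> carrier G" "Sf' \<subseteq> carrier G" "A \<subseteq> carrier G"
    using f by (auto simp: carrier_K A_def Sf_def Sf'_def dest: subsetD)
  let ?m = "\<lambda>h t. f h \<otimes>\<^bsub>R\<^esub> yd_act R h (f' t)"
  have m: "?m h t \<in> carrier R" for h t
    by (rule K_rep[OF f(1), of h]) (simp add: R_hopf_simps)
  have fh: "f h \<in> carrier R" for h by (rule K_rep[OF f(1), of h]) simp
  have K: "(f \<otimes>\<^bsub>K\<^esub> f') x = (\<Oplus>\<^bsub>R\<^esub>h\<in>Sf. \<Oplus>\<^bsub>R\<^esub>t\<in>{t \<in> Sf'. h \<otimes> t = x}. ?m h t)" for x
    by (simp add: block_bosonization_def bosonization_def Sf_def Sf'_def)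
  have cl: "(f \<otimes>\<^bsub>K\<^esub> f') x \<in> range nc" for x
    unfolding K R_simps(1)[symmetric] by (intro R.finsum_closed Pi_I m)
  have q: "qR ((f \<otimes>\<^bsub>K\<^esub> f') x) = (\<Sum>h\<in>Sf. \<Sum>t\<in>{t \<in> Sf'. h \<otimes> t = x}. qR (?m h t))" for x
    unfolding K using m by (subst qR_finsum) (auto intro!: sum.cong qR_finsum R.finsum_closed simp del: R_simps(1))
  have s: "smash_supp R (f \<otimes>\<^bsub>K\<^esub> f') \<subseteq> A"
  proof
    fix x assume x: "x \<in> smash_supp R (f \<otimes>\<^bsub>K\<^esub> f')"
    show "x \<in> A"
    proof (rule ccontr)
      assume "x \<notin> A"
      then have e: "{t \<in> Sf'. h \<otimes> t = x} = {}" if "h \<in> Sf" for h using that by (auto simp: A_def)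
      have "qR ((f \<otimes>\<^bsub>K\<^esub> f') x) = 0" unfolding q by (intro sum.neutral ballI) (simp only: e empty_iff)
      moreover obtain p where "(f \<otimes>\<^bsub>K\<^esub> f') x = nc p" using cl[of x] by blast
      ultimately have "(f \<otimes>\<^bsub>K\<^esub> f') x = nc 0" by (simp add: nc_eq_iff qJ_rules)
      with x show False by (simp add: smash_supp_def)
    qed
  qed
  have K: "f \<otimes>\<^bsub>K\<^esub> f' \<in> carrier K"
    by (simp add: carrier_K cl finite_subset[OF s fin(3)] order_trans[OF s G(3)])
  have "\<kappa>K (f \<otimes>\<^bsub>K\<^esub> f') = (\<Sum>x\<in>A. \<Sum>h\<in>Sf. \<Sum>t\<in>{t \<in> Sf'. h \<otimes> t = x}. rt x (qR (?m h t)))"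
    by (simp add: \<kappa>K_superset[OF fin(3) s] q rt_rules)
  also have "\<dots> = (\<Sum>h\<in>Sf. \<Sum>x\<in>A. \<Sum>t\<in>{t \<in> Sf'. h \<otimes> t = x}. rt x (qR (?m h t)))"
    by (rule sum.swap)
  also have "\<dots> = (\<Sum>h\<in>Sf. \<Sum>x\<in>A. \<Sum>t\<in>{t \<in> Sf'. h \<otimes> t = x}. rt (h \<otimes> t) (qR (?m h t)))"
    by (intro sum.cong) auto
  \<comment> \<open>The sum over \<open>x\<close> merely sorts the pairs by their product, each pair
    occurring for exactly one \<open>x\<close>.\<close>
  also have "\<dots> = (\<Sum>h\<in>Sf. \<Sum>t\<in>Sf'. rt (h \<otimes> t) (qR (?m h t)))"
    by (intro sum.cong[OF refl] sum.group fin) (auto simp: A_def)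
  also have "\<dots> = (\<Sum>h\<in>Sf. \<Sum>t\<in>Sf'. \<mu> (rt h (qR (f h))) (rt t (qR (f' t))))"
    using G by (intro sum.cong refl rt_mult fh) auto
  also have "\<dots> = \<mu> (\<kappa>K f) (\<kappa>K f')"
    unfolding \<kappa>K_def Sf_def Sf'_def
    by (simp only: plin_sum[OF pbilinD(1)[OF pbilin_\<mu>]] plin_sum[OF pbilinD(2)[OF pbilin_\<mu>]]) (rule sum.swap)
  finally show ?thesis using K by blast
qed

subsubsection \<open>Comultiplication\<close>

text \<open>Image of \<open>a \<otimes> v\<close> under \<open>r \<otimes> s \<mapsto> r # s\<^sub>(\<^sub>-\<^sub>1\<^sub>) h \<otimes> s\<^sub>(\<^sub>0\<^sub>) # h\<close>.\<close>

definition cm :: "'g \<Rightarrow> (nat \<times> 'g \<times> nat \<Rightarrow>\<^sub>0 'k) \<Rightarrow> (nat \<times> 'g \<times> nat \<Rightarrow>\<^sub>0 'k) \<Rightarrow>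
    ((nat \<times> 'g \<times> nat) \<times> (nat \<times> 'g \<times> nat) \<Rightarrow>\<^sub>0 'k)"
  where "cm h a v = lin_ext (\<lambda>i. tens (rt (g [^] deg i \<otimes> h) a) (rt h (pure i))) v"

lemma plin_cm: "plin (cm h a)"
  by (simp add: cm_def[abs_def])

lemma cm_homogeneous:
  assumes "v \<in> lc {i \<in> IX. deg i = n}"
  shows "cm h a v = tens (rt (g [^] n \<otimes> h) a) (rt h v)"
proof -
  have s: "supp v \<subseteq> {i \<in> IX. deg i = n}" using assms by (simp add: lc_def)
  show ?thesis
    by (rule plin_eq_on[OF s plin_cm plin_comp[OF plin_tens_right plin_rt]]) (auto simp: cm_def)
qed

lemma T_tens:
  assumes x: "x = A1 \<or> x = A2" and a: "a \<in> lc IX" and b: "b \<in> lc IX"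
  shows "T x (tens a b) = tens (op x a) b + tens (opG g a) (op x b)"
proof -
  have s: "supp a \<subseteq> IX" "supp b \<subseteq> IX" using a b by (simp_all add: lc_def)
  have 1: "T x (tens (pure i) b) = tens (op x (pure i)) b + tens (opG g (pure i)) (op x b)" if i: "i \<in> IX" for i
    by (rule plin_eq_on[OF s(2) plin_comp[OF plin_T plin_tens_right]
          plin_plus[OF plin_tens_right plin_comp[OF plin_tens_right plin_op]]])
      (use T_A[OF x i] in simp)
  show ?thesis
    by (rule plin_eq_on[OF s(1) plin_comp[OF plin_T plin_tens_left]
          plin_plus[OF plin_comp[OF plin_tens_left plin_op] plin_comp[OF plin_tens_left plin_opG]]])
      (rule 1)
qed

text \<open>Left multiplication by \<Delta>(x) corresponds to left multiplication by x \<otimes> 1 +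
  1 \<otimes> x in the braided tensor square: the g of g \<otimes> x is moved through the left
  factor, acting on it, and joins the power of g recorded by the degree of the right factor.\<close>

lemma T_cm:
  assumes h: "h \<in> carrier G" and v: "v \<in> lc IX"
  shows "T (block_gen x) (cm h (qJ p) v) =
    cm h (op (block_gen x) (qJ p)) v + cm h (qJ (tensor_act \<alpha> g p)) (op (block_gen x) v)"
proof -
  let ?x = "block_gen x :: 'g gen"
  have x: "?x = A1 \<or> ?x = A2" and xg: "?x \<in> lift_gens G" and wx: "wdeg [?x] = 1" by (cases x, auto)+
  have s: "supp v \<subseteq> IX" using v by (simp add: lc_def)
  show ?thesis
  proof (rule plin_eq_on[OF s plin_comp[OF plin_T plin_cm] plin_plus[OF plin_cm plin_comp[OF plin_cm plin_op]]])
    fix i assume i: "i \<in> IX"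
    let ?u = "g [^] deg i \<otimes> h"
    have u: "?u \<in> carrier G" using h g_closed by simp
    have "op ?x (pure i) \<in> lc {j \<in> IX. deg j = Suc (deg i)}"
      using op_eq_deg[OF xg, of "pure i" "deg i"] i wx by simp
    from cm_homogeneous[OF this] have c: "cm h (qJ (tensor_act \<alpha> g p)) (op ?x (pure i)) =
        tens (rt (g [^] Suc (deg i) \<otimes> h) (qJ (tensor_act \<alpha> g p))) (rt h (op ?x (pure i)))" .
    have "g [^] Suc (deg i) \<otimes> h = g \<otimes> ?u"
      using h g_closed g_central[of "g [^] deg i"] by (simp add: m_assoc[symmetric])
    then have "rt (g [^] Suc (deg i) \<otimes> h) (qJ (tensor_act \<alpha> g p)) = rt ?u (rt g (qJ (tensor_act \<alpha> g p)))"
      using rt_rt[OF g_closed u qJ_lc] by simp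
    also have "\<dots> = opG g (rt ?u (qJ p))"
      using tensor_act_comm[OF g_closed, of p] rt_op[of "Grp g" ?u "qJ p"] u g_closed qJ_lc by simp
    finally have c': "cm h (qJ (tensor_act \<alpha> g p)) (op ?x (pure i)) =
        tens (opG g (rt ?u (qJ p))) (op ?x (rt h (pure i)))"
      unfolding c using rt_op[OF xg h, of "pure i"] i by simp
    have "T ?x (cm h (qJ p) (pure i)) = T ?x (tens (rt ?u (qJ p)) (rt h (pure i)))"
      by (simp add: cm_def)
    also have "\<dots> = tens (op ?x (rt ?u (qJ p))) (rt h (pure i)) + tens (opG g (rt ?u (qJ p))) (op ?x (rt h (pure i)))"
      using i by (intro T_tens x rt_lc u h qJ_lc) simp
    also have "tens (op ?x (rt ?u (qJ p))) (rt h (pure i)) = cm h (op ?x (qJ p)) (pure i)"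
      using rt_op[OF xg u qJ_lc] by (simp add: cm_def)
    finally show "T ?x (cm h (qJ p) (pure i)) =
        cm h (op ?x (qJ p)) (pure i) + cm h (qJ (tensor_act \<alpha> g p)) (op ?x (pure i))"
      using c' by simp
  qed
qed

lemma word_degree_const: "word_degree G (\<lambda>_. g) w = g [^] length w"
  using g_closed g_central by (induction w) simp_all

lemma opG_one: "v \<in> lc IX \<Longrightarrow> opG \<one> v = v"
  using \<mu>_h[of \<one> v] \<mu>_unit(1)[of v] by simp

text \<open>Both sides are built up letter by letter by the same multiplication, so the braided
  coproduct bosonizes to the coproduct of the lifted word.\<close>

lemma cm_word_comult:
  assumes h: "h \<in> carrier G"
  shows "lin_ext (\<lambda>(a, b). cm h (qJ a) (qJ b)) (word_comult G (\<lambda>_. g) \<alpha> w) = \<Delta> (rt h (qJ (pure w)))"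
proof (induction w)
  case Nil
  have W: "[Grp h] \<in> W" "[] \<in> W" using h by auto
  have "\<Delta> (pure (0, h, 0)) = T (Grp h) (\<Delta> vac)"
    using \<Delta>_q_pure[OF W(1)] \<Delta>_q_pure[OF W(2)] qq_wd_Cons[of "Grp h" "[]"] h by simp
  also have "\<dots> = tens (pure (0, h, 0)) (pure (0, h, 0))"
    using T_Grp[OF h, of "(0, \<one>, 0)" "(0, \<one>, 0)"] h \<Delta>_one by (simp add: IX_def)
  finally show ?case
    using h by (simp add: cm_def rt_vac)
next
  case (Cons x w)
  let ?x = "block_gen x :: 'g gen" and ?wc = "word_comult G (\<lambda>_. g) \<alpha>"
  have act1: "qJ (tensor_act \<alpha> \<one> p) = qJ p" for p
    using tensor_act_comm[of \<one> p] rt_one[OF qJ_lc] opG_one[OF qJ_lc] by simp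
  have "?wc (x # w) = lin_ext (\<lambda>(c, d).
      pure (var x \<odot> tensor_act \<alpha> \<one> c, pure [] \<odot> d) + pure (pure [] \<odot> tensor_act \<alpha> g c, var x \<odot> d)) (?wc w)"
    using g_closed
    by (simp add: braided_tensor_mult_def tensor_coact_def lin_ext_simps free_monoid_simps case_prod_unfold lin_ext_fun_add)
  then have "lin_ext (\<lambda>(a, b). cm h (qJ a) (qJ b)) (?wc (x # w)) =
      lin_ext (\<lambda>(c, d). cm h (op ?x (qJ c)) (qJ d) + cm h (qJ (tensor_act \<alpha> g c)) (op ?x (qJ d))) (?wc w)"
    by (simp add: plin_lin_ext_comp[OF plin_lin_ext] case_prod_unfold lin_ext_simps fm_unit qJ_var_fm act1)
  also have "\<dots> = lin_ext (\<lambda>(c, d). T ?x (cm h (qJ c) (qJ d))) (?wc w)"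
    by (simp add: T_cm[OF h qJ_lc])
  also have "\<dots> = T ?x (\<Delta> (rt h (qJ (pure w))))"
    unfolding Cons[symmetric] by (simp add: plin_lin_ext_comp[OF plin_T] case_prod_unfold)
  also have "\<dots> = \<Delta> (rt h (qJ (pure (x # w))))"
    unfolding rt_qJ_word[OF h] using \<Delta>_q_pure[OF word_Grp_W[OF h, of w]] \<Delta>_q_pure[OF word_Grp_W[OF h, of "x # w"]]
      qq_wd_Cons[OF block_gen_gens[of x] word_Grp_W[OF h, of w]] by (simp del: q_pure)
  finally show ?case .
qed

lemma cm_comult:
  assumes h: "h \<in> carrier G"
  shows "lin_ext (\<lambda>(a, b). cm h (qJ a) (qJ b)) (lin_ext (word_comult G (\<lambda>_. g) \<alpha>) p) = \<Delta> (rt h (qJ p))"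
  by (rule plin_eq_on[OF subset_UNIV, of "\<lambda>p. lin_ext (\<lambda>(a, b). cm h (qJ a) (qJ b)) (lin_ext (word_comult G (\<lambda>_. g) \<alpha>) p)"
        "\<lambda>p. \<Delta> (rt h (qJ p))"])
    (auto intro: plin_comp[OF plin_lin_ext plin_lin_ext] plin_comp[OF plin_\<Delta> plin_comp[OF plin_rt plin_qJ]]
      simp: cm_word_comult[OF h])

lemma K_comult_formula: "comult K f = (\<Sum>h\<in>smash_supp R f. lin_ext (\<lambda>(a, b).
    lin_ext (\<lambda>w. pure (smash R (nc a) (g [^] length w \<otimes> h), smash R (nc (pure w)) h)) (rep (nc b)))
      (lin_ext (word_comult G (\<lambda>_. g) \<alpha>) (rep (f h))))"
  by (simp add: block_bosonization_def bosonization_def R_hopf_simps tensor_map_def tensor_coact_def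
      plin_lin_ext_comp[OF plin_lin_ext] case_prod_unfold word_degree_const)

lemma K_comult:
  assumes f: "f \<in> carrier K"
  shows "supp (comult K f) \<subseteq> carrier K \<times> carrier K \<and> tcoord \<kappa>K (comult K f) = \<Delta> (\<kappa>K f)"
proof -
  have G: "h \<in> carrier G" if "h \<in> smash_supp R f" for h using f that by (auto simp: carrier_K)
  have "supp (comult K f) \<subseteq> carrier K \<times> carrier K"
    unfolding K_comult_formula
  proof (rule order_trans[OF supp_sum], intro UN_least supp_lin_ext_subset)
    fix h and ab :: "(block list \<Rightarrow>\<^sub>0 'k) \<times> (block list \<Rightarrow>\<^sub>0 'k)"
    assume "h \<in> smash_supp R f"
    then have h: "h \<in> carrier G" by (rule G)
    obtain a b where ab: "ab = (a, b)" by (cases ab)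
    show "supp (case ab of (a, b) \<Rightarrow>
        lin_ext (\<lambda>w. pure (smash R (nc a) (g [^] length w \<otimes> h), smash R (nc (pure w)) h)) (rep (nc b)))
        \<subseteq> carrier K \<times> carrier K"
      unfolding ab prod.case using h g_closed by (intro supp_lin_ext_subset) (simp add: smash_K)
  qed
  moreover have "tcoord \<kappa>K (comult K f) = \<Delta> (\<kappa>K f)"
  proof -
    have "tcoord \<kappa>K (lin_ext (\<lambda>(a, b).
        lin_ext (\<lambda>w. pure (smash R (nc a) (g [^] length w \<otimes> h), smash R (nc (pure w)) h)) (rep (nc b)))
        (lin_ext (word_comult G (\<lambda>_. g) \<alpha>) (rep (f h)))) = \<Delta> (rt h (qR (f h)))"
      if "h \<in> smash_supp R f" for h
    proof -
      have h: "h \<in> carrier G" by (rule G[OF that])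
      \<comment> \<open>The chosen representative of a coset may be any word combination; on each
        word \<open>cm\<close> is homogeneous, and its total depends only on the image in the Jordan
        plane.\<close>
      have c: "lin_ext (\<lambda>w. tens (rt (g [^] length w \<otimes> h) (qJ a)) (rt h (qJ (pure w)))) (rep (nc b)) = cm h (qJ a) (qJ b)" for a b
      proof -
        have "cm h (qJ a) (qJ (rep (nc b))) = lin_ext (\<lambda>w. cm h (qJ a) (qJ (pure w))) (rep (nc b))"
          by (rule plin_eq_lin_ext[OF plin_comp[OF plin_cm plin_qJ]])
        then show ?thesis by (simp add: cm_homogeneous[OF qJ_deg])
      qed
      have "tcoord \<kappa>K (lin_ext (\<lambda>(a, b).
        lin_ext (\<lambda>w. pure (smash R (nc a) (g [^] length w \<otimes> h), smash R (nc (pure w)) h)) (rep (nc b)))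
        (lin_ext (word_comult G (\<lambda>_. g) \<alpha>) (rep (f h)))) =
        lin_ext (\<lambda>(a, b). cm h (qJ a) (qJ b)) (lin_ext (word_comult G (\<lambda>_. g) \<alpha>) (rep (f h)))"
        unfolding tcoord_lin_ext[of \<kappa>K] case_prod_unfold tcoord_simps
        using h g_closed by (simp add: smash_K c)
      then show ?thesis unfolding cm_comult[OF h] by (simp add: qR_def)
    qed
    then show ?thesis
      unfolding K_comult_formula tcoord_sum by (simp add: \<kappa>K_def plin_sum[OF plin_\<Delta>])
  qed
  ultimately show ?thesis ..
qed

lemma K_counit:
  assumes f: "f \<in> carrier K"
  shows "counit K f = lin_form ep (\<kappa>K f)"
proof -
  have "counit K f = (\<Sum>h\<in>smash_supp R f. coef (rep (f h)) [])"
    by (simp add: block_bosonization_def bosonization_def R_hopf_simps)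
  also have "\<dots> = (\<Sum>h\<in>smash_supp R f. lin_form ep (rt h (qR (f h))))"
    using f by (intro sum.cong refl) (auto simp: carrier_K qR_def ep_rt_qJ)
  also have "\<dots> = lin_form ep (\<kappa>K f)"
  proof -
    have "lin_form ep (\<Sum>h\<in>A. v h) = (\<Sum>h\<in>A. lin_form ep (v h))" for A :: "'g set" and v
      by (induction A rule: infinite_finite_induct) (auto simp: lin_form_simps)
    then show ?thesis by (simp add: \<kappa>K_def)
  qed
  finally show ?thesis .
qed

lemma bosonization_realization: "hopf_realization IX \<mu> vac \<Delta> ep S K \<kappa>K"
  by unfold_locales (rule \<kappa>K_bij K_zero K_one | erule (1) K_add | erule K_scale | erule (1) K_mult | erule K_comult | erule K_counit)+

lemma bosonization_component:
  "\<kappa>K ` block_component G g \<eta> n = lc {i \<in> IX. deg i = n}" "block_component G g \<eta> n \<subseteq> carrier K"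
proof -
  \<comment> \<open>Cosets only use the addition, which the free algebra and \<open>Tn\<close>
    share.\<close>
  have nc: "NJ +>\<^bsub>free_algebra UNIV\<^esub> p = nc p" for p by (simp add: a_r_coset_def')
  have bc: "f \<in> block_component G g \<eta> n \<longleftrightarrow>
      f \<in> carrier K \<and> (\<forall>h. \<exists>p. (\<forall>w\<in>supp p. length w = n) \<and> f h = nc p)" for f
    by (simp add: block_component_def nc)
  show sub: "block_component G g \<eta> n \<subseteq> carrier K" by (auto simp: bc)
  have "\<kappa>K f \<in> lc {i \<in> IX. deg i = n}" if f: "f \<in> block_component G g \<eta> n" for f
    unfolding \<kappa>K_def
  proof (rule lc_sum)
    fix h assume "h \<in> smash_supp R f"
    then have h: "h \<in> carrier G" using f by (auto simp: bc carrier_K)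
    obtain p where p: "supp p \<subseteq> {w. length w = n}" "f h = nc p" using f unfolding bc by blast
    have "rt h (qJ p) \<in> lc {i \<in> IX. deg i = n}"
    proof (rule lc_plin[OF plin_comp[OF plin_rt plin_qJ]])
      show "p \<in> lc {w. length w = n}" using p by (simp add: lc_def)
    next
      fix w :: "block list" assume "w \<in> {w. length w = n}"
      then show "rt h (qJ (pure w)) \<in> lc {i \<in> IX. deg i = n}" using rt_qJ_degree[OF h, of w] by simp
    qed
    then show "rt h (qR (f h)) \<in> lc {i \<in> IX. deg i = n}" using p by simp
  qed
  moreover have "v \<in> \<kappa>K ` block_component G g \<eta> n" if v: "v \<in> lc {i \<in> IX. deg i = n}" for v
  proof -
    have "v \<in> lc IX" using v by (auto simp: lc_def)
    then have "v \<in> \<kappa>K ` carrier K" using \<kappa>K_bij by (simp add: bij_betw_def)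
    then obtain f where f: "f \<in> carrier K" "\<kappa>K f = v" by blast
    \<comment> \<open>A preimage of \<open>v\<close> need not be visibly homogeneous. Replacing
      representatives by their length n parts changes the coordinates to their degree n part, which
      is \<open>v\<close> itself.\<close>
    define f' where "f' h = (if h \<in> smash_supp R f then nc (word_component n (rep (f h))) else nc 0)" for h
    have s: "smash_supp R f' \<subseteq> smash_supp R f" by (auto simp: smash_supp_def f'_def)
    have fin: "finite (smash_supp R f)" using f by (simp add: carrier_K)
    have f'K: "f' \<in> carrier K"
      using f(1) by (auto simp: carrier_K finite_subset[OF s] order_trans[OF s]) (simp add: f'_def)
    have "\<exists>p. (\<forall>w\<in>supp p. length w = n) \<and> f' h = nc p" for h
    proof (cases "h \<in> smash_supp R f")
      case True
      then show ?thesis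
        by (intro exI[of _ "word_component n (rep (f h))"])
          (auto simp: f'_def in_keys_iff coef_word_component split: if_splits)
    qed (auto simp: f'_def intro!: exI[of _ 0])
    with f'K have "f' \<in> block_component G g \<eta> n" by (simp add: bc)
    moreover have "\<kappa>K f' = v"
    proof -
      have "\<kappa>K f' = (\<Sum>h\<in>smash_supp R f. hc n (rt h (qR (f h))))"
        unfolding \<kappa>K_superset[OF fin s]
      proof (rule sum.cong[OF refl])
        fix h assume h: "h \<in> smash_supp R f"
        then have "h \<in> carrier G" using f by (auto simp: carrier_K)
        then show "rt h (qR (f' h)) = hc n (rt h (qR (f h)))"
          using h by (simp add: f'_def rt_qJ_hc) (simp add: qR_def)
      qed
      also have "\<dots> = hc n v" by (simp add: f(2)[symmetric] \<kappa>K_def hc_rules)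
      also have "\<dots> = v"
        by (rule poly_mapping_eqI) (use lc_coef[OF v] in \<open>auto simp: coef_hc\<close>)
      finally show ?thesis .
    qed
    ultimately show ?thesis by blast
  qed
  ultimately show "\<kappa>K ` block_component G g \<eta> n = lc {i \<in> IX. deg i = n}" by blast
qed

end

text \<open>Both sides realize the structure constants of the graded companion, and in both the n-th
  component corresponds to the indices of degree n.\<close>

lemma (in lift_pair) gr_isomorphic_bosonization:
  "graded_hopf_isomorphic (gr_hopf H, gr_component H) (block_bosonization G g \<eta>, block_component G g \<eta>)"
proof -
  interpret B: hopf_realization IX Z.\<mu> vac Z.\<Delta> Z.ep Z.S "block_bosonization G g \<eta>" Z.\<kappa>K
    by (rule Z.bosonization_realization)
  define \<phi> where "\<phi> = (\<lambda>x. B.elt (\<kappa>g x))"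
  have "hopf_iso (gr_hopf H) (block_bosonization G g \<eta>) \<phi>"
    unfolding \<phi>_def by (rule hopf_iso_realizations[OF gr_realization Z.bosonization_realization])
  moreover have "\<phi> ` gr_component H n = block_component G g \<eta> n" for n
  proof -
    have "\<phi> ` gr_component H n = B.elt ` Z.\<kappa>K ` block_component G g \<eta> n"
      unfolding Z.bosonization_component(1) gr_component(1)[symmetric] by (simp add: \<phi>_def image_image)
    also have "\<dots> = (\<lambda>x. x) ` block_component G g \<eta> n"
      unfolding image_image using Z.bosonization_component(2)[of n] by (intro image_cong refl B.elt_\<kappa>) blast
    finally show ?thesis by simp
  qed
  ultimately show ?thesis by (auto simp: graded_hopf_isomorphic_def)
qed

section \<open>Gelfand-Kirillov dimension\<close>

lemma ln_mult_ratio_tendsto: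
  assumes "0 < c"
  shows "(\<lambda>n. ln (real (c * n)) / ln (real n)) \<longlonglongrightarrow> 1"
proof -
  have ln: "filterlim (\<lambda>n. ln (real n)) at_top sequentially"
    by (rule filterlim_compose[OF ln_at_top filterlim_real_sequentially])
  have A: "(\<lambda>n. ln (real c) / ln (real n) + 1) \<longlonglongrightarrow> 0 + 1"
    by (intro tendsto_add tendsto_const tendsto_divide_0[OF tendsto_const filterlim_at_top_imp_at_infinity[OF ln]])
  have B: "\<forall>\<^sub>F n in sequentially. ln (real c) / ln (real n) + 1 = ln (real (c * n)) / ln (real n)"
    using eventually_ge_at_top[of 2]
  proof eventually_elim
    case (elim n)
    then have "ln (real n) > 0" by simp
    then show ?case using elim assms by (simp add: ln_mult field_simps)
  qed
  show ?thesis using Lim_transform_eventually[OF A B] by (simp del: of_nat_mult)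
qed

text \<open>Passing to the subsequence \<open>r\<close> can only lower the limsup, and factors
  tending to 1 do not change it. Nonnegativity of \<open>y\<close> excludes the value minus
  infinity.\<close>

lemma limsup_affine_le:
  fixes x y u v :: "nat \<Rightarrow> real"
  assumes "\<forall>\<^sub>F n in sequentially. x n \<le> u n * y (r n) + v n"
    and "\<forall>\<^sub>F n in sequentially. 0 \<le> y n" and "strict_mono r" and u: "u \<longlonglongrightarrow> 1" and v: "v \<longlonglongrightarrow> d"
  shows "limsup (\<lambda>n. ereal (x n)) \<le> limsup (\<lambda>n. ereal (y n)) + ereal d"
proof (cases "limsup (\<lambda>n. ereal (y n))")
  case (real L)
  have "\<forall>\<^sub>F n in sequentially. ereal (x n) < C" if C: "ereal (L + d) < C" for C
  proof -
    obtain c where c: "L + d < c" "ereal c \<le> C"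
      using C by (cases C) (auto intro: that[of "L + d + 1"])
    \<comment> \<open>The midpoint leaves room on both sides: it bounds \<open>y\<close> eventually,
      while \<open>e + d\<close> stays below \<open>c\<close>.\<close>
    define e where "e = L + (c - (L + d)) / 2"
    have e: "L < e" "e + d < c" using c by (auto simp: e_def field_simps)
    have "limsup (\<lambda>n. ereal (y n)) < ereal e" using real e by simp
    then have "\<forall>\<^sub>F n in sequentially. y n < e" using Limsup_lessD by fastforce
    then have "\<forall>\<^sub>F n in sequentially. y (r n) < e"
      by (rule eventually_compose_filterlim[OF _ filterlim_subseq[OF assms(3)]])
    moreover have "\<forall>\<^sub>F n in sequentially. 0 < u n" by (rule order_tendstoD(1)[OF u]) simp
    moreover have "(\<lambda>n. u n * e + v n) \<longlonglongrightarrow> 1 * e + d" by (intro tendsto_intros u v)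
    then have "\<forall>\<^sub>F n in sequentially. u n * e + v n < c" by (rule order_tendstoD(2)) (use e in simp)
    ultimately have "\<forall>\<^sub>F n in sequentially. x n < c"
      using assms(1)
    proof eventually_elim
      case (elim n)
      then have "u n * y (r n) \<le> u n * e" by (intro mult_left_mono) auto
      with elim show ?case by linarith
    qed
    then show ?thesis by eventually_elim (rule less_le_trans[OF _ c(2)], simp)
  qed
  then show ?thesis unfolding Limsup_le_iff real by simp
next
  case MInf
  have "0 \<le> limsup (\<lambda>n. ereal (y n))"
    by (rule le_Limsup) (use assms(2) in \<open>auto elim: eventually_mono\<close>)
  with MInf show ?thesis by simp
qed simp

lemma ln_of_nat_mono: "a \<le> b \<Longrightarrow> 1 \<le> b \<Longrightarrow> ln (real a) \<le> ln (real b)"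
  by (cases "a = 0") simp_all

lemma limsup_log_mono:
  assumes "\<And>n. 1 \<le> n \<Longrightarrow> a n \<le> (b n :: nat)"
  shows "limsup (\<lambda>n. ereal (log (real n) (real (a n)))) \<le> limsup (\<lambda>n. ereal (log (real n) (real (b n))))"
proof (rule Limsup_mono)
  show "\<forall>\<^sub>F n in sequentially. ereal (log (real n) (real (a n))) \<le> ereal (log (real n) (real (b n)))"
    using eventually_ge_at_top[of 2]
  proof eventually_elim
    case (elim n)
    with assms[of n] show ?case
      by (cases "a n = 0"; cases "b n = 0") (auto simp: log_def divide_right_mono)
  qed
qed

text \<open>After division by log n the square contributes 2 log(cn) / log n, which tends to 2, and
  dilation by \<open>c\<close> is invisible to the limsup because log(cn) / log n tends to
  1.\<close>

lemma limsup_log_scale: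
  assumes "0 < c" and "\<And>n. 1 \<le> n \<Longrightarrow> 1 \<le> b n"
    and "\<And>n. 1 \<le> n \<Longrightarrow> a n \<le> (c * n) ^ 2 * (b (c * n) :: nat)"
  shows "limsup (\<lambda>n. ereal (log (real n) (real (a n)))) \<le> limsup (\<lambda>n. ereal (log (real n) (real (b n)))) + 2"
proof -
  let ?u = "\<lambda>n. ln (real (c * n)) / ln (real n)"
  have u: "?u \<longlonglongrightarrow> 1" by (rule ln_mult_ratio_tendsto[OF assms(1)])
  have v: "(\<lambda>n. 2 * ?u n) \<longlonglongrightarrow> 2 * 1" by (intro tendsto_intros u)
  have "\<forall>\<^sub>F n in sequentially. log (real n) (real (a n)) \<le>
      ?u n * log (real (c * n)) (real (b (c * n))) + 2 * ?u n"
    using eventually_ge_at_top[of 2]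
  proof eventually_elim
    case (elim n)
    have cn: "2 \<le> c * n" using elim assms(1) by (cases c) auto
    have b: "1 \<le> b (c * n)" by (rule assms(2)) (use cn in linarith)
    have "real 2 \<le> real (c * n)" using cn by (simp only: of_nat_le_iff)
    then have ln: "0 < ln (real (c * n))" "0 < ln (real n)"
      using elim by (intro ln_gt_zero, linarith, simp)
    have "0 < (c * n) ^ 2 * b (c * n)"
      by (intro mult_pos_pos zero_less_power) (use b elim assms(1) in linarith)+
    then have "ln (real (a n)) \<le> ln (real ((c * n) ^ 2 * b (c * n)))"
      using assms(3)[of n] elim by (intro ln_of_nat_mono) simp_all
    also have "\<dots> = 2 * ln (real (c * n)) + ln (real (b (c * n)))"
      using b elim assms(1) by (simp only: of_nat_mult[of "(c * n) ^ 2"] of_nat_power) (simp add: ln_mult ln_realpow del: of_nat_mult)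
    finally have "ln (real (a n)) \<le> 2 * ln (real (c * n)) + ln (real (b (c * n)))" .
    then have "ln (real (a n)) / ln (real n) \<le> (2 * ln (real (c * n)) + ln (real (b (c * n)))) / ln (real n)"
      using ln by (intro divide_right_mono) auto
    then show ?case using ln by (simp add: log_def add_divide_distrib del: of_nat_mult)
  qed
  moreover have "\<forall>\<^sub>F n in sequentially. 0 \<le> log (real n) (real (b n))"
    using eventually_ge_at_top[of 2]
    by eventually_elim (use assms(2) in \<open>auto simp: log_def intro!: divide_nonneg_nonneg\<close>)
  moreover have "strict_mono (\<lambda>n. c * n)" using assms(1) by (simp add: strict_mono_def)
  ultimately have "limsup (\<lambda>n. ereal (log (real n) (real (a n)))) \<le>
      limsup (\<lambda>n. ereal (log (real n) (real (b n)))) + ereal (2 * 1)"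
    by (rule limsup_affine_le[OF _ _ _ u v])
  then show ?thesis by (simp add: numeral_eq_ereal)
qed

text \<open>The reverse comparison: the dilation is on the larger side, and its limsup is bounded
  below along the multiples of \<open>c\<close>.\<close>

lemma limsup_log_scale_ge:
  assumes "0 < c" and "\<And>n. 1 \<le> n \<Longrightarrow> 1 \<le> a n"
    and "\<And>n. 1 \<le> n \<Longrightarrow> n ^ 2 * a n \<le> (b (c * n) :: nat)"
    and "\<And>n. 1 \<le> n \<Longrightarrow> 1 \<le> b n"
  shows "limsup (\<lambda>n. ereal (log (real n) (real (a n)))) + 2 \<le> limsup (\<lambda>n. ereal (log (real n) (real (b n))))"
proof -
  let ?u = "\<lambda>n. ln (real (c * n)) / ln (real n)"
  have u: "?u \<longlonglongrightarrow> 1" by (rule ln_mult_ratio_tendsto[OF assms(1)])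
  have "\<forall>\<^sub>F n in sequentially. log (real n) (real (a n)) \<le>
      ?u n * log (real (c * n)) (real (b (c * n))) + (- 2)"
    using eventually_ge_at_top[of 2]
  proof eventually_elim
    case (elim n)
    have cn: "2 \<le> c * n" using elim assms(1) by (cases c) auto
    have a: "1 \<le> a n" using assms(2) elim by simp
    have "real 2 \<le> real (c * n)" using cn by (simp only: of_nat_le_iff)
    then have ln: "0 < ln (real (c * n))" "0 < ln (real n)"
      using elim by (intro ln_gt_zero, linarith, simp)
    have "2 * ln (real n) + ln (real (a n)) = ln (real (n ^ 2 * a n))"
      using a elim by (simp add: ln_mult ln_realpow)
    also have "\<dots> \<le> ln (real (b (c * n)))"
      using assms(3)[of n] assms(4)[of "c * n"] elim cn by (intro ln_of_nat_mono) linarith+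
    finally have "(2 * ln (real n) + ln (real (a n))) / ln (real n) \<le> ln (real (b (c * n))) / ln (real n)"
      using ln by (intro divide_right_mono) auto
    then show ?case using ln by (simp add: log_def add_divide_distrib del: of_nat_mult)
  qed
  moreover have "\<forall>\<^sub>F n in sequentially. 0 \<le> log (real n) (real (b n))"
    using eventually_ge_at_top[of 2]
    by eventually_elim (use assms(4) in \<open>auto simp: log_def intro!: divide_nonneg_nonneg\<close>)
  moreover have "strict_mono (\<lambda>n. c * n)" using assms(1) by (simp add: strict_mono_def)
  ultimately have "limsup (\<lambda>n. ereal (log (real n) (real (a n)))) \<le>
      limsup (\<lambda>n. ereal (log (real n) (real (b n)))) + ereal (- 2)"
    by (rule limsup_affine_le[OF _ _ _ u tendsto_const])
  from add_right_mono[OF this, of 2] show ?thesis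
    by (cases "limsup (\<lambda>n. ereal (log (real n) (real (b n))))") (simp_all add: numeral_eq_ereal)
qed

subsection \<open>Balls\<close>

definition wprod :: "('g, 'm) monoid_scheme \<Rightarrow> 'g list \<Rightarrow> 'g"
  where "wprod G w = foldr (monoid.mult G) w \<one>\<^bsub>G\<^esub>"

text \<open>Words in \<open>T\<close> without inverses, matching powers of a subspace. Symmetric
  generating sets are among the finite sets over which suprema are taken.\<close>

definition gball :: "('g, 'm) monoid_scheme \<Rightarrow> 'g set \<Rightarrow> nat \<Rightarrow> 'g set"
  where "gball G T n = wprod G ` {w \<in> lists T. length w \<le> n}"

definition growth :: "('g, 'm) monoid_scheme \<Rightarrow> 'g set \<Rightarrow> ereal"
  where "growth G T = limsup (\<lambda>n. ereal (log (real n) (real (card (gball G T n)))))"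

lemma wprod_simps [simp]: "wprod G [] = \<one>\<^bsub>G\<^esub>" "wprod G (x # w) = x \<otimes>\<^bsub>G\<^esub> wprod G w"
  by (simp_all add: wprod_def)

context group
begin

lemma wprod_closed: "w \<in> lists (carrier G) \<Longrightarrow> wprod G w \<in> carrier G"
  by (induction w) auto

lemma wprod_append: "u \<in> lists (carrier G) \<Longrightarrow> w \<in> lists (carrier G) \<Longrightarrow> wprod G (u @ w) = wprod G u \<otimes> wprod G w"
  by (induction u) (auto simp: wprod_closed m_assoc)

lemma gball_closed: "T \<subseteq> carrier G \<Longrightarrow> gball G T n \<subseteq> carrier G"
  unfolding gball_def using lists_mono[of T "carrier G"] by (auto intro!: wprod_closed)

lemma finite_gball: "finite T \<Longrightarrow> finite (gball G T n)"
  unfolding gball_def using finite_lists_length_le[of T n] by (auto simp: conj_commute lists_eq_set intro: finite_subset)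

lemma one_gball: "\<one> \<in> gball G T n"
  unfolding gball_def by (rule image_eqI[of _ _ "[]"]) auto

lemma gball_mono: "m \<le> n \<Longrightarrow> gball G T m \<subseteq> gball G T n"
  unfolding gball_def by auto

lemma gball_gen: "t \<in> T \<Longrightarrow> T \<subseteq> carrier G \<Longrightarrow> t \<in> gball G T 1"
  unfolding gball_def by (rule image_eqI[of _ _ "[t]"]) auto

lemma gball_mult:
  assumes T: "T \<subseteq> carrier G" and h: "h \<in> gball G T m" and k: "k \<in> gball G T n"
  shows "h \<otimes> k \<in> gball G T (m + n)"
proof -
  obtain u where u: "u \<in> lists T" "length u \<le> m" "h = wprod G u" using h by (auto simp: gball_def)
  obtain w where w: "w \<in> lists T" "length w \<le> n" "k = wprod G w" using k by (auto simp: gball_def)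
  have "wprod G (u @ w) = h \<otimes> k"
    using u w lists_mono[OF T] wprod_append by blast
  then show ?thesis unfolding gball_def using u w by (intro image_eqI[of _ _ "u @ w"]) auto
qed

lemma card_gball_pos: "finite T \<Longrightarrow> 1 \<le> card (gball G T n)"
  using finite_gball[of T n] one_gball[of T n] by (simp add: Suc_le_eq card_gt_0_iff) blast

end

subsection \<open>Powers of a subspace in coordinates\<close>

context coords
begin

abbreviation pow_upto :: "'a set \<Rightarrow> nat \<Rightarrow> 'a set"
  where "pow_upto V n \<equiv> k_span A (\<Union>i\<le>n. subspace_pow A V i)"

lemma k_span_lc:
  assumes "S \<subseteq> carrier A" and "\<kappa> ` S \<subseteq> lc Z"
  shows "\<kappa> ` k_span A S \<subseteq> lc Z"
  unfolding \<kappa>_k_span[OF assms(1)] using assms(2) PV.subspace_span[of "pure ` Z"]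
  by (intro PV.span_minimal) (simp_all add: span_pure)

lemma subspace_pow_closed: "V \<subseteq> carrier A \<Longrightarrow> subspace_pow A V n \<subseteq> carrier A"
  by (induction n) (auto intro!: k_span_subset)

lemma subspace_pow_mult:
  assumes "V \<subseteq> carrier A" "x \<in> subspace_pow A V n" "y \<in> V"
  shows "x \<otimes> y \<in> subspace_pow A V (Suc n)"
proof -
  have "{x \<otimes> y | x y. x \<in> subspace_pow A V n \<and> y \<in> V} \<subseteq> carrier A"
    using subspace_pow_closed[OF assms(1), of n] assms(1) by blast
  from k_span_superset[OF this] assms show ?thesis by auto
qed

lemma one_subspace_pow: "\<one> \<in> subspace_pow A V 0"
  using k_span_superset[of "{\<one>}"] by simp

lemma pow_upto_lc:
  assumes V: "V \<subseteq> carrier A" and one: "\<kappa> \<one> \<in> lc (Z 0)" and mono: "\<And>m n. m \<le> n \<Longrightarrow> Z m \<subseteq> Z n"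
    and step: "\<And>n x y. x \<in> carrier A \<Longrightarrow> \<kappa> x \<in> lc (Z n) \<Longrightarrow> y \<in> V \<Longrightarrow> \<kappa> (x \<otimes> y) \<in> lc (Z (Suc n))"
  shows "\<kappa> ` pow_upto V n \<subseteq> lc (Z n)"
proof -
  have p: "\<kappa> ` subspace_pow A V i \<subseteq> lc (Z i)" for i
  proof (induction i)
    case 0
    show ?case using one k_span_lc[of "{\<one>}" "Z 0"] by simp
  next
    case (Suc i)
    have "\<kappa> ` {x \<otimes> y | x y. x \<in> subspace_pow A V i \<and> y \<in> V} \<subseteq> lc (Z (Suc i))"
      using Suc step subspace_pow_closed[OF V, of i] by blast
    moreover have "{x \<otimes> y | x y. x \<in> subspace_pow A V i \<and> y \<in> V} \<subseteq> carrier A"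
      using subspace_pow_closed[OF V, of i] V by blast
    ultimately show ?case by (simp add: k_span_lc)
  qed
  show ?thesis
  proof (rule k_span_lc)
    show "(\<Union>i\<le>n. subspace_pow A V i) \<subseteq> carrier A" using subspace_pow_closed[OF V] by blast
    have "\<kappa> ` subspace_pow A V i \<subseteq> lc (Z n)" if "i \<le> n" for i
      using p[of i] lc_mono[OF mono[OF that]] by blast
    then show "\<kappa> ` (\<Union>i\<le>n. subspace_pow A V i) \<subseteq> lc (Z n)" by blast
  qed
qed

lemma subspace_pow_pow_upto: "V \<subseteq> carrier A \<Longrightarrow> i \<le> n \<Longrightarrow> subspace_pow A V i \<subseteq> pow_upto V n"
  using subspace_pow_closed k_span_superset[of "\<Union>i\<le>n. subspace_pow A V i"] by blast

lemma pow_upto_closed: "V \<subseteq> carrier A \<Longrightarrow> pow_upto V n \<subseteq> carrier A"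
  using subspace_pow_closed by (intro k_span_subset) blast

lemma k_dim_pow_upto_ge:
  assumes V: "V \<subseteq> carrier A" and "\<kappa> ` pow_upto V n \<subseteq> lc Y" "finite Y" and "pure ` Z \<subseteq> \<kappa> ` pow_upto V n"
  shows "card Z \<le> k_dim A (pow_upto V n)"
  using subspace_pow_closed[OF V] by (intro k_dim_ge[OF _ refl assms(2-4)]) blast

end

text \<open>A finite-dimensional subspace involves finitely many group elements, so its powers lie
  in the span of their balls; conversely the span of a finite set has powers containing its
  balls.\<close>

lemma (in group) GKdim_group_algebra:
  "GKdim (monoid_algebra G :: ('a \<Rightarrow>\<^sub>0 'k::field, 'k) kalg) = (SUP T\<in>{T. finite T \<and> T \<subseteq> carrier G}. growth G T)"
proof -
  let ?A = "monoid_algebra G :: ('a \<Rightarrow>\<^sub>0 'k, 'k) kalg"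
  interpret A: coords ?A id "carrier G" by (rule coords_monoid_algebra) unfold_locales
  have up: "id ` A.pow_upto V n \<subseteq> lc (gball G T n)"
    if V: "V \<subseteq> lc T" and T: "T \<subseteq> carrier G" for V n T
  proof (rule A.pow_upto_lc)
    show "V \<subseteq> carrier ?A" using V lc_mono[OF T] by auto
    fix n :: nat and x y :: "'a \<Rightarrow>\<^sub>0 'k"
    assume "id x \<in> lc (gball G T n)" "y \<in> V"
    then have x: "supp x \<subseteq> gball G T n" and y: "supp y \<subseteq> T" using V by (auto simp: lc_def)
    show "id (x \<otimes>\<^bsub>?A\<^esub> y) \<in> lc (gball G T (Suc n))"
      unfolding monoid_algebra_simps id_def conv_def
    proof (intro lc_lin_ext)
      fix h t assume "h \<in> supp x" "t \<in> supp y"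
      then have "h \<otimes> t \<in> gball G T (n + 1)"
        using x y gball_mult[OF T, of h n t 1] gball_gen[of t T] T by blast
      then show "pure (h \<otimes> t) \<in> lc (gball G T (Suc n))" by simp
    qed
  qed (use one_gball gball_mono in auto)
  show ?thesis
    unfolding GKdim_def
  proof (intro antisym SUP_least)
    fix V assume "V \<in> {k_span ?A S | S. finite S \<and> S \<subseteq> carrier ?A}"
    then obtain S where S: "finite S" "S \<subseteq> lc (carrier G)" "V = k_span ?A S" by auto
    define T where "T = (\<Union>p\<in>S. supp p)"
    have T: "finite T" "T \<subseteq> carrier G" using S by (auto simp: T_def lc_def)
    have "id ` k_span ?A S \<subseteq> lc T" using S(2) by (intro A.k_span_lc) (auto simp: T_def lc_def)
    then have V: "V \<subseteq> lc T" using S(3) by simp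
    then have VA: "V \<subseteq> carrier ?A" using lc_mono[OF T(2)] by auto
    have "limsup (\<lambda>n. ereal (log (real n) (real (k_dim ?A (A.pow_upto V n))))) \<le> growth G T"
      unfolding growth_def
      by (intro limsup_log_mono A.k_dim_le[OF A.pow_upto_closed[OF VA] up[OF V T(2)]] finite_gball T)
    also have "\<dots> \<le> (SUP T\<in>{T. finite T \<and> T \<subseteq> carrier G}. growth G T)" by (rule SUP_upper) (use T in simp)
    finally show "limsup (\<lambda>n. ereal (log (real n) (real (k_dim ?A (A.pow_upto V n))))) \<le>
        (SUP T\<in>{T. finite T \<and> T \<subseteq> carrier G}. growth G T)" .
  next
    fix T assume "T \<in> {T. finite T \<and> T \<subseteq> carrier G}"
    then have T: "finite T" "T \<subseteq> carrier G" by auto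
    define S where "S = (pure ` T :: ('a \<Rightarrow>\<^sub>0 'k) set)"
    define V where "V = k_span ?A S"
    have S: "finite S" "S \<subseteq> carrier ?A" using T by (auto simp: S_def)
    have "id ` V \<subseteq> lc T" unfolding V_def using S(2) by (intro A.k_span_lc) (auto simp: S_def)
    then have V: "V \<subseteq> lc T" "V \<subseteq> carrier ?A" using lc_mono[OF T(2)] by auto
    have SV: "S \<subseteq> V" unfolding V_def by (rule A.k_span_superset[OF S(2)])
    have w: "pure (wprod G w) \<in> subspace_pow ?A V (length w)" if "w \<in> lists T" for w
      using that
    proof (induction w rule: rev_induct)
      case Nil
      show ?case using A.one_subspace_pow by simp
    next
      case (snoc t w)
      then have t: "pure t \<in> V" "t \<in> carrier G" "w \<in> lists (carrier G)" using SV T lists_mono[OF T(2)] by (auto simp: S_def)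
      have "pure (wprod G w) \<otimes>\<^bsub>?A\<^esub> pure t \<in> subspace_pow ?A V (Suc (length w))"
        by (rule A.subspace_pow_mult[OF V(2) _ t(1)]) (use snoc in simp)
      then show ?case using wprod_append[of w "[t]"] t by simp
    qed
    have "pure ` gball G T n \<subseteq> id ` A.pow_upto V n" for n
    proof safe
      fix h assume "h \<in> gball G T n"
      then obtain u where u: "u \<in> lists T" "length u \<le> n" "h = wprod G u" by (auto simp: gball_def)
      then have "pure h \<in> A.pow_upto V n"
        using w[OF u(1)] A.subspace_pow_pow_upto[OF V(2) u(2)] by blast
      then show "pure h \<in> id ` A.pow_upto V n" by simp
    qed
    then have "growth G T \<le> limsup (\<lambda>n. ereal (log (real n) (real (k_dim ?A (A.pow_upto V n)))))"
      unfolding growth_def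
      by (intro limsup_log_mono A.k_dim_pow_upto_ge[OF V(2) up[OF V(1) T(2)]] finite_gball T)
    also have "\<dots> \<le> (SUP V \<in> {k_span ?A S | S. finite S \<and> S \<subseteq> carrier ?A}.
        limsup (\<lambda>n. ereal (log (real n) (real (k_dim ?A (A.pow_upto V n))))))"
      by (rule SUP_upper) (use S V_def in blast)
    finally show "growth G T \<le> \<dots>" .
  qed
qed

context lift_data
begin

text \<open>Counting \<open>a\<^sub>1\<close> and \<open>a\<^sub>2\<close> with weight one and \<open>h\<close> with its word length bounds the products of
  monomials, provided \<open>g\<close> is among the generators.\<close>

definition wt :: "'g set \<Rightarrow> nat \<Rightarrow> (nat \<times> 'g \<times> nat) set"
  where "wt Ts N = {(m, h, n). \<exists>p. h \<in> gball G Ts p \<and> m + n + p \<le> N}"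

lemma wtI: "h \<in> gball G Ts p \<Longrightarrow> m + n + p \<le> N \<Longrightarrow> (m, h, n) \<in> wt Ts N"
  by (auto simp: wt_def)

lemma wt_mono: "M \<le> N \<Longrightarrow> wt Ts M \<subseteq> wt Ts N"
  by (force simp: wt_def)

lemma wt_subset: "wt Ts N \<subseteq> {..N} \<times> gball G Ts N \<times> {..N}"
proof
  fix i assume "i \<in> wt Ts N"
  then obtain m h n p where i: "i = (m, h, n)" "h \<in> gball G Ts p" "m + n + p \<le> N" by (auto simp: wt_def)
  then show "i \<in> {..N} \<times> gball G Ts N \<times> {..N}" using gball_mono[of p N Ts] by auto
qed

text \<open>Left multiplication by a1 or a2 raises the weight by at most one. For a2 this requires g
  to be a generator, since g and g^2 appear in the correction terms.\<close>

lemma op_wt: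
  assumes Ts: "Ts \<subseteq> carrier G" and v: "v \<in> lc (wt Ts N)"
  shows "op1 v \<in> lc (wt Ts (Suc N))" and "g \<in> Ts \<Longrightarrow> op2 v \<in> lc (wt Ts (Suc N))"
    and "t \<in> gball G Ts k \<Longrightarrow> opG t v \<in> lc (wt Ts (k + N))"
proof -
  show "op1 v \<in> lc (wt Ts (Suc N))"
    by (rule lc_plin[OF plin_op1 v]) (force simp: wt_def)
  show "opG t v \<in> lc (wt Ts (k + N))" if t: "t \<in> gball G Ts k"
  proof (rule lc_plin[OF plin_opG v])
    fix i assume "i \<in> wt Ts N"
    then obtain m h n p where i: "i = (m, h, n)" "h \<in> gball G Ts p" "m + n + p \<le> N" by (auto simp: wt_def)
    show "opG t (pure i) \<in> lc (wt Ts (k + N))"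
      using i gball_mult[OF Ts t i(2)] by (auto intro!: wtI)
  qed
  show "op2 v \<in> lc (wt Ts (Suc N))" if gT: "g \<in> Ts"
  proof (rule lc_plin[OF plin_op2 v])
    fix i assume "i \<in> wt Ts N"
    then obtain m h n p where i: "i = (m, h, n)" "h \<in> gball G Ts p" "m + n + p \<le> N" by (auto simp: wt_def)
    have gh: "g \<otimes> h \<in> gball G Ts (Suc p)" using gball_mult[OF Ts gball_gen[OF gT Ts] i(2)] by simp
    have ggh: "g \<otimes> (g \<otimes> h) \<in> gball G Ts (Suc (Suc p))" using gball_mult[OF Ts gball_gen[OF gT Ts] gh] by simp
    have 1: "pure (m, h, Suc n) \<in> lc (wt Ts (Suc N))" "pure (Suc m, h, n) \<in> lc (wt Ts (Suc N))"
      "pure (m, h, n) - pure (m, g \<otimes> h, n) \<in> lc (wt Ts (Suc N))"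
      using i gh by (auto intro!: lc_minus wtI)
    \<comment> \<open>The two extra letters g are partly paid for by the loss of one a1; for
      \<open>m = 0\<close> the term vanishes.\<close>
    have 2: "pscale (of_nat m * lam) (pure (m - 1, h, n) - pure (m - 1, g \<otimes> (g \<otimes> h), n)) \<in> lc (wt Ts (Suc N))"
      using i ggh by (cases m) (auto intro!: lc_pscale lc_minus wtI)
    show "op2 (pure i) \<in> lc (wt Ts (Suc N))"
      unfolding i op2_pure by (intro lc_minus lc_pscale 1 2)
  qed
qed

lemma \<mu>_wt:
  assumes Ts: "Ts \<subseteq> carrier G" "g \<in> Ts" and v: "v \<in> lc (wt Ts a)" and w: "w \<in> lc (wt Ts b)"
  shows "\<mu> v w \<in> lc (wt Ts (a + b))"
proof (rule lc_plin[OF pbilinD(2)[OF pbilin_\<mu>] v])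
  fix i assume "i \<in> wt Ts a"
  then obtain m h n p where i: "i = (m, h, n)" "h \<in> gball G Ts p" "m + n + p \<le> a" by (auto simp: wt_def)
  have 2: "(op2 ^^ k) w \<in> lc (wt Ts (k + b))" for k
    by (induction k) (use w op_wt(2)[OF Ts(1) _ Ts(2)] in auto)
  have 1: "(op1 ^^ k) u \<in> lc (wt Ts (k + c))" if "u \<in> lc (wt Ts c)" for k c u
    by (induction k) (use that op_wt(1)[OF Ts(1)] in auto)
  have "\<mu> (pure i) w = (op1 ^^ m) (opG h ((op2 ^^ n) w))"
    by (simp add: \<mu>_def i sw_def foldr_replicate)
  also have "\<dots> \<in> lc (wt Ts (m + (p + (n + b))))" by (intro 1 op_wt(3)[OF Ts(1)] 2 i)
  finally show "\<mu> (pure i) w \<in> lc (wt Ts (a + b))"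
    using lc_mono[OF wt_mono[of "m + (p + (n + b))" "a + b" Ts]] i by auto
qed

lemma qco_mult: "x \<in> carrier U \<Longrightarrow> y \<in> carrier U \<Longrightarrow> U.qco (x \<otimes>\<^bsub>U\<^esub> y) = \<mu> (U.qco x) (U.qco y)"
  by (auto simp: U_carrier U_mult qco_cls q_mult fm_W)

lemma pow_upto_wt:
  assumes Ts: "Ts \<subseteq> carrier G" "g \<in> Ts" and V: "V \<subseteq> carrier U" "U.qco ` V \<subseteq> lc (wt Ts N)"
  shows "U.qco ` UC.pow_upto V n \<subseteq> lc (wt Ts (N * n))"
proof (rule UC.pow_upto_lc[OF V(1)])
  show "U.qco \<one>\<^bsub>U\<^esub> \<in> lc (wt Ts (N * 0))"
    by (auto simp: U_one qco_cls intro!: wtI one_gball)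
  show "wt Ts (N * m) \<subseteq> wt Ts (N * n)" if "m \<le> n" for m n using that by (intro wt_mono) simp
  fix n x y assume "x \<in> carrier U" "U.qco x \<in> lc (wt Ts (N * n))" "y \<in> V"
  then show "U.qco (x \<otimes>\<^bsub>U\<^esub> y) \<in> lc (wt Ts (N * Suc n))"
    using V \<mu>_wt[OF Ts, of "U.qco x" "N * n" "U.qco y" N] by (auto simp: qco_mult subset_iff add.commute)
qed

text \<open>Finitely many elements involve finitely many indices. Taking all their group components,
  and g, as generators makes every group component a single letter.\<close>

lemma finite_wt_exists:
  assumes "finite Vs" "Vs \<subseteq> carrier U"
  obtains Ts N where "finite Ts" "Ts \<subseteq> carrier G" "g \<in> Ts" "0 < N" "U.qco ` k_span U Vs \<subseteq> lc (wt Ts N)"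
proof -
  define Y where "Y = (\<Union>x\<in>Vs. supp (U.qco x))"
  have Y: "finite Y" "Y \<subseteq> IX" using assms UC.\<kappa>_closed by (auto simp: Y_def lc_def)
  define Ts where "Ts = insert g ((\<lambda>i. fst (snd i)) ` Y)"
  \<comment> \<open>A crude common bound: the sum of all weights dominates each of them, and the
    outer \<open>Suc\<close> keeps it positive if there are none.\<close>
  define N where "N = Suc (\<Sum>i\<in>Y. Suc (fst i + snd (snd i)))"
  have Ts: "finite Ts" "Ts \<subseteq> carrier G" "g \<in> Ts" using Y by (auto simp: Ts_def IX_def)
  have "Y \<subseteq> wt Ts N"
  proof
    fix i assume i: "i \<in> Y"
    then have "Suc (fst i + snd (snd i)) \<le> N"
      unfolding N_def using member_le_sum[of i Y "\<lambda>i. Suc (fst i + snd (snd i))"] Y by simp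
    moreover have "fst (snd i) \<in> gball G Ts 1" using i Ts by (intro gball_gen) (auto simp: Ts_def)
    ultimately show "i \<in> wt Ts N" by (cases i) (auto intro!: wtI)
  qed
  then have "U.qco ` Vs \<subseteq> lc (wt Ts N)" by (auto simp: Y_def lc_def)
  from UC.k_span_lc[OF assms(2) this] Ts show ?thesis using that[of Ts N] by (simp add: N_def)
qed

text \<open>Modulo dilation of n, powers of a generating subspace are squeezed between two sets of
  triples whose size is n^2 times a ball. The upper bound is subadditivity of the weight, the lower
  one exhibits words for all small triples.\<close>

theorem GKdim_lift: "GKdim U = GKdim (monoid_algebra G :: ('g \<Rightarrow>\<^sub>0 'k, 'k) kalg) + 2"
proof -
  let ?\<gamma> = "SUP Ts\<in>{Ts. finite Ts \<and> Ts \<subseteq> carrier G}. growth G Ts"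
  let ?D = "\<lambda>V n. k_dim U (UC.pow_upto V n)"
  have "GKdim U = ?\<gamma> + 2"
  proof (rule antisym)
    show "GKdim U \<le> ?\<gamma> + 2"
      unfolding GKdim_def
    proof (intro SUP_least)
      fix V assume "V \<in> {k_span U Vs | Vs. finite Vs \<and> Vs \<subseteq> carrier U}"
      then obtain Vs where Vs: "finite Vs" "Vs \<subseteq> carrier U" "V = k_span U Vs" by auto
      obtain Ts N where Ts: "finite Ts" "Ts \<subseteq> carrier G" "g \<in> Ts" "0 < N" and VN: "U.qco ` V \<subseteq> lc (wt Ts N)"
        using finite_wt_exists[OF Vs(1,2)] Vs(3) by metis
      have V: "V \<subseteq> carrier U" using UC.k_span_subset[OF Vs(2)] Vs(3) by simp
      \<comment> \<open>The dilation is \<open>Suc N\<close> rather than \<open>N\<close> because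
        each exponent takes \<open>Suc (N * n)\<close> values, at most \<open>Suc N * n\<close> for
        n at least 1.\<close>
      have "?D V n \<le> (Suc N * n) ^ 2 * card (gball G Ts (Suc N * n))" if "1 \<le> n" for n
      proof -
        have fin: "finite ({..N * n} \<times> gball G Ts (N * n) \<times> {..N * n})" using finite_gball[OF Ts(1)] by simp
        have "?D V n \<le> card (wt Ts (N * n))"
          using UC.k_dim_le[OF UC.pow_upto_closed[OF V] pow_upto_wt[OF Ts(2,3) V VN]] finite_subset[OF wt_subset fin] .
        also have "\<dots> \<le> card ({..N * n} \<times> gball G Ts (N * n) \<times> {..N * n})" by (rule card_mono[OF fin wt_subset])
        also have "\<dots> = Suc (N * n) ^ 2 * card (gball G Ts (N * n))" by (simp add: power2_eq_square card_cartesian_product algebra_simps)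
        also have "\<dots> \<le> (Suc N * n) ^ 2 * card (gball G Ts (Suc N * n))"
          using that by (intro mult_mono power_mono card_mono finite_gball Ts gball_mono) auto
        finally show ?thesis .
      qed
      then have "limsup (\<lambda>n. ereal (log (real n) (real (?D V n)))) \<le> growth G Ts + 2"
        unfolding growth_def by (intro limsup_log_scale[where c = "Suc N"] card_gball_pos Ts) auto
      also have "\<dots> \<le> ?\<gamma> + 2" using Ts by (intro add_right_mono SUP_upper) simp
      finally show "limsup (\<lambda>n. ereal (log (real n) (real (?D V n)))) \<le> ?\<gamma> + 2" .
    qed
    have "growth G Ts + 2 \<le> GKdim U" if "finite Ts" "Ts \<subseteq> carrier G" for Ts
    proof -
      define gens where "gens = {A1, A2} \<union> Grp ` Ts"
      define Vs where "Vs = (\<lambda>x. cls (var x)) ` gens"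
      define V where "V = k_span U Vs"
      have gens: "gens \<subseteq> lift_gens G" using that by (auto simp: gens_def)
      have Vs: "finite Vs" "Vs \<subseteq> carrier U" using that gens by (auto simp: Vs_def gens_def U_carrier)
      have V: "V \<subseteq> carrier U" unfolding V_def by (rule UC.k_span_subset[OF Vs(2)])
      have SV: "Vs \<subseteq> V" unfolding V_def by (rule UC.k_span_superset[OF Vs(2)])
      have w: "cls (pure w) \<in> subspace_pow U V (length w)" if "w \<in> lists gens" for w
        using that
      proof (induction w rule: rev_induct)
        case Nil
        show ?case using UC.one_subspace_pow by (simp add: U_one)
      next
        case (snoc x w)
        then have xw: "x \<in> gens" "w \<in> lists gens" by auto
        have x: "cls (var x) \<in> V" using SV xw(1) by (auto simp: Vs_def)
        have wW: "w \<in> W" "[x] \<in> W"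
          using subsetD[OF lists_mono[OF gens] xw(2)] subsetD[OF gens xw(1)] by - (assumption, simp)
        have "cls (pure w) \<otimes>\<^bsub>U\<^esub> cls (var x) \<in> subspace_pow U V (Suc (length w))"
          by (rule UC.subspace_pow_mult[OF V _ x]) (use snoc in simp)
        then show ?case using U_mult[of "pure w" "var x"] wW by (simp del: lists.simps in_lists_conv_set)
      qed
      obtain Ts' N where Ts': "finite Ts'" "Ts' \<subseteq> carrier G" "g \<in> Ts'" and VN: "U.qco ` V \<subseteq> lc (wt Ts' N)"
        using finite_wt_exists[OF Vs] V_def by metis
      \<comment> \<open>At most n letters a1, n group letters and n letters a2 suffice for the
        triple, whence the dilation by 3. These words are exactly the basis vectors, without lower
        terms.\<close>
      have ge: "Suc n ^ 2 * card (gball G Ts n) \<le> ?D V (3 * n)" for n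
      proof -
        have "pure ` ({..n} \<times> gball G Ts n \<times> {..n}) \<subseteq> U.qco ` UC.pow_upto V (3 * n)"
        proof safe
          fix m h k assume m: "m \<le> n" "k \<le> n" "h \<in> gball G Ts n"
          then obtain u where u: "u \<in> lists Ts" "length u \<le> n" "h = wprod G u" by (auto simp: gball_def)
          let ?w = "replicate m A1 @ map Grp u @ replicate k A2"
          have wg: "?w \<in> lists gens" using u by (auto simp: gens_def)
          then have wW: "?w \<in> W" using lists_mono[OF gens] by blast
          have op: "foldr op (map Grp u) (pure (0, \<one>, k)) = pure (0, h, k)"
            unfolding u(3) by (induction u) auto
          have "q (pure ?w) = pure (m, h, k)"
            by (simp add: foldr_replicate op2_power_vac op)
          moreover have "cls (pure ?w) \<in> UC.pow_upto V (3 * n)"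
            using w[OF wg] UC.subspace_pow_pow_upto[OF V, of "length ?w" "3 * n"] m u by auto
          ultimately show "pure (m, h, k) \<in> U.qco ` UC.pow_upto V (3 * n)"
            using qco_cls[of "pure ?w"] wW by (intro image_eqI[of _ _ "cls (pure ?w)"]) (simp_all del: lists.simps q_pure)
        qed
        then have "card ({..n} \<times> gball G Ts n \<times> {..n}) \<le> ?D V (3 * n)"
          using finite_subset[OF wt_subset] finite_gball[OF Ts'(1)]
          by (intro UC.k_dim_pow_upto_ge[OF V pow_upto_wt[OF Ts'(2,3) V VN]]) auto
        then show ?thesis by (simp add: power2_eq_square card_cartesian_product algebra_simps)
      qed
      have pos: "1 \<le> ?D V n" for n
      proof -
        have "pure ` {(0, \<one>, 0)} \<subseteq> U.qco ` UC.pow_upto V n"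
          using UC.one_subspace_pow[of V] UC.subspace_pow_pow_upto[OF V, of 0 n] qco_cls[of "pure []"]
          by (auto simp: U_one intro!: image_eqI[of _ _ "cls (pure [])"])
        then have "card {(0 :: nat, \<one>, 0 :: nat)} \<le> ?D V n"
          using finite_subset[OF wt_subset] finite_gball[OF Ts'(1)]
          by (intro UC.k_dim_pow_upto_ge[OF V pow_upto_wt[OF Ts'(2,3) V VN]]) auto
        then show ?thesis by simp
      qed
      have "n ^ 2 * card (gball G Ts n) \<le> ?D V (3 * n)" for n
        using ge[of n] by (rule order_trans[rotated]) (intro mult_right_mono power_mono, auto)
      then have "growth G Ts + 2 \<le> limsup (\<lambda>n. ereal (log (real n) (real (?D V n))))"
        unfolding growth_def using that pos by (intro limsup_log_scale_ge[where c = 3] card_gball_pos) auto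
      also have "\<dots> \<le> GKdim U" unfolding GKdim_def by (rule SUP_upper) (use Vs V_def in blast)
      finally show ?thesis .
    qed
    then have "(SUP Ts\<in>{Ts. finite Ts \<and> Ts \<subseteq> carrier G}. growth G Ts + 2) \<le> GKdim U"
      by (intro SUP_least) simp
    moreover have "(SUP Ts\<in>{Ts. finite Ts \<and> Ts \<subseteq> carrier G}. growth G Ts + 2) = ?\<gamma> + 2"
      by (rule SUP_ereal_add_left) auto
    ultimately show "?\<gamma> + 2 \<le> GKdim U" by simp
  qed
  then show ?thesis by (simp add: GKdim_group_algebra)
qed

end

section \<open>Growth of nilpotent-by-finite groups\<close>

context group
begin

lemma mult_inv_cancel: "x \<in> carrier G \<Longrightarrow> v \<in> carrier G \<Longrightarrow> x \<otimes> (inv x \<otimes> v) = v"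
  "x \<in> carrier G \<Longrightarrow> v \<in> carrier G \<Longrightarrow> inv x \<otimes> (x \<otimes> v) = v"
  by (simp_all add: m_assoc[symmetric])

lemma gball_superset: "T \<subseteq> T' \<Longrightarrow> gball G T n \<subseteq> gball G T' n"
  unfolding gball_def using lists_mono[of T T'] by auto

lemma gball_gball:
  assumes "T \<subseteq> carrier G" and "T' \<subseteq> gball G T m"
  shows "gball G T' n \<subseteq> gball G T (m * n)"
proof -
  have "wprod G w \<in> gball G T (m * length w)" if "w \<in> lists T'" for w
    using that
  proof (induction w)
    case (Cons t w)
    then have "t \<in> gball G T m" "wprod G w \<in> gball G T (m * length w)" using assms(2) by auto
    from gball_mult[OF assms(1) this] show ?case by simp
  qed (use one_gball in simp)
  moreover have "gball G T (m * k) \<subseteq> gball G T (m * n)" if "k \<le> n" for k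
    using that by (intro gball_mono) simp
  ultimately show ?thesis unfolding gball_def[of G T' n] by blast
qed

section \<open>Polynomial growth and collection of letters\<close>

definition poly_growth :: "'a set \<Rightarrow> bool"
  where "poly_growth T \<longleftrightarrow> (\<exists>C d. \<forall>n. card (gball G T n) \<le> C * Suc n ^ d)"

text \<open>The commutator of the inverses of z and y, chosen so that y^(-1) z y = z
  \<open>comm_right y z\<close> with the correction on the right.\<close>

definition comm_right :: "'a \<Rightarrow> 'a \<Rightarrow> 'a"
  where "comm_right y z = inv z \<otimes> inv y \<otimes> z \<otimes> y"

lemma comm_right_closed: "y \<in> carrier G \<Longrightarrow> z \<in> carrier G \<Longrightarrow> comm_right y z \<in> carrier G"
  by (simp add: comm_right_def)

lemma comm_right_funpow_closed: "y \<in> carrier G \<Longrightarrow> z \<in> carrier G \<Longrightarrow> (comm_right y ^^ j) z \<in> carrier G"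
  by (induction j) (auto intro: comm_right_closed)

lemma lower_central_props:
  assumes "subgroup N G"
  shows "subgroup (lower_central G N k) G \<and> lower_central G N k \<subseteq> N"
proof (induction k)
  case (Suc k)
  interpret N: subgroup N G by fact
  have sub: "{x \<otimes> y \<otimes> inv x \<otimes> inv y | x y. x \<in> lower_central G N k \<and> y \<in> N} \<subseteq> N"
    using Suc by (auto intro!: N.m_closed N.m_inv_closed)
  then have "generate G {x \<otimes> y \<otimes> inv x \<otimes> inv y | x y. x \<in> lower_central G N k \<and> y \<in> N} \<subseteq> N"
    using generate_subgroup_incl assms by blast
  moreover have "subgroup (generate G {x \<otimes> y \<otimes> inv x \<otimes> inv y | x y. x \<in> lower_central G N k \<and> y \<in> N}) G"
    using sub N.subset by (intro generate_is_subgroup) blast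
  ultimately show ?case by simp
qed (simp add: assms)

lemma lower_central_Suc_subset:
  assumes "subgroup N G"
  shows "lower_central G N (Suc k) \<subseteq> lower_central G N k"
proof (induction k)
  case 0
  show ?case using lower_central_props[OF assms, of 1] by simp
next
  case (Suc k)
  then show ?case
    unfolding lower_central.simps(2)[of G N "Suc k"] lower_central.simps(2)[of G N k]
    by (intro mono_generate) (auto simp del: lower_central.simps)
qed

lemma comm_right_lower_central:
  assumes N: "subgroup N G" and y: "y \<in> N" and z: "z \<in> lower_central G N k"
  shows "comm_right y z \<in> lower_central G N (Suc k)"
proof -
  interpret N: subgroup N G by fact
  interpret K: subgroup "lower_central G N k" G using lower_central_props[OF N] by blast
  have "inv z \<in> lower_central G N k" "inv y \<in> N" using y z by auto
  then have "inv z \<otimes> inv y \<otimes> inv (inv z) \<otimes> inv (inv y) \<in> lower_central G N (Suc k)"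
    unfolding lower_central.simps by (intro generate.incl) blast
  then show ?thesis using y z by (simp add: comm_right_def del: lower_central.simps)
qed

lemma comm_right_funpow_lower_central:
  assumes "subgroup N G" "y \<in> N" "z \<in> lower_central G N k"
  shows "(comm_right y ^^ j) z \<in> lower_central G N (k + j)"
  by (induction j) (use assms comm_right_lower_central[OF assms(1,2)] in \<open>auto simp del: lower_central.simps\<close>)

text \<open>As \<open>y\<inverse> z y = z \<cdot> comm_right y z\<close>, conjugation by \<open>y\<^sup>e\<close> turns \<open>z\<close> into a word of polynomial
  length in the iterated commutators.\<close>

lemma conj_power_gball:
  assumes N: "subgroup N G" and y: "y \<in> N" and triv: "lower_central G N c = {\<one>}"
    and "i \<le> c" and "z \<in> lower_central G N (c - i)"
  shows "inv (y [^] e) \<otimes> z \<otimes> y [^] (e :: nat) \<in> gball G (range (\<lambda>j. (comm_right y ^^ j) z)) (Suc e ^ i)"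
  using assms(4,5)
proof (induction e arbitrary: i z)
  interpret N: subgroup N G by fact
  case 0
  then have z: "z \<in> carrier G" using lower_central_props[OF N] N.subset by blast
  have "range (\<lambda>j. (comm_right y ^^ j) z) \<subseteq> carrier G" using comm_right_funpow_closed z y N.subset by blast
  moreover have "z \<in> range (\<lambda>j. (comm_right y ^^ j) z)" using rangeI[of "\<lambda>j. (comm_right y ^^ j) z" 0] by simp
  ultimately show ?case using gball_gen z by simp
next
  interpret N: subgroup N G by fact
  case (Suc e)
  have yG: "y \<in> carrier G" using y by simp
  have z: "z \<in> carrier G" using Suc.prems lower_central_props[OF N] N.subset by blast
  let ?D = "range (\<lambda>j. (comm_right y ^^ j) z)"
  have D: "?D \<subseteq> carrier G" using comm_right_funpow_closed z yG by blast
  note IH = Suc.IH and ic = Suc.prems(1) and zc = Suc.prems(2)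
  show ?case
  proof (cases i)
    case 0
    \<comment> \<open>For \<open>i = 0\<close> the element lies in the trivial term of the lower
      central series.\<close>
    then have "z = \<one>" using zc triv by simp
    then show ?thesis using one_gball yG by (simp add: m_assoc del: nat_pow_Suc)
  next
    case (Suc i')
    let ?d = "comm_right y z" and ?p = "y [^] e"
    have d: "?d \<in> carrier G" by (rule comm_right_closed[OF yG z])
    have "?d \<in> lower_central G N (Suc (c - i))" by (rule comm_right_lower_central[OF N y zc])
    then have d': "?d \<in> lower_central G N (c - i')" using Suc ic by (simp add: Suc_diff_Suc del: lower_central.simps)
    have "range (\<lambda>j. (comm_right y ^^ j) ?d) \<subseteq> ?D"
    proof safe
      fix j
      have "(comm_right y ^^ j) ?d = (comm_right y ^^ Suc j) z" by (simp add: funpow_swap1)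
      then show "(comm_right y ^^ j) ?d \<in> ?D" by blast
    qed
    from gball_superset[OF this] IH[OF _ d'] have 2: "inv ?p \<otimes> ?d \<otimes> ?p \<in> gball G ?D (Suc e ^ i')"
      using Suc ic by (meson Suc_leD subsetD)
    have 1: "inv ?p \<otimes> z \<otimes> ?p \<in> gball G ?D (Suc e ^ i)" by (rule IH[OF ic zc])
    have "inv (y [^] Suc e) \<otimes> z \<otimes> y [^] Suc e = inv ?p \<otimes> (inv y \<otimes> z \<otimes> y) \<otimes> ?p"
      unfolding nat_pow_Suc2[OF yG] using yG z by (simp add: inv_mult_group m_assoc)
    also have "inv y \<otimes> z \<otimes> y = z \<otimes> ?d"
      using yG z by (simp add: comm_right_def m_assoc mult_inv_cancel)
    also have "inv ?p \<otimes> (z \<otimes> ?d) \<otimes> ?p = (inv ?p \<otimes> z \<otimes> ?p) \<otimes> (inv ?p \<otimes> ?d \<otimes> ?p)"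
      using yG z d by (simp add: m_assoc mult_inv_cancel)
    also have "\<dots> \<in> gball G ?D (Suc e ^ i + Suc e ^ i')" by (rule gball_mult[OF D 1 2])
    also have "gball G ?D (Suc e ^ i + Suc e ^ i') \<subseteq> gball G ?D (Suc (Suc e) ^ i)"
    proof (rule gball_mono)
      \<comment> \<open>One more conjugation costs one word for z and one for its commutator, which
        sits one step deeper; (e + 1)^i + (e + 1)^(i - 1) is at most (e + 2)^i.\<close>
      have "Suc e ^ i + Suc e ^ i' = Suc (Suc e) * Suc e ^ i'" by (simp add: Suc)
      also have "\<dots> \<le> Suc (Suc e) * Suc (Suc e) ^ i'" by (intro mult_left_mono power_mono) auto
      finally show "Suc e ^ i + Suc e ^ i' \<le> Suc (Suc e) ^ i" by (simp add: Suc)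
    qed
    finally show ?thesis .
  qed
qed

text \<open>Reading the word from the right, it has the form y^e v. A new letter x other than y
  passes y^e by x y^e = y^e (y^(-e) x y^e), and the conjugate is a word of polynomial length in
  iterated commutators.\<close>

lemma collect_letter:
  assumes N: "subgroup N G" and y: "y \<in> N" and triv: "lower_central G N c = {\<one>}"
    and A: "A \<subseteq> N" and B: "B \<subseteq> carrier G" "\<And>z j. z \<in> A \<Longrightarrow> (comm_right y ^^ j) z \<in> B"
  shows "gball G (insert y A) n \<subseteq> (\<lambda>(e, v). y [^] e \<otimes> v) ` ({..n} \<times> gball G B (n * Suc n ^ c))"
proof -
  interpret N: subgroup N G by fact
  have yG: "y \<in> carrier G" using y by simp
  have "\<exists>e\<le>length w. \<exists>v\<in>gball G B (length w * Suc n ^ c). wprod G w = y [^] e \<otimes> v"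
    if "w \<in> lists (insert y A)" "length w \<le> n" for w
    using that
  proof (induction w)
    case Nil
    show ?case using one_gball[of B 0] by (auto intro!: bexI[of _ \<one>])
  next
    case (Cons x w)
    then obtain e v where e: "e \<le> length w" and v: "v \<in> gball G B (length w * Suc n ^ c)"
      and w: "wprod G w = y [^] e \<otimes> v" by auto
    have vG: "v \<in> carrier G" using v gball_closed[OF B(1)] by blast
    show ?case
    proof (cases "x = y")
      case True
      have "v \<in> gball G B (length (x # w) * Suc n ^ c)"
        using v gball_mono[of "length w * Suc n ^ c" "length (x # w) * Suc n ^ c" B] by auto
      moreover have "wprod G (x # w) = y [^] Suc e \<otimes> v"
        using True w yG vG nat_pow_Suc2[OF yG, of e] m_assoc[of y "y [^] e" v] by (simp del: nat_pow_Suc)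
      ultimately show ?thesis using e by (intro exI[of _ "Suc e"]) auto
    next
      case False
      then have x: "x \<in> A" using Cons by simp
      then have xG: "x \<in> carrier G" and x0: "x \<in> lower_central G N (c - c)" using A N.subset by auto
      let ?u = "inv (y [^] e) \<otimes> x \<otimes> y [^] e"
      have "?u \<in> gball G (range (\<lambda>j. (comm_right y ^^ j) x)) (Suc e ^ c)"
        by (rule conj_power_gball[OF N y triv order_refl x0])
      also have "\<dots> \<subseteq> gball G B (Suc e ^ c)" by (rule gball_superset) (use B(2)[OF x] in blast)
      also have "\<dots> \<subseteq> gball G B (Suc n ^ c)" by (rule gball_mono) (use e Cons.prems in \<open>intro power_mono; simp\<close>)
      finally have "?u \<otimes> v \<in> gball G B (Suc n ^ c + length w * Suc n ^ c)" using v by (rule gball_mult[OF B(1)])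
      moreover have "wprod G (x # w) = y [^] e \<otimes> (?u \<otimes> v)"
        using w xG yG vG by (simp add: m_assoc mult_inv_cancel)
      ultimately show ?thesis using e by (intro exI[of _ e]) auto
    qed
  qed
  moreover have "gball G B (length w * Suc n ^ c) \<subseteq> gball G B (n * Suc n ^ c)" if "length w \<le> n" for w :: "'a list"
    using that by (intro gball_mono mult_right_mono) auto
  ultimately show ?thesis unfolding gball_def[of G "insert y A"] by fastforce
qed

text \<open>Downward along the lower central series: collecting a letter of \<open>A\<close> removes
  it at the price of commutators in the next term, where the claim is already known. The number of
  words is multiplied by the possible exponents, and lengths grow polynomially.\<close>

lemma nilpotent_poly_growth:
  assumes N: "subgroup N G" and triv: "lower_central G N c = {\<one>}"
    and "finite A" "A \<subseteq> lower_central G N k" "k \<le> c"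
  shows "poly_growth A"
  using assms(5,3,4)
proof (induction k arbitrary: A rule: inc_induct)
  case base
  then have "gball G A n \<subseteq> {\<one>}" for n
    using triv gball_gball[of "{}" A 0 n] one_gball[of "{}" 0] unfolding gball_def[of G "{}"] by auto
  then have "card (gball G A n) \<le> 1 * Suc n ^ 0" for n
    using card_mono[of "{\<one>}"] by fastforce
  then show ?case unfolding poly_growth_def by blast
next
  case (step k)
  interpret N: subgroup N G by fact
  have sub: "lower_central G N j \<subseteq> N" "lower_central G N j \<subseteq> carrier G" for j
    using lower_central_props[OF N] N.subset by blast+
  \<comment> \<open>Generalised by a set \<open>B\<close> from the next term, which absorbs the
    commutators created while letters of \<open>A\<close> are removed one after the other.\<close>
  have "poly_growth (A \<union> B)" if "finite B" "B \<subseteq> lower_central G N (Suc k)" for B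
    using \<open>finite A\<close> \<open>A \<subseteq> lower_central G N k\<close> that
  proof (induction A arbitrary: B rule: finite_induct)
    case empty
    then show ?case using step.IH by simp
  next
    case (insert y A)
    have y: "y \<in> N" using insert.prems sub by blast
    \<comment> \<open>Iterated commutators of positive order lie in the next term; those of order 0
      are the letters of \<open>A\<close> and \<open>B\<close> themselves.\<close>
    define B' where "B' = B \<union> (\<Union>z\<in>A \<union> B. (\<lambda>j. (comm_right y ^^ Suc j) z) ` UNIV)"
    have AB: "A \<union> B \<subseteq> lower_central G N k"
      using insert.prems lower_central_Suc_subset[OF N, of k] by blast
    \<comment> \<open>Nilpotency makes the sequence of iterated commutators constant from index
      \<open>c\<close> on.\<close>
    have fin: "finite (range (\<lambda>j. (comm_right y ^^ j) z))" if z: "z \<in> N" for z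
    proof -
      have "(comm_right y ^^ c) z = \<one>" using comm_right_funpow_lower_central[OF N y, of z 0 c] z triv by simp
      moreover have "comm_right y \<one> = \<one>" using y by (simp add: comm_right_def)
      then have "(comm_right y ^^ j) \<one> = \<one>" for j by (induction j) auto
      ultimately have one: "(comm_right y ^^ j) z = \<one>" if "c \<le> j" for j
        using that by (metis funpow_add le_add_diff_inverse2 comp_apply)
      have "range (\<lambda>j. (comm_right y ^^ j) z) \<subseteq> insert \<one> ((\<lambda>j. (comm_right y ^^ j) z) ` {..c})"
      proof (rule image_subsetI)
        fix j
        show "(comm_right y ^^ j) z \<in> insert \<one> ((\<lambda>j. (comm_right y ^^ j) z) ` {..c})"
          by (cases "c \<le> j") (simp_all add: one)
      qed
      then show ?thesis by (rule finite_subset) simp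
    qed
    have fB': "finite B'"
    proof -
      have "finite ((\<lambda>j. (comm_right y ^^ Suc j) z) ` UNIV)" if "z \<in> A \<union> B" for z
      proof (rule finite_subset[OF _ fin])
        show "z \<in> N" using that AB sub by blast
      qed (rule image_subsetI, rule rangeI)
      then show ?thesis using insert by (simp add: B'_def)
    qed
    have B': "B' \<subseteq> lower_central G N (Suc k)"
    proof -
      have "(comm_right y ^^ Suc j) z \<in> lower_central G N (Suc k)" if "z \<in> A \<union> B" for z j
      proof -
        have "(comm_right y ^^ j) z \<in> lower_central G N k"
        proof (induction j)
          case 0
          show ?case using that AB by auto
        next
          case (Suc j)
          then show ?case
            using comm_right_lower_central[OF N y Suc] lower_central_Suc_subset[OF N, of k] by (auto simp del: lower_central.simps)
        qed
        from comm_right_lower_central[OF N y this] show ?thesis by simp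
      qed
      then show ?thesis using insert.prems unfolding B'_def by blast
    qed
    have cl: "A \<union> B' \<subseteq> carrier G" using insert.prems B' sub by blast
    have D: "(comm_right y ^^ j) z \<in> A \<union> B'" if "z \<in> A \<union> B" for z j
    proof (cases j)
      case 0
      then show ?thesis using that by (auto simp: B'_def)
    next
      case (Suc i)
      then show ?thesis using that unfolding B'_def by blast
    qed
    have "poly_growth (A \<union> B')" using insert.prems by (intro insert.IH fB' B') auto
    then obtain C d where Cd: "card (gball G (A \<union> B') n) \<le> C * Suc n ^ d" for n unfolding poly_growth_def by blast
    have "card (gball G (insert y A \<union> B) n) \<le> C * Suc n ^ Suc (Suc c * d)" for n
    proof -
      have fg: "finite ({..n} \<times> gball G (A \<union> B') (n * Suc n ^ c))"
        using insert.hyps fB' by (simp add: finite_gball)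
      have "gball G (insert y (A \<union> B)) n \<subseteq> (\<lambda>(e, v). y [^] e \<otimes> v) ` ({..n} \<times> gball G (A \<union> B') (n * Suc n ^ c))"
        by (rule collect_letter[OF N y triv _ cl D]) (use AB sub in blast)
      then have "card (gball G (insert y A \<union> B) n) \<le> card ({..n} \<times> gball G (A \<union> B') (n * Suc n ^ c))"
        using surj_card_le[OF fg] by simp
      also have "\<dots> = Suc n * card (gball G (A \<union> B') (n * Suc n ^ c))" by (simp add: card_cartesian_product)
      also have "\<dots> \<le> Suc n * (C * Suc (n * Suc n ^ c) ^ d)" using Cd by (intro mult_left_mono) simp_all
      also have "\<dots> \<le> Suc n * (C * (Suc n ^ Suc c) ^ d)"
        by (intro mult_left_mono power_mono) (simp_all add: Suc_le_eq)
      also have "\<dots> = C * Suc n ^ Suc (Suc c * d)"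
        by (simp only: power_mult[symmetric] power_Suc[of _ "Suc c * d"] mult.left_commute)
      finally show ?thesis .
    qed
    then show ?case unfolding poly_growth_def by blast
  qed
  from this[of "{}"] show ?case by simp
qed

text \<open>Schreier's rewriting: with coset representatives r and s, each step r t = (r t s^(-1)) s
  splits off a letter from N and keeps a representative as remainder. A word becomes one of the same
  length in finitely many elements of N, times a representative.\<close>

lemma finite_index_poly_growth:
  assumes N: "N \<lhd> G" and fin: "finite (carrier (G Mod N))" and nil: "\<And>A. finite A \<Longrightarrow> A \<subseteq> N \<Longrightarrow> poly_growth A"
    and T: "finite T" "T \<subseteq> carrier G"
  shows "poly_growth T"
proof -
  interpret N: normal N G by fact
  \<comment> \<open>The neutral element is added as the remainder for the empty word.\<close>
  define R where "R = insert \<one> ((\<lambda>C. SOME x. x \<in> C) ` (rcosets N))"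
  have finR: "finite R" using fin by (simp add: R_def FactGroup_def)
  have rep: "\<exists>r\<in>R. r \<in> carrier G \<and> h \<otimes> inv r \<in> N" if h: "h \<in> carrier G" for h
  proof -
    let ?r = "SOME x. x \<in> N #> h"
    have "h \<in> N #> h" using h by (rule rcos_self) unfold_locales
    then have r: "?r \<in> N #> h" by (rule someI)
    then obtain n where n: "n \<in> N" "?r = n \<otimes> h" by (auto simp: r_coset_def)
    then have "h \<otimes> inv ?r = inv n" using h by (simp add: inv_mult_group m_assoc[symmetric])
    moreover have "?r \<in> R" using h by (auto simp: R_def RCOSETS_def)
    ultimately show ?thesis using n h by (intro bexI[of _ ?r]) auto
  qed
  have RG: "R \<subseteq> carrier G"
  proof
    fix r assume "r \<in> R"
    then consider "r = \<one>" | h where "h \<in> carrier G" "r = (SOME x. x \<in> N #> h)" by (auto simp: R_def RCOSETS_def)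
    then show "r \<in> carrier G"
    proof cases
      case 2
      have "h \<in> N #> h" using 2(1) by (rule rcos_self) unfold_locales
      then have "r \<in> N #> h" unfolding 2(2) by (rule someI)
      then show ?thesis using 2 by (auto simp: r_coset_def)
    qed simp
  qed
  define A where "A = (\<lambda>(r, t, s). r \<otimes> t \<otimes> inv s) ` (R \<times> T \<times> R) \<inter> N"
  have A: "finite A" "A \<subseteq> N" using finR T by (simp_all add: A_def)
  then have AG: "A \<subseteq> carrier G" using N.subset by blast
  have w: "\<exists>x\<in>gball G A (length w). \<exists>r\<in>R. wprod G w = x \<otimes> r" if "w \<in> lists T" for w
    using that
  proof (induction w rule: rev_induct)
    case Nil
    show ?case using one_gball[of A 0] by (intro bexI[of _ \<one>]) (auto simp: R_def)
  next
    case (snoc t w)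
    then obtain x r where x: "x \<in> gball G A (length w)" and r: "r \<in> R" and w: "wprod G w = x \<otimes> r" by auto
    have t: "t \<in> T" "t \<in> carrier G" "w \<in> lists (carrier G)" using snoc.prems T(2) by auto
    have xr: "x \<in> carrier G" "r \<in> carrier G" using x r RG gball_closed[OF AG] by auto
    obtain s where s: "s \<in> R" "s \<in> carrier G" "r \<otimes> t \<otimes> inv s \<in> N" using rep[of "r \<otimes> t"] xr t by auto
    have "r \<otimes> t \<otimes> inv s \<in> A" unfolding A_def using r s t by (auto intro!: image_eqI[of _ _ "(r, t, s)"])
    from gball_mult[OF AG x gball_gen[OF this AG]]
    have "x \<otimes> (r \<otimes> t \<otimes> inv s) \<in> gball G A (length (w @ [t]))" by simp
    moreover have "wprod G (w @ [t]) = x \<otimes> (r \<otimes> t \<otimes> inv s) \<otimes> s"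
      using t xr s w by (simp add: wprod_append m_assoc)
    ultimately show ?case using s by blast
  qed
  obtain C d where Cd: "card (gball G A n) \<le> C * Suc n ^ d" for n using nil[OF A] unfolding poly_growth_def by blast
  have "card (gball G T n) \<le> (C * card R) * Suc n ^ d" for n
  proof -
    have "gball G T n \<subseteq> (\<lambda>(x, r). x \<otimes> r) ` (gball G A n \<times> R)"
    proof
      fix h assume "h \<in> gball G T n"
      then obtain u where u: "u \<in> lists T" "length u \<le> n" "h = wprod G u" by (auto simp: gball_def)
      obtain x r where "x \<in> gball G A (length u)" "r \<in> R" "h = x \<otimes> r" using w[OF u(1)] u(3) by auto
      moreover have "gball G A (length u) \<subseteq> gball G A n" by (rule gball_mono[OF u(2)])
      ultimately show "h \<in> (\<lambda>(x, r). x \<otimes> r) ` (gball G A n \<times> R)" by (intro image_eqI[of _ _ "(x, r)"]) auto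
    qed
    then have "card (gball G T n) \<le> card (gball G A n \<times> R)"
      using finR A by (intro surj_card_le) (auto simp: finite_gball)
    also have "\<dots> \<le> (C * Suc n ^ d) * card R" unfolding card_cartesian_product by (intro mult_right_mono Cd) simp
    finally show ?thesis by (simp add: mult_ac)
  qed
  then show ?thesis unfolding poly_growth_def by blast
qed

text \<open>Balls use positive words only, so inverses are adjoined to the generators.\<close>

lemma generate_gball:
  assumes "S \<subseteq> carrier G" and "h \<in> generate G S"
  shows "\<exists>m. h \<in> gball G (S \<union> m_inv G ` S) m"
proof -
  let ?S = "S \<union> m_inv G ` S"
  have S: "?S \<subseteq> carrier G" using assms(1) by auto
  show ?thesis
    using assms(2)
  proof induction
    case one
    then show ?case using one_gball by blast
  next
    case (incl h)
    then show ?case using gball_gen[OF _ S, of h] by blast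
  next
    case (inv h)
    then show ?case using gball_gen[OF _ S, of "inv h"] by blast
  next
    case (eng h k)
    then show ?case using gball_mult[OF S] by blast
  qed
qed

text \<open>Any finite set lies in some ball of a finite symmetric generating set, so its balls lie
  in dilated balls. Dilation changes only the constant of the polynomial bound, and so one exponent
  serves for all finite sets.\<close>

theorem nilpotent_by_finite_growth:
  assumes fg: "finitely_generated G" and nf: "nilpotent_by_finite G"
  shows "\<exists>d :: nat. \<forall>T. finite T \<and> T \<subseteq> carrier G \<longrightarrow> growth G T \<le> ereal (real d)"
proof -
  obtain S where S: "finite S" "S \<subseteq> carrier G" "generate G S = carrier G"
    using fg by (auto simp: finitely_generated_def)
  obtain N c where N: "N \<lhd> G" "lower_central G N c = {\<one>}" "finite (carrier (G Mod N))"
    using nf by (auto simp: nilpotent_by_finite_def)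
  interpret N: normal N G by (rule N)
  let ?S = "S \<union> m_inv G ` S"
  have S': "finite ?S" "?S \<subseteq> carrier G" using S by auto
  have "poly_growth ?S"
  proof (rule finite_index_poly_growth[OF N(1,3) _ S'])
    fix A assume "finite A" "A \<subseteq> N"
    then show "poly_growth A"
      using nilpotent_poly_growth[OF N.subgroup_axioms N(2), of A 0] by simp
  qed
  then obtain C d where Cd: "card (gball G ?S n) \<le> C * Suc n ^ d" for n unfolding poly_growth_def by blast
  have "growth G T \<le> ereal (real (Suc d))" if T: "finite T" "T \<subseteq> carrier G" for T
  proof -
    have "\<exists>m. T \<subseteq> gball G ?S m"
      using T
    proof (induction T rule: finite_induct)
      case (insert t T)
      then obtain m where m: "T \<subseteq> gball G ?S m" by auto
      obtain k where k: "t \<in> gball G ?S k" using generate_gball[OF S(2), of t] insert.prems S(3) by auto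
      have "gball G ?S m \<subseteq> gball G ?S (m + k)" "gball G ?S k \<subseteq> gball G ?S (m + k)" by (intro gball_mono; simp)+
      then show ?case using m k by blast
    qed simp
    then obtain m where m: "T \<subseteq> gball G ?S m" by blast
    have "\<forall>\<^sub>F n in sequentially. ereal (log (real n) (real (card (gball G T n)))) \<le> ereal (real (Suc d))"
      \<comment> \<open>From here on n exceeds the constant factor, which is absorbed by one more
        power of n; hence the bound \<open>Suc d\<close>.\<close>
      using eventually_ge_at_top[of "max 2 (C * Suc m ^ d)"]
    proof eventually_elim
      case (elim n)
      then have n: "2 \<le> n" "C * Suc m ^ d \<le> n" by auto
      have "card (gball G T n) \<le> card (gball G ?S (m * n))"
        using gball_gball[OF S'(2) m] finite_gball[OF S'(1)] by (intro card_mono) auto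
      also have "\<dots> \<le> C * Suc (m * n) ^ d" by (rule Cd)
      also have "\<dots> \<le> C * (Suc m * n) ^ d" using n by (intro mult_left_mono power_mono) auto
      also have "\<dots> = (C * Suc m ^ d) * n ^ d" by (simp add: power_mult_distrib del: mult_Suc)
      also have "\<dots> \<le> n * n ^ d" using n by (intro mult_right_mono) auto
      finally have "card (gball G T n) \<le> n ^ Suc d" by simp
      then have "real (card (gball G T n)) \<le> real (n ^ Suc d)" by (simp only: of_nat_le_iff)
      then have "log (real n) (real (card (gball G T n))) \<le> log (real n) (real n ^ Suc d)"
        using n card_gball_pos[OF T(1), of n] by (intro log_mono) auto
      also have "\<dots> = real (Suc d)" using n by (subst log_nat_power) (auto simp del: power_Suc)
      finally show ?case by simp
    qed
    then show ?thesis unfolding growth_def by (rule Limsup_bounded)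
  qed
  then show ?thesis by (intro exI[of _ "Suc d"]) blast
qed

end

theorem (in lift_data) GKdim_lift_finite:
  assumes "finitely_generated G" and "nilpotent_by_finite G"
  shows "GKdim U < \<infinity>"
proof -
  obtain d where d: "growth G Ts \<le> ereal (real d)" if "finite Ts" "Ts \<subseteq> carrier G" for Ts
    using nilpotent_by_finite_growth[OF assms] by blast
  have "GKdim (monoid_algebra G :: ('g \<Rightarrow>\<^sub>0 'k, 'k) kalg) \<le> ereal (real d)"
    unfolding GKdim_group_algebra by (rule SUP_least) (use d in blast)
  then have "GKdim U \<le> ereal (real d) + 2"
    unfolding GKdim_lift by (rule add_right_mono)
  also have "\<dots> < \<infinity>" by (simp add: numeral_eq_ereal)
  finally show ?thesis .
qed

text \<open>The zero derivation and the scalar 0 supply the graded companion for the same group, g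
  and \<eta>.\<close>

lemma (in lift_data) lift_pair:
  assumes "\<xi> (pure g) = 0"
  shows "lift_pair G g \<eta> \<xi>"
proof -
  have z: "(\<lambda>_. 0) \<in> Der_triv G" by (simp add: Der_triv_def)
  interpret h: lift_hopf_data G g \<eta> \<xi> lam by unfold_locales (rule assms)
  interpret z: lift_data G g \<eta> "\<lambda>_. 0" 0 by unfold_locales (rule yd, rule z)
  interpret j: jordan_data G g \<eta> by unfold_locales simp
  show ?thesis by unfold_locales
qed

text \<open>That the comultiplication is determined by its conditions is expressed by
  \<open>same_coalgebra\<close> for every competitor. Injectivity is stated besides the basis
  property so that the monomials form a basis as a family, without repetitions. Finite generation
  accompanies nilpotent-by-finite because a free abelian group of infinite rank is nilpotent, while
  its group algebra has infinite dimension in this sense.\<close>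

theorem lemma10:
  fixes G :: "('g, 'm) monoid_scheme" and g :: 'g
    and \<eta> \<xi> :: "('g \<Rightarrow>\<^sub>0 'k::{alg_closed_field, field_char_0}) \<Rightarrow> 'k" and lam :: 'k
  assumes "group G" and "yd_triple G g \<eta>" and "\<xi> \<in> Der_triv G"
  shows
    "(\<xi> (pure g) = 0 \<longrightarrow>
       (\<exists>H. lift_hopf G g \<eta> \<xi> lam H \<and>
            (\<forall>H'. lift_hopf G g \<eta> \<xi> lam H' \<longrightarrow> same_coalgebra H H') \<and>
            pointed H \<and>
            graded_hopf_isomorphic (gr_hopf H, gr_component H)
              (block_bosonization G g \<eta>, block_component G g \<eta>))) \<and>
     inj_on (lift_monomial G g \<eta> \<xi> lam) (UNIV \<times> UNIV \<times> carrier G) \<and>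
     k_basis (lift_alg G g \<eta> \<xi> lam) (carrier (lift_alg G g \<eta> \<xi> lam))
       (lift_monomial G g \<eta> \<xi> lam ` (UNIV \<times> UNIV \<times> carrier G)) \<and>
     GKdim (lift_alg G g \<eta> \<xi> lam) = GKdim (monoid_algebra G :: ('g \<Rightarrow>\<^sub>0 'k, 'k) kalg) + 2 \<and>
     (finitely_generated G \<and> nilpotent_by_finite G \<longrightarrow> GKdim (lift_alg G g \<eta> \<xi> lam) < \<infinity>)"
proof (intro conjI impI)
  interpret group G by fact
  interpret lift_data G g \<eta> \<xi> lam by unfold_locales fact+
  show "inj_on (lift_monomial G g \<eta> \<xi> lam) (UNIV \<times> UNIV \<times> carrier G)"
    by (rule lift_monomial_inj)
  show "k_basis (lift_alg G g \<eta> \<xi> lam) (carrier (lift_alg G g \<eta> \<xi> lam))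
      (lift_monomial G g \<eta> \<xi> lam ` (UNIV \<times> UNIV \<times> carrier G))"
    by (rule lift_monomial_basis)
  show "GKdim (lift_alg G g \<eta> \<xi> lam) = GKdim (monoid_algebra G :: ('g \<Rightarrow>\<^sub>0 'k, 'k) kalg) + 2"
    by (rule GKdim_lift)
  show "GKdim (lift_alg G g \<eta> \<xi> lam) < \<infinity>" if "finitely_generated G \<and> nilpotent_by_finite G"
    using GKdim_lift_finite that by blast
  assume "\<xi> (pure g) = 0"
  then interpret P: lift_pair G g \<eta> \<xi> lam by (rule lift_pair)
  show "\<exists>H. lift_hopf G g \<eta> \<xi> lam H \<and> (\<forall>H'. lift_hopf G g \<eta> \<xi> lam H' \<longrightarrow> same_coalgebra H H') \<and>
      pointed H \<and> graded_hopf_isomorphic (gr_hopf H, gr_component H)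
        (block_bosonization G g \<eta>, block_component G g \<eta>)"
    using P.lift_hopf_H P.lift_hopf_unique P.pointed_H P.gr_isomorphic_bosonization by blast
qed

end
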